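(* Let $d\ge 4$ be an integer, let $p$ be an odd prime and let $a\in\mathbb Z/p\mathbb Z$. (1) Suppose $a\neq 0$. If $d\ge 5$, then for every function $f:X_{p,d}(a)\to\mathbb C$, $$\lim_{\substack{n\to\infty\\ n\equiv a \ (\mathrm{mod}\ p)}}\frac{1}{|X_d(n)|}\sum_{x\in X_d(n)} f(x[p])=\frac{1}{|X_{p,d}(a)|}\sum_{x\in X_{p,d}(a)}f(x).$$ If $d=4$, then for every $f:X_{p,4}(a)\to\mathbb C$ the same limit formula holds when $n\to\infty$ through odd integers $n\equiv a \pmod p$. (2) Suppose $a=0$. If $d\ge5$, then for every function $f:X_{p,d}(0)\setminus\{(0,\dots,0)\}\to\mathbb C$, $$\lim_{\substack{n\to\infty\\ n\in p\mathbb Z}}\frac{1}{\left|\{x\in\mathbb Z^d\setminus(p\mathbb Z)^d: Q(x,x)=n\}\right|}\sum_{\substack{x\in\mathbb Z^d\setminus(p\mathbb Z)^d\\ Q(x,x)=n}} f(x[p])=\frac{1}{|X_{p,d}(0)|-1}\sum_{\substack{x\in X_{p,d}(0)\\ x\neq 0}}f(x).$$ If $d=4$, then for every $f:X_{p,4}(0)\setminus\{(0,\dots,0)\}\to\mathbb C$ the same limit formula holds when $n\to\infty$ through odd integers $n\in p\mathbb Z$.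
   Context: $Q(x,y)=x_1y_1+\dots+x_dy_d$ denotes the standard symmetric bilinear form on $\mathbb Z^d$, and also the analogous form on $(\mathbb Z/p\mathbb Z)^d$. For $n\in\mathbb N$, $X_d(n)=\{x\in\mathbb Z^d: Q(x,x)=n\}$. For $a\in\mathbb Z/p\mathbb Z$, $X_{p,d}(a)=\{x\in(\mathbb Z/p\mathbb Z)^d: Q(x,x)=a\}$. For $x\in\mathbb Z^d$, $x[p]$ denotes its reduction modulo $p$ in $(\mathbb Z/p\mathbb Z)^d$. *)

theory Defs
  imports Complex_Main "HOL-Number_Theory.Residues"
begin

text \<open>
  Vectors of length \<open>d\<close> are extensional functions on \<open>{..<d}\<close>, and
  \<open>\<int>/p\<int>\<close> is the library ring \<^const>\<open>residue_ring\<close> with carrier \<open>{0..p - 1}\<close>.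
\<close>

definition int_vecs :: "nat \<Rightarrow> (nat \<Rightarrow> int) set" where
  "int_vecs d = {..<d} \<rightarrow>\<^sub>E UNIV"

definition multiple_vecs :: "nat \<Rightarrow> nat \<Rightarrow> (nat \<Rightarrow> int) set" where
  "multiple_vecs p d = {..<d} \<rightarrow>\<^sub>E {z. int p dvd z}"

definition residue_vecs :: "nat \<Rightarrow> nat \<Rightarrow> (nat \<Rightarrow> int) set" where
  "residue_vecs p d = {..<d} \<rightarrow>\<^sub>E carrier (residue_ring (int p))"

definition zero_vec :: "nat \<Rightarrow> nat \<Rightarrow> int" where
  "zero_vec d = (\<lambda>i\<in>{..<d}. 0)"

definition reduce :: "nat \<Rightarrow> nat \<Rightarrow> (nat \<Rightarrow> int) \<Rightarrow> nat \<Rightarrow> int" where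
  "reduce p d x = (\<lambda>i\<in>{..<d}. x i mod int p)"

definition Q_int :: "nat \<Rightarrow> (nat \<Rightarrow> int) \<Rightarrow> (nat \<Rightarrow> int) \<Rightarrow> int" where
  "Q_int d x y = (\<Sum>i<d. x i * y i)"

definition Q_mod :: "nat \<Rightarrow> nat \<Rightarrow> (nat \<Rightarrow> int) \<Rightarrow> (nat \<Rightarrow> int) \<Rightarrow> int" where
  "Q_mod p d x y =
     finsum (residue_ring (int p)) (\<lambda>i. x i \<otimes>\<^bsub>residue_ring (int p)\<^esub> y i) {..<d}"

definition X_int :: "nat \<Rightarrow> nat \<Rightarrow> (nat \<Rightarrow> int) set" where
  "X_int d n = {x \<in> int_vecs d. Q_int d x x = int n}"

definition X_mod :: "nat \<Rightarrow> nat \<Rightarrow> int \<Rightarrow> (nat \<Rightarrow> int) set" where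
  "X_mod p d a = {x \<in> residue_vecs p d. Q_mod p d x x = a}"

definition X_int' :: "nat \<Rightarrow> nat \<Rightarrow> nat \<Rightarrow> (nat \<Rightarrow> int) set" where
  "X_int' p d n = {x \<in> int_vecs d - multiple_vecs p d. Q_int d x x = int n}"

definition at_top_through :: "nat set \<Rightarrow> nat filter" where
  "at_top_through N = inf sequentially (principal N)"

end

theory Submission
  imports Defs "HOL-Analysis.L2_Norm" "HOL-Computational_Algebra.Squarefree"
begin

text \<open>
  For \<open>d = 4\<close> identify \<open>\<int>\<^sup>4\<close> with the Lipschitz quaternions and fix an auxiliary odd prime \<open>l \<noteq> p\<close>. Left
  multiplications by primitive quaternions of norm \<open>l ^ k\<close> act on functions modulo \<open>p\<close> as Hecke operators;
  on the orthogonal complement of the functions that only see norms they have a spectral gap, which the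
  Hecke recursion turns into exponential decay. A sum \<open>S\<close> of such a function over the primitive quaternions
  of norm \<open>n\<close> is unchanged by the Hecke correspondences \<open>y \<mapsto> \<alpha> y \<beta>\<^sup>* / l ^ k\<close> up to their degree.
  Splitting according to the residue of \<open>y\<close> modulo \<open>q = l ^ k\<close> and applying Cauchy--Schwarz bounds
  \<open>S\<^sup>2\<close> by the decay factor times the number of pairs \<open>y \<equiv> y' (mod q)\<close> of norm \<open>n\<close>. For such a pair the real
  part of \<open>y y'\<^sup>*\<close> is determined modulo \<open>q\<^sup>2\<close>, so for \<open>q\<^sup>3\<close> of size \<open>n\<close> there are at most \<open>n powr (1 + \<epsilon>)\<close>
  pairs, and \<open>S\<close> is smaller than \<open>n\<close> by a power of \<open>n\<close>.

  Any two nonzero classes modulo \<open>p\<close> of equal norm are linked by multiplications of this kind, so they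
  contain almost equally many vectors of norm \<open>n\<close>; even \<open>n\<close> reduces to odd \<open>n\<close> by dividing by a
  quaternion of norm 2. For \<open>d > 4\<close> fix the first or the last coordinate and sum the bound in
  dimension \<open>d - 1\<close>: moves of these two kinds link all nonzero classes of equal norm. The number of all
  vectors exceeds a multiple of \<open>n powr (d / 2 - 1)\<close>, for \<open>d = 4\<close> when \<open>n\<close> is odd.
\<close>

section \<open>Lipschitz quaternions\<close>

datatype quat = Quat (q0: int) (q1: int) (q2: int) (q3: int)

lemma quat_eq_iff: "x = y \<longleftrightarrow> q0 x = q0 y \<and> q1 x = q1 y \<and> q2 x = q2 y \<and> q3 x = q3 y"
  by (cases x; cases y) auto

instantiation quat :: ring_1
begin

definition "0 = Quat 0 0 0 0"
definition "1 = Quat 1 0 0 0"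
definition "x + y = Quat (q0 x + q0 y) (q1 x + q1 y) (q2 x + q2 y) (q3 x + q3 y)"
definition "x - y = Quat (q0 x - q0 y) (q1 x - q1 y) (q2 x - q2 y) (q3 x - q3 y)"
definition "- x = Quat (- q0 x) (- q1 x) (- q2 x) (- q3 x)"
definition "x * y = Quat
  (q0 x * q0 y - q1 x * q1 y - q2 x * q2 y - q3 x * q3 y)
  (q0 x * q1 y + q1 x * q0 y + q2 x * q3 y - q3 x * q2 y)
  (q0 x * q2 y - q1 x * q3 y + q2 x * q0 y + q3 x * q1 y)
  (q0 x * q3 y + q1 x * q2 y - q2 x * q1 y + q3 x * q0 y)"

lemma quat_sel [simp]:
  "q0 0 = 0" "q1 0 = 0" "q2 0 = 0" "q3 0 = 0"
  "q0 1 = 1" "q1 1 = 0" "q2 1 = 0" "q3 1 = 0"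
  "q0 (x + y) = q0 x + q0 y" "q1 (x + y) = q1 x + q1 y"
  "q2 (x + y) = q2 x + q2 y" "q3 (x + y) = q3 x + q3 y"
  "q0 (x - y) = q0 x - q0 y" "q1 (x - y) = q1 x - q1 y"
  "q2 (x - y) = q2 x - q2 y" "q3 (x - y) = q3 x - q3 y"
  "q0 (- x) = - q0 x" "q1 (- x) = - q1 x" "q2 (- x) = - q2 x" "q3 (- x) = - q3 x"
  "q0 (x * y) = q0 x * q0 y - q1 x * q1 y - q2 x * q2 y - q3 x * q3 y"
  "q1 (x * y) = q0 x * q1 y + q1 x * q0 y + q2 x * q3 y - q3 x * q2 y"
  "q2 (x * y) = q0 x * q2 y - q1 x * q3 y + q2 x * q0 y + q3 x * q1 y"
  "q3 (x * y) = q0 x * q3 y + q1 x * q2 y - q2 x * q1 y + q3 x * q0 y"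
  by (simp_all add: zero_quat_def one_quat_def plus_quat_def minus_quat_def uminus_quat_def times_quat_def)

instance
  by standard (auto simp: quat_eq_iff algebra_simps)

end

lemma of_nat_quat: "(of_nat n :: quat) = Quat (int n) 0 0 0"
  by (induction n) (auto simp: quat_eq_iff)

instance quat :: ring_char_0
  by standard (simp add: inj_on_def of_nat_quat)

lemma of_int_sel [simp]:
  "q0 (of_int m) = m" "q1 (of_int m) = 0" "q2 (of_int m) = 0" "q3 (of_int m) = 0"
  by (cases m rule: int_cases2; simp add: of_nat_quat)+

lemma numeral_sel [simp]:
  "q0 (numeral k) = numeral k" "q1 (numeral k) = 0" "q2 (numeral k) = 0" "q3 (numeral k) = 0"
  using of_int_sel[of "numeral k"] by simp_all

lemma of_int_mult_left_commute: "x * (of_int m * y) = of_int m * (x * (y :: quat))"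
  by (simp add: quat_eq_iff algebra_simps)

definition qcnj :: "quat \<Rightarrow> quat" where
  "qcnj x = Quat (q0 x) (- q1 x) (- q2 x) (- q3 x)"

definition nrm :: "quat \<Rightarrow> int" where
  "nrm x = (q0 x)\<^sup>2 + (q1 x)\<^sup>2 + (q2 x)\<^sup>2 + (q3 x)\<^sup>2"

definition tr :: "quat \<Rightarrow> int" where
  "tr x = 2 * q0 x"

lemma qcnj_sel [simp]:
  "q0 (qcnj x) = q0 x" "q1 (qcnj x) = - q1 x" "q2 (qcnj x) = - q2 x" "q3 (qcnj x) = - q3 x"
  by (simp_all add: qcnj_def)

lemma qcnj_simps [simp]:
  "qcnj (qcnj x) = x" "qcnj 0 = 0" "qcnj 1 = 1" "qcnj (of_int m) = of_int m"
  "qcnj (x + y) = qcnj x + qcnj y" "qcnj (x - y) = qcnj x - qcnj y" "qcnj (- x) = - qcnj x"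
  by (simp_all add: quat_eq_iff)

lemma qcnj_mult: "qcnj (x * y) = qcnj y * qcnj x"
  by (simp add: quat_eq_iff algebra_simps)

lemma qcnj_eq_iff [simp]: "qcnj x = qcnj y \<longleftrightarrow> x = y"
  by (metis qcnj_simps(1))

lemma bij_qcnj: "bij qcnj"
  by (rule o_bij[of qcnj]) (auto simp: fun_eq_iff)

lemma nrm_mult: "nrm (x * y) = nrm x * nrm y"
  by (simp add: nrm_def power2_eq_square algebra_simps)

lemma nrm_simps [simp]:
  "nrm (qcnj x) = nrm x" "nrm (- x) = nrm x" "nrm (of_int m) = m\<^sup>2" "nrm 0 = 0" "nrm 1 = 1"
  by (simp_all add: nrm_def)

lemma nrm_ge_0 [simp]: "0 \<le> nrm x"
  by (simp add: nrm_def)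

lemma nrm_eq_0_iff [simp]: "nrm x = 0 \<longleftrightarrow> x = 0"
  by (auto simp: nrm_def quat_eq_iff add_nonneg_eq_0_iff)

lemma nrm_pos_iff: "0 < nrm x \<longleftrightarrow> x \<noteq> 0"
  using nrm_ge_0[of x] nrm_eq_0_iff[of x] by linarith

instance quat :: ring_1_no_zero_divisors
  by standard (metis mult_eq_0_iff nrm_eq_0_iff nrm_mult)

lemma nrm_add: "nrm (x + y) = nrm x + tr (x * qcnj y) + nrm y"
  by (simp add: nrm_def tr_def power2_eq_square algebra_simps)

lemma mult_qcnj: "x * qcnj x = of_int (nrm x)" "qcnj x * x = of_int (nrm x)"
  by (simp_all add: quat_eq_iff nrm_def power2_eq_square algebra_simps)

lemma mult_qcnj_assoc:
  "x * (qcnj x * y) = of_int (nrm x) * y" "qcnj x * (x * y) = of_int (nrm x) * y"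
  by (simp_all add: mult_qcnj mult.assoc[symmetric])

lemma tr_mult_commute: "tr (x * y) = tr (y * x)"
  by (simp add: tr_def algebra_simps)

lemma abs_le_if_square_le:
  fixes a n :: int
  assumes "a\<^sup>2 \<le> n"
  shows "\<bar>a\<bar> \<le> n"
proof (cases "a = 0")
  case False
  then have "\<bar>a\<bar> \<le> \<bar>a\<bar>\<^sup>2" by (intro self_le_power) auto
  then show ?thesis using assms by simp
qed (use assms in simp)

lemma finite_nrm: "finite {x. nrm x = n}"
proof -
  have "x \<in> (\<lambda>(a, b, c, d). Quat a b c d) ` ({-n..n} \<times> {-n..n} \<times> {-n..n} \<times> {-n..n})" if "nrm x = n" for x
  proof -
    have "(q0 x)\<^sup>2 \<le> n" "(q1 x)\<^sup>2 \<le> n" "(q2 x)\<^sup>2 \<le> n" "(q3 x)\<^sup>2 \<le> n"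
      using that by (auto simp: nrm_def)
    then have "\<bar>q0 x\<bar> \<le> n" "\<bar>q1 x\<bar> \<le> n" "\<bar>q2 x\<bar> \<le> n" "\<bar>q3 x\<bar> \<le> n"
      by (simp_all add: abs_le_if_square_le)
    then show ?thesis
      by (intro image_eqI[of _ _ "(q0 x, q1 x, q2 x, q3 x)"]) (auto simp: abs_le_iff)
  qed
  then have "{x. nrm x = n} \<subseteq> (\<lambda>(a, b, c, d). Quat a b c d) ` ({-n..n} \<times> {-n..n} \<times> {-n..n} \<times> {-n..n})"
    by blast
  then show ?thesis by (rule finite_subset) auto
qed

abbreviation "qi \<equiv> Quat 0 1 0 0"
abbreviation "qj \<equiv> Quat 0 0 1 0"
abbreviation "qk \<equiv> Quat 0 0 0 1"

lemma card_units: "card {u. nrm u = 1} = 8"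
proof -
  have "{u. nrm u = 1} = {Quat 1 0 0 0, Quat (-1) 0 0 0, Quat 0 1 0 0, Quat 0 (-1) 0 0,
     Quat 0 0 1 0, Quat 0 0 (-1) 0, Quat 0 0 0 1, Quat 0 0 0 (-1)}" (is "_ = ?S")
  proof
    show "{u. nrm u = 1} \<subseteq> ?S"
    proof
      fix u assume "u \<in> {u. nrm u = 1}"
      then have norm: "(q0 u)\<^sup>2 + (q1 u)\<^sup>2 + (q2 u)\<^sup>2 + (q3 u)\<^sup>2 = 1" by (simp add: nrm_def)
      have "a \<in> {-1, 0, 1}" if "a\<^sup>2 \<le> 1" for a :: int
        using that abs_square_le_1[of a] by auto
      moreover have "(q0 u)\<^sup>2 \<le> 1" "(q1 u)\<^sup>2 \<le> 1" "(q2 u)\<^sup>2 \<le> 1" "(q3 u)\<^sup>2 \<le> 1"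
        unfolding norm[symmetric] by auto
      ultimately have "q0 u \<in> {-1, 0, 1}" "q1 u \<in> {-1, 0, 1}" "q2 u \<in> {-1, 0, 1}" "q3 u \<in> {-1, 0, 1}"
        by blast+
      then show "u \<in> ?S" using norm by (cases u) (simp, elim disjE; simp)
    qed
  qed (auto simp: nrm_def)
  then show ?thesis by simp
qed

definition qdvd :: "int \<Rightarrow> quat \<Rightarrow> bool" where
  "qdvd m x \<longleftrightarrow> m dvd q0 x \<and> m dvd q1 x \<and> m dvd q2 x \<and> m dvd q3 x"

lemma qdvd_iff: "qdvd m x \<longleftrightarrow> (\<exists>y. x = of_int m * y)"
proof
  assume "qdvd m x"
  then obtain a b c d where "q0 x = m * a" "q1 x = m * b" "q2 x = m * c" "q3 x = m * d"
    unfolding qdvd_def dvd_def by blast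
  then have "x = of_int m * Quat a b c d" by (simp add: quat_eq_iff)
  then show "\<exists>y. x = of_int m * y" ..
qed (auto simp: qdvd_def)

lemma qdvdE: "qdvd m x \<Longrightarrow> (\<And>y. x = of_int m * y \<Longrightarrow> P) \<Longrightarrow> P"
  using qdvd_iff by blast

lemma qdvd_add: "qdvd m x \<Longrightarrow> qdvd m y \<Longrightarrow> qdvd m (x + y)"
  and qdvd_diff: "qdvd m x \<Longrightarrow> qdvd m y \<Longrightarrow> qdvd m (x - y)"
  and qdvd_minus [simp]: "qdvd m (- x) \<longleftrightarrow> qdvd m x"
  and qdvd_0 [simp]: "qdvd m 0"
  and qdvd_qcnj [simp]: "qdvd m (qcnj x) \<longleftrightarrow> qdvd m x"
  and qdvd_triv [simp]: "qdvd m (of_int m * x)"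
  and qdvd_of_int [simp]: "qdvd m (of_int c) \<longleftrightarrow> m dvd c"
  by (auto simp: qdvd_def)

lemma qdvd_mult_left: "qdvd m x \<Longrightarrow> qdvd m (y * x)"
  and qdvd_mult_right: "qdvd m x \<Longrightarrow> qdvd m (x * y)"
  by (auto simp: qdvd_def intro!: dvd_add dvd_diff)

lemma qdvd_of_int_mult_dvd: "m dvd c \<Longrightarrow> qdvd m (of_int c * x)"
  by (auto simp: qdvd_def)

lemma qdvd_of_int_mult_coprime: "coprime m c \<Longrightarrow> qdvd m (of_int c * x) \<longleftrightarrow> qdvd m x"
  by (simp add: qdvd_def coprime_dvd_mult_right_iff)

lemma qdvd_of_int_mult_cancel: "c \<noteq> 0 \<Longrightarrow> qdvd (c * m) (of_int c * x) \<longleftrightarrow> qdvd m x"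
  by (simp add: qdvd_def)

lemma qdvd_imp_square_dvd_nrm: "qdvd m x \<Longrightarrow> m\<^sup>2 dvd nrm x"
  by (auto simp: qdvd_def nrm_def intro!: dvd_add)

lemma qdvd_nrm_mult_iff:
  assumes "b \<noteq> 0"
  shows "qdvd (nrm b) (a * b) \<longleftrightarrow> (\<exists>w. a = w * qcnj b)"
proof
  assume "qdvd (nrm b) (a * b)"
  then obtain w where "a * b = of_int (nrm b) * w" by (rule qdvdE)
  then have "of_int (nrm b) * a = of_int (nrm b) * (w * qcnj b)"
    by (metis mult.assoc mult_of_int_commute mult_qcnj(1))
  then show "\<exists>w. a = w * qcnj b" using assms by auto
next
  assume "\<exists>w. a = w * qcnj b"
  then obtain w where "a = w * qcnj b" ..
  then have "a * b = of_int (nrm b) * w" by (simp add: mult.assoc mult_qcnj mult_of_int_commute)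
  then show "qdvd (nrm b) (a * b)" by simp
qed

definition qcong :: "int \<Rightarrow> quat \<Rightarrow> quat \<Rightarrow> bool" where
  "qcong m x y \<longleftrightarrow> qdvd m (x - y)"

lemma qcong_refl [simp]: "qcong m x x"
  and qcong_0 [simp]: "qcong m x 0 \<longleftrightarrow> qdvd m x"
  and qcong_qcnj [simp]: "qcong m (qcnj x) (qcnj y) \<longleftrightarrow> qcong m x y"
  by (simp_all add: qcong_def flip: qcnj_simps(6))

lemma qcong_sym: "qcong m x y \<Longrightarrow> qcong m y x"
  using qdvd_minus[of m "x - y"] by (simp add: qcong_def)

lemma qcong_trans [trans]: "qcong m x y \<Longrightarrow> qcong m y z \<Longrightarrow> qcong m x z"
  using qdvd_add[of m "x - y" "y - z"] by (simp add: qcong_def)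

lemma qcong_mult_left: "qcong m x y \<Longrightarrow> qcong m (a * x) (a * y)"
  using qdvd_mult_left[of m "x - y" a] by (simp add: qcong_def right_diff_distrib)

lemma qcong_mult_right: "qcong m x y \<Longrightarrow> qcong m (x * b) (y * b)"
  using qdvd_mult_right[of m "x - y" b] by (simp add: qcong_def left_diff_distrib)

lemma qcong_of_int_mult: "m dvd a - b \<Longrightarrow> qcong m (of_int a * x) (of_int b * x)"
  using qdvd_of_int_mult_dvd[of m "a - b" x] by (simp add: qcong_def left_diff_distrib)

lemma qcong_of_int_mult_coprime: "coprime m c \<Longrightarrow> qcong m (of_int c * x) (of_int c * y) \<longleftrightarrow> qcong m x y"
  using qdvd_of_int_mult_coprime[of m c "x - y"] by (simp add: qcong_def right_diff_distrib)

lemma qcong_qdvd_iff: "qcong m x y \<Longrightarrow> qdvd m x \<longleftrightarrow> qdvd m y"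
  by (metis qcong_0 qcong_sym qcong_trans)

lemma qcong_cong_left: "qcong m x y \<Longrightarrow> qcong m x z \<longleftrightarrow> qcong m y z"
  and qcong_cong_right: "qcong m x y \<Longrightarrow> qcong m z x \<longleftrightarrow> qcong m z y"
  by (meson qcong_sym qcong_trans)+

lemma qcong_dvd_nrm_diff:
  assumes "qcong m x y"
  shows "m dvd nrm x - nrm y"
proof -
  obtain z where "x - y = of_int m * z" using assms unfolding qcong_def by (rule qdvdE)
  then have "x = y + of_int m * z" by (simp add: algebra_simps)
  then have "nrm x - nrm y = tr (y * qcnj (of_int m * z)) + nrm (of_int m * z)" by (simp add: nrm_add)
  also have "\<dots> = m * (tr (y * qcnj z) + m * nrm z)"
    by (simp add: nrm_mult tr_def power2_eq_square algebra_simps)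
  finally show ?thesis by simp
qed

definition content :: "quat \<Rightarrow> int" where
  "content x = gcd (gcd (q0 x) (q1 x)) (gcd (q2 x) (q3 x))"

lemma qdvd_iff_dvd_content: "qdvd m x \<longleftrightarrow> m dvd content x"
  by (auto simp: qdvd_def content_def)

lemma content_eq_0_iff [simp]: "content x = 0 \<longleftrightarrow> x = 0"
  by (auto simp: content_def quat_eq_iff)

lemma content_ge_0 [simp]: "content x \<ge> 0"
  by (simp add: content_def)

lemma content_simps [simp]: "content (qcnj x) = content x" "content (- x) = content x" "content 1 = 1"
  by (simp_all add: content_def)

lemma content_of_int_mult: "content (of_int c * x) = \<bar>c\<bar> * content x"
  by (simp add: content_def gcd_mult_left abs_mult)

lemma content_dvd_content_mult: "content y dvd content (x * y)" "content x dvd content (x * y)"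
  using qdvd_mult_left qdvd_mult_right
  by (simp_all flip: qdvd_iff_dvd_content) (simp_all add: qdvd_iff_dvd_content)

lemma content_square_dvd_nrm: "(content x)\<^sup>2 dvd nrm x"
  by (simp add: qdvd_imp_square_dvd_nrm qdvd_iff_dvd_content)

lemma content_factor_eq_1:
  assumes "content (x * y) = 1"
  shows "content x = 1" "content y = 1"
  using content_dvd_content_mult[of x y] content_dvd_content_mult[of y x] assms content_ge_0
  by (metis zdvd1_eq abs_of_nonneg content_dvd_content_mult)+

lemma content_decomp:
  assumes "x \<noteq> 0"
  obtains w where "x = of_int (content x) * w" "content w = 1"
proof -
  have "qdvd (content x) x" by (simp add: qdvd_iff_dvd_content)
  then obtain w where w: "x = of_int (content x) * w" by (rule qdvdE)
  have "content x = content x * content w"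
    using arg_cong[OF w, of content] by (simp add: content_of_int_mult)
  then have "content w = 1" using assms by simp
  then show thesis using that w by blast
qed

lemma content_mult_coprime:
  assumes "coprime (nrm x) (nrm y)" "content x = 1" "content y = 1"
  shows "content (x * y) = 1"
proof -
  have "content (x * y) dvd content (qcnj x * (x * y))" "content (x * y) dvd content (x * y * qcnj y)"
    by (rule content_dvd_content_mult)+
  then have "content (x * y) dvd nrm y" "content (x * y) dvd nrm x"
    using assms(2,3) by (simp_all add: mult_qcnj_assoc content_of_int_mult mult.assoc mult_qcnj
        flip: mult_of_int_commute)
  then have "is_unit (content (x * y))" using assms(1) coprime_common_divisor by blast
  then show ?thesis by (simp add: abs_of_nonneg)
qed

definition primitive :: "int \<Rightarrow> quat set" where
  "primitive n = {x. nrm x = n \<and> content x = 1}"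

lemma finite_primitive: "finite (primitive n)"
  by (rule finite_subset[OF _ finite_nrm[of n]]) (auto simp: primitive_def)

lemma primitive_squarefree:
  assumes "squarefree n"
  shows "primitive n = {x. nrm x = n}"
proof -
  have "content x = 1" if "nrm x = n" for x
    using content_square_dvd_nrm[of x] assms that by (auto simp: squarefree_def abs_of_nonneg)
  then show ?thesis by (auto simp: primitive_def)
qed

lemma primitive_1: "primitive 1 = {u. nrm u = 1}"
  by (rule primitive_squarefree) simp

lemma primitive_prime: "prime l \<Longrightarrow> primitive l = {x. nrm x = l}"
  by (rule primitive_squarefree) (rule squarefree_prime)

lemma primitive_prime_power:
  fixes l :: int
  assumes l: "prime l"
  shows "primitive (l ^ k) = {x. nrm x = l ^ k \<and> \<not> qdvd l x}"
proof -
  have "content x = 1 \<longleftrightarrow> \<not> qdvd l x" if x: "nrm x = l ^ k" for x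
  proof -
    have "content x dvd l ^ k"
      using content_square_dvd_nrm[of x] x by (metis dvd_mult_left power2_eq_square)
    then obtain i where "normalize (content x) = l ^ i" using divides_primepow[OF l] by metis
    then have "content x = l ^ i" by simp
    moreover have "l ^ i = 1 \<longleftrightarrow> i = 0"
      using one_less_power[OF prime_gt_1_int[OF l], of i] by (cases "i = 0") auto
    ultimately show ?thesis
      using prime_gt_1_int[OF l] by (cases i) (auto simp: qdvd_iff_dvd_content)
  qed
  then show ?thesis by (auto simp: primitive_def)
qed

definition quat_div :: "quat \<Rightarrow> int \<Rightarrow> quat" where
  "quat_div x m = Quat (q0 x div m) (q1 x div m) (q2 x div m) (q3 x div m)"

lemma quat_div_of_int_mult [simp]: "m \<noteq> 0 \<Longrightarrow> quat_div (of_int m * x) m = x"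
  by (simp add: quat_div_def quat_eq_iff)

section \<open>Right ideals of odd index\<close>

lemma round_to_multiple:
  fixes a t :: int
  assumes "t > 0"
  obtains w where "\<bar>2 * (a - t * w)\<bar> \<le> t"
proof -
  define w where "w = (2 * a + t) div (2 * t)"
  have "2 * a + t = 2 * t * w + (2 * a + t) mod (2 * t)" by (simp add: w_def)
  moreover have "0 \<le> (2 * a + t) mod (2 * t)" "(2 * a + t) mod (2 * t) < 2 * t" using assms by auto
  ultimately show thesis by (intro that[of w]) (simp add: algebra_simps abs_le_iff)
qed

text \<open>The remainder fails to be strictly smaller only when all four coordinates of the quotient are
  half-integral.\<close>

lemma quat_division:
  assumes "y \<noteq> 0"
  obtains w where "nrm (z - y * w) < nrm y" | c where "2 * z = y * c"
proof -
  define t where "t = nrm y"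
  have t: "t > 0" using assms by (simp add: t_def nrm_pos_iff)
  define a where "a = qcnj y * z"
  obtain w0 w1 w2 w3 where rounding: "\<bar>2 * (q0 a - t * w0)\<bar> \<le> t" "\<bar>2 * (q1 a - t * w1)\<bar> \<le> t"
    "\<bar>2 * (q2 a - t * w2)\<bar> \<le> t" "\<bar>2 * (q3 a - t * w3)\<bar> \<le> t"
    using round_to_multiple[OF t] by metis
  define w where "w = Quat w0 w1 w2 w3"
  define r where "r = qcnj y * (z - y * w)"
  have "r = a - of_int t * w" by (simp add: r_def a_def right_diff_distrib mult_qcnj_assoc t_def)
  then have small: "(2 * q0 r)\<^sup>2 \<le> t\<^sup>2" "(2 * q1 r)\<^sup>2 \<le> t\<^sup>2" "(2 * q2 r)\<^sup>2 \<le> t\<^sup>2" "(2 * q3 r)\<^sup>2 \<le> t\<^sup>2"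
    using rounding t by (auto simp: w_def abs_le_square_iff[symmetric])
  have nrm_r: "nrm r = t * nrm (z - y * w)" by (simp add: r_def nrm_mult t_def)
  show thesis
  proof (cases "nrm r < t\<^sup>2")
    case True
    then have "nrm (z - y * w) < t"
      using t unfolding nrm_r power2_eq_square by (simp only: mult_less_cancel_left_pos)
    then show thesis using that(1) by (simp add: t_def)
  next
    case False
    have "4 * nrm r = (2 * q0 r)\<^sup>2 + (2 * q1 r)\<^sup>2 + (2 * q2 r)\<^sup>2 + (2 * q3 r)\<^sup>2"
      by (simp add: nrm_def power2_eq_square)
    then have "(2 * q0 r)\<^sup>2 = t\<^sup>2" "(2 * q1 r)\<^sup>2 = t\<^sup>2" "(2 * q2 r)\<^sup>2 = t\<^sup>2" "(2 * q3 r)\<^sup>2 = t\<^sup>2"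
      using small False by linarith+
    then have "qdvd t (2 * r)" unfolding power2_eq_iff qdvd_def by auto
    then obtain e where e: "2 * r = of_int t * e" by (rule qdvdE)
    have "of_int t * (2 * (z - y * w)) = y * (2 * r)"
      using of_int_mult_left_commute[of "qcnj y" 2 "z - y * w"]
      unfolding r_def t_def mult_qcnj_assoc[symmetric] by simp
    also have "\<dots> = of_int t * (y * e)" by (simp add: e of_int_mult_left_commute)
    finally have "2 * (z - y * w) = y * e" using t by simp
    then have "2 * z = y * (e + 2 * w)"
      using of_int_mult_left_commute[of y 2 w] by (simp add: algebra_simps)
    then show thesis by (rule that(2))
  qed
qed

lemma even_nrm_imp_half_multiple:
  assumes "even (nrm y)"
  obtains e y' where "nrm e = 2" "y * e = 2 * y'"
proof -
  have "even (q0 y + q1 y + q2 y + q3 y)" using assms by (simp add: nrm_def)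
  then consider "even (q0 y + q1 y)" "even (q2 y + q3 y)" | "even (q0 y + q2 y)" "even (q1 y + q3 y)"
    | "even (q0 y + q3 y)" "even (q1 y + q2 y)"
    by fastforce
  then have "\<exists>e. nrm e = 2 \<and> qdvd 2 (y * e)"
  proof cases
    case 1
    then show ?thesis by (intro exI[of _ "Quat 1 1 0 0"]) (auto simp: qdvd_def nrm_def)
  next
    case 2
    then show ?thesis by (intro exI[of _ "Quat 1 0 1 0"]) (auto simp: qdvd_def nrm_def)
  next
    case 3
    then show ?thesis by (intro exI[of _ "Quat 1 0 0 1"]) (auto simp: qdvd_def nrm_def)
  qed
  then show thesis using that by (auto simp: qdvd_iff)
qed

definition right_ideal :: "quat \<Rightarrow> int \<Rightarrow> quat set" where
  "right_ideal x m = {x * a + of_int m * b | a b. True}"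

lemma right_ideal_mult:
  assumes "z \<in> right_ideal x m"
  shows "z * c \<in> right_ideal x m"
proof -
  obtain a b where "z = x * a + of_int m * b" using assms by (auto simp: right_ideal_def)
  then have "z * c = x * (a * c) + of_int m * (b * c)" by (simp add: algebra_simps)
  then show ?thesis by (auto simp: right_ideal_def)
qed

lemma right_ideal_diff:
  assumes "z \<in> right_ideal x m" "w \<in> right_ideal x m"
  shows "z - w \<in> right_ideal x m"
proof -
  obtain a b a' b' where "z = x * a + of_int m * b" "w = x * a' + of_int m * b'"
    using assms by (auto simp: right_ideal_def)
  then have "z - w = x * (a - a') + of_int m * (b - b')" by (simp add: algebra_simps)
  then show ?thesis by (auto simp: right_ideal_def)
qed

lemma right_ideal_generators: "x \<in> right_ideal x m" "of_int m \<in> right_ideal x m"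
proof -
  have "x = x * 1 + of_int m * 0" "of_int m = x * 0 + of_int m * 1" by simp_all
  then show "x \<in> right_ideal x m" "of_int m \<in> right_ideal x m" unfolding right_ideal_def by blast+
qed

lemma qdvd_mult_generator_iff:
  assumes "right_ideal x m = range (\<lambda>d. y * d)"
  shows "qdvd m (c * x) \<longleftrightarrow> qdvd m (c * y)"
proof
  have "y \<in> right_ideal x m" unfolding assms by (intro image_eqI[of _ _ 1]) auto
  then obtain a b where "y = x * a + of_int m * b" by (auto simp: right_ideal_def)
  then have y: "c * y = c * x * a + of_int m * (c * b)"
    by (simp only: distrib_left mult.assoc of_int_mult_left_commute)
  assume "qdvd m (c * x)"
  then have "qdvd m (c * x * a)" by (rule qdvd_mult_right)
  then show "qdvd m (c * y)" unfolding y by (rule qdvd_add[OF _ qdvd_triv])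
next
  have "x \<in> range (\<lambda>d. y * d)" using right_ideal_generators(1) unfolding assms[symmetric] .
  then obtain d where "x = y * d" by blast
  moreover assume "qdvd m (c * y)"
  then have "qdvd m (c * y * d)" by (rule qdvd_mult_right)
  ultimately show "qdvd m (c * x)" by (simp add: mult.assoc)
qed

lemma right_ideal_half:
  assumes "odd m" "2 * z \<in> right_ideal x m"
  shows "z \<in> right_ideal x m"
proof -
  obtain k where "m = 2 * k + 1" using assms(1) by (auto elim: oddE)
  then have "z = of_int m * z - 2 * z * of_int k" by (simp add: quat_eq_iff algebra_simps)
  then show ?thesis using assms(2) right_ideal_diff right_ideal_mult right_ideal_generators(2) by metis
qed

lemma dvd_nrm_right_ideal:
  assumes "m dvd nrm x" "z \<in> right_ideal x m"
  shows "m dvd nrm z"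
proof -
  obtain a b where z: "z = x * a + of_int m * b" using assms(2) by (auto simp: right_ideal_def)
  then have "qcong m z (x * a)" by (simp add: qcong_def)
  then have "m dvd (nrm z - nrm (x * a)) + nrm (x * a)"
    using assms(1) by (intro dvd_add qcong_dvd_nrm_diff) (auto simp: nrm_mult)
  then show ?thesis by simp
qed

text \<open>Division by an element of minimal norm succeeds up to a factor 2. That norm is odd, since an element
  of even norm could be halved after multiplication by one of norm 2, so the factor can be removed.\<close>

lemma right_ideal_principal:
  assumes "odd m"
  obtains y where "right_ideal x m = range (\<lambda>d. y * d)"
proof -
  let ?J = "right_ideal x m"
  have "of_int m \<in> ?J \<and> of_int m \<noteq> (0 :: quat)" using assms right_ideal_generators by auto
  then obtain y where y: "y \<in> ?J" "y \<noteq> 0" and min: "\<And>z. z \<in> ?J \<Longrightarrow> z \<noteq> 0 \<Longrightarrow> nrm y \<le> nrm z"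
    using ex_has_least_nat[of "\<lambda>z. z \<in> ?J \<and> z \<noteq> 0" _ "\<lambda>z. nat (nrm z)"]
    by (metis nat_le_eq_zle nrm_ge_0)
  have double: "\<exists>c. 2 * z = y * c" if z: "z \<in> ?J" for z
    using y(2)
  proof (rule quat_division[of _ z])
    fix w assume "nrm (z - y * w) < nrm y"
    moreover have "z - y * w \<in> ?J" using z y right_ideal_diff right_ideal_mult by blast
    ultimately have "z - y * w = 0" using min by force
    then have "2 * z = y * (2 * w)" using of_int_mult_left_commute[of y 2 w] by simp
    then show ?thesis by blast
  qed blast
  have "odd (nrm y)"
  proof
    assume "even (nrm y)"
    then obtain e y' where e: "nrm e = 2" "y * e = 2 * y'" by (rule even_nrm_imp_half_multiple)
    then have "nrm y' \<noteq> 0" using y(2) by auto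
    moreover have "nrm y * 2 = 4 * nrm y'"
      using arg_cong[OF e(2), of nrm] e(1) nrm_simps(3)[of 2] by (simp add: nrm_mult del: nrm_simps)
    moreover have "y' \<in> ?J" using right_ideal_half[OF assms] right_ideal_mult[OF y(1), of e] e(2) by simp
    ultimately show False using min[of y'] nrm_ge_0[of y'] by auto
  qed
  then obtain k where k: "nrm y = 2 * k + 1" by (rule oddE)
  have "z \<in> range (\<lambda>d. y * d)" if z: "z \<in> ?J" for z
  proof -
    obtain c where c: "2 * z = y * c" using double[OF z] by blast
    have "z = of_int (nrm y) * z - of_int k * (2 * z)" by (simp add: k quat_eq_iff algebra_simps)
    also have "\<dots> = y * (qcnj y * z - of_int k * c)"
      by (simp add: c right_diff_distrib mult_qcnj_assoc of_int_mult_left_commute)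
    finally show ?thesis by blast
  qed
  then have "?J = range (\<lambda>d. y * d)" using right_ideal_mult[OF y(1)] by blast
  then show thesis by (rule that)
qed

lemma right_ideal_generator_of_norm:
  assumes m: "odd m" "m > 0" "m dvd nrm x" "coprime m (content x)"
  obtains y where "nrm y = m" "right_ideal x m = range (\<lambda>d. y * d)"
proof -
  obtain y where y: "right_ideal x m = range (\<lambda>d. y * d)" using right_ideal_principal[OF m(1)] by blast
  then have "y * 1 \<in> right_ideal x m" by blast
  then have "m dvd nrm y" using dvd_nrm_right_ideal[OF m(3)] by simp
  then obtain s where s: "nrm y = m * s" ..
  obtain b where b: "of_int m = y * b" using right_ideal_generators(2)[of m x] y by auto
  obtain d where d: "x = y * d" using right_ideal_generators(1)[of x m] y by auto
  have "of_int m * (of_int s * b) = qcnj y * (y * b)" by (simp add: mult_qcnj_assoc s mult.assoc)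
  also have "\<dots> = of_int m * qcnj y" by (simp add: mult_of_int_commute flip: b)
  finally have "qcnj y = of_int s * b" using m(2) by simp
  then have s_dvd: "qdvd s y" using qdvd_qcnj[of s y] by simp
  then have "s dvd m" using qdvd_mult_right[of s y b] by (simp flip: b)
  moreover have "s dvd content x"
    using qdvd_mult_right[OF s_dvd, of d] by (simp add: d qdvd_iff_dvd_content)
  ultimately have "is_unit s" using m(4) coprime_common_divisor by blast
  moreover have "s > 0"
  proof -
    have "y \<noteq> 0" using b m(2) by auto
    then show ?thesis using m(2) s nrm_pos_iff[of y] by (simp add: zero_less_mult_iff)
  qed
  ultimately show thesis using that y s by simp
qed

section \<open>Factors of prescribed norm\<close>

definition left_factors :: "int \<Rightarrow> quat \<Rightarrow> quat set" where
  "left_factors m x = {y. nrm y = m \<and> (\<exists>d. x = y * d)}"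

definition right_factors :: "int \<Rightarrow> quat \<Rightarrow> quat set" where
  "right_factors m x = {y. nrm y = m \<and> (\<exists>d. x = d * y)}"

lemma left_factors_qcnj: "left_factors m (qcnj x) = qcnj ` right_factors m x"
proof (intro Set.set_eqI iffI)
  fix y assume "y \<in> left_factors m (qcnj x)"
  then obtain d where d: "nrm y = m" "qcnj x = y * d" by (auto simp: left_factors_def)
  then have "x = qcnj d * qcnj y" by (metis qcnj_mult qcnj_simps(1))
  then have "qcnj y \<in> right_factors m x" using d by (auto simp: right_factors_def)
  then show "y \<in> qcnj ` right_factors m x" by (metis imageI qcnj_simps(1))
qed (auto simp: left_factors_def right_factors_def qcnj_mult)

lemma right_factors_Int_nonempty_iff:
  assumes m: "odd m" "m > 0" "m dvd nrm x" "coprime m (content x)"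
  shows "right_factors m x \<inter> right_factors m y \<noteq> {} \<longleftrightarrow> qdvd m (x * qcnj y)"
proof
  assume "right_factors m x \<inter> right_factors m y \<noteq> {}"
  then obtain z d e where z: "nrm z = m" "x = d * z" "y = e * z" by (auto simp: right_factors_def)
  have "x * qcnj y = of_int m * (d * qcnj e)"
    unfolding z(2,3) qcnj_mult mult.assoc mult_qcnj_assoc z(1) by (rule of_int_mult_left_commute)
  then show "qdvd m (x * qcnj y)" by (simp only: qdvd_triv)
next
  obtain z where z: "nrm z = m" "right_ideal (qcnj x) m = range (\<lambda>d. z * d)"
    using right_ideal_generator_of_norm[of m "qcnj x"] m by auto
  have "qcnj x \<in> range (\<lambda>d. z * d)" using right_ideal_generators(1) unfolding z(2)[symmetric] .
  then obtain d where "qcnj x = z * d" by blast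
  then have "x = qcnj d * qcnj z" by (metis qcnj_mult qcnj_simps(1))
  then have factor: "qcnj z \<in> right_factors m x" using z(1) by (auto simp: right_factors_def)
  assume "qdvd m (x * qcnj y)"
  then have "qdvd m (qcnj (x * qcnj y))" by (simp only: qdvd_qcnj)
  then have "qdvd (nrm z) (y * z)"
    unfolding z(1) by (simp add: qcnj_mult qdvd_mult_generator_iff[OF z(2)])
  then obtain e where "y = e * qcnj z" using qdvd_nrm_mult_iff[of z y] z(1) m(2) by fastforce
  then have "qcnj z \<in> right_factors m y" using z(1) by (auto simp: right_factors_def)
  then show "right_factors m x \<inter> right_factors m y \<noteq> {}" using factor by blast
qed

lemma left_factors_nonempty:
  assumes "odd m" "m > 0" "m dvd nrm x" "coprime m (content x)"
  shows "left_factors m x \<noteq> {}"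
proof -
  obtain y where y: "nrm y = m" "right_ideal x m = range (\<lambda>d. y * d)"
    using right_ideal_generator_of_norm[OF assms] by blast
  then have "x \<in> range (\<lambda>d. y * d)" using right_ideal_generators(1) by blast
  then show ?thesis using y(1) by (auto simp: left_factors_def)
qed

text \<open>Every left factor of norm \<open>m\<close> generates the same right ideal.\<close>

lemma left_factors_eq_unit_orbit:
  assumes m: "odd m" "m > 0" "m dvd nrm x" "coprime m (content x)" and y: "y \<in> left_factors m x"
  shows "left_factors m x = (\<lambda>u. y * u) ` {u. nrm u = 1}"
proof (intro Set.set_eqI iffI)
  obtain g where g: "nrm g = m" "right_ideal x m = range (\<lambda>d. g * d)"
    using right_ideal_generator_of_norm[OF m] by blast
  have "g * 1 \<in> right_ideal x m" using g(2) by blast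
  then obtain a b where g_eq: "g = x * a + of_int m * b" by (auto simp: right_ideal_def)
  have associate: "\<exists>u. nrm u = 1 \<and> z = g * u" if z: "z \<in> left_factors m x" for z
  proof -
    obtain d where d: "nrm z = m" "x = z * d" using z by (auto simp: left_factors_def)
    have g_z: "g = z * (d * a + qcnj z * b)"
      by (simp add: g_eq d(2) algebra_simps mult_qcnj_assoc d(1))
    have "nrm (d * a + qcnj z * b) = 1"
      using m(2) g(1) d(1) arg_cong[OF g_z, of nrm] by (simp add: nrm_mult)
    then show ?thesis
      by (intro exI[of _ "qcnj (d * a + qcnj z * b)"]) (subst g_z, simp add: mult.assoc mult_qcnj del: qcnj_simps)
  qed
  obtain u0 where u0: "nrm u0 = 1" "y = g * u0" using associate[OF y] by blast
  fix z
  show "z \<in> (\<lambda>u. y * u) ` {u. nrm u = 1}" if z: "z \<in> left_factors m x"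
  proof -
    obtain u where "nrm u = 1" "z = g * u" using associate[OF z] by blast
    then have "z = y * (qcnj u0 * u)" "nrm (qcnj u0 * u) = 1"
      using u0 by (simp_all add: mult.assoc mult_qcnj_assoc nrm_mult)
    then show ?thesis by blast
  qed
  show "z \<in> left_factors m x" if z: "z \<in> (\<lambda>u. y * u) ` {u. nrm u = 1}"
  proof -
    obtain u where u: "nrm u = 1" "z = y * u" using z by blast
    obtain d where "nrm y = m" "x = y * d" using y by (auto simp: left_factors_def)
    then have "nrm z = m" "x = z * (qcnj u * d)"
      using u by (simp_all add: nrm_mult mult.assoc mult_qcnj_assoc)
    then show ?thesis by (auto simp: left_factors_def)
  qed
qed

lemma card_left_factors:
  assumes "odd m" "m > 0" "m dvd nrm x" "coprime m (content x)"
  shows "card (left_factors m x) = 8"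
proof -
  obtain y where y: "y \<in> left_factors m x" using left_factors_nonempty[OF assms] by blast
  then have "y \<noteq> 0" using assms(2) by (auto simp: left_factors_def)
  then have "inj_on (\<lambda>u. y * u) {u. nrm u = 1}" by (auto simp: inj_on_def)
  then show ?thesis unfolding left_factors_eq_unit_orbit[OF assms y] by (simp add: card_image card_units)
qed

lemma card_right_factors:
  assumes "odd m" "m > 0" "m dvd nrm x" "coprime m (content x)"
  shows "card (right_factors m x) = 8"
proof -
  have "card (left_factors m (qcnj x)) = 8" using assms by (intro card_left_factors) auto
  then show ?thesis unfolding left_factors_qcnj by (simp add: card_image inj_on_def)
qed

lemma right_factors_eqI:
  assumes m: "odd m" "m > 0" and x: "m dvd nrm x" "coprime m (content x)"
    and x': "m dvd nrm x'" "coprime m (content x')"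
    and y: "y \<in> right_factors m x" "y \<in> right_factors m x'"
  shows "right_factors m x = right_factors m x'"
proof -
  have "qcnj y \<in> left_factors m (qcnj x)" "qcnj y \<in> left_factors m (qcnj x')"
    using y by (auto simp: left_factors_qcnj)
  then have "left_factors m (qcnj x) = left_factors m (qcnj x')"
    using left_factors_eq_unit_orbit[OF m, of "qcnj x" "qcnj y"]
      left_factors_eq_unit_orbit[OF m, of "qcnj x'" "qcnj y"]
      x x' by simp
  then show ?thesis unfolding left_factors_qcnj
    using inj_image_eq_iff[OF bij_is_inj[OF bij_qcnj]] by blast
qed

lemma annihilated_eq_right_factors:
  assumes "m \<noteq> 0"
  shows "{b. nrm b = m \<and> qdvd m (a * b)} = qcnj ` right_factors m a"
proof (intro Set.set_eqI iffI)
  fix b assume "b \<in> {b. nrm b = m \<and> qdvd m (a * b)}"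
  then have "qcnj b \<in> right_factors m a"
    using qdvd_nrm_mult_iff[of b a] assms by (auto simp: right_factors_def)
  then show "b \<in> qcnj ` right_factors m a" by (metis imageI qcnj_simps(1))
next
  fix b assume "b \<in> qcnj ` right_factors m a"
  then obtain y d where y: "b = qcnj y" "nrm y = m" "a = d * y" by (auto simp: right_factors_def)
  then have "a = d * qcnj b" "nrm b = m" by simp_all
  then show "b \<in> {b. nrm b = m \<and> qdvd m (a * b)}" using qdvd_nrm_mult_iff[of b a] assms by auto
qed

lemma qcong_imp_right_multiple:
  assumes "qcong (nrm a) y (x * a)"
  shows "\<exists>d. y = d * a"
proof -
  obtain w where w: "y - x * a = of_int (nrm a) * w" using assms unfolding qcong_def by (rule qdvdE)
  have "of_int (nrm a) * w = w * qcnj a * a" by (simp add: mult.assoc mult_qcnj mult_of_int_commute)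
  then have "y = (x + w * qcnj a) * a" using w by (simp add: algebra_simps)
  then show ?thesis ..
qed

lemma inverse_mod:
  fixes c m :: int
  assumes "coprime c m"
  obtains c' where "m dvd c' * c - 1"
  using cong_solve_coprime_int[OF assms] by (metis cong_iff_dvd_diff mult.commute)

lemma qcong_imp_right_multiple_coprime:
  assumes "coprime c (nrm a)" "qcong (nrm a) (of_int c * y) (x * a)"
  shows "\<exists>d. y = d * a"
proof -
  obtain c' where "nrm a dvd c' * c - 1" using inverse_mod[OF assms(1)] .
  then have "qcong (nrm a) (of_int 1 * y) (of_int (c' * c) * y)"
    by (intro qcong_sym[OF qcong_of_int_mult]) simp
  also have "of_int (c' * c) * y = of_int c' * (of_int c * y)" by (simp add: mult.assoc)
  also have "qcong (nrm a) \<dots> (of_int c' * (x * a))" by (rule qcong_mult_left[OF assms(2)])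
  finally have "qcong (nrm a) y (of_int c' * x * a)" by (simp add: mult.assoc)
  then show ?thesis by (rule qcong_imp_right_multiple)
qed

subsection \<open>Factorizations of primitive quaternions\<close>

lemma sum_comp_card_fibers:
  fixes F :: "'b \<Rightarrow> real"
  assumes "finite S" "finite T" "g ` S \<subseteq> T" "\<And>y. y \<in> T \<Longrightarrow> card {x \<in> S. g x = y} = c"
  shows "(\<Sum>x\<in>S. F (g x)) = real c * (\<Sum>y\<in>T. F y)"
proof -
  have "(\<Sum>x\<in>S. F (g x)) = (\<Sum>y\<in>T. \<Sum>x\<in>{x \<in> S. g x = y}. F (g x))"
    using sum.group[OF assms(1-3), of "\<lambda>x. F (g x)"] by simp
  also have "\<dots> = (\<Sum>y\<in>T. real (card {x \<in> S. g x = y}) * F y)" by (intro sum.cong refl) simp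
  also have "\<dots> = real c * (\<Sum>y\<in>T. F y)" using assms(4) by (simp add: sum_distrib_left)
  finally show ?thesis .
qed

lemma bij_betw_fst_left_factors:
  assumes "m \<noteq> 0" "nrm x = m * k"
  shows "bij_betw fst {(a, b). nrm a = m \<and> nrm b = k \<and> a * b = x} (left_factors m x)"
    (is "bij_betw fst ?P _")
proof (rule bij_betw_imageI)
  show "inj_on fst ?P" using assms(1) by (auto simp: inj_on_def)
  show "fst ` ?P = left_factors m x"
  proof (intro Set.set_eqI iffI)
    fix a assume "a \<in> left_factors m x"
    then obtain d where d: "nrm a = m" "x = a * d" by (auto simp: left_factors_def)
    then have "nrm d = k" using assms by (simp add: nrm_mult)
    then have "(a, d) \<in> ?P" using d by simp
    then show "a \<in> fst ` ?P" by force
  qed (auto simp: left_factors_def)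
qed

lemma card_factorizations:
  assumes m: "odd m" "m > 0" and x: "x \<in> primitive (m * k)"
  shows "card {(a, b) \<in> primitive m \<times> primitive k. a * b = x} = 8"
proof -
  have "content a = 1 \<and> content b = 1" if "a * b = x" for a b
    using content_factor_eq_1[of a b] that x by (simp add: primitive_def)
  then have "{(a, b) \<in> primitive m \<times> primitive k. a * b = x}
    = {(a, b). nrm a = m \<and> nrm b = k \<and> a * b = x}"
    unfolding primitive_def by blast
  then have "card {(a, b) \<in> primitive m \<times> primitive k. a * b = x} = card (left_factors m x)"
    using bij_betw_same_card[OF bij_betw_fst_left_factors[of m x k]] m x by (simp add: primitive_def)
  also have "\<dots> = 8" using m x by (intro card_left_factors) (auto simp: primitive_def)
  finally show ?thesis .
qed

definition primitive_pairs :: "int \<Rightarrow> int \<Rightarrow> (quat \<times> quat) set" where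
  "primitive_pairs m k = {(a, b) \<in> primitive m \<times> primitive k. content (a * b) = 1}"

lemma finite_primitive_pairs: "finite (primitive_pairs m k)"
  by (rule finite_subset[of _ "primitive m \<times> primitive k"])
    (auto simp: primitive_pairs_def finite_primitive)

lemma primitive_pairs_coprime: "coprime m k \<Longrightarrow> primitive_pairs m k = primitive m \<times> primitive k"
  using content_mult_coprime by (auto simp: primitive_pairs_def primitive_def)

lemma sum_primitive_pairs:
  fixes F :: "quat \<Rightarrow> real"
  assumes m: "odd m" "m > 0"
  shows "(\<Sum>(a, b)\<in>primitive_pairs m k. F (a * b)) = 8 * (\<Sum>x\<in>primitive (m * k). F x)"
proof -
  have "(\<Sum>ab\<in>primitive_pairs m k. F (case ab of (a, b) \<Rightarrow> a * b)) = real 8 * (\<Sum>x\<in>primitive (m * k). F x)"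
  proof (rule sum_comp_card_fibers)
    fix x assume x: "x \<in> primitive (m * k)"
    have "{ab \<in> primitive_pairs m k. (case ab of (a, b) \<Rightarrow> a * b) = x}
      = {(a, b) \<in> primitive m \<times> primitive k. a * b = x}"
      using x by (auto simp: primitive_pairs_def primitive_def)
    then show "card {ab \<in> primitive_pairs m k. (case ab of (a, b) \<Rightarrow> a * b) = x} = 8"
      using card_factorizations[OF m x] by simp
  qed (auto simp: finite_primitive_pairs finite_primitive, auto simp: primitive_pairs_def primitive_def nrm_mult)
  then show ?thesis by (simp add: case_prod_unfold)
qed

lemma sum_primitive_mult:
  fixes F :: "quat \<Rightarrow> real"
  assumes "odd m" "m > 0" "coprime m k"
  shows "(\<Sum>a\<in>primitive m. \<Sum>b\<in>primitive k. F (a * b)) = 8 * (\<Sum>x\<in>primitive (m * k). F x)"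
  using sum_primitive_pairs[OF assms(1,2), of F k]
  by (simp add: primitive_pairs_coprime[OF assms(3)] sum.cartesian_product)

lemma mult_qcnj_eq_of_int_mult_iff:
  assumes "nrm \<alpha> = q" "nrm \<beta> = q" "q \<noteq> 0"
  shows "\<alpha> * y * qcnj \<beta> = of_int q * z \<longleftrightarrow> \<beta> * qcnj y = qcnj z * \<alpha>"
proof -
  have "\<alpha> \<noteq> 0" using assms by auto
  then have "\<alpha> * y * qcnj \<beta> = of_int q * z \<longleftrightarrow> qcnj \<alpha> * (\<alpha> * y * qcnj \<beta>) = qcnj \<alpha> * (of_int q * z)"
    by (metis mult_cancel_left nrm_eq_0_iff nrm_simps(1))
  also have "\<dots> \<longleftrightarrow> of_int q * (y * qcnj \<beta>) = of_int q * (qcnj \<alpha> * z)"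
    by (simp add: mult.assoc mult_qcnj_assoc assms of_int_mult_left_commute)
  also have "\<dots> \<longleftrightarrow> y * qcnj \<beta> = qcnj \<alpha> * z" using assms(3) by simp
  also have "\<dots> \<longleftrightarrow> \<beta> * qcnj y = qcnj z * \<alpha>" by (metis qcnj_mult qcnj_simps(1))
  finally show ?thesis .
qed

lemma primitive_exchange:
  assumes y: "y \<in> primitive m" and \<beta>: "\<beta> \<in> primitive q" and \<alpha>: "nrm \<alpha> = q" and q: "coprime q m" "q \<noteq> 0"
    and eq: "\<beta> * qcnj y = qcnj z * \<alpha>"
  shows "z \<in> primitive m"
proof -
  have "content (\<beta> * qcnj y) = 1"
    using y \<beta> q(1) by (intro content_mult_coprime) (auto simp: primitive_def)
  then have "content z = 1" unfolding eq using content_factor_eq_1(1) content_simps(1) by metis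
  moreover have "nrm z = m"
    using arg_cong[OF eq, of nrm] y \<beta> q(2) by (simp add: nrm_mult \<alpha> primitive_def)
  ultimately show ?thesis by (simp add: primitive_def)
qed

text \<open>The correspondence \<open>y \<mapsto> \<alpha> y \<beta>\<^sup>* / q\<close> has degree 8: the fiber over \<open>z\<close> consists of the factorizations
  \<open>\<beta> y\<^sup>* = z\<^sup>* \<alpha>\<close>.\<close>

lemma sum_correspondence:
  fixes F :: "quat \<Rightarrow> real"
  assumes q: "odd q" "q > 0" "coprime q m" and \<alpha>: "\<alpha> \<in> primitive q"
  shows "(\<Sum>y\<in>primitive m. \<Sum>\<beta> | \<beta> \<in> primitive q \<and> qdvd q (\<alpha> * y * qcnj \<beta>).
    F (quat_div (\<alpha> * y * qcnj \<beta>) q))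
    = 8 * (\<Sum>z\<in>primitive m. F z)"
proof -
  define S where "S = (SIGMA y:primitive m. {\<beta> \<in> primitive q. qdvd q (\<alpha> * y * qcnj \<beta>)})"
  define g where "g = (\<lambda>(y, \<beta>). quat_div (\<alpha> * y * qcnj \<beta>) q)"
  have q0: "q \<noteq> 0" and nrm_\<alpha>: "nrm \<alpha> = q" using q(2) \<alpha> by (auto simp: primitive_def)
  have fiber_iff: "(y, \<beta>) \<in> S \<and> g (y, \<beta>) = z
    \<longleftrightarrow> y \<in> primitive m \<and> \<beta> \<in> primitive q \<and> \<beta> * qcnj y = qcnj z * \<alpha>"
    for y \<beta> z
  proof -
    have "qdvd q w \<and> quat_div w q = z \<longleftrightarrow> w = of_int q * z" for w using q0 by (auto simp: qdvd_iff)
    then show ?thesis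
      using mult_qcnj_eq_of_int_mult_iff[OF nrm_\<alpha> _ q0, of \<beta> y z]
      by (auto simp: S_def g_def primitive_def)
  qed
  have fiber: "{s \<in> S. g s = z} = {(y, \<beta>). y \<in> primitive m \<and> \<beta> \<in> primitive q \<and> \<beta> * qcnj y = qcnj z * \<alpha>}"
    for z
    using fiber_iff[of _ _ z] by blast
  have "(\<Sum>s\<in>S. F (g s)) = real 8 * (\<Sum>z\<in>primitive m. F z)"
  proof (rule sum_comp_card_fibers)
    show "finite S" by (auto simp: S_def finite_primitive)
    show "g ` S \<subseteq> primitive m"
    proof clarify
      fix y \<beta> assume "(y, \<beta>) \<in> S"
      then show "g (y, \<beta>) \<in> primitive m"
        using fiber_iff[of y \<beta> "g (y, \<beta>)"] primitive_exchange[OF _ _ nrm_\<alpha> q(3) q0] by blast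
    qed
    fix z assume z: "z \<in> primitive m"
    have "qcnj z * \<alpha> \<in> primitive (q * m)"
      using z \<alpha> q(3) content_mult_coprime[of "qcnj z" \<alpha>]
      by (simp add: primitive_def nrm_mult coprime_commute)
    moreover have "bij_betw (\<lambda>(y, \<beta>). (\<beta>, qcnj y)) {s \<in> S. g s = z}
      {(a, b) \<in> primitive q \<times> primitive m. a * b = qcnj z * \<alpha>}"
      unfolding fiber by (rule bij_betw_byWitness[where f' = "\<lambda>(a, b). (qcnj b, a)"])
        (auto simp: primitive_def)
    ultimately show "card {s \<in> S. g s = z} = 8"
      using card_factorizations[OF q(1,2)] bij_betw_same_card by fastforce
  qed (rule finite_primitive)
  also have "(\<Sum>s\<in>S. F (g s)) = (\<Sum>y\<in>primitive m. \<Sum>\<beta> | \<beta> \<in> primitive q \<and> qdvd q (\<alpha> * y * qcnj \<beta>).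
    F (quat_div (\<alpha> * y * qcnj \<beta>) q))"
    unfolding S_def g_def by (subst sum.Sigma) (auto simp: finite_primitive intro!: sum.cong)
  finally show ?thesis by simp
qed

section \<open>Primitive quaternions of prime power norm\<close>

lemma int_eq_0_if_dvd_abs_less:
  fixes m z :: int
  assumes "m dvd z" "\<bar>z\<bar> < m"
  shows "z = 0"
  using assms dvd_imp_le_int[of z m] by force

lemma squares_mod_inj_on:
  fixes r :: int
  assumes "prime r" "odd r"
  shows "inj_on (\<lambda>x. x\<^sup>2 mod r) {0..r div 2}"
proof (rule inj_onI)
  fix x y assume x: "x \<in> {0..r div 2}" and y: "y \<in> {0..r div 2}" and "x\<^sup>2 mod r = y\<^sup>2 mod r"
  then have "r dvd (x - y) * (x + y)" by (simp add: mod_eq_dvd_iff power2_eq_square algebra_simps)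
  then have "r dvd x - y \<or> r dvd x + y" using assms(1) prime_dvd_mult_iff by blast
  moreover have "\<bar>x - y\<bar> < r" "\<bar>x + y\<bar> < r"
    using x y assms(2) prime_gt_0_int[OF assms(1)] by (auto elim!: oddE)
  ultimately have "x - y = 0 \<or> x + y = 0" using int_eq_0_if_dvd_abs_less by blast
  then show "x = y" using x y by auto
qed

text \<open>Pigeonhole: the squares and the numbers \<open>c - y\<^sup>2\<close> both occupy more than half of the residue classes.\<close>

lemma sum_two_squares_mod:
  fixes r c :: int
  assumes r: "prime r" "odd r"
  obtains x y where "r dvd x\<^sup>2 + y\<^sup>2 - c"
proof -
  let ?H = "{0..r div 2}"
  define A where "A = (\<lambda>x. x\<^sup>2 mod r) ` ?H"
  define B where "B = (\<lambda>y. (c - y\<^sup>2) mod r) ` ?H"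
  have "inj_on (\<lambda>y. (c - y\<^sup>2) mod r) ?H"
  proof (rule inj_onI)
    fix x y assume "x \<in> ?H" "y \<in> ?H" "(c - x\<^sup>2) mod r = (c - y\<^sup>2) mod r"
    moreover from this(3) have "x\<^sup>2 mod r = y\<^sup>2 mod r"
      using dvd_diff_commute[of r "x\<^sup>2"] by (simp add: mod_eq_dvd_iff)
    ultimately show "x = y" using squares_mod_inj_on[OF r] by (blast dest: inj_onD)
  qed
  then have cards: "card A = card ?H" "card B = card ?H"
    using squares_mod_inj_on[OF r] by (simp_all add: A_def B_def card_image)
  have "A \<inter> B \<noteq> {}"
  proof
    assume "A \<inter> B = {}"
    then have "card A + card B = card (A \<union> B)"
      by (intro card_Un_disjoint[symmetric]) (auto simp: A_def B_def)
    also have "\<dots> \<le> card {0..<r}"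
      using prime_gt_0_int[OF r(1)] by (intro card_mono) (auto simp: A_def B_def)
    finally show False using cards r(2) prime_gt_0_int[OF r(1)] by (auto elim!: oddE)
  qed
  then obtain x y where "x\<^sup>2 mod r = (c - y\<^sup>2) mod r" by (auto simp: A_def B_def)
  then have "r dvd x\<^sup>2 + y\<^sup>2 - c" by (simp add: mod_eq_dvd_iff algebra_simps)
  then show thesis by (rule that)
qed

text \<open>Averaging over conjugation by the four units \<open>1, i, j, k\<close> projects onto the real part.\<close>

lemma conj_average:
  "u * (1 * c) * v + u * (qi * c) * v * qcnj qi + u * (qj * c) * v * qcnj qj + u * (qk * c) * v * qcnj qk
    = of_int (4 * q0 (c * v)) * u"
  by (simp add: quat_eq_iff algebra_simps)

lemma qdvd_if_dvd_real_parts: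
  assumes "\<And>g. r dvd q0 (g * x)"
  shows "qdvd r x"
  using assms[of 1] assms[of qi] assms[of qj] assms[of qk] by (simp add: qdvd_def)

lemma not_qdvd_prime_mult:
  assumes r: "prime r" "odd r" and u: "\<not> qdvd r u" and v: "\<not> qdvd r v"
  obtains \<kappa> where "\<not> qdvd r (u * \<kappa> * v)"
proof (rule ccontr)
  assume "\<not> thesis"
  then have all: "qdvd r (u * \<kappa> * v)" for \<kappa> using that by blast
  have "coprime r (2 * 2)"
    using r(2) by (simp only: coprime_mult_right_iff coprime_right_2_iff_odd simp_thms)
  then have cop4: "coprime r 4" by simp
  have "r dvd q0 (c * v)" for c
  proof (rule ccontr)
    assume "\<not> r dvd q0 (c * v)"
    then have "coprime r (4 * q0 (c * v))" using cop4 r(1)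
      by (simp only: coprime_mult_right_iff prime_imp_coprime not_False_eq_True simp_thms)
    moreover have "qdvd r (of_int (4 * q0 (c * v)) * u)"
      unfolding conj_average[symmetric] by (intro qdvd_add qdvd_mult_right[of r "_ * _ * _"] all)
    ultimately show False using u qdvd_of_int_mult_coprime by blast
  qed
  then show False using v qdvd_if_dvd_real_parts by blast
qed

lemma not_dvd_tr_mult:
  assumes "odd r" "\<not> qdvd r u"
  obtains g where "\<not> r dvd tr (u * g)"
proof (rule ccontr)
  assume "\<not> thesis"
  then have "r dvd tr (u * g)" for g using that by blast
  then have "r dvd 2 * q0 (g * u)" for g by (metis tr_def tr_mult_commute)
  moreover have "coprime r 2" using assms(1) by simp
  ultimately show False using assms(2) qdvd_if_dvd_real_parts coprime_dvd_mult_right_iff by blast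
qed

locale odd_prime =
  fixes l :: int
  assumes prime_l: "prime l" and odd_l: "odd l"
begin

lemma l_gt_2: "l > 2"
  using prime_l odd_l prime_ge_2_int[of l] by (cases "l = 2") auto

lemma l_pow_pos: "l ^ k > 0"
  using l_gt_2 by simp

lemma odd_l_pow: "odd (l ^ k)"
  using odd_l by simp

lemma coprime_l: "\<not> l dvd a \<Longrightarrow> coprime a l"
  using prime_imp_coprime[OF prime_l, of a] coprime_commute by blast

lemma coprime_l_pow: "\<not> l dvd a \<Longrightarrow> coprime (l ^ k) a"
  using coprime_l[of a] by (simp add: coprime_commute)

lemma primitive_l_pow_iff: "x \<in> primitive (l ^ k) \<longleftrightarrow> nrm x = l ^ k \<and> \<not> qdvd l x"
  by (simp add: primitive_prime_power[OF prime_l])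

lemma card_left_factors_l:
  "l ^ i dvd nrm x \<Longrightarrow> \<not> qdvd l x \<Longrightarrow> card (left_factors (l ^ i) x) = 8"
  using odd_l_pow l_pow_pos coprime_l_pow by (intro card_left_factors) (auto simp: qdvd_iff_dvd_content)

lemma card_right_factors_l:
  "l ^ i dvd nrm x \<Longrightarrow> \<not> qdvd l x \<Longrightarrow> card (right_factors (l ^ i) x) = 8"
  using odd_l_pow l_pow_pos coprime_l_pow by (intro card_right_factors) (auto simp: qdvd_iff_dvd_content)

subsection \<open>Quaternions of prime norm\<close>

lemma isotropic_pair:
  obtains s t where "l dvd s\<^sup>2 + t\<^sup>2 + 1" "\<not> l dvd t"
proof -
  obtain s t where st: "l dvd s\<^sup>2 + t\<^sup>2 - (-1)" using sum_two_squares_mod[OF prime_l odd_l] by metis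
  show thesis
  proof (cases "l dvd t")
    case True
    have "\<not> l dvd s"
    proof
      assume "l dvd s"
      then have "l dvd s\<^sup>2 + t\<^sup>2" using True by (simp add: power2_eq_square)
      then have "l dvd 1" using st dvd_add_right_iff[of l "s\<^sup>2 + t\<^sup>2" 1] by simp
      then show False using l_gt_2 by auto
    qed
    then show thesis using that[of t s] st by (simp add: add.commute)
  qed (use that[of s t] st in simp)
qed

definition line_representatives :: "quat set" where
  "line_representatives = insert qi ((\<lambda>b. Quat 1 b 0 0) ` {0..<l})"

lemma card_line_representatives: "int (card line_representatives) = l + 1" "finite line_representatives"
proof -
  have "card line_representatives = Suc (card ((\<lambda>b. Quat 1 b 0 0) ` {0..<l}))"
    unfolding line_representatives_def by (subst card_insert_disjoint) auto
  also have "card ((\<lambda>b. Quat 1 b 0 0) ` {0..<l}) = card {0..<l}"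
    by (intro card_image) (auto simp: inj_on_def)
  finally show "int (card line_representatives) = l + 1" using l_gt_2 by simp
qed (simp add: line_representatives_def)

lemma line_representative_exists:
  assumes "\<not> (l dvd a \<and> l dvd b)"
  obtains z c where "z \<in> line_representatives" "coprime c l" "qcong l (of_int c * z) (Quat a b 0 0)"
proof (cases "l dvd a")
  case False
  then obtain a' where a': "l dvd a' * a - 1" using inverse_mod[OF coprime_l] by metis
  define z where "z = Quat 1 ((a' * b) mod l) 0 0"
  have "[a * ((a' * b) mod l) = (a' * a) * b] (mod l)" by (simp add: cong_def mod_mult_right_eq mult_ac)
  moreover have "[(a' * a) * b = 1 * b] (mod l)"
    using a' by (intro cong_scalar_right) (simp add: cong_iff_dvd_diff)
  ultimately have "l dvd a * ((a' * b) mod l) - b" by (metis cong_iff_dvd_diff cong_trans mult_1)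
  then have "qcong l (of_int a * z) (Quat a b 0 0)" by (simp add: qcong_def qdvd_def z_def)
  moreover have "z \<in> line_representatives" using l_gt_2 by (simp add: z_def line_representatives_def)
  ultimately show thesis using that coprime_l[OF False] by blast
next
  case True
  then have "coprime b l" using assms coprime_l by blast
  moreover have "qcong l (of_int b * qi) (Quat a b 0 0)" using True by (simp add: qcong_def qdvd_def)
  ultimately show thesis using that[of qi b] by (simp add: line_representatives_def)
qed

context
  fixes s t :: int
  assumes isotropic: "l dvd s\<^sup>2 + t\<^sup>2 + 1" and t: "\<not> l dvd t"
begin

definition null_quat :: quat where
  "null_quat = Quat 1 s t 0"

lemma dvd_nrm_null_quat_mult: "l dvd nrm (null_quat * z)"
proof -
  have "nrm null_quat = s\<^sup>2 + t\<^sup>2 + 1" by (simp add: null_quat_def nrm_def)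
  then show ?thesis using isotropic by (simp add: nrm_mult)
qed

lemma not_qdvd_null_quat_mult: "z \<in> line_representatives \<Longrightarrow> \<not> qdvd l (null_quat * z)"
  using t by (auto simp: line_representatives_def null_quat_def qdvd_def)

text \<open>Modulo \<open>l\<close> the right multiples of the null quaternion form a plane, spanned by its multiples by \<open>1\<close>
  and \<open>i\<close>.\<close>

lemma null_quat_mult_reduce:
  obtains a b where "qcong l (null_quat * x) (null_quat * Quat a b 0 0)"
proof -
  obtain A where A: "l dvd A * t - 1" using inverse_mod[OF coprime_l[OF t]] by blast
  define B where "B = - s * A"
  define a where "a = q0 x + A * q2 x + B * q3 x"
  define b where "b = q1 x + B * q2 x - A * q3 x"
  define e where "e = A - s * B + t"
  define g where "g = A * t - 1"
  have "e = A * (s\<^sup>2 + t\<^sup>2 + 1) - t * g" by (simp add: e_def g_def B_def power2_eq_square algebra_simps)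
  then have "l dvd e" "l dvd g" using A isotropic by (simp_all add: g_def)
  moreover have "null_quat * Quat a b 0 0 - null_quat * x
    = Quat (e * q2 x) (- (e * q3 x)) (g * q2 x - s * (g * q3 x)) (s * (g * q2 x) + g * q3 x)"
    by (simp add: quat_eq_iff null_quat_def a_def b_def B_def e_def g_def algebra_simps)
  ultimately have "qcong l (null_quat * Quat a b 0 0) (null_quat * x)" by (simp add: qcong_def qdvd_def)
  then show thesis using that qcong_sym by blast
qed

lemma primitive_l_eq_UN_right_factors:
  "primitive l = (\<Union>z\<in>line_representatives. right_factors l (null_quat * z))"
proof (intro subset_antisym subsetI)
  fix \<alpha> assume "\<alpha> \<in> primitive l"
  then have \<alpha>: "nrm \<alpha> = l" "\<not> qdvd l \<alpha>" using primitive_l_pow_iff[of \<alpha> 1] by auto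
  have "\<not> qdvd l null_quat"
    using not_qdvd_null_quat_mult[of qi] qdvd_mult_right by (auto simp: line_representatives_def)
  then obtain g where g: "\<not> qdvd l (null_quat * g * \<alpha>)"
    using not_qdvd_prime_mult[OF prime_l odd_l _ \<alpha>(2)] by metis
  obtain a b where ab: "qcong l (null_quat * (g * \<alpha>)) (null_quat * Quat a b 0 0)"
    by (rule null_quat_mult_reduce)
  have "\<not> (l dvd a \<and> l dvd b)"
    using g qcong_qdvd_iff[OF ab] qdvd_mult_left[of l "Quat a b 0 0" null_quat]
    by (auto simp: qdvd_def mult.assoc)
  then obtain z c where z: "z \<in> line_representatives" "coprime c l"
    "qcong l (of_int c * z) (Quat a b 0 0)"
    by (rule line_representative_exists)
  have "of_int c * (null_quat * z) = null_quat * (of_int c * z)"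
    by (rule of_int_mult_left_commute[symmetric])
  also have "qcong l \<dots> (null_quat * g * \<alpha>)"
    using qcong_trans[OF qcong_mult_left[OF z(3)] qcong_sym[OF ab]] by (simp add: mult.assoc)
  finally have "\<exists>d. null_quat * z = d * \<alpha>" using qcong_imp_right_multiple_coprime z(2) \<alpha>(1) by metis
  then show "\<alpha> \<in> (\<Union>z\<in>line_representatives. right_factors l (null_quat * z))"
    using z(1) \<alpha>(1) by (auto simp: right_factors_def)
qed (auto simp: right_factors_def primitive_prime[OF prime_l])

lemma null_quat_no_common_right_factor:
  assumes \<alpha>: "nrm \<alpha> = l" and e: "null_quat * qi = e * \<alpha>" and d: "null_quat * Quat 1 b 0 0 = d * \<alpha>"
  shows False
proof -
  have "null_quat = null_quat * Quat 1 b 0 0 - of_int b * (null_quat * qi)"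
    by (simp add: quat_eq_iff null_quat_def algebra_simps)
  then have null: "null_quat = (d - of_int b * e) * \<alpha>" unfolding d e by (simp add: algebra_simps)
  have "null_quat * qi * qcnj null_quat = of_int l * (e * qcnj (d - of_int b * e))"
    unfolding e by (subst null)
      (simp add: qcnj_mult mult.assoc mult_qcnj_assoc \<alpha> of_int_mult_left_commute del: qcnj_simps)
  then have "qdvd l (null_quat * qi * qcnj null_quat)" by simp
  then have "l dvd 2 * t" by (simp add: qdvd_def null_quat_def)
  then show False using t prime_l odd_l by (simp add: coprime_dvd_mult_right_iff)
qed

lemma right_factors_null_quat_disjoint:
  assumes z: "z \<in> line_representatives" and w: "w \<in> line_representatives" and "z \<noteq> w"
  shows "right_factors l (null_quat * z) \<inter> right_factors l (null_quat * w) = {}"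
proof (rule ccontr)
  assume "right_factors l (null_quat * z) \<inter> right_factors l (null_quat * w) \<noteq> {}"
  then obtain \<alpha> d d' where \<alpha>: "nrm \<alpha> = l" "null_quat * z = d * \<alpha>" "null_quat * w = d' * \<alpha>"
    by (auto simp: right_factors_def)
  from z w consider "z = qi" "w \<noteq> qi" | "w = qi" "z \<noteq> qi"
    | b b' where "z = Quat 1 b 0 0" "w = Quat 1 b' 0 0" "b \<in> {0..<l}" "b' \<in> {0..<l}"
    using \<open>z \<noteq> w\<close> unfolding line_representatives_def by blast
  then show False
  proof cases
    case 1
    then show False using w \<alpha> null_quat_no_common_right_factor by (auto simp: line_representatives_def)
  next
    case 2
    then show False using z \<alpha> null_quat_no_common_right_factor by (auto simp: line_representatives_def)
  next
    case 3
    then have "b - b' \<noteq> 0" "\<bar>b - b'\<bar> < l" using \<open>z \<noteq> w\<close> by auto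
    then have "coprime (b - b') l" using coprime_l int_eq_0_if_dvd_abs_less by blast
    moreover have "of_int (b - b') * (null_quat * qi) = null_quat * z - null_quat * w"
      unfolding 3(1,2) by (simp add: quat_eq_iff null_quat_def algebra_simps)
    then have "of_int (b - b') * (null_quat * qi) = (d - d') * \<alpha>"
      using \<alpha> by (simp add: left_diff_distrib)
    ultimately obtain e where "null_quat * qi = e * \<alpha>"
      using qcong_imp_right_multiple_coprime[of "b - b'" \<alpha> "null_quat * qi" "d - d'"] \<alpha>(1) by auto
    then show False using null_quat_no_common_right_factor[OF \<alpha>(1)] \<alpha>(2) 3(1) by blast
  qed
qed

end

lemma card_primitive_l: "int (card (primitive l)) = 8 * (l + 1)"
proof -
  obtain s t where st: "l dvd s\<^sup>2 + t\<^sup>2 + 1" "\<not> l dvd t" by (rule isotropic_pair)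
  have "card (primitive l) = (\<Sum>z\<in>line_representatives. card (right_factors l (null_quat s t * z)))"
    unfolding primitive_l_eq_UN_right_factors[OF st]
  proof (rule card_UN_disjoint)
    show "\<forall>z\<in>line_representatives. finite (right_factors l (null_quat s t * z))"
      by (auto intro: finite_subset[OF _ finite_nrm[of l]] simp: right_factors_def)
  qed (use card_line_representatives(2) right_factors_null_quat_disjoint[OF st] in auto)
  also have "\<dots> = 8 * card line_representatives"
    using card_right_factors_l[of 1] dvd_nrm_null_quat_mult[OF st] not_qdvd_null_quat_mult[OF st] by simp
  finally show ?thesis using card_line_representatives(1) by simp
qed

subsection \<open>Multiplication by quaternions of prime norm\<close>

lemma card_annihilated:
  assumes "a \<in> primitive (l ^ m)" "m \<ge> 1"
  shows "card {b \<in> primitive l. qdvd l (a * b)} = 8"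
proof -
  have "{b \<in> primitive l. qdvd l (a * b)} = {b. nrm b = l \<and> qdvd l (a * b)}"
    by (simp add: primitive_prime[OF prime_l])
  also have "\<dots> = qcnj ` right_factors l a"
    using l_gt_2 by (intro annihilated_eq_right_factors) simp
  also have "card \<dots> = card (right_factors l a)" by (intro card_image) (simp add: inj_on_def)
  also have "\<dots> = 8" using card_right_factors_l[of 1 a] assms by (simp add: primitive_l_pow_iff)
  finally show ?thesis .
qed

lemma card_not_annihilated:
  assumes "a \<in> primitive (l ^ m)" "m \<ge> 1"
  shows "int (card {b \<in> primitive l. \<not> qdvd l (a * b)}) = 8 * l"
proof -
  have "card {b \<in> primitive l. \<not> qdvd l (a * b)} + card {b \<in> primitive l. qdvd l (a * b)}
    = card (primitive l)"
    by (subst card_Un_disjoint[symmetric]) (auto simp: finite_primitive intro: arg_cong[where f = card])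
  then show ?thesis using card_annihilated[OF assms] card_primitive_l by simp
qed

lemma primitive_pairs_l_pow:
  "primitive_pairs (l ^ m) l = (SIGMA a:primitive (l ^ m). {b \<in> primitive l. \<not> qdvd l (a * b)})"
proof -
  have "content (a * b) = 1 \<longleftrightarrow> \<not> qdvd l (a * b)" if "a \<in> primitive (l ^ m)" "b \<in> primitive l" for a b
    using primitive_l_pow_iff[of "a * b" "Suc m"] that by (simp add: primitive_def nrm_mult mult.commute)
  then show ?thesis by (auto simp: primitive_pairs_def)
qed

lemma card_primitive_l_pow_Suc:
  assumes "m \<ge> 1"
  shows "int (card (primitive (l ^ Suc m))) = l * int (card (primitive (l ^ m)))"
proof -
  have "int (card (primitive_pairs (l ^ m) l))
    = (\<Sum>a\<in>primitive (l ^ m). int (card {b \<in> primitive l. \<not> qdvd l (a * b)}))"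
    unfolding primitive_pairs_l_pow by (simp add: card_SigmaI finite_primitive)
  also have "\<dots> = 8 * l * int (card (primitive (l ^ m)))" using card_not_annihilated assms by simp
  finally have "int (card (primitive_pairs (l ^ m) l)) = 8 * l * int (card (primitive (l ^ m)))" .
  moreover have "real (card (primitive_pairs (l ^ m) l)) = 8 * real (card (primitive (l ^ m * l)))"
    using sum_primitive_pairs[OF odd_l_pow l_pow_pos, of "\<lambda>_. 1" m l] by simp
  then have "card (primitive_pairs (l ^ m) l) = 8 * card (primitive (l ^ Suc m))"
    by (simp add: mult.commute)
  ultimately show ?thesis by simp
qed

lemma card_primitive_l_pow:
  assumes "m \<ge> 1"
  shows "int (card (primitive (l ^ m))) = 8 * (l + 1) * l ^ (m - 1)"
  using assms
proof (induction m rule: nat_induct_at_least)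
  case base
  then show ?case using card_primitive_l by simp
next
  case (Suc m)
  then show ?case using card_primitive_l_pow_Suc[of m] by (cases m) (auto simp: algebra_simps)
qed

lemma card_primitive_l_pow_bounds:
  "8 * of_int (l ^ m) \<le> real (card (primitive (l ^ m)))"
  "real (card (primitive (l ^ m))) \<le> 16 * of_int (l ^ m)"
proof -
  have "8 * l ^ m \<le> int (card (primitive (l ^ m))) \<and> int (card (primitive (l ^ m))) \<le> 16 * l ^ m"
  proof (cases m)
    case 0
    then show ?thesis by (simp add: primitive_1 card_units)
  next
    case (Suc k)
    have "8 * l * l ^ k \<le> 8 * (l + 1) * l ^ k" "8 * (l + 1) * l ^ k \<le> 16 * l * l ^ k"
      using l_gt_2 by (intro mult_right_mono; simp)+
    then show ?thesis using card_primitive_l_pow[of m] Suc by simp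
  qed
  then show "8 * of_int (l ^ m) \<le> real (card (primitive (l ^ m)))"
    "real (card (primitive (l ^ m))) \<le> 16 * of_int (l ^ m)" by linarith+
qed

lemma bij_betw_backtracking:
  "bij_betw (\<lambda>(w, c). (w * c, qcnj c)) (primitive_pairs (l ^ m) l)
    {(a, b) \<in> primitive (l ^ Suc m) \<times> primitive l. qdvd l (a * b)}"
proof (rule bij_betw_imageI)
  let ?f = "\<lambda>(w, c). (w * c, qcnj c)"
  let ?B = "{(a, b) \<in> primitive (l ^ Suc m) \<times> primitive l. qdvd l (a * b)}"
  have nonzero: "c \<noteq> 0" if "c \<in> primitive l" for c using that l_gt_2 by (auto simp: primitive_def)
  show "inj_on ?f (primitive_pairs (l ^ m) l)"
    using nonzero by (auto simp: inj_on_def primitive_pairs_def)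
  show "?f ` primitive_pairs (l ^ m) l = ?B"
  proof (intro Set.set_eqI iffI)
    fix ab assume "ab \<in> ?f ` primitive_pairs (l ^ m) l"
    then obtain w c where wc: "ab = (w * c, qcnj c)" "(w, c) \<in> primitive_pairs (l ^ m) l" by auto
    then have "w * c \<in> primitive (l ^ Suc m)" "qcnj c \<in> primitive l"
      by (auto simp: primitive_pairs_def primitive_def nrm_mult mult.commute)
    moreover have "w * c * qcnj c = of_int l * w"
      using wc(2) by (auto simp: primitive_pairs_def primitive_def mult.assoc mult_qcnj mult_of_int_commute)
    ultimately show "ab \<in> ?B" using wc(1) by simp
  next
    fix ab assume "ab \<in> ?B"
    then obtain a b where ab: "ab = (a, b)" "a \<in> primitive (l ^ Suc m)" "b \<in> primitive l"
      "qdvd l (a * b)" by auto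
    then obtain w where w: "a = w * qcnj b"
      using qdvd_nrm_mult_iff[OF nonzero] by (auto simp: primitive_def)
    have "content w = 1" using ab(2) w content_factor_eq_1(1) by (auto simp: primitive_def)
    moreover have "nrm w = l ^ m" using ab(2,3) l_gt_2 by (simp add: w primitive_def nrm_mult)
    ultimately have "(w, qcnj b) \<in> primitive_pairs (l ^ m) l"
      using ab(2,3) w by (auto simp: primitive_pairs_def primitive_def)
    then show "ab \<in> ?f ` primitive_pairs (l ^ m) l" using ab(1) w by force
  qed
qed

lemma sum_mult_primitive_l:
  fixes F :: "quat \<Rightarrow> real"
  assumes "m \<ge> 1"
  shows "(\<Sum>a\<in>primitive (l ^ Suc m). \<Sum>b\<in>primitive l. F (a * b))
    = 8 * (\<Sum>x\<in>primitive (l ^ (m + 2)). F x) + 8 * of_int l * (\<Sum>a\<in>primitive (l ^ m). F (of_int l * a))"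
proof -
  let ?P = "primitive (l ^ Suc m) \<times> primitive l"
  let ?B = "{(a, b) \<in> ?P. qdvd l (a * b)}"
  have split: "?P = primitive_pairs (l ^ Suc m) l \<union> ?B" unfolding primitive_pairs_l_pow by auto
  have disjoint: "primitive_pairs (l ^ Suc m) l \<inter> ?B = {}" unfolding primitive_pairs_l_pow by auto
  have fin: "finite ?P" by (simp add: finite_primitive)
  have "(\<Sum>(a, b)\<in>?B. F (a * b)) = (\<Sum>(w, c)\<in>primitive_pairs (l ^ m) l. F (w * c * qcnj c))"
    using sum.reindex_bij_betw[OF bij_betw_backtracking, of "\<lambda>(a, b). F (a * b)" m]
    by (simp add: case_prod_unfold)
  also have "\<dots> = (\<Sum>(w, c)\<in>primitive_pairs (l ^ m) l. F (of_int l * w))"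
    by (intro sum.cong refl)
      (auto simp: primitive_pairs_def primitive_def mult.assoc mult_qcnj mult_of_int_commute)
  also have "\<dots> = (\<Sum>w\<in>primitive (l ^ m).
    real (card {c \<in> primitive l. \<not> qdvd l (w * c)}) * F (of_int l * w))"
    unfolding primitive_pairs_l_pow by (subst sum.Sigma[symmetric]) (auto simp: finite_primitive)
  also have "\<dots> = 8 * of_int l * (\<Sum>w\<in>primitive (l ^ m). F (of_int l * w))"
  proof -
    have "real (card {c \<in> primitive l. \<not> qdvd l (w * c)}) = 8 * of_int l"
      if "w \<in> primitive (l ^ m)" for w
      using card_not_annihilated[OF that assms] by linarith
    then show ?thesis by (simp add: sum_distrib_left)
  qed
  finally have backtracking: "(\<Sum>(a, b)\<in>?B. F (a * b))
    = 8 * of_int l * (\<Sum>w\<in>primitive (l ^ m). F (of_int l * w))" .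
  have "(\<Sum>a\<in>primitive (l ^ Suc m). \<Sum>b\<in>primitive l. F (a * b))
    = (\<Sum>(a, b)\<in>primitive_pairs (l ^ Suc m) l. F (a * b)) + (\<Sum>(a, b)\<in>?B. F (a * b))"
    unfolding sum.cartesian_product using fin disjoint by (subst split, subst sum.union_disjoint)
      (auto intro: finite_subset[OF _ fin] simp: finite_primitive_pairs)
  then show ?thesis
    using sum_primitive_pairs[OF odd_l_pow l_pow_pos, of F "Suc m" l] backtracking by (simp add: mult_ac)
qed

end

section \<open>Incidences modulo a prime power\<close>

definition quat_residues :: "int \<Rightarrow> quat set" where
  "quat_residues m = {x. q0 x \<in> {0..<m} \<and> q1 x \<in> {0..<m} \<and> q2 x \<in> {0..<m} \<and> q3 x \<in> {0..<m}}"

lemma bij_betw_quat_residues: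
  "bij_betw (\<lambda>(a, b, c, d). Quat a b c d) ({0..<m} \<times> {0..<m} \<times> {0..<m} \<times> {0..<m}) (quat_residues m)"
  by (rule bij_betw_byWitness[where f' = "\<lambda>x. (q0 x, q1 x, q2 x, q3 x)"]) (auto simp: quat_residues_def)

lemma finite_quat_residues: "finite (quat_residues m)"
  using bij_betw_finite[OF bij_betw_quat_residues[of m]] by simp

lemma sum_quat_residues:
  "(\<Sum>x\<in>quat_residues m. f x) = (\<Sum>a=0..<m. \<Sum>b=0..<m. \<Sum>c=0..<m. \<Sum>d=0..<m. f (Quat a b c d))"
  using sum.reindex_bij_betw[OF bij_betw_quat_residues, of f m]
  by (simp add: sum.cartesian_product case_prod_unfold)

definition additive_char :: "int \<Rightarrow> int \<Rightarrow> complex" where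
  "additive_char q x = cis (2 * pi * of_int x / of_int q)"

lemma additive_char_add: "additive_char q (x + y) = additive_char q x * additive_char q y"
  by (simp add: additive_char_def cis_mult add_divide_distrib distrib_left)

lemma additive_char_mult_int: "additive_char q (a * int k) = additive_char q a ^ k"
  by (simp add: additive_char_def DeMoivre mult_ac)

lemma additive_char_eq_1_iff:
  assumes "q > 0"
  shows "additive_char q x = 1 \<longleftrightarrow> q dvd x"
proof
  assume "q dvd x"
  then obtain k where "x = q * k" ..
  then have "2 * pi * of_int x / of_int q = 2 * pi * of_int k" using assms by simp
  then show "additive_char q x = 1" by (simp add: additive_char_def)
next
  assume "additive_char q x = 1"
  then have "cos (2 * pi * of_int x / of_int q) = 1" by (simp add: additive_char_def complex_eq_iff)
  then obtain k where "2 * pi * of_int x / of_int q = of_int k * 2 * pi"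
    using cos_one_2pi_int by blast
  then have "of_int x = (of_int (q * k) :: real)" using assms by (simp add: field_simps)
  then have "x = q * k" by (simp only: of_int_eq_iff)
  then show "q dvd x" by simp
qed

lemma sum_additive_char:
  assumes q: "q > 0"
  shows "(\<Sum>x=0..<q. additive_char q (a * x)) = (if q dvd a then of_int q else 0)"
proof (cases "q dvd a")
  case True
  then have "additive_char q (a * x) = 1" for x using additive_char_eq_1_iff[OF q] by simp
  then show ?thesis using True q by simp
next
  case False
  have "additive_char q a ^ nat q = 1"
    using additive_char_eq_1_iff[OF q, of "a * q"] q by (simp flip: additive_char_mult_int)
  moreover have "additive_char q a \<noteq> 1" using False additive_char_eq_1_iff[OF q] by blast
  moreover have "(\<Sum>x=0..<q. additive_char q (a * x)) = (\<Sum>k<nat q. additive_char q a ^ k)"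
    by (rule sum.reindex_bij_witness[of _ int nat]) (auto simp flip: additive_char_mult_int)
  ultimately show ?thesis using False by (simp add: geometric_sum)
qed

lemma sum_additive_char_tr:
  assumes q: "q > 0" "odd q"
  shows "(\<Sum>g\<in>quat_residues q. additive_char q (tr (u * g))) = (if qdvd q u then of_int (q ^ 4) else 0)"
proof -
  have tr_eq: "tr (u * Quat a b c d)
    = 2 * q0 u * a + (- 2 * q1 u) * b + (- 2 * q2 u) * c + (- 2 * q3 u) * d"
    for a b c d by (simp add: tr_def algebra_simps)
  have "coprime q 2" using q by simp
  then have dvd_double: "q dvd 2 * z \<longleftrightarrow> q dvd z" "q dvd - 2 * z \<longleftrightarrow> q dvd z" for z
    by (simp_all add: coprime_dvd_mult_right_iff)
  have "(\<Sum>g\<in>quat_residues q. additive_char q (tr (u * g)))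
    = (\<Sum>a=0..<q. additive_char q (2 * q0 u * a)) * (\<Sum>b=0..<q. additive_char q (- 2 * q1 u * b)) *
      (\<Sum>c=0..<q. additive_char q (- 2 * q2 u * c)) * (\<Sum>d=0..<q. additive_char q (- 2 * q3 u * d))"
    unfolding sum_quat_residues tr_eq additive_char_add
    by (simp only: sum_distrib_left[symmetric] sum_distrib_right[symmetric])
  also have "\<dots> = (if qdvd q u then of_int (q ^ 4) else 0)"
    unfolding sum_additive_char[OF q(1)] dvd_double by (auto simp: qdvd_def power4_eq_xxxx)
  finally show ?thesis .
qed

lemma card_common_zeros_of_forms:
  assumes q: "q > 0" "odd q"
  shows "int (card {g \<in> quat_residues q. q dvd tr (u * g) \<and> q dvd tr (v * g)})
    = q\<^sup>2 * int (card {(c, c') \<in> {0..<q} \<times> {0..<q}. qcong q (of_int c * u) (of_int c' * v)})"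
    (is "int (card ?A) = q\<^sup>2 * int (card ?C)")
proof -
  let ?I = "{0..<q}" and ?e = "additive_char q"
  have detect: "(\<Sum>c\<in>?I. ?e (x * c)) * (\<Sum>c'\<in>?I. ?e (- y * c'))
    = (if q dvd x \<and> q dvd y then (of_int q)\<^sup>2 else 0)" for x y
    unfolding sum_additive_char[OF q(1)] by (simp add: power2_eq_square)
  have expand: "(\<Sum>c\<in>?I. ?e (tr (u * g) * c)) * (\<Sum>c'\<in>?I. ?e (- tr (v * g) * c'))
    = (\<Sum>c\<in>?I. \<Sum>c'\<in>?I. ?e (tr ((of_int c * u - of_int c' * v) * g)))" for g
  proof -
    have "tr ((of_int c * u - of_int c' * v) * g) = tr (u * g) * c + - tr (v * g) * c'" for c c'
      by (simp add: tr_def algebra_simps)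
    then show ?thesis by (simp only: additive_char_add sum_product)
  qed
  have "(of_int q)\<^sup>2 * of_nat (card ?A)
    = (\<Sum>g\<in>quat_residues q. if q dvd tr (u * g) \<and> q dvd tr (v * g) then (of_int q :: complex)\<^sup>2 else 0)"
    by (simp add: finite_quat_residues flip: sum.inter_filter)
  also have "\<dots> = (\<Sum>g\<in>quat_residues q. \<Sum>c\<in>?I. \<Sum>c'\<in>?I. ?e (tr ((of_int c * u - of_int c' * v) * g)))"
    unfolding detect[symmetric] expand ..
  also have "\<dots> = (\<Sum>c\<in>?I. \<Sum>c'\<in>?I. \<Sum>g\<in>quat_residues q. ?e (tr ((of_int c * u - of_int c' * v) * g)))"
    by (subst sum.swap, intro sum.cong refl, rule sum.swap)
  also have "\<dots> = (\<Sum>cc\<in>?I \<times> ?I.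
    if qcong q (of_int (fst cc) * u) (of_int (snd cc) * v) then of_int (q ^ 4) else 0)"
    unfolding sum_additive_char_tr[OF q] sum.cartesian_product qcong_def by (simp add: case_prod_unfold)
  also have "\<dots> = of_nat (card {cc \<in> ?I \<times> ?I. qcong q (of_int (fst cc) * u) (of_int (snd cc) * v)})
    * of_int (q ^ 4)"
    by (simp flip: sum.inter_filter)
  also have "{cc \<in> ?I \<times> ?I. qcong q (of_int (fst cc) * u) (of_int (snd cc) * v)} = ?C" by auto
  finally have "of_int (q\<^sup>2 * int (card ?A)) = (of_int (q\<^sup>2 * (q\<^sup>2 * int (card ?C))) :: complex)"
    by (simp add: power4_eq_xxxx power2_eq_square mult_ac)
  then have "q\<^sup>2 * int (card ?A) = q\<^sup>2 * (q\<^sup>2 * int (card ?C))" by (simp only: of_int_eq_iff)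
  moreover have "q\<^sup>2 \<noteq> 0" using q(1) by simp
  ultimately show ?thesis using mult_left_cancel by blast
qed

text \<open>Modulo \<open>nrm a\<close> the element \<open>a\<close> behaves like a matrix of rank one.\<close>

lemma qcong_rank_one: "qcong (nrm a) (a * z * a) (of_int (tr (a * z)) * a)"
proof -
  have "a * z * a = of_int (tr (a * z)) * a - of_int (nrm a) * qcnj z"
    by (simp add: quat_eq_iff tr_def nrm_def power2_eq_square algebra_simps)
  then show ?thesis by (simp add: qcong_def)
qed

lemma qdvd_mult_mult_qcnj: "qdvd (nrm a) (x * a * qcnj a)" "qdvd (nrm a) (a * (qcnj a * x))"
  by (simp_all add: mult.assoc mult_qcnj mult_qcnj_assoc qdvd_mult_left)

lemma qcong_tr_proportional:
  assumes "qdvd m (u * qcnj v)" "qdvd m (qcnj u * v)"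
  shows "qcong m (of_int (tr (u * g)) * v) (of_int (tr (v * g)) * u)"
proof -
  have "of_int (tr (u * g)) * v - of_int (tr (v * g)) * u
    = qcnj g * (qcnj u * v) - (u * qcnj v) * qcnj g"
    by (simp add: quat_eq_iff tr_def algebra_simps)
  then show ?thesis using assms by (simp add: qcong_def qdvd_diff qdvd_mult_left qdvd_mult_right)
qed

context odd_prime
begin

lemma l_pow_dvd_if_qdvd_of_int_mult:
  assumes "\<not> qdvd l v" "qdvd (l ^ k) (of_int c * v)"
  shows "l ^ k dvd c"
proof -
  have "l ^ k dvd \<bar>c\<bar> * content v"
    using assms(2) by (simp only: qdvd_iff_dvd_content content_of_int_mult)
  moreover have "coprime (l ^ k) (content v)"
    using assms(1) by (intro coprime_l_pow) (simp add: qdvd_iff_dvd_content)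
  ultimately show ?thesis by (simp add: coprime_dvd_mult_left_iff)
qed

lemma qdvd_left_form_cancel:
  assumes \<alpha>: "nrm \<alpha> = l ^ k" and form: "\<not> qdvd l (\<eta> * \<alpha>)" and w: "qdvd (l ^ k) (\<eta> * \<alpha> * w)"
  shows "qdvd (l ^ k) (\<alpha> * w)"
proof -
  obtain g where g: "\<not> l dvd tr (\<eta> * \<alpha> * g)" using not_dvd_tr_mult[OF odd_l form] .
  have "tr (\<alpha> * (g * \<eta>)) = tr (\<eta> * \<alpha> * g)" using tr_mult_commute[of "\<alpha> * g" \<eta>] by (simp add: mult.assoc)
  then have "qcong (l ^ k) (\<alpha> * (g * \<eta>) * \<alpha> * w) (of_int (tr (\<eta> * \<alpha> * g)) * \<alpha> * w)"
    using qcong_mult_right[OF qcong_rank_one[of \<alpha> "g * \<eta>"], of w] \<alpha> by simp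
  moreover have "qdvd (l ^ k) (\<alpha> * (g * \<eta>) * \<alpha> * w)"
    using qdvd_mult_left[OF w, of "\<alpha> * g"] by (simp add: mult.assoc)
  ultimately have "qdvd (l ^ k) (of_int (tr (\<eta> * \<alpha> * g)) * (\<alpha> * w))"
    using qcong_qdvd_iff by (simp add: mult.assoc)
  then show ?thesis using qdvd_of_int_mult_coprime[OF coprime_l_pow[OF g]] by blast
qed

lemma qdvd_right_form_cancel:
  assumes \<beta>: "nrm \<beta> = l ^ k" and form: "\<not> qdvd l (qcnj \<beta> * \<eta>)" and w: "qdvd (l ^ k) (w * (qcnj \<beta> * \<eta>))"
  shows "qdvd (l ^ k) (w * qcnj \<beta>)"
proof -
  have "\<not> qdvd l (qcnj \<eta> * \<beta>)" "qdvd (l ^ k) (qcnj \<eta> * \<beta> * qcnj w)"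
    using form w qdvd_qcnj[of l "qcnj \<beta> * \<eta>"] qdvd_qcnj[of "l ^ k" "w * (qcnj \<beta> * \<eta>)"]
    by (simp_all add: qcnj_mult mult.assoc del: qdvd_qcnj)
  then have "qdvd (l ^ k) (\<beta> * qcnj w)" using qdvd_left_form_cancel[OF \<beta>] by blast
  then have "qdvd (l ^ k) (qcnj (\<beta> * qcnj w))" by (simp only: qdvd_qcnj)
  then show ?thesis by (simp add: qcnj_mult)
qed

text \<open>\<open>\<beta>\<^sup>* \<xi> \<alpha>\<close> represents the linear form that cuts out the condition \<open>l ^ k | \<alpha> g \<beta>\<^sup>*\<close>.\<close>

lemma incidence_iff_form:
  assumes \<alpha>: "nrm \<alpha> = l ^ k" and \<beta>: "nrm \<beta> = l ^ k" and form: "\<not> qdvd l (qcnj \<beta> * \<xi> * \<alpha>)"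
  shows "qdvd (l ^ k) (\<alpha> * g * qcnj \<beta>) \<longleftrightarrow> l ^ k dvd tr (qcnj \<beta> * \<xi> * \<alpha> * g)"
proof
  have tr_eq: "tr (\<alpha> * g * qcnj \<beta> * \<xi>) = tr (qcnj \<beta> * \<xi> * \<alpha> * g)"
    using tr_mult_commute[of "\<alpha> * g" "qcnj \<beta> * \<xi>"] by (simp add: mult.assoc)
  show "l ^ k dvd tr (qcnj \<beta> * \<xi> * \<alpha> * g)" if "qdvd (l ^ k) (\<alpha> * g * qcnj \<beta>)"
  proof -
    have "qdvd (l ^ k) (\<alpha> * g * qcnj \<beta> * \<xi>)" using that by (rule qdvd_mult_right)
    then show ?thesis unfolding tr_eq[symmetric] unfolding tr_def qdvd_def by (simp only: dvd_mult)
  qed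
  show "qdvd (l ^ k) (\<alpha> * g * qcnj \<beta>)" if "l ^ k dvd tr (qcnj \<beta> * \<xi> * \<alpha> * g)"
  proof -
    have "qcong (l ^ k) (\<alpha> * (g * qcnj \<beta> * \<xi>) * \<alpha>) (of_int (tr (\<alpha> * g * qcnj \<beta> * \<xi>)) * \<alpha>)"
      using qcong_rank_one[of \<alpha> "g * qcnj \<beta> * \<xi>"] \<alpha> by (simp add: mult.assoc)
    then have "qdvd (l ^ k) (\<alpha> * (g * qcnj \<beta> * \<xi>) * \<alpha>)"
      using qdvd_of_int_mult_dvd[OF that] qcong_qdvd_iff unfolding tr_eq by blast
    then have "qdvd (l ^ k) (\<alpha> * g * (qcnj \<beta> * (\<xi> * \<alpha>)))" by (simp add: mult.assoc)
    then show ?thesis using qdvd_right_form_cancel[OF \<beta>] form by (metis mult.assoc)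
  qed
qed

lemma forms_qcong_imp:
  assumes \<alpha>: "nrm \<alpha> = l ^ k" and \<beta>: "nrm \<beta> = l ^ k" and \<alpha>': "nrm \<alpha>' = l ^ k" and \<beta>': "nrm \<beta>' = l ^ k"
    and form: "\<not> qdvd l (qcnj \<beta> * \<xi> * \<alpha>)"
    and cong: "qcong (l ^ k) (of_int c * (qcnj \<beta> * \<xi> * \<alpha>)) (of_int c' * (qcnj \<beta>' * \<xi>' * \<alpha>'))"
  shows "qdvd (l ^ k) (of_int c * (\<alpha> * qcnj \<alpha>'))" "qdvd (l ^ k) (of_int c * (\<beta> * qcnj \<beta>'))"
proof -
  have "qdvd (l ^ k) (of_int c' * (qcnj \<beta>' * \<xi>') * \<alpha>' * qcnj \<alpha>')"
    using qdvd_mult_mult_qcnj(1)[of \<alpha>'] by (simp only: \<alpha>')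
  then have "qdvd (l ^ k) (of_int c * (qcnj \<beta> * \<xi> * \<alpha>) * qcnj \<alpha>')"
    using qcong_qdvd_iff[OF qcong_mult_right[OF cong, of "qcnj \<alpha>'"]] by (simp only: mult.assoc)
  then have "qdvd (l ^ k) (qcnj \<beta> * \<xi> * \<alpha> * (of_int c * qcnj \<alpha>'))"
    by (simp only: mult.assoc of_int_mult_left_commute)
  from qdvd_left_form_cancel[OF \<alpha> form this] show "qdvd (l ^ k) (of_int c * (\<alpha> * qcnj \<alpha>'))"
    by (simp only: of_int_mult_left_commute)
  have "qdvd (l ^ k) (of_int c' * (\<beta>' * (qcnj \<beta>' * (\<xi>' * \<alpha>'))))"
    using qdvd_mult_mult_qcnj(2)[of \<beta>' "\<xi>' * \<alpha>'"] unfolding \<beta>' by (rule qdvd_mult_left)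
  then have "qdvd (l ^ k) (\<beta>' * (of_int c * (qcnj \<beta> * \<xi> * \<alpha>)))"
    using qcong_qdvd_iff[OF qcong_mult_left[OF cong, of \<beta>']]
    by (simp only: mult.assoc of_int_mult_left_commute[of \<beta>'])
  then have "qdvd (l ^ k) (of_int c * \<beta>' * (qcnj \<beta> * (\<xi> * \<alpha>)))"
    by (simp only: mult.assoc of_int_mult_left_commute)
  then have "qdvd (l ^ k) (of_int c * \<beta>' * qcnj \<beta>)"
    using qdvd_right_form_cancel[OF \<beta>] form by (metis mult.assoc)
  then have "qdvd (l ^ k) (qcnj (of_int c * \<beta>' * qcnj \<beta>))" by (simp only: qdvd_qcnj)
  then show "qdvd (l ^ k) (of_int c * (\<beta> * qcnj \<beta>'))"
    by (simp only: qcnj_mult qcnj_simps mult_of_int_commute[symmetric] of_int_mult_left_commute)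
qed

lemma forms_qcong_exists:
  assumes form': "\<not> qdvd l (qcnj \<beta>' * \<xi>' * \<alpha>')"
    and \<alpha>: "qdvd (l ^ k) (of_int c * (\<alpha> * qcnj \<alpha>'))" and \<beta>: "qdvd (l ^ k) (of_int c * (\<beta> * qcnj \<beta>'))"
  shows "\<exists>c'. qcong (l ^ k) (of_int c * (qcnj \<beta> * \<xi> * \<alpha>)) (of_int c' * (qcnj \<beta>' * \<xi>' * \<alpha>'))"
proof -
  define u where "u = of_int c * (qcnj \<beta> * \<xi> * \<alpha>)"
  define v where "v = qcnj \<beta>' * \<xi>' * \<alpha>'"
  have "u * qcnj v = (qcnj \<beta> * \<xi>) * (of_int c * (\<alpha> * qcnj \<alpha>')) * (qcnj \<xi>' * \<beta>')"
    by (simp only: u_def v_def qcnj_mult mult.assoc of_int_mult_left_commute qcnj_simps)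
  then have "qdvd (l ^ k) (u * qcnj v)" using \<alpha> by (simp only: qdvd_mult_left qdvd_mult_right)
  moreover have "qcnj u * v = (qcnj \<alpha> * qcnj \<xi>) * (of_int c * (\<beta> * qcnj \<beta>')) * (\<xi>' * \<alpha>')"
    by (simp only: u_def v_def qcnj_mult mult.assoc of_int_mult_left_commute qcnj_simps
      mult_of_int_commute[symmetric])
  then have "qdvd (l ^ k) (qcnj u * v)" using \<beta> by (simp only: qdvd_mult_left qdvd_mult_right)
  ultimately have proportional: "qcong (l ^ k) (of_int (tr (u * g)) * v) (of_int (tr (v * g)) * u)" for g
    by (rule qcong_tr_proportional)
  obtain g where "\<not> l dvd tr (v * g)" using not_dvd_tr_mult[OF odd_l form'] unfolding v_def .
  then obtain d where d: "l ^ k dvd d * tr (v * g) - 1"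
    using inverse_mod[of "tr (v * g)" "l ^ k"] coprime_l_pow by (metis coprime_commute)
  have "qcong (l ^ k) (of_int 1 * u) (of_int (d * tr (v * g)) * u)"
    by (rule qcong_sym) (rule qcong_of_int_mult[OF d])
  also have "of_int (d * tr (v * g)) * u = of_int d * (of_int (tr (v * g)) * u)"
    by (simp add: mult.assoc)
  also have "qcong (l ^ k) \<dots> (of_int d * (of_int (tr (u * g)) * v))"
    by (rule qcong_mult_left) (rule qcong_sym[OF proportional])
  finally have "qcong (l ^ k) u (of_int (d * tr (u * g)) * v)" by (simp add: mult.assoc)
  then show ?thesis unfolding u_def v_def ..
qed

lemma card_common_incidences:
  assumes \<alpha>: "\<alpha> \<in> primitive (l ^ k)" and \<beta>: "\<beta> \<in> primitive (l ^ k)"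
    and \<alpha>': "\<alpha>' \<in> primitive (l ^ k)" and \<beta>': "\<beta>' \<in> primitive (l ^ k)"
  shows "int (card {g \<in> quat_residues (l ^ k).
    qdvd (l ^ k) (\<alpha> * g * qcnj \<beta>) \<and> qdvd (l ^ k) (\<alpha>' * g * qcnj \<beta>')})
    = (l ^ k)\<^sup>2 * int (card {c \<in> {0..<l ^ k}.
        qdvd (l ^ k) (of_int c * (\<alpha> * qcnj \<alpha>')) \<and> qdvd (l ^ k) (of_int c * (\<beta> * qcnj \<beta>'))})"
proof -
  let ?q = "l ^ k"
  have norms: "nrm \<alpha> = ?q" "nrm \<beta> = ?q" "nrm \<alpha>' = ?q" "nrm \<beta>' = ?q"
    using assms by (simp_all add: primitive_def)
  have "\<not> qdvd l \<alpha>" "\<not> qdvd l (qcnj \<beta>)" "\<not> qdvd l \<alpha>'" "\<not> qdvd l (qcnj \<beta>')"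
    using assms by (simp_all add: primitive_l_pow_iff)
  then obtain \<xi> \<xi>' where form: "\<not> qdvd l (qcnj \<beta> * \<xi> * \<alpha>)" and form': "\<not> qdvd l (qcnj \<beta>' * \<xi>' * \<alpha>')"
    using not_qdvd_prime_mult[OF prime_l odd_l] by metis
  define u where "u = qcnj \<beta> * \<xi> * \<alpha>"
  define v where "v = qcnj \<beta>' * \<xi>' * \<alpha>'"
  let ?C = "{(c, c') \<in> {0..<?q} \<times> {0..<?q}. qcong ?q (of_int c * u) (of_int c' * v)}"
  have unique: "c' = c''"
    if "c' \<in> {0..<?q}" "c'' \<in> {0..<?q}" "qcong ?q w (of_int c' * v)" "qcong ?q w (of_int c'' * v)"
      for w c' c''
  proof -
    have "qcong ?q (of_int c' * v) (of_int c'' * v)" using that(3,4) qcong_sym qcong_trans by blast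
    then have "?q dvd c' - c''"
      using l_pow_dvd_if_qdvd_of_int_mult[of v k "c' - c''"] form'
      by (simp add: v_def qcong_def left_diff_distrib)
    then have "c' - c'' = 0" using that(1,2) by (intro int_eq_0_if_dvd_abs_less) auto
    then show ?thesis by simp
  qed
  have reduce_multiplier: "qcong ?q (of_int c' * v) (of_int (c' mod ?q) * v)" for c'
    by (rule qcong_of_int_mult) (simp flip: mod_eq_dvd_iff)
  have "inj_on fst ?C" using unique by (fastforce simp: inj_on_def)
  then have "card ?C = card (fst ` ?C)" by (simp add: card_image)
  also have "fst ` ?C = {c \<in> {0..<?q}. \<exists>c'. qcong ?q (of_int c * u) (of_int c' * v)}"
  proof (intro Set.set_eqI iffI)
    fix c assume "c \<in> {c \<in> {0..<?q}. \<exists>c'. qcong ?q (of_int c * u) (of_int c' * v)}"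
    then obtain c' where "c \<in> {0..<?q}" "qcong ?q (of_int c * u) (of_int c' * v)" by blast
    then have "(c, c' mod ?q) \<in> ?C" using qcong_trans[OF _ reduce_multiplier] l_pow_pos[of k] by simp
    then show "c \<in> fst ` ?C" by (rule image_eqI[rotated]) simp
  qed auto
  also have "\<dots> = {c \<in> {0..<?q}. qdvd ?q (of_int c * (\<alpha> * qcnj \<alpha>')) \<and> qdvd ?q (of_int c * (\<beta> * qcnj \<beta>'))}"
    unfolding u_def v_def using forms_qcong_imp[OF norms form] forms_qcong_exists[OF form'] by blast
  finally show ?thesis
    unfolding incidence_iff_form[OF norms(1,2) form] incidence_iff_form[OF norms(3,4) form']
      card_common_zeros_of_forms[OF l_pow_pos odd_l_pow] u_def v_def by simp
qed

lemma card_common_right_factors: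
  assumes a: "\<alpha> \<in> primitive (l ^ k)" "\<alpha>' \<in> primitive (l ^ k)" and e: "e \<le> k"
  shows "card (right_factors (l ^ e) \<alpha> \<inter> right_factors (l ^ e) \<alpha>')
    = (if qdvd (l ^ e) (\<alpha> * qcnj \<alpha>') then 8 else 0)"
proof -
  let ?m = "l ^ e"
  have dvd: "?m dvd nrm \<alpha>" "?m dvd nrm \<alpha>'" and not_dvd: "\<not> qdvd l \<alpha>" "\<not> qdvd l \<alpha>'"
    using a e by (auto simp: primitive_l_pow_iff le_imp_power_dvd)
  have coprime: "coprime ?m (content \<alpha>)" "coprime ?m (content \<alpha>')"
    using not_dvd coprime_l_pow by (simp_all add: qdvd_iff_dvd_content)
  note common_iff = right_factors_Int_nonempty_iff[OF odd_l_pow l_pow_pos dvd(1) coprime(1), of \<alpha>']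
  show ?thesis
  proof (cases "qdvd ?m (\<alpha> * qcnj \<alpha>')")
    case True
    then obtain \<gamma> where "\<gamma> \<in> right_factors ?m \<alpha>" "\<gamma> \<in> right_factors ?m \<alpha>'" using common_iff by blast
    then have "right_factors ?m \<alpha> = right_factors ?m \<alpha>'"
      using right_factors_eqI[OF odd_l_pow l_pow_pos dvd(1) coprime(1) dvd(2) coprime(2)] by blast
    then show ?thesis using True card_right_factors_l[OF dvd(1) not_dvd(1)] by simp
  qed (use common_iff in auto)
qed

lemma gcd_l_pow_level:
  assumes "c \<in> {0..<l ^ k}"
  obtains e where "e \<le> k" "gcd c (l ^ k) = l ^ (k - e)"
    "\<And>z. qdvd (l ^ k) (of_int c * z) \<longleftrightarrow> qdvd (l ^ e) z"
proof -
  have "gcd c (l ^ k) dvd l ^ k" by simp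
  then obtain i where i: "i \<le> k" "normalize (gcd c (l ^ k)) = l ^ i"
    by (rule divides_primepow[OF prime_l])
  then have g: "gcd c (l ^ k) = l ^ i" by simp
  have split: "l ^ k = l ^ i * l ^ (k - i)" using i by (simp flip: power_add)
  define c1 where "c1 = c div l ^ i"
  have c: "c = l ^ i * c1" using g by (metis c1_def dvd_mult_div_cancel gcd_dvd1)
  have "coprime (c div gcd c (l ^ k)) (l ^ k div gcd c (l ^ k))"
    using l_gt_2 by (intro div_gcd_coprime) auto
  moreover have "l ^ k div l ^ i = l ^ (k - i)" using split l_gt_2 by simp
  ultimately have cop: "coprime (l ^ (k - i)) c1" unfolding g c1_def by (simp add: coprime_commute)
  have "qdvd (l ^ k) (of_int c * z) \<longleftrightarrow> qdvd (l ^ (k - i)) z" for z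
  proof -
    have "qdvd (l ^ k) (of_int c * z) \<longleftrightarrow> qdvd (l ^ i * l ^ (k - i)) (of_int (l ^ i) * (of_int c1 * z))"
      unfolding split[symmetric] c by (simp only: of_int_mult mult.assoc)
    also have "\<dots> \<longleftrightarrow> qdvd (l ^ (k - i)) (of_int c1 * z)"
      using l_gt_2 by (intro qdvd_of_int_mult_cancel) simp
    also have "\<dots> \<longleftrightarrow> qdvd (l ^ (k - i)) z" using cop by (rule qdvd_of_int_mult_coprime)
    finally show ?thesis .
  qed
  then show thesis using that[of "k - i"] i g by simp
qed

lemma card_gcd_l_pow_level:
  assumes "e \<le> k"
  shows "real (card {c \<in> {0..<l ^ k}. gcd c (l ^ k) = l ^ (k - e)}) \<le> of_int (l ^ e)"
proof -
  have split: "l ^ k = l ^ (k - e) * l ^ e" using assms by (simp flip: power_add)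
  have "{c \<in> {0..<l ^ k}. gcd c (l ^ k) = l ^ (k - e)} \<subseteq> (\<lambda>j. l ^ (k - e) * j) ` {0..<l ^ e}"
  proof
    fix c assume "c \<in> {c \<in> {0..<l ^ k}. gcd c (l ^ k) = l ^ (k - e)}"
    then have c: "0 \<le> c" "c < l ^ k" "l ^ (k - e) dvd c" by (auto, metis gcd_dvd1)
    then obtain j where j: "c = l ^ (k - e) * j" by (auto elim: dvdE)
    have "0 \<le> j" using c(1) j l_pow_pos[of "k - e"] by (simp add: zero_le_mult_iff)
    moreover have "j < l ^ e" using c(2) j split l_pow_pos[of "k - e"] by simp
    ultimately show "c \<in> (\<lambda>j. l ^ (k - e) * j) ` {0..<l ^ e}" using j by auto
  qed
  then have "card {c \<in> {0..<l ^ k}. gcd c (l ^ k) = l ^ (k - e)} \<le> card {0..<l ^ e}"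
    by (rule surj_card_le[rotated]) simp
  then have "int (card {c \<in> {0..<l ^ k}. gcd c (l ^ k) = l ^ (k - e)}) \<le> l ^ e"
    using l_pow_pos[of e] by simp
  then show ?thesis by linarith
qed

end

lemma sum_square_relation:
  fixes h :: "'i \<Rightarrow> real"
  assumes "finite I" "finite G"
  shows "(\<Sum>g\<in>G. (\<Sum>i | i \<in> I \<and> R i g. h i)\<^sup>2)
    = (\<Sum>i\<in>I. \<Sum>j\<in>I. real (card {g \<in> G. R i g \<and> R j g}) * (h i * h j))"
proof -
  have "(\<Sum>g\<in>G. (\<Sum>i | i \<in> I \<and> R i g. h i)\<^sup>2)
    = (\<Sum>g\<in>G. \<Sum>i\<in>I. \<Sum>j\<in>I. if R i g \<and> R j g then h i * h j else 0)"
  proof (intro sum.cong refl)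
    fix g
    have "(\<Sum>i | i \<in> I \<and> R i g. h i) = (\<Sum>i\<in>I. if R i g then h i else 0)"
      by (rule sum.inter_filter[OF assms(1)])
    then show "(\<Sum>i | i \<in> I \<and> R i g. h i)\<^sup>2 = (\<Sum>i\<in>I. \<Sum>j\<in>I. if R i g \<and> R j g then h i * h j else 0)"
      unfolding power2_eq_square by (auto simp: sum_product intro!: sum.cong)
  qed
  also have "\<dots> = (\<Sum>i\<in>I. \<Sum>j\<in>I. \<Sum>g\<in>G. if R i g \<and> R j g then h i * h j else 0)"
    by (subst sum.swap, intro sum.cong refl, rule sum.swap)
  also have "\<dots> = (\<Sum>i\<in>I. \<Sum>j\<in>I. real (card {g \<in> G. R i g \<and> R j g}) * (h i * h j))"
    using assms(2) by (intro sum.cong refl) (simp flip: sum.inter_filter)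
  finally show ?thesis .
qed

context odd_prime
begin

abbreviation pairs_l_pow :: "nat \<Rightarrow> (quat \<times> quat) set" where
  "pairs_l_pow k \<equiv> primitive (l ^ k) \<times> primitive (l ^ k)"

definition incident :: "nat \<Rightarrow> quat \<times> quat \<Rightarrow> quat \<Rightarrow> bool" where
  "incident k = (\<lambda>(\<alpha>, \<beta>) g. qdvd (l ^ k) (\<alpha> * g * qcnj \<beta>))"

definition right_divides :: "nat \<Rightarrow> quat \<times> quat \<Rightarrow> quat \<times> quat \<Rightarrow> bool" where
  "right_divides e = (\<lambda>(\<alpha>, \<beta>) (\<gamma>, \<delta>). \<gamma> \<in> right_factors (l ^ e) \<alpha> \<and> \<delta> \<in> right_factors (l ^ e) \<beta>)"

lemma card_common_right_divisors:
  assumes "(\<alpha>, \<beta>) \<in> pairs_l_pow k" "(\<alpha>', \<beta>') \<in> pairs_l_pow k" "e \<le> k"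
  shows "card {c \<in> pairs_l_pow e. right_divides e (\<alpha>, \<beta>) c \<and> right_divides e (\<alpha>', \<beta>') c}
    = (if qdvd (l ^ e) (\<alpha> * qcnj \<alpha>') \<and> qdvd (l ^ e) (\<beta> * qcnj \<beta>') then 64 else 0)"
proof -
  have "right_factors (l ^ e) x \<subseteq> primitive (l ^ e)" if "x \<in> primitive (l ^ k)" for x
    using that content_factor_eq_1(2) by (auto simp: right_factors_def primitive_def)
  then have "{c \<in> pairs_l_pow e. right_divides e (\<alpha>, \<beta>) c \<and> right_divides e (\<alpha>', \<beta>') c}
    = (right_factors (l ^ e) \<alpha> \<inter> right_factors (l ^ e) \<alpha>')
      \<times> (right_factors (l ^ e) \<beta> \<inter> right_factors (l ^ e) \<beta>')"
    using assms(1,2) by (auto simp: right_divides_def)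
  then show ?thesis
    using assms card_common_right_factors[of \<alpha> k \<alpha>' e] card_common_right_factors[of \<beta> k \<beta>' e]
    by (simp add: card_cartesian_product)
qed

lemma card_scalar_annihilators:
  "card {c \<in> {0..<l ^ k}. qdvd (l ^ k) (of_int c * x) \<and> qdvd (l ^ k) (of_int c * y)}
    = (\<Sum>e | e \<le> k \<and> qdvd (l ^ e) x \<and> qdvd (l ^ e) y.
      card {c \<in> {0..<l ^ k}. gcd c (l ^ k) = l ^ (k - e)})"
proof -
  let ?q = "l ^ k"
  define level where "level e = {c \<in> {0..<?q}. gcd c ?q = l ^ (k - e)}" for e
  define close where "close e \<longleftrightarrow> qdvd (l ^ e) x \<and> qdvd (l ^ e) y" for e
  define annihilators where
    "annihilators = {c \<in> {0..<?q}. qdvd ?q (of_int c * x) \<and> qdvd ?q (of_int c * y)}"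
  have finite_level: "finite (level e)" for e
    by (rule finite_subset[of _ "{0..<?q}"]) (auto simp: level_def)
  have level_unique: "e = e'" if "e \<le> k" "e' \<le> k" "c \<in> level e" "c \<in> level e'" for e e' c
  proof -
    have "l ^ (k - e) = l ^ (k - e')" using that(3,4) by (simp add: level_def)
    then have "k - e = k - e'" using power_inject_exp[of l "k - e" "k - e'"] l_gt_2 by simp
    then show ?thesis using that(1,2) by simp
  qed
  have "annihilators = (\<Union>e\<in>{e \<in> {..k}. close e}. level e)"
  proof (intro Set.set_eqI)
    fix c
    show "c \<in> annihilators \<longleftrightarrow> c \<in> (\<Union>e\<in>{e \<in> {..k}. close e}. level e)"
    proof (cases "c \<in> {0..<?q}")
      case True
      obtain e where e: "e \<le> k" and gcd: "gcd c ?q = l ^ (k - e)"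
        and ann: "\<And>z. qdvd ?q (of_int c * z) \<longleftrightarrow> qdvd (l ^ e) z"
        using gcd_l_pow_level[OF True] by blast
      have level: "c \<in> level e" using True gcd by (simp add: level_def)
      have "e' = e" if "e' \<le> k" "c \<in> level e'" for e' using level_unique[OF that(1) e that(2) level] .
      then have "c \<in> (\<Union>e\<in>{e \<in> {..k}. close e}. level e) \<longleftrightarrow> close e" using e level by blast
      also have "\<dots> \<longleftrightarrow> c \<in> annihilators"
        using True unfolding close_def annihilators_def mem_Collect_eq ann by blast
      finally show ?thesis ..
    qed (auto simp: annihilators_def level_def)
  qed
  also have "card \<dots> = (\<Sum>e | e \<in> {..k} \<and> close e. card (level e))"
    using level_unique by (intro card_UN_disjoint) (auto simp: finite_level)
  finally show ?thesis by (simp add: annihilators_def level_def close_def)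
qed

text \<open>Both sides count scalars: a common zero of two incidence conditions is a scalar annihilating them, and
  the scalars of level \<open>e\<close> annihilate exactly the pairs with common right divisors of norm \<open>l ^ e\<close>.\<close>

lemma card_common_incident:
  assumes i: "i \<in> pairs_l_pow k" and j: "j \<in> pairs_l_pow k"
  shows "real (card {g \<in> quat_residues (l ^ k). incident k i g \<and> incident k j g})
    = (of_int (l ^ k))\<^sup>2 / 64 * (\<Sum>e\<le>k. real (card {c \<in> {0..<l ^ k}. gcd c (l ^ k) = l ^ (k - e)})
        * real (card {c \<in> pairs_l_pow e. right_divides e i c \<and> right_divides e j c}))"
proof -
  let ?q = "l ^ k"
  obtain \<alpha> \<beta> \<alpha>' \<beta>' where ij: "i = (\<alpha>, \<beta>)" "j = (\<alpha>', \<beta>')" by fastforce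
  define level where "level e = card {c \<in> {0..<?q}. gcd c ?q = l ^ (k - e)}" for e
  define close where "close e \<longleftrightarrow> qdvd (l ^ e) (\<alpha> * qcnj \<alpha>') \<and> qdvd (l ^ e) (\<beta> * qcnj \<beta>')" for e
  let ?annihilators = "{c \<in> {0..<?q}.
    qdvd ?q (of_int c * (\<alpha> * qcnj \<alpha>')) \<and> qdvd ?q (of_int c * (\<beta> * qcnj \<beta>'))}"
  have "card ?annihilators = (\<Sum>e | e \<in> {..k} \<and> close e. level e)"
    unfolding card_scalar_annihilators close_def level_def atMost_iff ..
  also have "\<dots> = (\<Sum>e\<le>k. if close e then level e else 0)"
    by (rule sum.inter_filter) simp
  finally have annihilators: "real (card ?annihilators) = (\<Sum>e\<le>k. if close e then real (level e) else 0)"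
    by (simp add: if_distrib[of real] cong: if_cong)
  have "real (card {g \<in> quat_residues ?q. incident k i g \<and> incident k j g})
    = (of_int ?q)\<^sup>2 * real (card ?annihilators)"
    using arg_cong[OF card_common_incidences[of \<alpha> k \<beta> \<alpha>' \<beta>'], of real_of_int] i j
    unfolding ij incident_def by simp
  also have "\<dots> = (of_int ?q)\<^sup>2 / 64 * (\<Sum>e\<le>k. real (level e) * (if close e then 64 else 0))"
    unfolding annihilators by (simp add: sum_distrib_left if_distrib cong: if_cong)
  also have "\<dots> = (of_int ?q)\<^sup>2 / 64 * (\<Sum>e\<le>k. real (level e)
      * real (card {c \<in> pairs_l_pow e. right_divides e i c \<and> right_divides e j c}))"
    using i j unfolding ij close_def
    by (intro arg_cong2[of _ _ _ _ "(*)"] sum.cong refl) (simp add: card_common_right_divisors)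
  finally show ?thesis by (simp only: level_def)
qed

lemma sum_incident_square_le:
  fixes h :: "quat \<times> quat \<Rightarrow> real"
  shows "(\<Sum>g\<in>quat_residues (l ^ k). (\<Sum>i | i \<in> pairs_l_pow k \<and> incident k i g. h i)\<^sup>2)
    \<le> (of_int (l ^ k))\<^sup>2 / 64 *
      (\<Sum>e\<le>k. of_int (l ^ e) * (\<Sum>c\<in>pairs_l_pow e. (\<Sum>i | i \<in> pairs_l_pow k \<and> right_divides e i c. h i)\<^sup>2))"
proof -
  let ?P = "pairs_l_pow k" and ?q = "l ^ k"
  define N where "N e = real (card {c \<in> {0..<?q}. gcd c ?q = l ^ (k - e)})" for e
  define K where "K e i j = real (card {c \<in> pairs_l_pow e. right_divides e i c \<and> right_divides e j c})"
    for e i j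
  have fin: "finite (pairs_l_pow e)" for e by (simp add: finite_primitive)
  have "(\<Sum>g\<in>quat_residues ?q. (\<Sum>i | i \<in> ?P \<and> incident k i g. h i)\<^sup>2)
    = (\<Sum>i\<in>?P. \<Sum>j\<in>?P. ((of_int ?q)\<^sup>2 / 64 * (\<Sum>e\<le>k. N e * K e i j)) * (h i * h j))"
    unfolding sum_square_relation[OF fin finite_quat_residues] N_def K_def
    by (intro sum.cong refl arg_cong2[of _ _ _ _ "(*)"] card_common_incident)
  also have "\<dots> = (\<Sum>i\<in>?P. \<Sum>j\<in>?P. \<Sum>e\<le>k. (of_int ?q)\<^sup>2 / 64 * (N e * (K e i j * (h i * h j))))"
    by (simp only: sum_distrib_left sum_distrib_right mult.assoc)
  also have "\<dots> = (\<Sum>e\<le>k. \<Sum>i\<in>?P. \<Sum>j\<in>?P. (of_int ?q)\<^sup>2 / 64 * (N e * (K e i j * (h i * h j))))"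
    by (subst sum.swap[of _ "{..k}" ?P]) (intro sum.cong refl sum.swap)
  also have "\<dots> = (of_int ?q)\<^sup>2 / 64 * (\<Sum>e\<le>k. N e * (\<Sum>i\<in>?P. \<Sum>j\<in>?P. K e i j * (h i * h j)))"
    by (simp only: sum_distrib_left)
  also have "\<dots> = (of_int ?q)\<^sup>2 / 64
    * (\<Sum>e\<le>k. N e * (\<Sum>c\<in>pairs_l_pow e. (\<Sum>i | i \<in> ?P \<and> right_divides e i c. h i)\<^sup>2))"
    unfolding sum_square_relation[OF fin fin] K_def ..
  also have "\<dots> \<le> (of_int ?q)\<^sup>2 / 64
    * (\<Sum>e\<le>k. of_int (l ^ e) * (\<Sum>c\<in>pairs_l_pow e. (\<Sum>i | i \<in> ?P \<and> right_divides e i c. h i)\<^sup>2))"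
    unfolding N_def using card_gcd_l_pow_level
    by (intro mult_left_mono sum_mono mult_right_mono sum_nonneg) auto
  finally show ?thesis .
qed

end

section \<open>Hecke operators on functions modulo \<open>p\<close>\<close>

definition quat_mod :: "quat \<Rightarrow> int \<Rightarrow> quat" where
  "quat_mod x m = Quat (q0 x mod m) (q1 x mod m) (q2 x mod m) (q3 x mod m)"

lemma quat_mod_in_quat_residues: "m > 0 \<Longrightarrow> quat_mod x m \<in> quat_residues m"
  by (simp add: quat_mod_def quat_residues_def)

lemma quat_mod_eq_iff: "quat_mod x m = quat_mod y m \<longleftrightarrow> qcong m x y"
  by (simp add: quat_mod_def qcong_def qdvd_def mod_eq_dvd_iff)

lemma quat_mod_residue: "x \<in> quat_residues m \<Longrightarrow> quat_mod x m = x"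
  by (simp add: quat_mod_def quat_residues_def quat_eq_iff)

lemma qcong_quat_mod: "qcong m x (quat_mod x m)"
  by (simp add: quat_mod_def qcong_def qdvd_def)

lemma quat_residues_eqI: "x \<in> quat_residues m \<Longrightarrow> y \<in> quat_residues m \<Longrightarrow> qcong m x y \<Longrightarrow> x = y"
  by (metis quat_mod_eq_iff quat_mod_residue)

definition periodic :: "int \<Rightarrow> (quat \<Rightarrow> real) \<Rightarrow> bool" where
  "periodic p f \<longleftrightarrow> (\<forall>x y. qcong p x y \<longrightarrow> f x = f y)"

lemma periodicD: "periodic p f \<Longrightarrow> qcong p x y \<Longrightarrow> f x = f y"
  unfolding periodic_def by blast

lemma periodic_mult: "periodic p f \<Longrightarrow> periodic p (\<lambda>x. f (a * x * b))"
  unfolding periodic_def using qcong_mult_left qcong_mult_right by blast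

lemma periodic_mult_left: "periodic p f \<Longrightarrow> periodic p (\<lambda>x. f (a * x))"
  using periodic_mult[of p f a 1] by simp

lemma periodic_sum: "(\<And>a. a \<in> A \<Longrightarrow> periodic p (f a)) \<Longrightarrow> periodic p (\<lambda>x. \<Sum>a\<in>A. f a x)"
  unfolding periodic_def by (auto intro!: sum.cong)

lemma sum_quat_residues_mult:
  assumes p: "prime p" and f: "periodic p f" and a: "\<not> p dvd nrm a" and b: "\<not> p dvd nrm b"
  shows "(\<Sum>x\<in>quat_residues p. f (a * x * b)) = (\<Sum>x\<in>quat_residues p. f x)"
proof -
  define t where "t x = quat_mod (a * x * b) p" for x
  have "inj_on t (quat_residues p)"
  proof (rule inj_onI)
    fix x y assume xy: "x \<in> quat_residues p" "y \<in> quat_residues p" and "t x = t y"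
    then have "qcong p (a * x * b) (a * y * b)" by (simp add: t_def quat_mod_eq_iff)
    then have "qcong p (qcnj a * (a * x * b) * qcnj b) (qcnj a * (a * y * b) * qcnj b)"
      by (rule qcong_mult_right[OF qcong_mult_left])
    moreover have "qcnj a * (a * z * b) * qcnj b = of_int (nrm a * nrm b) * z" for z
    proof -
      have "qcnj a * (a * z * b) * qcnj b = (qcnj a * a) * z * (b * qcnj b)" by (simp only: mult.assoc)
      then show ?thesis by (simp add: mult_qcnj quat_eq_iff)
    qed
    moreover have "coprime p (nrm a * nrm b)"
      using a b p by (intro prime_imp_coprime) (auto simp: prime_dvd_mult_iff)
    ultimately have "qcong p x y" by (simp only: qcong_of_int_mult_coprime)
    then show "x = y" using xy quat_residues_eqI by blast
  qed
  moreover have "t ` quat_residues p \<subseteq> quat_residues p"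
    using prime_gt_0_int[OF p] by (auto simp: t_def quat_mod_in_quat_residues)
  ultimately have "bij_betw t (quat_residues p) (quat_residues p)"
    using endo_inj_surj[OF finite_quat_residues] by (simp add: bij_betw_def)
  then have "(\<Sum>x\<in>quat_residues p. f x) = (\<Sum>x\<in>quat_residues p. f (t x))"
    by (rule sum.reindex_bij_betw[symmetric])
  also have "\<dots> = (\<Sum>x\<in>quat_residues p. f (a * x * b))"
    by (intro sum.cong refl) (auto simp: t_def intro!: periodicD[OF f, symmetric] qcong_quat_mod)
  finally show ?thesis by simp
qed

locale level = odd_prime +
  fixes p :: int
  assumes prime_p: "prime p" and odd_p: "odd p" and l_neq_p: "l \<noteq> p"
begin

sublocale p: odd_prime p
  by standard (rule prime_p odd_p)+

lemma p_not_dvd_l_pow: "\<not> p dvd l ^ k"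
  using prime_l prime_p l_neq_p by (metis prime_dvd_power primes_dvd_imp_eq)

lemma p_not_dvd_l: "\<not> p dvd l"
  using p_not_dvd_l_pow[of 1] by simp

lemma p_not_dvd_nrm_of_int: "\<not> p dvd c \<Longrightarrow> \<not> p dvd nrm (of_int c)"
  using prime_p by (simp add: prime_dvd_power_iff)

lemma p_not_dvd_nrm_1: "\<not> p dvd nrm 1"
  using p.l_gt_2 by simp

lemma p_not_dvd_nrm_primitive: "a \<in> primitive (l ^ m) \<Longrightarrow> \<not> p dvd nrm a"
  using p_not_dvd_l_pow by (simp add: primitive_def)

definition inv_p :: "int \<Rightarrow> int" where
  "inv_p c = (SOME c'. p dvd c' * c - 1)"

lemma dvd_inv_p_mult: "\<not> p dvd c \<Longrightarrow> p dvd inv_p c * c - 1"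
  unfolding inv_p_def using inverse_mod[OF p.coprime_l, of c] by (metis someI)

lemma p_not_dvd_inv_p: "\<not> p dvd c \<Longrightarrow> \<not> p dvd inv_p c"
proof
  assume "\<not> p dvd c" "p dvd inv_p c"
  then have "p dvd inv_p c * c - (inv_p c * c - 1)" by (intro dvd_diff dvd_mult2 dvd_inv_p_mult)
  then have "p dvd 1" by (simp only: diff_diff_eq2 add_diff_cancel_left')
  then show False using p.l_gt_2 zdvd_imp_le[of p 1] by simp
qed

lemma periodic_inv_p_mult:
  assumes "periodic p f" "\<not> p dvd c"
  shows "f (of_int (inv_p c) * (of_int c * x)) = f x"
proof -
  have "qcong p (of_int (inv_p c * c) * x) (of_int 1 * x)"
    by (rule qcong_of_int_mult[OF dvd_inv_p_mult[OF assms(2)]])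
  then show ?thesis using periodicD[OF assms(1)] by (simp add: mult.assoc)
qed

subsection \<open>The inner product on functions modulo \<open>p\<close>\<close>

definition l2norm :: "(quat \<Rightarrow> real) \<Rightarrow> real" where
  "l2norm f = L2_set f (quat_residues p)"

definition l2inner :: "(quat \<Rightarrow> real) \<Rightarrow> (quat \<Rightarrow> real) \<Rightarrow> real" where
  "l2inner f g = (\<Sum>x\<in>quat_residues p. f x * g x)"

lemma l2norm_square_eq_sum: "(l2norm f)\<^sup>2 = (\<Sum>x\<in>quat_residues p. (f x)\<^sup>2)"
  by (simp add: l2norm_def L2_set_def sum_nonneg)

lemma l2norm_square: "(l2norm f)\<^sup>2 = l2inner f f"
  unfolding l2norm_square_eq_sum by (simp add: l2inner_def power2_eq_square)

lemma l2norm_ge_0 [simp]: "l2norm f \<ge> 0"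
  by (simp add: l2norm_def)

lemma l2norm_minus [simp]: "l2norm (\<lambda>x. - f x) = l2norm f"
  by (simp add: l2norm_def L2_set_def)

lemma l2norm_triangle: "l2norm (\<lambda>x. f x + g x) \<le> l2norm f + l2norm g"
  unfolding l2norm_def by (rule L2_set_triangle_ineq)

lemma l2norm_sum: "finite A \<Longrightarrow> l2norm (\<lambda>x. \<Sum>a\<in>A. f a x) \<le> (\<Sum>a\<in>A. l2norm (f a))"
proof (induction A rule: finite_induct)
  case empty
  then show ?case by (simp add: l2norm_def L2_set_def)
next
  case (insert a A)
  then show ?case using l2norm_triangle[of "f a" "\<lambda>x. \<Sum>a\<in>A. f a x"] by simp
qed

lemma abs_l2inner_le: "\<bar>l2inner f g\<bar> \<le> l2norm f * l2norm g"
proof -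
  have "\<bar>l2inner f g\<bar> \<le> (\<Sum>x\<in>quat_residues p. \<bar>f x\<bar> * \<bar>g x\<bar>)"
    unfolding l2inner_def by (rule order_trans[OF sum_abs]) (simp add: abs_mult)
  also have "\<dots> \<le> l2norm f * l2norm g" unfolding l2norm_def by (rule L2_set_mult_ineq)
  finally show ?thesis .
qed

lemma l2inner_diff_right: "l2inner f (\<lambda>x. g x - c * h x) = l2inner f g - c * l2inner f h"
  and l2inner_diff_left: "l2inner (\<lambda>x. g x - c * h x) f = l2inner g f - c * l2inner h f"
  by (simp_all add: l2inner_def sum_subtractf sum_distrib_left algebra_simps)

lemma l2inner_mult:
  assumes "periodic p f" "periodic p g" "\<not> p dvd nrm a" "\<not> p dvd nrm b"
  shows "l2inner (\<lambda>x. f (a * x * b)) (\<lambda>x. g (a * x * b)) = l2inner f g"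
  unfolding l2inner_def using assms
  by (intro sum_quat_residues_mult[OF prime_p]) (auto simp: periodic_def)

lemma l2inner_mult_left:
  assumes "periodic p f" "periodic p g" "\<not> p dvd nrm a"
  shows "l2inner (\<lambda>x. f (a * x)) (\<lambda>x. g (a * x)) = l2inner f g"
  using l2inner_mult[OF assms p_not_dvd_nrm_1] by simp

lemma l2norm_mult:
  assumes "periodic p f" "\<not> p dvd nrm a" "\<not> p dvd nrm b"
  shows "l2norm (\<lambda>x. f (a * x * b)) = l2norm f"
  using l2inner_mult[OF assms(1,1-3)] by (metis l2norm_ge_0 l2norm_square power2_eq_imp_eq)

lemma l2norm_mult_left:
  assumes "periodic p f" "\<not> p dvd nrm a"
  shows "l2norm (\<lambda>x. f (a * x)) = l2norm f"
  using l2norm_mult[OF assms p_not_dvd_nrm_1] by simp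

subsection \<open>Cuspidal functions\<close>

definition norm_invariant :: "(quat \<Rightarrow> real) \<Rightarrow> bool" where
  "norm_invariant f \<longleftrightarrow> periodic p f \<and> (\<forall>a a' x. nrm a = l \<longrightarrow> nrm a' = l \<longrightarrow> f (a * x) = f (a' * x))"

lemma norm_invariant_periodic: "norm_invariant f \<Longrightarrow> periodic p f"
  unfolding norm_invariant_def by blast

lemma norm_invariantD: "norm_invariant f \<Longrightarrow> nrm a = l \<Longrightarrow> nrm a' = l \<Longrightarrow> f (a * x) = f (a' * x)"
  unfolding norm_invariant_def by blast

lemma norm_invariant_of_int_mult:
  assumes "norm_invariant f"
  shows "norm_invariant (\<lambda>x. f (of_int c * x))"
  unfolding norm_invariant_def of_int_mult_left_commute[symmetric]
  using periodic_mult_left[OF norm_invariant_periodic[OF assms]] norm_invariantD[OF assms] by blast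

lemma norm_invariant_mult_left:
  assumes f: "norm_invariant f" and a: "nrm a = 1 \<or> nrm a = l"
  shows "norm_invariant (\<lambda>x. f (a * x))"
proof -
  have "f (a * (b * x)) = f (a * (b' * x))" if b: "nrm b = l" "nrm b' = l" for b b' x
    using a
  proof
    assume "nrm a = 1"
    then show ?thesis using norm_invariantD[OF f, of "a * b" "a * b'"] b
      by (simp add: nrm_mult mult.assoc)
  next
    assume a_l: "nrm a = l"
    have "f (a * (b * x)) = f (of_int l * x)" if "nrm b = l" for b
      using norm_invariantD[OF f, of a "qcnj b" "b * x"] a_l that by (simp add: mult_qcnj_assoc)
    then show ?thesis using b by simp
  qed
  then show ?thesis
    unfolding norm_invariant_def using periodic_mult_left[OF norm_invariant_periodic[OF f]] by blast
qed

definition cuspidal :: "(quat \<Rightarrow> real) set" where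
  "cuspidal = {f. periodic p f \<and> (\<forall>f0. norm_invariant f0 \<longrightarrow> l2inner f f0 = 0)}"

lemma cuspidal_periodic: "f \<in> cuspidal \<Longrightarrow> periodic p f"
  by (simp add: cuspidal_def)

lemma cuspidal_orthogonal: "f \<in> cuspidal \<Longrightarrow> norm_invariant f0 \<Longrightarrow> l2inner f f0 = 0"
  by (simp add: cuspidal_def)

lemma cuspidal_sum:
  assumes "\<And>a. a \<in> A \<Longrightarrow> f a \<in> cuspidal"
  shows "(\<lambda>x. \<Sum>a\<in>A. f a x) \<in> cuspidal"
proof -
  have "l2inner (\<lambda>x. \<Sum>a\<in>A. f a x) f0 = (\<Sum>a\<in>A. l2inner (f a) f0)" for f0
    unfolding l2inner_def sum_distrib_right by (rule sum.swap)
  then have "l2inner (\<lambda>x. \<Sum>a\<in>A. f a x) f0 = 0" if "norm_invariant f0" for f0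
    using cuspidal_orthogonal[OF assms that] by simp
  moreover have "periodic p (\<lambda>x. \<Sum>a\<in>A. f a x)" using assms by (intro periodic_sum cuspidal_periodic)
  ultimately show ?thesis by (simp add: cuspidal_def)
qed

text \<open>Multiplication by \<open>a\<close> is unitary and its inverse is, up to a scalar, multiplication by \<open>a\<^sup>*\<close>.\<close>

lemma cuspidal_mult_left:
  assumes f: "f \<in> cuspidal" and a: "\<not> p dvd nrm a"
    and adjoint: "\<And>f0. norm_invariant f0 \<Longrightarrow> norm_invariant (\<lambda>x. f0 (qcnj a * x))"
  shows "(\<lambda>x. f (a * x)) \<in> cuspidal"
proof -
  have "l2inner (\<lambda>x. f (a * x)) f0 = 0" if f0: "norm_invariant f0" for f0
  proof -
    define g where "g x = f0 (of_int (inv_p (nrm a)) * (qcnj a * x))" for x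
    have g: "norm_invariant g"
      unfolding g_def using adjoint[OF norm_invariant_of_int_mult[OF f0]] .
    have "f0 x = g (a * x)" for x
      using periodic_inv_p_mult[OF norm_invariant_periodic[OF f0] a] by (simp add: g_def mult_qcnj_assoc)
    then have "l2inner (\<lambda>x. f (a * x)) f0 = l2inner (\<lambda>x. f (a * x)) (\<lambda>x. g (a * x))"
      by (simp add: l2inner_def)
    also have "\<dots> = l2inner f g"
      by (rule l2inner_mult_left[OF cuspidal_periodic[OF f] norm_invariant_periodic[OF g] a])
    also have "\<dots> = 0" by (rule cuspidal_orthogonal[OF f g])
    finally show ?thesis .
  qed
  then show ?thesis using periodic_mult_left[OF cuspidal_periodic[OF f]] by (simp add: cuspidal_def)
qed

lemma cuspidal_of_int_mult: "f \<in> cuspidal \<Longrightarrow> \<not> p dvd c \<Longrightarrow> (\<lambda>x. f (of_int c * x)) \<in> cuspidal"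
  by (intro cuspidal_mult_left p_not_dvd_nrm_of_int) (simp_all add: norm_invariant_of_int_mult)

lemma cuspidal_mult_primitive: "f \<in> cuspidal \<Longrightarrow> a \<in> primitive (l ^ m) \<Longrightarrow> (\<lambda>x. f (a * x)) \<in> cuspidal"
proof (induction m arbitrary: a)
  case 0
  then show ?case using p_not_dvd_nrm_primitive[of a 0]
    by (intro cuspidal_mult_left norm_invariant_mult_left) (auto simp: primitive_def)
next
  case (Suc m)
  have "card (right_factors l a) = 8"
    using card_right_factors_l[of 1 a] Suc.prems(2) primitive_l_pow_iff[of a "Suc m"] by simp
  then have "right_factors l a \<noteq> {}" by auto
  then obtain b d where b: "nrm b = l" "a = d * b" by (auto simp: right_factors_def)
  then have "nrm d = l ^ m" "content d = 1"
    using Suc.prems l_gt_2 content_factor_eq_1(1) by (auto simp: primitive_def nrm_mult)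
  then have "(\<lambda>x. f (d * x)) \<in> cuspidal" using Suc by (simp add: primitive_def)
  moreover have "\<not> p dvd nrm b" using b p_not_dvd_l by simp
  ultimately have "(\<lambda>x. f (d * (b * x))) \<in> cuspidal"
    using b by (intro cuspidal_mult_left[of "\<lambda>x. f (d * x)"] norm_invariant_mult_left) auto
  then show ?case using b by (simp add: mult.assoc)
qed

subsection \<open>Spectral gap\<close>

definition hecke_op :: "nat \<Rightarrow> (quat \<Rightarrow> real) \<Rightarrow> quat \<Rightarrow> real" where
  "hecke_op m f x = (\<Sum>a\<in>primitive (l ^ m). f (a * x))"

lemma hecke_op_1: "hecke_op 1 f x = (\<Sum>a\<in>primitive l. f (a * x))"
  by (simp add: hecke_op_def)

lemma cuspidal_hecke_op: "f \<in> cuspidal \<Longrightarrow> hecke_op m f \<in> cuspidal"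
  unfolding hecke_op_def[abs_def] by (intro cuspidal_sum cuspidal_mult_primitive)

lemma l2norm_hecke_op_le:
  assumes "periodic p f"
  shows "l2norm (hecke_op m f) \<le> real (card (primitive (l ^ m))) * l2norm f"
proof -
  have "l2norm (hecke_op m f) \<le> (\<Sum>a\<in>primitive (l ^ m). l2norm (\<lambda>x. f (a * x)))"
    unfolding hecke_op_def[abs_def] by (rule l2norm_sum) (rule finite_primitive)
  also have "\<dots> = (\<Sum>a\<in>primitive (l ^ m). l2norm f)"
    using assms by (intro sum.cong refl l2norm_mult_left p_not_dvd_nrm_primitive)
  finally show ?thesis by simp
qed

end

lemma square_sum_eq_sum_squares_diff:
  fixes g :: "'a \<Rightarrow> real"
  shows "(\<Sum>a\<in>A. g a)\<^sup>2 = real (card A) * (\<Sum>a\<in>A. (g a)\<^sup>2) - (\<Sum>a\<in>A. \<Sum>b\<in>A. (g a - g b)\<^sup>2) / 2"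
proof -
  have "(\<Sum>a\<in>A. \<Sum>b\<in>A. (g a - g b)\<^sup>2) = (\<Sum>a\<in>A. \<Sum>b\<in>A. (g a)\<^sup>2 + (g b)\<^sup>2 - 2 * (g a * g b))"
    by (intro sum.cong refl) (simp add: power2_eq_square algebra_simps)
  also have "\<dots> = 2 * (real (card A) * (\<Sum>a\<in>A. (g a)\<^sup>2)) - 2 * (\<Sum>a\<in>A. \<Sum>b\<in>A. g a * g b)"
    by (simp add: sum.distrib sum_subtractf sum_distrib_left)
  also have "(\<Sum>a\<in>A. \<Sum>b\<in>A. g a * g b) = (\<Sum>a\<in>A. g a)\<^sup>2"
    by (simp add: power2_eq_square sum_product)
  finally show ?thesis by (simp add: diff_divide_distrib)
qed

context level
begin

definition dirichlet_form :: "(quat \<Rightarrow> real) \<Rightarrow> real" where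
  "dirichlet_form f = (\<Sum>a\<in>primitive l. \<Sum>b\<in>primitive l. \<Sum>z\<in>quat_residues p. (f (a * z) - f (b * z))\<^sup>2)"

lemma dirichlet_form_ge_0: "dirichlet_form f \<ge> 0"
  unfolding dirichlet_form_def by (intro sum_nonneg) auto

lemma l2norm_hecke_op_1:
  assumes f: "periodic p f"
  shows "(l2norm (hecke_op 1 f))\<^sup>2 = (real (card (primitive l)) * l2norm f)\<^sup>2 - dirichlet_form f / 2"
proof -
  let ?P = "primitive l" and ?R = "quat_residues p"
  have "(l2norm (hecke_op 1 f))\<^sup>2 = (\<Sum>z\<in>?R. (\<Sum>a\<in>?P. f (a * z))\<^sup>2)"
    by (simp add: l2norm_square_eq_sum hecke_op_1 del: One_nat_def)
  also have "\<dots> = real (card ?P) * (\<Sum>z\<in>?R. \<Sum>a\<in>?P. (f (a * z))\<^sup>2)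
    - (\<Sum>z\<in>?R. \<Sum>a\<in>?P. \<Sum>b\<in>?P. (f (a * z) - f (b * z))\<^sup>2) / 2"
    unfolding square_sum_eq_sum_squares_diff
    by (simp add: sum_subtractf sum_distrib_left sum_divide_distrib)
  also have "(\<Sum>z\<in>?R. \<Sum>a\<in>?P. (f (a * z))\<^sup>2) = (\<Sum>a\<in>?P. (l2norm (\<lambda>x. f (a * x)))\<^sup>2)"
    by (subst sum.swap) (simp add: l2norm_square_eq_sum)
  also have "\<dots> = real (card ?P) * (l2norm f)\<^sup>2"
    using l2norm_mult_left[OF f p_not_dvd_nrm_primitive[of _ 1]] by simp
  also have "(\<Sum>z\<in>?R. \<Sum>a\<in>?P. \<Sum>b\<in>?P. (f (a * z) - f (b * z))\<^sup>2)
    = (\<Sum>a\<in>?P. \<Sum>z\<in>?R. \<Sum>b\<in>?P. (f (a * z) - f (b * z))\<^sup>2)"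
    by (rule sum.swap)
  also have "\<dots> = dirichlet_form f"
    unfolding dirichlet_form_def by (intro sum.cong[OF refl] sum.swap)
  finally show ?thesis by (simp add: power2_eq_square)
qed

definition hecke_edges :: "(quat \<times> quat) set" where
  "hecke_edges = (\<lambda>(a, b, z). (quat_mod (a * z) p, quat_mod (b * z) p))
    ` (primitive l \<times> primitive l \<times> quat_residues p)"

lemma finite_hecke_edges: "finite hecke_edges"
  by (simp add: hecke_edges_def finite_primitive finite_quat_residues)

lemma hecke_edgesI:
  assumes "nrm a = l" "nrm b = l"
  shows "(quat_mod (a * z) p, quat_mod (b * z) p) \<in> hecke_edges"
proof -
  have "quat_mod (c * z) p = quat_mod (c * quat_mod z p) p" for c
    by (simp add: quat_mod_eq_iff qcong_mult_left qcong_quat_mod)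
  then show ?thesis
    using assms p.l_gt_2 unfolding hecke_edges_def
    by (intro image_eqI[of _ _ "(a, b, quat_mod z p)"])
      (auto simp: primitive_prime[OF prime_l] quat_mod_in_quat_residues)
qed

lemma abs_diff_hecke_edge_le:
  assumes f: "periodic p f" and xy: "(x, y) \<in> hecke_edges"
  shows "\<bar>f x - f y\<bar> \<le> sqrt (dirichlet_form f)"
proof -
  obtain a b z where ab: "a \<in> primitive l" "b \<in> primitive l" "z \<in> quat_residues p"
    and xy_eq: "x = quat_mod (a * z) p" "y = quat_mod (b * z) p"
    using xy by (auto simp: hecke_edges_def)
  have "(f (a * z) - f (b * z))\<^sup>2 \<le> (\<Sum>z\<in>quat_residues p. (f (a * z) - f (b * z))\<^sup>2)"
    by (rule member_le_sum) (use ab finite_quat_residues in auto)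
  also have "\<dots> \<le> (\<Sum>b\<in>primitive l. \<Sum>z\<in>quat_residues p. (f (a * z) - f (b * z))\<^sup>2)"
    by (rule member_le_sum) (use ab finite_primitive in \<open>auto intro!: sum_nonneg\<close>)
  also have "\<dots> \<le> dirichlet_form f"
    unfolding dirichlet_form_def
    by (rule member_le_sum[of a]) (use ab finite_primitive in \<open>auto intro!: sum_nonneg\<close>)
  finally have "\<bar>f (a * z) - f (b * z)\<bar> \<le> sqrt (dirichlet_form f)" by (simp add: real_le_rsqrt)
  then show ?thesis using periodicD[OF f qcong_quat_mod] unfolding xy_eq by metis
qed

lemma abs_diff_hecke_path_le:
  assumes f: "periodic p f" and xy: "(x, y) \<in> hecke_edges\<^sup>*"
  shows "\<bar>f x - f y\<bar> \<le> real (card hecke_edges) * sqrt (dirichlet_form f)"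
proof -
  have path: "\<bar>f x - f y\<bar> \<le> real n * sqrt (dirichlet_form f)" if "(x, y) \<in> hecke_edges ^^ n" for n y
    using that
  proof (induction n arbitrary: y)
    case (Suc n)
    then obtain w where "(x, w) \<in> hecke_edges ^^ n" "(w, y) \<in> hecke_edges" by auto
    then have "\<bar>f x - f w\<bar> \<le> real n * sqrt (dirichlet_form f)" "\<bar>f w - f y\<bar> \<le> sqrt (dirichlet_form f)"
      using Suc.IH abs_diff_hecke_edge_le[OF f] by auto
    then show ?case by (simp add: algebra_simps)
  qed simp
  obtain n where n: "n \<le> card hecke_edges" "(x, y) \<in> hecke_edges ^^ n"
    using xy rtrancl_finite_eq_relpow[OF finite_hecke_edges] by auto
  have "\<bar>f x - f y\<bar> \<le> real n * sqrt (dirichlet_form f)" by (rule path[OF n(2)])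
  also have "\<dots> \<le> real (card hecke_edges) * sqrt (dirichlet_form f)"
    using n(1) dirichlet_form_ge_0 by (intro mult_right_mono) auto
  finally show ?thesis .
qed

lemma norm_invariant_component: "norm_invariant (\<lambda>y. of_bool ((x, quat_mod y p) \<in> hecke_edges\<^sup>*))"
  unfolding norm_invariant_def
proof (intro conjI allI impI)
  show "periodic p (\<lambda>y. of_bool ((x, quat_mod y p) \<in> hecke_edges\<^sup>*))"
    unfolding periodic_def quat_mod_eq_iff[symmetric] by simp
  fix a a' y assume "nrm a = l" "nrm a' = l"
  then have "(quat_mod (a * y) p, quat_mod (a' * y) p) \<in> hecke_edges"
    "(quat_mod (a' * y) p, quat_mod (a * y) p) \<in> hecke_edges"
    using hecke_edgesI by blast+
  then have "(x, quat_mod (a * y) p) \<in> hecke_edges\<^sup>* \<longleftrightarrow> (x, quat_mod (a' * y) p) \<in> hecke_edges\<^sup>*"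
    using rtrancl_into_rtrancl[of x _ hecke_edges] by blast
  then show "of_bool ((x, quat_mod (a * y) p) \<in> hecke_edges\<^sup>*)
    = (of_bool ((x, quat_mod (a' * y) p) \<in> hecke_edges\<^sup>*) :: real)"
    by (rule arg_cong)
qed

lemma cuspidal_sum_component:
  assumes "f \<in> cuspidal"
  shows "(\<Sum>y | y \<in> quat_residues p \<and> (x, y) \<in> hecke_edges\<^sup>*. f y) = 0"
proof -
  have "(\<Sum>y | y \<in> quat_residues p \<and> (x, y) \<in> hecke_edges\<^sup>*. f y)
    = (\<Sum>y\<in>quat_residues p. if (x, y) \<in> hecke_edges\<^sup>* then f y else 0)"
    by (rule sum.inter_filter[OF finite_quat_residues])
  also have "\<dots> = l2inner f (\<lambda>y. of_bool ((x, quat_mod y p) \<in> hecke_edges\<^sup>*))"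
    unfolding l2inner_def by (intro sum.cong refl) (simp add: quat_mod_residue)
  also have "\<dots> = 0" using cuspidal_orthogonal[OF assms norm_invariant_component] .
  finally show ?thesis .
qed

lemma cuspidal_abs_le:
  assumes f: "f \<in> cuspidal" and x: "x \<in> quat_residues p"
  shows "\<bar>f x\<bar> \<le> real (card hecke_edges) * sqrt (dirichlet_form f)"
proof -
  define Y where "Y = {y \<in> quat_residues p. (x, y) \<in> hecke_edges\<^sup>*}"
  have Y: "finite Y" "x \<in> Y" using x by (auto simp: Y_def finite_quat_residues)
  have "real (card Y) * \<bar>f x\<bar> = \<bar>\<Sum>y\<in>Y. f x - f y\<bar>"
    using cuspidal_sum_component[OF f, of x] by (simp add: Y_def sum_subtractf abs_mult)
  also have "\<dots> \<le> (\<Sum>y\<in>Y. real (card hecke_edges) * sqrt (dirichlet_form f))"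
    by (rule order_trans[OF sum_abs], rule sum_mono)
      (simp add: Y_def abs_diff_hecke_path_le[OF cuspidal_periodic[OF f]])
  finally have "real (card Y) * \<bar>f x\<bar>
    \<le> real (card Y) * (real (card hecke_edges) * sqrt (dirichlet_form f))" by simp
  moreover have "real (card Y) > 0" using Y by (auto simp: card_gt_0_iff)
  ultimately show ?thesis by simp
qed

lemma poincare_inequality:
  obtains K where "K \<ge> 1" "\<And>f. f \<in> cuspidal \<Longrightarrow> (l2norm f)\<^sup>2 \<le> K * dirichlet_form f"
proof -
  let ?D = "real (card hecke_edges)" and ?N = "real (card (quat_residues p))"
  have "(l2norm f)\<^sup>2 \<le> (?N * ?D\<^sup>2 + 1) * dirichlet_form f" if f: "f \<in> cuspidal" for f
  proof -
    have "(f x)\<^sup>2 \<le> ?D\<^sup>2 * dirichlet_form f" if "x \<in> quat_residues p" for x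
      using power_mono[OF cuspidal_abs_le[OF f that], of 2] dirichlet_form_ge_0[of f]
      by (simp add: power_mult_distrib)
    then have "(l2norm f)\<^sup>2 \<le> (\<Sum>x\<in>quat_residues p. ?D\<^sup>2 * dirichlet_form f)"
      unfolding l2norm_square_eq_sum by (rule sum_mono)
    also have "\<dots> \<le> (?N * ?D\<^sup>2 + 1) * dirichlet_form f"
      using dirichlet_form_ge_0[of f] by (simp add: algebra_simps)
    finally show ?thesis .
  qed
  then show thesis using that[of "?N * ?D\<^sup>2 + 1"] by simp
qed

lemma spectral_gap:
  obtains \<rho> where "0 \<le> \<rho>" "\<rho> < 1"
    "\<And>f. f \<in> cuspidal \<Longrightarrow> l2norm (hecke_op 1 f) \<le> \<rho> * real (card (primitive l)) * l2norm f"
proof -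
  obtain K where K: "K \<ge> 1" "\<And>f. f \<in> cuspidal \<Longrightarrow> (l2norm f)\<^sup>2 \<le> K * dirichlet_form f"
    using poincare_inequality by blast
  define N where "N = real (card (primitive l))"
  have N: "N \<ge> 1" using card_primitive_l l_gt_2 by (simp add: N_def)
  define r where "r = 1 - 1 / (2 * K * N\<^sup>2)"
  have "K * N\<^sup>2 \<ge> 1" using K(1) N mult_mono[of 1 K 1 "N\<^sup>2"] by (simp add: one_le_power)
  then have r: "0 \<le> r" "r < 1" using K(1) N by (auto simp: r_def field_simps)
  have "l2norm (hecke_op 1 f) \<le> sqrt r * N * l2norm f" if f: "f \<in> cuspidal" for f
  proof -
    have "(l2norm (hecke_op 1 f))\<^sup>2 = (N * l2norm f)\<^sup>2 - dirichlet_form f / 2"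
      using l2norm_hecke_op_1[OF cuspidal_periodic[OF f]] by (simp add: N_def)
    also have "\<dots> \<le> (N * l2norm f)\<^sup>2 - (l2norm f)\<^sup>2 / (2 * K)"
      using K(2)[OF f] K(1) by (simp add: field_simps)
    also have "\<dots> = (sqrt r * N * l2norm f)\<^sup>2"
      using r(1) N K(1) by (simp add: power_mult_distrib r_def) (simp add: field_simps)
    finally show ?thesis using r N by (elim power2_le_imp_le) (intro mult_nonneg_nonneg, auto)
  qed
  then show thesis using that[of "sqrt r"] r by (simp add: N_def)
qed

end

subsection \<open>Exponential decay\<close>

lemma le_if_quadratic_le:
  fixes x y \<mu> \<nu> B :: real
  assumes "0 \<le> y" "\<nu> \<le> \<mu>" "0 \<le> B" and quadratic: "(x - \<mu> * y) * (x - \<nu> * y) \<le> B\<^sup>2"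
  shows "x \<le> \<mu> * y + B"
proof (cases "x \<le> \<mu> * y")
  case False
  have "\<nu> * y \<le> \<mu> * y" using assms by (intro mult_right_mono)
  then have "(x - \<mu> * y) * (x - \<mu> * y) \<le> (x - \<mu> * y) * (x - \<nu> * y)"
    using False by (intro mult_left_mono) auto
  then have "(x - \<mu> * y)\<^sup>2 \<le> B\<^sup>2" using quadratic by (simp add: power2_eq_square)
  then have "x - \<mu> * y \<le> B" using assms(3) by (rule power2_le_imp_le)
  then show ?thesis by simp
qed (use assms in simp)

lemma decay_rate_exists:
  fixes L \<rho> :: real
  assumes L: "3 \<le> L" and \<rho>: "\<rho> < 1"
  obtains \<theta> where "9 / 10 \<le> \<theta>" "\<theta> < 1" "1 / \<theta> \<le> L * \<theta>" "\<rho> * (L + 1) \<le> L * \<theta> + 1 / \<theta>"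
proof -
  have gap: "\<rho> * (L + 1) < L + 1" using L \<rho> by simp
  define \<theta> where "\<theta> = max (9 / 10) ((\<rho> * (L + 1) - 1) / L)"
  have "(\<rho> * (L + 1) - 1) / L < 1" by (subst pos_divide_less_eq) (use gap L in linarith)+
  then have \<theta>: "9 / 10 \<le> \<theta>" "\<theta> < 1" by (auto simp: \<theta>_def)
  have "1 \<le> 3 * (9 / 10 * (9 / 10 :: real))" by simp
  also have "\<dots> \<le> L * (\<theta> * \<theta>)" using L \<theta> by (intro mult_mono) auto
  finally have "1 / \<theta> \<le> L * \<theta>" using \<theta> by (simp add: field_simps)
  moreover have "(\<rho> * (L + 1) - 1) / L \<le> \<theta>" by (simp add: \<theta>_def)
  then have "\<rho> * (L + 1) - 1 \<le> L * \<theta>" using L by (simp add: pos_divide_le_eq mult.commute)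
  moreover have "1 \<le> 1 / \<theta>" using \<theta> by simp
  ultimately show thesis using that[OF \<theta>] by linarith
qed

lemma sqrt_less_mult:
  fixes L \<theta> :: real
  assumes L: "3 \<le> L" and \<theta>: "9 / 10 \<le> \<theta>"
  shows "sqrt L < L * \<theta>"
proof -
  have "3 * (9 / 10 * (9 / 10)) \<le> L * (\<theta> * \<theta>)" using L \<theta> by (intro mult_mono) auto
  then have "1 * L < L * (\<theta> * \<theta>) * L" using L by (intro mult_strict_right_mono) auto
  then have "L < (L * \<theta>)\<^sup>2" by (simp add: power2_eq_square mult_ac)
  then show ?thesis using L \<theta> by (intro real_less_lsqrt) auto
qed

lemma affine_recurrence_le:
  fixes x :: "nat \<Rightarrow> real"
  assumes s: "0 \<le> s" "s < \<mu>" and K: "0 \<le> K" "x 1 \<le> K"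
    and step: "\<And>m. m \<ge> 1 \<Longrightarrow> x (Suc m) \<le> \<mu> * x m + K * s ^ m" and m: "m \<ge> 1"
  shows "x m \<le> K / (\<mu> - s) * \<mu> ^ m"
proof -
  have "x m \<le> K * (\<mu> ^ m - s ^ m) / (\<mu> - s)"
    using m
  proof (induction m rule: nat_induct_at_least)
    case base
    then show ?case using s K by simp
  next
    case (Suc m)
    have "x (Suc m) \<le> \<mu> * (K * (\<mu> ^ m - s ^ m) / (\<mu> - s)) + K * s ^ m"
      using step[OF Suc.hyps] mult_left_mono[OF Suc.IH, of \<mu>] s by linarith
    also have "\<dots> = K * (\<mu> ^ Suc m - s ^ Suc m) / (\<mu> - s)" using s by (simp add: field_simps)
    finally show ?case .
  qed
  also have "\<dots> \<le> K * \<mu> ^ m / (\<mu> - s)" using s K by (intro divide_right_mono mult_left_mono) auto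
  finally show ?thesis by simp
qed

context level
begin

lemma l2inner_hecke_op_1:
  assumes u: "periodic p u" and v: "periodic p v"
  shows "l2inner (hecke_op 1 u) (\<lambda>x. v (of_int l * x)) = l2inner u (hecke_op 1 v)"
proof -
  have "l2inner (hecke_op 1 u) (\<lambda>x. v (of_int l * x))
    = (\<Sum>a\<in>primitive l. l2inner (\<lambda>x. u (a * x)) (\<lambda>x. v (of_int l * x)))"
    unfolding l2inner_def hecke_op_1 sum_distrib_right by (rule sum.swap)
  also have "\<dots> = (\<Sum>a\<in>primitive l. l2inner u (\<lambda>x. v (qcnj a * x)))"
  proof (intro sum.cong refl)
    fix a assume "a \<in> primitive l"
    then have a: "nrm a = l" by (simp add: primitive_def)
    then have "l2inner u (\<lambda>x. v (qcnj a * x)) = l2inner (\<lambda>x. u (a * x)) (\<lambda>x. v (qcnj a * (a * x)))"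
      using l2inner_mult_left[OF u periodic_mult_left[OF v], of a "qcnj a"] p_not_dvd_l by simp
    then show "l2inner (\<lambda>x. u (a * x)) (\<lambda>x. v (of_int l * x)) = l2inner u (\<lambda>x. v (qcnj a * x))"
      by (simp add: mult_qcnj_assoc a)
  qed
  also have "\<dots> = (\<Sum>a\<in>primitive l. l2inner u (\<lambda>x. v (a * x)))"
    by (rule sum.reindex_bij_witness[of _ qcnj qcnj]) (auto simp: primitive_def)
  also have "\<dots> = l2inner u (hecke_op 1 v)"
    unfolding l2inner_def hecke_op_1 sum_distrib_left by (rule sum.swap)
  finally show ?thesis .
qed

lemma hecke_op_recurrence:
  assumes "m \<ge> 1"
  shows "hecke_op (m + 2) f x = hecke_op 1 (hecke_op (Suc m) f) x / 8
    - of_int l * hecke_op m f (of_int l * x)"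
proof -
  have "hecke_op 1 (hecke_op (Suc m) f) x = (\<Sum>a\<in>primitive (l ^ Suc m). \<Sum>b\<in>primitive l. f (a * b * x))"
    unfolding hecke_op_1 hecke_op_def[of "Suc m"] by (subst sum.swap) (simp add: mult.assoc)
  also have "\<dots> = 8 * hecke_op (m + 2) f x + 8 * of_int l * hecke_op m f (of_int l * x)"
    unfolding sum_mult_primitive_l[OF assms, of "\<lambda>y. f (y * x)"] hecke_op_def
    by (simp add: mult.assoc of_int_mult_left_commute)
  finally show ?thesis by (simp add: add_divide_distrib)
qed

text \<open>The energy of the Hecke recurrence \<open>z\<^sub>m\<^sub>+\<^sub>2 = T z\<^sub>m\<^sub>+\<^sub>1 - l z\<^sub>m(l \<cdot>)\<close>: each step multiplies it by \<open>l\<close>.\<close>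

definition hecke_energy :: "(quat \<Rightarrow> real) \<Rightarrow> nat \<Rightarrow> real" where
  "hecke_energy f m = (l2norm (hecke_op (Suc m) f))\<^sup>2
    - l2inner (hecke_op (Suc m) f) (hecke_op 1 (hecke_op m f)) / 8
      + of_int l * (l2norm (hecke_op m f))\<^sup>2"

lemma hecke_energy_Suc:
  assumes f: "f \<in> cuspidal" and m: "m \<ge> 1"
  shows "hecke_energy f (Suc m) = of_int l * hecke_energy f m"
proof -
  let ?z = "\<lambda>m. hecke_op m f" and ?T = "\<lambda>m x. hecke_op 1 (hecke_op m f) x / 8"
  have z: "periodic p (?z m)" for m by (rule cuspidal_periodic[OF cuspidal_hecke_op[OF f]])
  define w where "w x = ?z m (of_int l * x)" for x
  have z2: "?z (Suc (Suc m)) = (\<lambda>x. ?T (Suc m) x - of_int l * w x)"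
    using hecke_op_recurrence[OF m, of f] by (auto simp: w_def)
  have T: "l2inner g (\<lambda>x. h x / 8) = l2inner g h / 8" "l2inner (\<lambda>x. h x / 8) g = l2inner h g / 8" for g h
    by (simp_all add: l2inner_def sum_divide_distrib)
  have "(l2norm w)\<^sup>2 = (l2norm (?z m))\<^sup>2"
    unfolding w_def using l2norm_mult_left[OF z p_not_dvd_nrm_of_int[OF p_not_dvd_l]] by simp
  moreover have "l2inner (?T (Suc m)) w = l2inner (?z (Suc m)) (?T m)"
    unfolding T w_def l2inner_hecke_op_1[OF z z] ..
  ultimately have "l2inner (?z (Suc (Suc m))) w
    = l2inner (?z (Suc m)) (?T m) - of_int l * (l2norm (?z m))\<^sup>2"
    unfolding z2 l2inner_diff_left l2norm_square by simp
  moreover have "(l2norm (?z (Suc (Suc m))))\<^sup>2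
    = l2inner (?z (Suc (Suc m))) (?T (Suc m)) - of_int l * l2inner (?z (Suc (Suc m))) w"
    unfolding l2norm_square by (subst (2) z2) (rule l2inner_diff_right)
  ultimately show ?thesis unfolding hecke_energy_def T by (simp only: right_diff_distrib distrib_left)
qed

lemma hecke_energy_eq:
  assumes "f \<in> cuspidal" "m \<ge> 1"
  shows "hecke_energy f m = of_int l ^ (m - 1) * hecke_energy f 1"
  using assms(2)
proof (induction m rule: nat_induct_at_least)
  case (Suc m)
  then show ?case using hecke_energy_Suc[OF assms(1) Suc.hyps] by (cases m) auto
qed simp

lemma hecke_energy_1_le:
  obtains K where "K \<ge> 1" "\<And>f. f \<in> cuspidal \<Longrightarrow> hecke_energy f 1 \<le> K * (l2norm f)\<^sup>2"
proof -
  define c where "c m = real (card (primitive (l ^ m)))" for m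
  have "hecke_energy f 1 \<le> ((c 2)\<^sup>2 + c 2 * (c 1 * c 1) + of_int l * (c 1)\<^sup>2 + 1) * (l2norm f)\<^sup>2"
    if f: "f \<in> cuspidal" for f
  proof -
    have bound: "l2norm (hecke_op m g) \<le> c m * l2norm g" if "g \<in> cuspidal" for m g
      unfolding c_def by (rule l2norm_hecke_op_le[OF cuspidal_periodic[OF that]])
    have T: "l2norm (hecke_op 1 (hecke_op 1 f)) \<le> c 1 * (c 1 * l2norm f)"
      using bound[OF cuspidal_hecke_op[OF f], of 1 1] mult_left_mono[OF bound[OF f, of 1], of "c 1"]
      by (simp add: c_def)
    have "hecke_energy f 1 \<le> (l2norm (hecke_op 2 f))\<^sup>2
      + l2norm (hecke_op 2 f) * l2norm (hecke_op 1 (hecke_op 1 f))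
        + of_int l * (l2norm (hecke_op 1 f))\<^sup>2"
      using abs_l2inner_le[of "hecke_op 2 f" "hecke_op 1 (hecke_op 1 f)"]
      by (simp add: hecke_energy_def numeral_2_eq_2)
    also have "\<dots> \<le> (c 2 * l2norm f)\<^sup>2 + (c 2 * l2norm f) * (c 1 * (c 1 * l2norm f))
      + of_int l * (c 1 * l2norm f)\<^sup>2"
      using bound[OF f, of 1] bound[OF f, of 2] T l_gt_2
      by (intro add_mono mult_mono power_mono mult_nonneg_nonneg) (auto simp: c_def)
    also have "\<dots> \<le> ((c 2)\<^sup>2 + c 2 * (c 1 * c 1) + of_int l * (c 1)\<^sup>2 + 1) * (l2norm f)\<^sup>2"
      by (simp add: power2_eq_square algebra_simps)
    finally show ?thesis .
  qed
  moreover have "(c 2)\<^sup>2 + c 2 * (c 1 * c 1) + of_int l * (c 1)\<^sup>2 + 1 \<ge> 1"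
    using l_gt_2 by (simp add: c_def)
  ultimately show thesis using that by blast
qed

text \<open>The spectral gap bounds the quadratic form \<open>(x - l \<theta> y) (x - y / \<theta>)\<close> in the norms of two consecutive
  iterates by the energy, for some \<open>\<theta> < 1\<close>.\<close>

lemma l2norm_hecke_op_Suc_le:
  obtains \<theta> K where "9 / 10 \<le> \<theta>" "\<theta> < 1"
    "\<And>f m. f \<in> cuspidal \<Longrightarrow> m \<ge> 1 \<Longrightarrow>
      l2norm (hecke_op (Suc m) f) \<le> of_int l * \<theta> * l2norm (hecke_op m f)
        + K * l2norm f * sqrt (of_int l) ^ m"
proof -
  obtain \<rho> where \<rho>: "0 \<le> \<rho>" "\<rho> < 1"
    and gap: "\<And>f. f \<in> cuspidal \<Longrightarrow> l2norm (hecke_op 1 f) \<le> \<rho> * real (card (primitive l)) * l2norm f"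
    using spectral_gap by blast
  obtain K where K: "K \<ge> 1" "\<And>f. f \<in> cuspidal \<Longrightarrow> hecke_energy f 1 \<le> K * (l2norm f)\<^sup>2"
    using hecke_energy_1_le by blast
  define L where "L = real_of_int l"
  have L: "L \<ge> 3" using l_gt_2 by (simp add: L_def)
  have card_l: "real (card (primitive l)) = 8 * (L + 1)"
    using card_primitive_l
    by (metis L_def of_int_of_nat_eq of_int_add of_int_mult of_int_1 of_int_numeral)
  obtain \<theta> where \<theta>: "9 / 10 \<le> \<theta>" "\<theta> < 1" and inverse_\<theta>: "1 / \<theta> \<le> L * \<theta>"
    and gap_\<theta>: "\<rho> * (L + 1) \<le> L * \<theta> + 1 / \<theta>"
    by (rule decay_rate_exists[OF L \<rho>(2)])
  have "l2norm (hecke_op (Suc m) f) \<le> L * \<theta> * l2norm (hecke_op m f) + sqrt K * l2norm f * sqrt L ^ m"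
    if f: "f \<in> cuspidal" and m: "m \<ge> 1" for f m
  proof (rule le_if_quadratic_le[OF l2norm_ge_0 inverse_\<theta>])
    let ?x = "l2norm (hecke_op (Suc m) f)" and ?y = "l2norm (hecke_op m f)"
    have "l2inner (hecke_op (Suc m) f) (hecke_op 1 (hecke_op m f)) \<le> ?x * (\<rho> * (8 * (L + 1)) * ?y)"
      using abs_l2inner_le[of "hecke_op (Suc m) f" "hecke_op 1 (hecke_op m f)"]
        mult_left_mono[OF gap[OF cuspidal_hecke_op[OF f], of m] l2norm_ge_0[of "hecke_op (Suc m) f"]]
      unfolding card_l by linarith
    also have "\<dots> = 8 * (\<rho> * (L + 1) * (?x * ?y))" by simp
    finally have "l2inner (hecke_op (Suc m) f) (hecke_op 1 (hecke_op m f)) / 8 \<le> \<rho> * (L + 1) * (?x * ?y)"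
      by simp
    moreover have "\<rho> * (L + 1) * (?x * ?y) \<le> (L * \<theta> + 1 / \<theta>) * (?x * ?y)"
      using gap_\<theta> by (intro mult_right_mono) auto
    moreover have "(?x - L * \<theta> * ?y) * (?x - 1 / \<theta> * ?y) = ?x\<^sup>2 - (L * \<theta> + 1 / \<theta>) * (?x * ?y) + L * ?y\<^sup>2"
      using \<theta> by (simp add: power2_eq_square algebra_simps)
    ultimately have "(?x - L * \<theta> * ?y) * (?x - 1 / \<theta> * ?y) \<le> hecke_energy f m"
      unfolding hecke_energy_def L_def[symmetric] by linarith
    also have "\<dots> = L ^ (m - 1) * hecke_energy f 1" unfolding L_def by (rule hecke_energy_eq[OF f m])
    also have "\<dots> \<le> L ^ (m - 1) * (K * (l2norm f)\<^sup>2)" using K(2)[OF f] L by (intro mult_left_mono) auto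
    also have "\<dots> \<le> L ^ m * (K * (l2norm f)\<^sup>2)"
      using K(1) L by (intro mult_right_mono power_increasing) auto
    also have "\<dots> = (sqrt K * l2norm f * sqrt L ^ m)\<^sup>2"
      using K(1) L by (simp add: power_mult_distrib real_sqrt_power[symmetric])
    finally show "(?x - L * \<theta> * ?y) * (?x - 1 / \<theta> * ?y) \<le> (sqrt K * l2norm f * sqrt L ^ m)\<^sup>2" .
  qed (use K L in simp)
  then show thesis unfolding L_def by (rule that[OF \<theta>])
qed

lemma hecke_op_decay:
  obtains \<theta> C where "9 / 10 \<le> \<theta>" "\<theta> < 1" "C > 0"
    "\<And>f m. f \<in> cuspidal \<Longrightarrow> l2norm (hecke_op m f) \<le> C * (of_int l * \<theta>) ^ m * l2norm f"
proof -
  obtain \<theta> K where \<theta>: "9 / 10 \<le> \<theta>" "\<theta> < 1"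
    and step: "\<And>f m. f \<in> cuspidal \<Longrightarrow> m \<ge> 1 \<Longrightarrow>
      l2norm (hecke_op (Suc m) f) \<le> of_int l * \<theta> * l2norm (hecke_op m f)
        + K * l2norm f * sqrt (of_int l) ^ m"
    using l2norm_hecke_op_Suc_le by blast
  define \<mu> s K' where "\<mu> = of_int l * \<theta>" and "s = sqrt (of_int l)"
    and "K' = max K (real (card (primitive l)))"
  have "s < \<mu>" unfolding s_def \<mu>_def by (rule sqrt_less_mult) (use \<theta> l_gt_2 in auto)
  moreover have "s > 0" using l_gt_2 by (simp add: s_def)
  moreover have "K' \<ge> 0" by (simp add: K'_def le_max_iff_disj)
  moreover define C where "C = K' / (\<mu> - s) + 8"
  ultimately have C: "C \<ge> 8" "K' / (\<mu> - s) \<le> C" by simp_all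
  have "l2norm (hecke_op m f) \<le> C * \<mu> ^ m * l2norm f" if f: "f \<in> cuspidal" for f m
  proof (cases "m \<ge> 1")
    case True
    have "l2norm (hecke_op m f) \<le> K' * l2norm f / (\<mu> - s) * \<mu> ^ m"
    proof (rule affine_recurrence_le[OF less_imp_le[OF \<open>s > 0\<close>] \<open>s < \<mu>\<close> _ _ _ True])
      show "l2norm (hecke_op 1 f) \<le> K' * l2norm f"
        using l2norm_hecke_op_le[OF cuspidal_periodic[OF f], of 1]
          mult_right_mono[of "real (card (primitive l))" K' "l2norm f"] by (simp add: K'_def)
      show "l2norm (hecke_op (Suc i) f) \<le> \<mu> * l2norm (hecke_op i f) + K' * l2norm f * s ^ i"
        if "i \<ge> 1" for i
      proof -
        have "K * (l2norm f * s ^ i) \<le> K' * (l2norm f * s ^ i)"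
          using \<open>s > 0\<close> by (intro mult_right_mono) (auto simp: K'_def)
        then show ?thesis using step[OF f that] unfolding \<mu>_def s_def by (simp add: mult.assoc)
      qed
    qed (use \<open>K' \<ge> 0\<close> in simp)
    also have "\<dots> = K' / (\<mu> - s) * (\<mu> ^ m * l2norm f)" by simp
    also have "\<dots> \<le> C * (\<mu> ^ m * l2norm f)" using C(2) \<open>s < \<mu>\<close> \<open>s > 0\<close> by (intro mult_right_mono) auto
    finally show ?thesis by simp
  next
    case False
    then have "m = 0" by simp
    then have "l2norm (hecke_op m f) \<le> 8 * l2norm f"
      using l2norm_hecke_op_le[OF cuspidal_periodic[OF f], of 0] card_primitive_l_pow[of 0]
      by (simp add: primitive_1 card_units)
    also have "\<dots> \<le> C * l2norm f" using C(1) by (intro mult_right_mono) auto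
    finally show ?thesis using \<open>m = 0\<close> by simp
  qed
  then show thesis using that[OF \<theta>, of C] C(1) by (simp add: \<mu>_def)
qed

end

subsection \<open>Hecke operators without backtracking\<close>

lemma content_mult_unit:
  assumes "nrm u = 1"
  shows "content (u * x) = content x" "content (x * u) = content x"
proof -
  have "qcnj u * (u * x) = x" "x * u * qcnj u = x"
    using assms by (simp_all add: mult_qcnj_assoc mult.assoc mult_qcnj)
  then show "content (u * x) = content x" "content (x * u) = content x"
    using content_dvd_content_mult content_ge_0 by (metis zdvd_antisym_nonneg)+
qed

lemma bij_betw_mult_right_factor:
  assumes g: "nrm g > 0"
  shows "bij_betw (\<lambda>a. a * g) {a \<in> primitive n. content (a * g) = 1}
    {x \<in> primitive (n * nrm g). g \<in> right_factors (nrm g) x}"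
proof (rule bij_betw_imageI)
  have "g \<noteq> 0" using g by auto
  then show "inj_on (\<lambda>a. a * g) {a \<in> primitive n. content (a * g) = 1}" by (simp add: inj_on_def)
  show "(\<lambda>a. a * g) ` {a \<in> primitive n. content (a * g) = 1}
    = {x \<in> primitive (n * nrm g). g \<in> right_factors (nrm g) x}"
  proof (intro Set.set_eqI iffI)
    fix x assume "x \<in> {x \<in> primitive (n * nrm g). g \<in> right_factors (nrm g) x}"
    then obtain a where x: "x \<in> primitive (n * nrm g)" "x = a * g" by (auto simp: right_factors_def)
    then have a: "x = a * g" "nrm a * nrm g = n * nrm g" "content (a * g) = 1"
      by (simp_all add: primitive_def nrm_mult)
    moreover have "content a = 1" by (rule content_factor_eq_1(1)[OF a(3)])
    ultimately show "x \<in> (\<lambda>a. a * g) ` {a \<in> primitive n. content (a * g) = 1}"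
      using g by (auto simp: primitive_def)
  qed (auto simp: primitive_def right_factors_def nrm_mult)
qed

context level
begin

definition restricted_hecke_op :: "nat \<Rightarrow> quat \<Rightarrow> (quat \<Rightarrow> real) \<Rightarrow> quat \<Rightarrow> real" where
  "restricted_hecke_op m \<gamma> f x = (\<Sum>a | a \<in> primitive (l ^ m) \<and> content (a * \<gamma>) = 1. f (a * x))"

lemma periodic_restricted_hecke_op: "periodic p f \<Longrightarrow> periodic p (restricted_hecke_op m \<gamma> f)"
  unfolding restricted_hecke_op_def[abs_def] by (intro periodic_sum periodic_mult_left)

lemma restricted_hecke_op_eq:
  "(\<And>a. a \<in> primitive (l ^ m) \<Longrightarrow> content (a * \<gamma>) = 1) \<Longrightarrow> restricted_hecke_op m \<gamma> f = hecke_op m f"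
  unfolding restricted_hecke_op_def[abs_def] hecke_op_def[abs_def] by (auto intro!: ext sum.cong)

lemma restricted_hecke_op_unit: "nrm \<gamma> = 1 \<Longrightarrow> restricted_hecke_op m \<gamma> f = hecke_op m f"
  by (rule restricted_hecke_op_eq) (simp add: primitive_def content_mult_unit)

lemma hecke_op_Suc_split:
  assumes \<gamma>: "\<gamma> \<in> primitive (l ^ j)" and g: "nrm g = l" "right_ideal \<gamma> l = range (\<lambda>d. g * d)"
  shows "hecke_op (Suc m) f x = restricted_hecke_op (Suc m) \<gamma> f x
    + restricted_hecke_op m (qcnj g) f (qcnj g * x)"
proof -
  let ?P = "primitive (l ^ Suc m)"
  have content_iff: "content (a * \<gamma>) = 1 \<longleftrightarrow> \<not> qcnj g \<in> right_factors l a" if "a \<in> ?P" for a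
  proof -
    have "content (a * \<gamma>) = 1 \<longleftrightarrow> a * \<gamma> \<in> primitive (l ^ (Suc m + j))"
      using that \<gamma> by (simp add: primitive_def nrm_mult power_add)
    also have "\<dots> \<longleftrightarrow> \<not> qdvd l (a * \<gamma>)"
      using that \<gamma> unfolding primitive_l_pow_iff by (simp add: nrm_mult power_add)
    also have "\<dots> \<longleftrightarrow> \<not> qdvd (nrm g) (a * g)" unfolding qdvd_mult_generator_iff[OF g(2)] g(1) ..
    also have "\<dots> \<longleftrightarrow> \<not> qcnj g \<in> right_factors l a"
      using g(1) l_gt_2 by (subst qdvd_nrm_mult_iff) (auto simp: right_factors_def)
    finally show ?thesis .
  qed
  have "hecke_op (Suc m) f x = (\<Sum>a | a \<in> ?P \<and> content (a * \<gamma>) = 1. f (a * x))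
    + (\<Sum>a | a \<in> ?P \<and> qcnj g \<in> right_factors l a. f (a * x))"
    unfolding hecke_op_def using content_iff finite_primitive
    by (subst sum.union_disjoint[symmetric]) (auto intro!: sum.cong)
  also have "(\<Sum>a | a \<in> ?P \<and> qcnj g \<in> right_factors l a. f (a * x))
    = restricted_hecke_op m (qcnj g) f (qcnj g * x)"
    using sum.reindex_bij_betw[OF bij_betw_mult_right_factor[of "qcnj g" "l ^ m"], of "\<lambda>a. f (a * x)"] l_gt_2
    by (simp add: restricted_hecke_op_def g(1) mult.assoc mult.commute[of l])
  finally show ?thesis by (simp only: restricted_hecke_op_def)
qed

lemma l2norm_restricted_hecke_op_le:
  assumes f: "periodic p f" and \<gamma>: "\<gamma> \<in> primitive (l ^ j)"
  shows "l2norm (restricted_hecke_op m \<gamma> f) \<le> (\<Sum>i\<le>m. l2norm (hecke_op i f))"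
  using \<gamma>
proof (induction m arbitrary: \<gamma> j)
  case 0
  then have "restricted_hecke_op 0 \<gamma> f = hecke_op 0 f"
    by (intro restricted_hecke_op_eq) (simp add: primitive_def content_mult_unit)
  then show ?case by simp
next
  case (Suc m)
  show ?case
  proof (cases j)
    case 0
    then have "restricted_hecke_op (Suc m) \<gamma> f = hecke_op (Suc m) f"
      using Suc.prems by (intro restricted_hecke_op_unit) (simp add: primitive_def)
    then show ?thesis by (auto intro!: sum_nonneg)
  next
    case (Suc i)
    have "l dvd nrm \<gamma>" "coprime l (content \<gamma>)" using Suc.prems Suc by (auto simp: primitive_def)
    then obtain g where g: "nrm g = l" "right_ideal \<gamma> l = range (\<lambda>d. g * d)"
      using right_ideal_generator_of_norm odd_l l_gt_2 by (metis zero_less_numeral less_trans)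
    let ?R = "restricted_hecke_op m (qcnj g) f"
    have R: "periodic p ?R" by (rule periodic_restricted_hecke_op[OF f])
    have "restricted_hecke_op (Suc m) \<gamma> f = (\<lambda>x. hecke_op (Suc m) f x + - ?R (qcnj g * x))"
      using hecke_op_Suc_split[OF Suc.prems g] by auto
    then have "l2norm (restricted_hecke_op (Suc m) \<gamma> f)
      \<le> l2norm (hecke_op (Suc m) f) + l2norm (\<lambda>x. - ?R (qcnj g * x))"
      using l2norm_triangle by metis
    also have "l2norm (\<lambda>x. - ?R (qcnj g * x)) = l2norm ?R"
      using l2norm_mult_left[OF R, of "qcnj g"] g(1) p_not_dvd_l by simp
    also have "\<dots> \<le> (\<Sum>i\<le>m. l2norm (hecke_op i f))"
      by (rule Suc.IH[of _ 1]) (use g(1) in \<open>simp add: primitive_prime[OF prime_l]\<close>)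
    finally show ?thesis by simp
  qed
qed

definition restricted_hecke_decay :: "real \<Rightarrow> real \<Rightarrow> bool" where
  "restricted_hecke_decay \<theta> C \<longleftrightarrow> (\<forall>f m \<gamma> j. f \<in> cuspidal \<longrightarrow> \<gamma> \<in> primitive (l ^ j) \<longrightarrow>
    l2norm (restricted_hecke_op m \<gamma> f) \<le> C * (of_int l * \<theta>) ^ m * l2norm f)"

lemma restricted_hecke_decayD:
  "restricted_hecke_decay \<theta> C \<Longrightarrow> f \<in> cuspidal \<Longrightarrow> \<gamma> \<in> primitive (l ^ j) \<Longrightarrow>
    l2norm (restricted_hecke_op m \<gamma> f) \<le> C * (of_int l * \<theta>) ^ m * l2norm f"
  unfolding restricted_hecke_decay_def by blast

lemma hecke_decay:
  assumes "restricted_hecke_decay \<theta> C" "f \<in> cuspidal"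
  shows "l2norm (hecke_op m f) \<le> C * (of_int l * \<theta>) ^ m * l2norm f"
  using restricted_hecke_decayD[OF assms, of 1 0 m] restricted_hecke_op_unit[of 1 m f]
  by (simp add: primitive_def)

lemma restricted_hecke_decay_exists:
  obtains \<theta> C where "9 / 10 \<le> \<theta>" "\<theta> < 1" "C > 0" "restricted_hecke_decay \<theta> C"
proof -
  obtain \<theta> C where \<theta>: "9 / 10 \<le> \<theta>" "\<theta> < 1" "C > 0"
    and decay: "\<And>f m. f \<in> cuspidal \<Longrightarrow> l2norm (hecke_op m f) \<le> C * (of_int l * \<theta>) ^ m * l2norm f"
    using hecke_op_decay by blast
  define r where "r = of_int l * \<theta>"
  have r: "r \<ge> 2" using l_gt_2 \<theta> mult_mono[of 3 "of_int l" "9/10" \<theta>] by (simp add: r_def)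
  have geometric: "(\<Sum>i\<le>m. r ^ i) \<le> 2 * r ^ m" for m
  proof (induction m)
    case (Suc m)
    have "2 * r ^ m \<le> r * r ^ m" using r by (intro mult_right_mono) auto
    then show ?case using Suc by simp
  qed simp
  have "l2norm (restricted_hecke_op m \<gamma> f) \<le> 2 * C * r ^ m * l2norm f"
    if f: "f \<in> cuspidal" and \<gamma>: "\<gamma> \<in> primitive (l ^ j)" for f m \<gamma> j
  proof -
    have "l2norm (restricted_hecke_op m \<gamma> f) \<le> (\<Sum>i\<le>m. l2norm (hecke_op i f))"
      by (rule l2norm_restricted_hecke_op_le[OF cuspidal_periodic[OF f] \<gamma>])
    also have "\<dots> \<le> (\<Sum>i\<le>m. C * l2norm f * r ^ i)"
      using decay[OF f] by (intro sum_mono) (simp add: r_def mult_ac)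
    also have "\<dots> = C * l2norm f * (\<Sum>i\<le>m. r ^ i)" by (simp add: sum_distrib_left)
    also have "\<dots> \<le> C * l2norm f * (2 * r ^ m)" using geometric \<theta> by (intro mult_left_mono) auto
    finally show ?thesis by (simp add: mult_ac)
  qed
  then have "restricted_hecke_decay \<theta> (2 * C)" unfolding restricted_hecke_decay_def r_def by blast
  then show thesis using that[of \<theta> "2 * C"] \<theta> by simp
qed

end

section \<open>The amplified bound for cuspidal sums\<close>

subsection \<open>Correlation operators\<close>

context level
begin

lemma p_not_dvd_nrm_qcnj_primitive: "a \<in> primitive (l ^ m) \<Longrightarrow> \<not> p dvd nrm (qcnj a)"
  by (simp add: p_not_dvd_nrm_primitive)

lemma bij_betw_mult_primitive:
  assumes \<gamma>: "\<gamma> \<in> primitive (l ^ e)" and e: "e \<le> k"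
  shows "bij_betw (\<lambda>a. a * \<gamma>) {a \<in> primitive (l ^ (k - e)). content (a * \<gamma>) = 1}
    {\<alpha> \<in> primitive (l ^ k). \<gamma> \<in> right_factors (l ^ e) \<alpha>}"
proof -
  have "nrm \<gamma> = l ^ e" "l ^ (k - e) * l ^ e = l ^ k"
    using \<gamma> e by (simp_all add: primitive_def flip: power_add)
  then show ?thesis using bij_betw_mult_right_factor[of \<gamma> "l ^ (k - e)"] l_pow_pos[of e] by simp
qed

definition right_divides_op :: "nat \<Rightarrow> nat \<Rightarrow> (quat \<Rightarrow> real) \<Rightarrow> quat \<times> quat \<Rightarrow> quat \<Rightarrow> real" where
  "right_divides_op k e f c x = (\<Sum>i | i \<in> pairs_l_pow k \<and> right_divides e i c.
    f (fst i * x * qcnj (snd i)))"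

lemma right_divides_op_eq:
  assumes \<gamma>: "\<gamma> \<in> primitive (l ^ e)" and e: "e \<le> k"
  shows "right_divides_op k e f (\<gamma>, \<delta>) x
    = (\<Sum>\<beta> | \<beta> \<in> primitive (l ^ k) \<and> \<delta> \<in> right_factors (l ^ e) \<beta>.
      restricted_hecke_op (k - e) \<gamma> f (\<gamma> * x * qcnj \<beta>))"
proof -
  let ?A = "\<lambda>\<gamma>. {\<alpha> \<in> primitive (l ^ k). \<gamma> \<in> right_factors (l ^ e) \<alpha>}"
  have "{i. i \<in> pairs_l_pow k \<and> right_divides e i (\<gamma>, \<delta>)} = ?A \<gamma> \<times> ?A \<delta>"
    by (auto simp: right_divides_def)
  then have "right_divides_op k e f (\<gamma>, \<delta>) x = (\<Sum>\<alpha>\<in>?A \<gamma>. \<Sum>\<beta>\<in>?A \<delta>. f (\<alpha> * x * qcnj \<beta>))"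
    by (simp add: right_divides_op_def sum.cartesian_product case_prod_unfold)
  also have "\<dots> = (\<Sum>\<beta>\<in>?A \<delta>. \<Sum>\<alpha>\<in>?A \<gamma>. f (\<alpha> * x * qcnj \<beta>))" by (rule sum.swap)
  also have "\<dots> = (\<Sum>\<beta>\<in>?A \<delta>. restricted_hecke_op (k - e) \<gamma> f (\<gamma> * x * qcnj \<beta>))"
    unfolding restricted_hecke_op_def
    by (simp add: sum.reindex_bij_betw[OF bij_betw_mult_primitive[OF \<gamma> e], symmetric] mult.assoc)
  finally show ?thesis .
qed

lemma l2norm_right_divides_op_le:
  assumes decay: "restricted_hecke_decay \<theta> C" "0 \<le> \<theta>" "0 \<le> C" and f: "f \<in> cuspidal"
    and c: "c \<in> pairs_l_pow e" and e: "e \<le> k"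
  shows "l2norm (right_divides_op k e f c) \<le> 16 * C * (of_int l ^ 2 * \<theta>) ^ (k - e) * l2norm f"
proof -
  obtain \<gamma> \<delta> where c_eq: "c = (\<gamma>, \<delta>)" and \<gamma>: "\<gamma> \<in> primitive (l ^ e)" and \<delta>: "\<delta> \<in> primitive (l ^ e)"
    using c by auto
  let ?R = "restricted_hecke_op (k - e) \<gamma> f"
    and ?B = "{\<beta> \<in> primitive (l ^ k). \<delta> \<in> right_factors (l ^ e) \<beta>}"
  have R: "periodic p ?R" by (rule periodic_restricted_hecke_op[OF cuspidal_periodic[OF f]])
  have "l2norm (right_divides_op k e f c) = l2norm (\<lambda>x. \<Sum>\<beta>\<in>?B. ?R (\<gamma> * x * qcnj \<beta>))"
    unfolding c_eq right_divides_op_eq[OF \<gamma> e] ..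
  also have "\<dots> \<le> (\<Sum>\<beta>\<in>?B. l2norm (\<lambda>x. ?R (\<gamma> * x * qcnj \<beta>)))"
    by (rule l2norm_sum) (simp add: finite_primitive)
  also have "\<dots> = (\<Sum>\<beta>\<in>?B. l2norm ?R)"
    using p_not_dvd_nrm_primitive[OF \<gamma>] p_not_dvd_nrm_qcnj_primitive
    by (intro sum.cong refl l2norm_mult[OF R]) auto
  also have "\<dots> = real (card ?B) * l2norm ?R" by simp
  also have "\<dots> \<le> 16 * of_int (l ^ (k - e)) * (C * (of_int l * \<theta>) ^ (k - e) * l2norm f)"
  proof (rule mult_mono)
    have "card ?B = card {a \<in> primitive (l ^ (k - e)). content (a * \<delta>) = 1}"
      using bij_betw_same_card[OF bij_betw_mult_primitive[OF \<delta> e]] by simp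
    also have "\<dots> \<le> card (primitive (l ^ (k - e)))" by (rule card_mono) (auto simp: finite_primitive)
    finally show "real (card ?B) \<le> 16 * of_int (l ^ (k - e))"
      using card_primitive_l_pow_bounds(2)[of "k - e"] by linarith
    show "l2norm ?R \<le> C * (of_int l * \<theta>) ^ (k - e) * l2norm f"
      by (rule restricted_hecke_decayD[OF decay(1) f \<gamma>])
  qed (use l_gt_2 in auto)
  also have "\<dots> = 16 * C * (of_int l ^ 2 * \<theta>) ^ (k - e) * l2norm f"
    by (simp add: power_mult_distrib power2_eq_square)
  finally show ?thesis .
qed

lemma sum_l2norm_right_divides_op_square_le:
  assumes \<theta>: "9 / 10 \<le> \<theta>" "0 \<le> C" and decay: "restricted_hecke_decay \<theta> C" and f: "f \<in> cuspidal"
    and e: "e \<le> k"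
  shows "of_int l ^ e * (\<Sum>c\<in>pairs_l_pow e. (l2norm (right_divides_op k e f c))\<^sup>2)
    \<le> 65536 * C\<^sup>2 * (of_int l ^ 4 * \<theta>\<^sup>2) ^ k * (l2norm f)\<^sup>2"
proof -
  define L where "L = real_of_int l"
  have L: "L \<ge> 3" using l_gt_2 by (simp add: L_def)
  have "3 * (9 / 10 * (9 / 10)) \<le> L * (\<theta> * \<theta>)" using L \<theta> by (intro mult_mono) auto
  then have L\<theta>: "L * \<theta>\<^sup>2 \<ge> 1" by (simp add: power2_eq_square)
  let ?B = "16 * C * (L\<^sup>2 * \<theta>) ^ (k - e) * l2norm f"
  have "(\<Sum>c\<in>pairs_l_pow e. (l2norm (right_divides_op k e f c))\<^sup>2) \<le> (\<Sum>c\<in>pairs_l_pow e. ?B\<^sup>2)"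
    using \<theta> unfolding L_def
    by (intro sum_mono power_mono l2norm_right_divides_op_le[OF decay _ _ f _ e]) auto
  also have "\<dots> = (real (card (primitive (l ^ e))))\<^sup>2 * ?B\<^sup>2"
    by (simp add: power2_eq_square card_cartesian_product)
  also have "\<dots> \<le> (16 * L ^ e)\<^sup>2 * ?B\<^sup>2"
    using card_primitive_l_pow_bounds(2)[of e] by (intro mult_right_mono power_mono) (auto simp: L_def)
  finally have "L ^ e * (\<Sum>c\<in>pairs_l_pow e. (l2norm (right_divides_op k e f c))\<^sup>2)
    \<le> L ^ e * ((16 * L ^ e)\<^sup>2 * ?B\<^sup>2)"
    using L by (intro mult_left_mono) auto
  also have "\<dots> = 65536 * C\<^sup>2 * (l2norm f)\<^sup>2 * ((L ^ 3) ^ e * (L ^ 4 * \<theta>\<^sup>2) ^ (k - e))"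
    by (simp add: power_mult_distrib power2_eq_square power3_eq_cube power4_eq_xxxx mult_ac)
  also have "\<dots> \<le> 65536 * C\<^sup>2 * (l2norm f)\<^sup>2 * ((L ^ 4 * \<theta>\<^sup>2) ^ e * (L ^ 4 * \<theta>\<^sup>2) ^ (k - e))"
  proof (intro mult_left_mono mult_right_mono power_mono)
    show "L ^ 3 \<le> L ^ 4 * \<theta>\<^sup>2"
      using mult_left_mono[OF L\<theta>, of "L ^ 3"] L by (simp add: power_numeral_reduce mult_ac)
  qed (use L \<theta> in auto)
  also have "(L ^ 4 * \<theta>\<^sup>2) ^ e * (L ^ 4 * \<theta>\<^sup>2) ^ (k - e) = (L ^ 4 * \<theta>\<^sup>2) ^ k"
    using e by (simp flip: power_add)
  finally show ?thesis by (simp add: L_def mult_ac)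
qed

definition corr_op :: "nat \<Rightarrow> (quat \<Rightarrow> real) \<Rightarrow> quat \<Rightarrow> quat \<Rightarrow> real" where
  "corr_op k f g x = (\<Sum>i | i \<in> pairs_l_pow k \<and> incident k i g. f (fst i * x * qcnj (snd i)))"

lemma sum_corr_op_square_le:
  assumes \<theta>: "9 / 10 \<le> \<theta>" "0 \<le> C" and decay: "restricted_hecke_decay \<theta> C" and f: "f \<in> cuspidal"
  shows "(\<Sum>g\<in>quat_residues (l ^ k). \<Sum>x\<in>quat_residues p. (corr_op k f g x)\<^sup>2)
    \<le> 1024 * C\<^sup>2 * real (Suc k) * of_int (l ^ k) ^ 6 * \<theta> ^ (2 * k) * (l2norm f)\<^sup>2"
proof -
  define L where "L = real_of_int l"
  have "(\<Sum>g\<in>quat_residues (l ^ k). \<Sum>x\<in>quat_residues p. (corr_op k f g x)\<^sup>2)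
    = (\<Sum>x\<in>quat_residues p. \<Sum>g\<in>quat_residues (l ^ k). (corr_op k f g x)\<^sup>2)" by (rule sum.swap)
  also have "\<dots> \<le> (\<Sum>x\<in>quat_residues p.
    (L ^ k)\<^sup>2 / 64 * (\<Sum>e\<le>k. L ^ e * (\<Sum>c\<in>pairs_l_pow e. (right_divides_op k e f c x)\<^sup>2)))"
  proof (rule sum_mono)
    show "(\<Sum>g\<in>quat_residues (l ^ k). (corr_op k f g x)\<^sup>2)
      \<le> (L ^ k)\<^sup>2 / 64 * (\<Sum>e\<le>k. L ^ e * (\<Sum>c\<in>pairs_l_pow e. (right_divides_op k e f c x)\<^sup>2))" for x
      using sum_incident_square_le[of "\<lambda>i. f (fst i * x * qcnj (snd i))" k]
      by (simp only: corr_op_def right_divides_op_def L_def of_int_power)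
  qed
  also have "\<dots> = (L ^ k)\<^sup>2 / 64
    * (\<Sum>x\<in>quat_residues p. \<Sum>e\<le>k. L ^ e * (\<Sum>c\<in>pairs_l_pow e. (right_divides_op k e f c x)\<^sup>2))"
    by (rule sum_distrib_left[symmetric])
  also have "\<dots> = (L ^ k)\<^sup>2 / 64
    * (\<Sum>e\<le>k. \<Sum>x\<in>quat_residues p. L ^ e * (\<Sum>c\<in>pairs_l_pow e. (right_divides_op k e f c x)\<^sup>2))"
    by (subst sum.swap) (rule refl)
  also have "\<dots> = (L ^ k)\<^sup>2 / 64
    * (\<Sum>e\<le>k. L ^ e * (\<Sum>c\<in>pairs_l_pow e. (l2norm (right_divides_op k e f c))\<^sup>2))"
  proof -
    have "(\<Sum>x\<in>quat_residues p. L ^ e * (\<Sum>c\<in>pairs_l_pow e. (right_divides_op k e f c x)\<^sup>2))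
      = L ^ e * (\<Sum>c\<in>pairs_l_pow e. (l2norm (right_divides_op k e f c))\<^sup>2)" for e
      unfolding l2norm_square_eq_sum by (subst sum.swap) (rule sum_distrib_left[symmetric])
    then show ?thesis by (simp only:)
  qed
  also have "\<dots> \<le> (L ^ k)\<^sup>2 / 64 * (\<Sum>e\<le>k. 65536 * C\<^sup>2 * (L ^ 4 * \<theta>\<^sup>2) ^ k * (l2norm f)\<^sup>2)"
    unfolding L_def by (intro mult_left_mono sum_mono sum_l2norm_right_divides_op_square_le[OF \<theta> decay f]) auto
  also have "\<dots> = 1024 * C\<^sup>2 * real (Suc k) * of_int (l ^ k) ^ 6 * \<theta> ^ (2 * k) * (l2norm f)\<^sup>2"
    by (simp add: L_def power_mult_distrib power_mult[symmetric] mult_ac flip: power_add)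
  finally show ?thesis .
qed

lemma corr_op_quat_mod:
  assumes f: "periodic p f" and c: "coprime (l ^ k) c"
  shows "corr_op k f (quat_mod (of_int c * y) (l ^ k)) (quat_mod y p)
    = (\<Sum>i | i \<in> pairs_l_pow k \<and> incident k i y. f (fst i * y * qcnj (snd i)))"
proof -
  have "incident k i (quat_mod (of_int c * y) (l ^ k)) \<longleftrightarrow> incident k i y" for i
  proof -
    obtain \<alpha> \<beta> where i: "i = (\<alpha>, \<beta>)" by (cases i)
    have "qdvd (l ^ k) (\<alpha> * quat_mod (of_int c * y) (l ^ k) * qcnj \<beta>)
      \<longleftrightarrow> qdvd (l ^ k) (\<alpha> * (of_int c * y) * qcnj \<beta>)"
      by (rule qcong_qdvd_iff[OF qcong_sym[OF qcong_mult_right[OF qcong_mult_left[OF qcong_quat_mod]]]])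
    also have "\<alpha> * (of_int c * y) * qcnj \<beta> = of_int c * (\<alpha> * y * qcnj \<beta>)"
      by (simp only: of_int_mult_left_commute mult.assoc)
    also have "qdvd (l ^ k) \<dots> \<longleftrightarrow> qdvd (l ^ k) (\<alpha> * y * qcnj \<beta>)" by (rule qdvd_of_int_mult_coprime[OF c])
    finally show ?thesis by (simp add: incident_def i)
  qed
  then have "{i. i \<in> pairs_l_pow k \<and> incident k i (quat_mod (of_int c * y) (l ^ k))}
    = {i. i \<in> pairs_l_pow k \<and> incident k i y}"
    by blast
  moreover have "f (fst i * quat_mod y p * qcnj (snd i)) = f (fst i * y * qcnj (snd i))" for i
    using periodicD[OF f qcong_mult_right[OF qcong_mult_left[OF qcong_quat_mod]]] by metis
  ultimately show ?thesis unfolding corr_op_def by (simp only:)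
qed

lemma sum_incident:
  assumes h: "periodic p h" and m: "\<not> l dvd m"
  shows "(\<Sum>y\<in>primitive m. \<Sum>i | i \<in> pairs_l_pow k \<and> incident k i y.
    h (of_int (inv_p (l ^ k)) * (fst i * y * qcnj (snd i))))
    = 8 * real (card (primitive (l ^ k))) * (\<Sum>y\<in>primitive m. h y)"
proof -
  let ?q = "l ^ k"
  let ?B = "\<lambda>\<alpha> y. {\<beta> \<in> primitive ?q. qdvd ?q (\<alpha> * y * qcnj \<beta>)}"
  have "(\<Sum>i | i \<in> pairs_l_pow k \<and> incident k i y. h (of_int (inv_p ?q) * (fst i * y * qcnj (snd i))))
    = (\<Sum>\<alpha>\<in>primitive ?q. \<Sum>\<beta>\<in>?B \<alpha> y. h (quat_div (\<alpha> * y * qcnj \<beta>) ?q))" for y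
  proof -
    have "{i. i \<in> pairs_l_pow k \<and> incident k i y} = Sigma (primitive ?q) (\<lambda>\<alpha>. ?B \<alpha> y)"
      by (auto simp: incident_def)
    moreover have "h (of_int (inv_p ?q) * (\<alpha> * y * qcnj \<beta>)) = h (quat_div (\<alpha> * y * qcnj \<beta>) ?q)"
      if dvd: "qdvd ?q (\<alpha> * y * qcnj \<beta>)" for \<alpha> \<beta>
    proof -
      obtain z where "\<alpha> * y * qcnj \<beta> = of_int ?q * z" using dvd by (rule qdvdE)
      moreover have "?q \<noteq> 0" using l_pow_pos[of k] by linarith
      ultimately show ?thesis
        using periodic_inv_p_mult[OF h p_not_dvd_l_pow] by (simp del: of_int_power power_eq_0_iff)
    qed
    ultimately show ?thesis by (auto simp: sum.Sigma finite_primitive intro!: sum.cong)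
  qed
  then have "(\<Sum>y\<in>primitive m. \<Sum>i | i \<in> pairs_l_pow k \<and> incident k i y.
    h (of_int (inv_p ?q) * (fst i * y * qcnj (snd i))))
    = (\<Sum>y\<in>primitive m. \<Sum>\<alpha>\<in>primitive ?q. \<Sum>\<beta>\<in>?B \<alpha> y. h (quat_div (\<alpha> * y * qcnj \<beta>) ?q))" by simp
  also have "\<dots> = (\<Sum>\<alpha>\<in>primitive ?q. \<Sum>y\<in>primitive m. \<Sum>\<beta>\<in>?B \<alpha> y. h (quat_div (\<alpha> * y * qcnj \<beta>) ?q))"
    by (rule sum.swap)
  also have "\<dots> = (\<Sum>\<alpha>\<in>primitive ?q. 8 * (\<Sum>y\<in>primitive m. h y))"
    by (intro sum.cong refl sum_correspondence odd_l_pow l_pow_pos coprime_l_pow m)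
  finally show ?thesis by simp
qed

end

subsection \<open>Collisions\<close>

lemma collision_inequality:
  fixes F :: "'t \<Rightarrow> real"
  assumes I: "finite I" and T: "finite T" "G ` I \<subseteq> T"
  shows "(\<Sum>i\<in>I. F (G i))\<^sup>2 \<le> real (card {(i, j) \<in> I \<times> I. G i = G j}) * (\<Sum>t\<in>T. (F t)\<^sup>2)"
proof -
  define \<nu> where "\<nu> t = (\<Sum>i | i \<in> I \<and> G i = t. 1 :: real)" for t
  have "(\<Sum>t\<in>T. (\<nu> t)\<^sup>2) = (\<Sum>i\<in>I. \<Sum>j\<in>I. real (card {t \<in> T. G i = t \<and> G j = t}))"
    unfolding \<nu>_def sum_square_relation[OF I T(1)] by simp
  also have "\<dots> = (\<Sum>i\<in>I. \<Sum>j\<in>I. if G i = G j then 1 else 0)"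
  proof (intro sum.cong refl)
    fix i j assume "i \<in> I"
    then have "{t \<in> T. G i = t \<and> G j = t} = (if G i = G j then {G i} else {})" using T(2) by auto
    then show "real (card {t \<in> T. G i = t \<and> G j = t}) = (if G i = G j then 1 else 0)" by simp
  qed
  also have "\<dots> = real (card {(i, j) \<in> I \<times> I. G i = G j})"
  proof -
    have "{(i, j) \<in> I \<times> I. G i = G j} = Sigma I (\<lambda>i. {j \<in> I. G i = G j})" by auto
    then show ?thesis using I by (simp add: sum.inter_filter[symmetric])
  qed
  finally have collisions: "(\<Sum>t\<in>T. (\<nu> t)\<^sup>2) = real (card {(i, j) \<in> I \<times> I. G i = G j})" .
  have "(\<Sum>i\<in>I. F (G i)) = (\<Sum>t\<in>T. \<Sum>i | i \<in> I \<and> G i = t. F (G i))"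
    using sum.group[OF I T, of "\<lambda>i. F (G i)"] by simp
  also have "\<dots> = (\<Sum>t\<in>T. \<nu> t * F t)" by (intro sum.cong refl) (simp add: \<nu>_def)
  finally have "\<bar>\<Sum>i\<in>I. F (G i)\<bar> \<le> (\<Sum>t\<in>T. \<bar>\<nu> t\<bar> * \<bar>F t\<bar>)"
    using sum_abs[of "\<lambda>t. \<nu> t * F t" T] by (simp add: abs_mult)
  also have "\<dots> \<le> L2_set \<nu> T * L2_set F T" by (rule L2_set_mult_ineq)
  finally have "\<bar>\<Sum>i\<in>I. F (G i)\<bar>\<^sup>2 \<le> (L2_set \<nu> T * L2_set F T)\<^sup>2" by (rule power_mono) simp
  also have "\<dots> = (\<Sum>t\<in>T. (\<nu> t)\<^sup>2) * (\<Sum>t\<in>T. (F t)\<^sup>2)"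
    by (simp add: L2_set_def power_mult_distrib sum_nonneg)
  finally show ?thesis unfolding collisions by simp
qed

definition congruent_pairs :: "int \<Rightarrow> int \<Rightarrow> (quat \<times> quat) set" where
  "congruent_pairs m q = {(y, y') \<in> primitive m \<times> primitive m. qcong q y y'}"

lemma finite_congruent_pairs: "finite (congruent_pairs m q)"
  by (rule finite_subset[of _ "primitive m \<times> primitive m"])
    (auto simp: congruent_pairs_def finite_primitive)

context odd_prime
begin

definition unit_residues :: "nat \<Rightarrow> int set" where
  "unit_residues k = int ` totatives (nat l ^ k)"

lemma finite_unit_residues: "finite (unit_residues k)"
  by (simp add: unit_residues_def)

lemma unit_residuesD:
  assumes "c \<in> unit_residues k"
  shows "0 < c" "c \<le> l ^ k" "coprime (l ^ k) c"
proof -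
  obtain n where n: "c = int n" "n > 0" "n \<le> nat l ^ k" "coprime n (nat l ^ k)"
    using assms by (auto simp: unit_residues_def in_totatives_iff)
  have l_pow: "l ^ k = int (nat l ^ k)" using l_gt_2 by simp
  show "0 < c" "c \<le> l ^ k" "coprime (l ^ k) c"
    unfolding n(1) l_pow
    using n by (simp_all only: of_nat_le_iff of_nat_0_less_iff coprime_int_iff coprime_commute)
qed

lemma card_unit_residues_ge: "l ^ k \<le> 2 * int (card (unit_residues k))"
proof (cases k)
  case 0
  then show ?thesis by (simp add: unit_residues_def)
next
  case (Suc j)
  have "card (unit_residues k) = nat l ^ j * (nat l - 1)"
    using totient_prime_power_Suc[of "nat l" j] prime_l unfolding Suc
    by (simp add: unit_residues_def card_image totient_def)
  then have "int (card (unit_residues k)) = l ^ j * (l - 1)" using l_gt_2 by (simp add: of_nat_diff)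
  moreover have "l ^ j * l \<le> l ^ j * (2 * (l - 1))"
    using l_gt_2 l_pow_pos[of j] by (intro mult_left_mono) auto
  ultimately show ?thesis by (simp add: Suc algebra_simps)
qed

lemma l_pow_dvd_mult_cases:
  assumes "l ^ k dvd a * b" "k > 0 \<Longrightarrow> \<not> (l dvd a \<and> l dvd b)"
  shows "l ^ k dvd a \<or> l ^ k dvd b"
  using assms coprime_l_pow coprime_dvd_mult_left_iff coprime_dvd_mult_right_iff
  by (cases "k = 0") (simp, blast)

lemma unit_residues_proportional:
  assumes c: "c \<in> unit_residues k" "c' \<in> unit_residues k" and m: "\<not> l dvd m"
    and y: "nrm y = m" "nrm y' = m"
    and cong: "qcong (l ^ k) (of_int c * y) (of_int c' * y')"
  shows "l ^ k dvd c - c' \<or> l ^ k dvd c + c'"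
proof (rule l_pow_dvd_mult_cases)
  have "l ^ k dvd nrm (of_int c * y) - nrm (of_int c' * y')" by (rule qcong_dvd_nrm_diff[OF cong])
  also have "\<dots> = m * ((c - c') * (c + c'))"
    using y by (simp add: nrm_mult power2_eq_square algebra_simps)
  finally show "l ^ k dvd (c - c') * (c + c')"
    using coprime_dvd_mult_right_iff[OF coprime_l_pow[OF m]] by blast
  assume "k > 0"
  show "\<not> (l dvd c - c' \<and> l dvd c + c')"
  proof
    assume "l dvd c - c' \<and> l dvd c + c'"
    then have "l dvd (c - c') + (c + c')" by (meson dvd_add)
    then have "l dvd 2 * c" by simp
    then have "l dvd c" using odd_l coprime_dvd_mult_right_iff[of l 2 c] by simp
    moreover have "l dvd l ^ k" using \<open>k > 0\<close> by (simp add: dvd_power)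
    ultimately show False using unit_residuesD(3)[OF c(1)] prime_l not_coprimeI not_prime_unit by blast
  qed
qed

lemma unit_residues_sign:
  assumes c: "c \<in> unit_residues k" "c' \<in> unit_residues k" and m: "\<not> l dvd m"
    and y: "nrm y = m" "nrm y' = m"
    and cong: "qcong (l ^ k) (of_int c * y) (of_int c' * y')"
  obtains s where "s \<in> {1, - 1}" "l ^ k dvd s * c - c'" "qcong (l ^ k) y (of_int s * y')"
proof -
  obtain s where s: "s \<in> {1, - 1}" "l ^ k dvd s * c - c'"
  proof (cases "l ^ k dvd c - c'")
    case False
    then have "l ^ k dvd c + c'" using unit_residues_proportional[OF c m y cong] by simp
    then have "l ^ k dvd - 1 * c - c'" using dvd_minus_iff[of "l ^ k" "c + c'"] by simp
    then show thesis using that[of "- 1"] by blast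
  qed (use that[of 1] in simp)
  have "qcong (l ^ k) (of_int (s * c) * y') (of_int c' * y')" by (rule qcong_of_int_mult[OF s(2)])
  then have "qcong (l ^ k) (of_int c * y) (of_int c * (of_int s * y'))"
    using cong qcong_trans qcong_sym by (metis mult.assoc mult.commute of_int_mult)
  then have "qcong (l ^ k) y (of_int s * y')"
    using qcong_of_int_mult_coprime unit_residuesD(3)[OF c(1)] by blast
  then show thesis using s that by blast
qed

lemma card_collisions_le:
  assumes m: "\<not> l dvd m"
  shows "card {(i, j) \<in> (unit_residues k \<times> primitive m) \<times> (unit_residues k \<times> primitive m).
      qcong (l ^ k) (of_int (fst i) * snd i) (of_int (fst j) * snd j)}
    \<le> 2 * card (unit_residues k) * card (congruent_pairs m (l ^ k))"
proof -
  let ?q = "l ^ k" and ?U = "unit_residues k"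
  let ?S = "{(i, j) \<in> (?U \<times> primitive m) \<times> (?U \<times> primitive m).
    qcong ?q (of_int (fst i) * snd i) (of_int (fst j) * snd j)}"
  define F where "F = (\<lambda>(c, s, y :: quat, w :: quat). ((c, y), ((s * c - 1) mod ?q + 1, of_int s * w)))"
  have "?S \<subseteq> F ` (?U \<times> {1, - 1} \<times> congruent_pairs m ?q)"
  proof
    fix t assume "t \<in> ?S"
    then obtain c y c' y' where t: "t = ((c, y), (c', y'))" and c: "c \<in> ?U" "c' \<in> ?U"
      and y: "y \<in> primitive m" "y' \<in> primitive m" and cong: "qcong ?q (of_int c * y) (of_int c' * y')"
        by auto
    obtain s where s: "s \<in> {1, - 1}" "?q dvd s * c - c'" "qcong ?q y (of_int s * y')"
      using unit_residues_sign[OF c m _ _ cong] y by (auto simp: primitive_def)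
    have "(s * c - 1) mod ?q = (c' - 1) mod ?q" using s(2) by (simp add: mod_eq_dvd_iff)
    then have "(s * c - 1) mod ?q + 1 = c'" using unit_residuesD(1,2)[OF c(2)] by simp
    moreover have "of_int s * (of_int s * y') = y'" using s(1) by auto
    ultimately have "t = F (c, s, y, of_int s * y')" by (simp add: t F_def)
    moreover have "of_int s * y' \<in> primitive m"
      using s(1) y(2) by (auto simp: primitive_def nrm_mult content_of_int_mult)
    then have "(c, s, y, of_int s * y') \<in> ?U \<times> {1, - 1} \<times> congruent_pairs m ?q"
      using c(1) s y(1) by (simp add: congruent_pairs_def)
    ultimately show "t \<in> F ` (?U \<times> {1, - 1} \<times> congruent_pairs m ?q)" by blast
  qed
  then have "card ?S \<le> card (?U \<times> {1, - 1 :: int} \<times> congruent_pairs m ?q)"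
    by (rule surj_card_le[rotated]) (simp add: finite_unit_residues finite_congruent_pairs)
  then show ?thesis by (simp add: card_cartesian_product algebra_simps)
qed

end

context level
begin

text \<open>The sum of \<open>h\<close> is read off from the correlation operator at the points \<open>(c y mod q, y mod p)\<close>, where
  \<open>c\<close> runs over the units modulo \<open>q\<close>. Points collide only if \<open>y\<close> is congruent to \<open>\<plusminus>y'\<close> modulo \<open>q\<close>.\<close>

lemma card_unit_residues_sum_le:
  assumes h: "h \<in> cuspidal" and m: "\<not> l dvd m"
  shows "(real (card (unit_residues k))
    * (8 * real (card (primitive (l ^ k))) * (\<Sum>y\<in>primitive m. h y)))\<^sup>2
    \<le> 2 * real (card (unit_residues k)) * real (card (congruent_pairs m (l ^ k))) *
      (\<Sum>g\<in>quat_residues (l ^ k). \<Sum>x\<in>quat_residues p.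
        (corr_op k (\<lambda>x. h (of_int (inv_p (l ^ k)) * x)) g x)\<^sup>2)"
proof -
  let ?q = "l ^ k" and ?U = "unit_residues k" and ?f = "\<lambda>x. h (of_int (inv_p (l ^ k)) * x)"
  let ?I = "?U \<times> primitive m" and ?T = "quat_residues ?q \<times> quat_residues p"
  have f: "periodic p ?f" by (rule periodic_mult_left[OF cuspidal_periodic[OF h]])
  define G where "G i = (quat_mod (of_int (fst i) * snd i) ?q, quat_mod (snd i) p)" for i
  define F where "F t = corr_op k ?f (fst t) (snd t)" for t
  have "(\<Sum>i\<in>?I. F (G i)) = (\<Sum>c\<in>?U. \<Sum>y\<in>primitive m. F (G (c, y)))"
    by (simp add: sum.cartesian_product case_prod_unfold)
  also have "\<dots> = (\<Sum>c\<in>?U. \<Sum>y\<in>primitive m. \<Sum>i | i \<in> pairs_l_pow k \<and> incident k i y.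
    ?f (fst i * y * qcnj (snd i)))"
    unfolding F_def G_def fst_conv snd_conv
    by (intro sum.cong refl corr_op_quat_mod[OF f] unit_residuesD(3))
  also have "\<dots> = real (card ?U) * (8 * real (card (primitive ?q)) * (\<Sum>y\<in>primitive m. h y))"
    unfolding sum_incident[OF cuspidal_periodic[OF h] m] by simp
  finally have "(real (card ?U) * (8 * real (card (primitive ?q)) * (\<Sum>y\<in>primitive m. h y)))\<^sup>2
    = (\<Sum>i\<in>?I. F (G i))\<^sup>2" by simp
  also have "\<dots> \<le> real (card {(i, j) \<in> ?I \<times> ?I. G i = G j}) * (\<Sum>t\<in>?T. (F t)\<^sup>2)"
    using l_pow_pos[of k] p.l_gt_2
    by (intro collision_inequality)
      (auto simp: finite_unit_residues finite_primitive finite_quat_residues G_def quat_mod_in_quat_residues)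
  also have "\<dots> \<le> (2 * real (card ?U) * real (card (congruent_pairs m ?q))) * (\<Sum>t\<in>?T. (F t)\<^sup>2)"
  proof (rule mult_right_mono)
    have "card {(i, j) \<in> ?I \<times> ?I. G i = G j}
      \<le> card {(i, j) \<in> ?I \<times> ?I. qcong ?q (of_int (fst i) * snd i) (of_int (fst j) * snd j)}"
      by (rule card_mono, rule finite_subset[of _ "?I \<times> ?I"])
        (auto simp: finite_unit_residues finite_primitive G_def quat_mod_eq_iff)
    also have "\<dots> \<le> 2 * card ?U * card (congruent_pairs m ?q)" by (rule card_collisions_le[OF m])
    finally have "real (card {(i, j) \<in> ?I \<times> ?I. G i = G j})
      \<le> real (2 * card ?U * card (congruent_pairs m ?q))"
      by (rule of_nat_mono)
    then show "real (card {(i, j) \<in> ?I \<times> ?I. G i = G j})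
      \<le> 2 * real (card ?U) * real (card (congruent_pairs m ?q))"
      by simp
  qed (auto intro: sum_nonneg)
  also have "(\<Sum>t\<in>?T. (F t)\<^sup>2) = (\<Sum>g\<in>quat_residues ?q. \<Sum>x\<in>quat_residues p. (corr_op k ?f g x)\<^sup>2)"
    by (simp add: sum.cartesian_product case_prod_unfold F_def)
  finally show ?thesis .
qed

lemma cuspidal_sum_square_le:
  assumes \<theta>: "9 / 10 \<le> \<theta>" "0 \<le> C" and decay: "restricted_hecke_decay \<theta> C" and h: "h \<in> cuspidal"
    and m: "\<not> l dvd m"
  shows "(\<Sum>y\<in>primitive m. h y)\<^sup>2
    \<le> C\<^sup>2 * real (Suc k) * of_int (l ^ k) ^ 3 * \<theta> ^ (2 * k) * real (card (congruent_pairs m (l ^ k)))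
      * (l2norm h)\<^sup>2"
proof -
  define f where "f x = h (of_int (inv_p (l ^ k)) * x)" for x
  define Q U A P where "Q = real_of_int (l ^ k)" and "U = real (card (unit_residues k))"
    and "A = real (card (primitive (l ^ k)))" and "P = real (card (congruent_pairs m (l ^ k)))"
  define S W where "S = (\<Sum>y\<in>primitive m. h y)"
    and "W = (\<Sum>g\<in>quat_residues (l ^ k). \<Sum>x\<in>quat_residues p. (corr_op k f g x)\<^sup>2)"
  have f: "f \<in> cuspidal"
    unfolding f_def by (rule cuspidal_of_int_mult[OF h p_not_dvd_inv_p[OF p_not_dvd_l_pow]])
  have norm_f: "l2norm f = l2norm h"
    unfolding f_def
    by (rule l2norm_mult_left[OF cuspidal_periodic[OF h] p_not_dvd_nrm_of_int[OF p_not_dvd_inv_p[OF p_not_dvd_l_pow]]])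
  have Q: "Q > 0" "Q \<le> 2 * U" "8 * Q \<le> A"
    using l_pow_pos[of k] card_unit_residues_ge[of k] card_primitive_l_pow_bounds(1)[of k]
    by (auto simp: Q_def U_def A_def simp flip: of_int_power)
  have "U * (U * (8 * A)\<^sup>2 * S\<^sup>2) \<le> U * (2 * P * W)"
    using card_unit_residues_sum_le[OF h m, of k] unfolding Q_def U_def A_def P_def S_def W_def f_def
    by (simp add: power2_eq_square mult_ac)
  then have "U * (8 * A)\<^sup>2 * S\<^sup>2 \<le> 2 * P * W" using Q(1,2) by simp
  moreover have "Q / 2 * (8 * (8 * Q))\<^sup>2 * S\<^sup>2 \<le> U * (8 * A)\<^sup>2 * S\<^sup>2"
    using Q by (intro mult_right_mono mult_mono power_mono) auto
  moreover have "2 * P * W \<le> 2 * P * (1024 * C\<^sup>2 * real (Suc k) * Q ^ 6 * \<theta> ^ (2 * k) * (l2norm f)\<^sup>2)"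
    unfolding W_def Q_def P_def by (intro mult_left_mono sum_corr_op_square_le[OF \<theta> decay f]) auto
  ultimately have "2048 * Q ^ 3 * S\<^sup>2
    \<le> 2048 * Q ^ 3 * (C\<^sup>2 * real (Suc k) * Q ^ 3 * \<theta> ^ (2 * k) * P * (l2norm h)\<^sup>2)"
    by (simp add: norm_f power_numeral_reduce mult_ac del: of_nat_Suc)
  then show ?thesis using Q(1) by (simp add: S_def Q_def P_def)
qed

end

section \<open>Counting congruent pairs\<close>

subsection \<open>The divisor bound\<close>

definition pos_divisors :: "int \<Rightarrow> int set" where
  "pos_divisors n = {d. d > 0 \<and> d dvd n}"

lemma finite_pos_divisors: "n > 0 \<Longrightarrow> finite (pos_divisors n)"
  by (rule finite_subset[of _ "{0..n}"]) (auto simp: pos_divisors_def zdvd_imp_le)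

lemma card_pos_divisors_prime_power_mult:
  assumes "prime r" "m > 0"
  shows "card (pos_divisors (r ^ e * m)) \<le> Suc e * card (pos_divisors m)"
proof -
  have "pos_divisors (r ^ e * m) \<subseteq> (\<lambda>(i, d). r ^ i * d) ` ({..e} \<times> pos_divisors m)"
  proof
    fix d assume "d \<in> pos_divisors (r ^ e * m)"
    then have "d > 0" "d dvd r ^ e * m" by (auto simp: pos_divisors_def)
    then obtain a b where ab: "d = a * b" "a dvd r ^ e" "b dvd m" using division_decomp by blast
    obtain i where "i \<le> e" "\<bar>a\<bar> = r ^ i" using divides_primepow[OF assms(1) ab(2)] by auto
    moreover have "d = \<bar>a\<bar> * \<bar>b\<bar>" using ab(1) \<open>d > 0\<close> by (simp flip: abs_mult)
    moreover have "\<bar>b\<bar> \<in> pos_divisors m" using ab \<open>d > 0\<close> by (auto simp: pos_divisors_def)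
    ultimately show "d \<in> (\<lambda>(i, d). r ^ i * d) ` ({..e} \<times> pos_divisors m)" by auto
  qed
  then have "card (pos_divisors (r ^ e * m)) \<le> card ({..e} \<times> pos_divisors m)"
    using finite_pos_divisors[OF assms(2)] by (meson finite_SigmaI finite_atMost surj_card_le)
  then show ?thesis by (simp add: card_cartesian_product)
qed

lemma Suc_le_mult_power:
  fixes x :: real
  assumes "x > 1"
  shows "real (Suc e) \<le> (1 / ln x + 1) * x ^ e"
proof -
  have x_pow: "x ^ e = exp (real e * ln x)" using assms by (simp add: exp_of_nat_mult)
  have "real e * ln x \<le> x ^ e" using exp_ge_add_one_self[of "real e * ln x"] unfolding x_pow by linarith
  then have "real e \<le> 1 / ln x * x ^ e" using assms by (simp add: field_simps)
  moreover have "1 \<le> x ^ e" using assms by simp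
  ultimately show ?thesis by (simp add: distrib_right)
qed

lemma prime_power_factorE:
  fixes n :: int
  assumes "n > 1"
  obtains r e m where "prime r" "n = r ^ e * m" "\<not> r dvd m" "0 < m" "m < n"
    "prime_factors n = insert r (prime_factors m)"
proof -
  obtain r where r: "prime r" "r dvd n" using prime_divisor_exists[of n] assms by auto
  define e where "e = multiplicity r n"
  obtain m where m: "n = r ^ e * m" "\<not> r dvd m"
    using multiplicity_decompose'[of n r] r(1) assms not_prime_unit unfolding e_def
    by (metis less_irrefl less_trans zero_less_one)
  have e: "e > 0" using m r(2) by (cases e) auto
  have "r ^ e > 1" using prime_gt_1_int[OF r(1)] e by (simp add: one_less_power)
  moreover have "m > 0"
    using m(1) assms \<open>r ^ e > 1\<close> by (metis less_trans zero_less_mult_pos zero_less_one)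
  moreover have "prime_factors n = insert r (prime_factors m)"
    unfolding m(1) using r(1) e \<open>m > 0\<close>
    by (simp add: prime_factors_product prime_factors_power prime_prime_factors)
  ultimately show thesis using that[OF r(1) m] m(1) by simp
qed

lemma card_pos_divisors_le_prod:
  fixes \<kappa> :: "int \<Rightarrow> real"
  assumes local: "\<And>r e. prime r \<Longrightarrow> real (Suc e) \<le> \<kappa> r * (of_int r powr \<epsilon>) ^ e" and "n > 0"
  shows "real (card (pos_divisors n)) \<le> (\<Prod>r\<in>prime_factors n. \<kappa> r) * of_int n powr \<epsilon>"
  using \<open>n > 0\<close>
proof (induction "nat n" arbitrary: n rule: less_induct)
  case less
  show ?case
  proof (cases "n = 1")
    case True
    have "pos_divisors 1 = {1}" by (auto simp: pos_divisors_def)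
    then show ?thesis using True by simp
  next
    case False
    then have "n > 1" using less.prems by simp
    then obtain r e m where r: "prime r" "n = r ^ e * m" "\<not> r dvd m" "0 < m" "m < n"
      and factors: "prime_factors n = insert r (prime_factors m)"
      by (rule prime_power_factorE)
    have "card (pos_divisors n) \<le> Suc e * card (pos_divisors m)"
      unfolding r(2) by (rule card_pos_divisors_prime_power_mult[OF r(1,4)])
    then have "real (card (pos_divisors n)) \<le> real (Suc e) * real (card (pos_divisors m))"
      using of_nat_mono[where ?'a = real] by (metis of_nat_mult)
    also have "\<dots> \<le> (\<kappa> r * (of_int r powr \<epsilon>) ^ e) * ((\<Prod>r\<in>prime_factors m. \<kappa> r) * of_int m powr \<epsilon>)"
      using local[OF r(1)] less.hyps[of m] r(4,5) order_trans[OF of_nat_0_le_iff local[OF r(1), of e]]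
      by (intro mult_mono) auto
    also have "\<dots> = (\<kappa> r * (\<Prod>r\<in>prime_factors m. \<kappa> r)) * ((of_int r powr \<epsilon>) ^ e * of_int m powr \<epsilon>)" by simp
    also have "(of_int r powr \<epsilon>) ^ e * of_int m powr \<epsilon> = of_int n powr \<epsilon>"
      using prime_gt_0_int[OF r(1)] r(4) unfolding r(2)
      by (simp add: powr_mult powr_realpow[symmetric] powr_powr mult.commute)
    also have "\<kappa> r * (\<Prod>r\<in>prime_factors m. \<kappa> r) = (\<Prod>r\<in>prime_factors n. \<kappa> r)"
      using r(3,4) unfolding factors by (subst prod.insert) (auto simp: prime_factors_dvd)
    finally show ?thesis .
  qed
qed

text \<open>Only the finitely many primes below \<open>2 powr (1 / \<epsilon>)\<close> contribute a local factor exceeding \<open>1\<close>.\<close>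

lemma divisor_bound:
  fixes \<epsilon> :: real
  assumes \<epsilon>: "\<epsilon> > 0"
  obtains C where "C \<ge> 1" "\<And>n. n > 0 \<Longrightarrow> real (card (pos_divisors n)) \<le> C * of_int n powr \<epsilon>"
proof -
  define B where "B = \<lceil>2 powr (1 / \<epsilon>)\<rceil>"
  define K where "K = 1 / ln (2 powr \<epsilon>) + 1"
  define \<kappa> where "\<kappa> r = (if r < B then K else 1)" for r
  have K: "K \<ge> 1" using \<epsilon> by (simp add: K_def ln_powr)
  have local: "real (Suc e) \<le> \<kappa> r * (of_int r powr \<epsilon>) ^ e" if r: "prime r" for r e
  proof (cases "r < B")
    case True
    have "2 powr \<epsilon> \<le> of_int r powr \<epsilon>" using prime_ge_2_int[OF r] \<epsilon> by (intro powr_mono2) auto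
    then have "K * (2 powr \<epsilon>) ^ e \<le> K * (of_int r powr \<epsilon>) ^ e"
      using K by (intro mult_left_mono power_mono) auto
    then show ?thesis using Suc_le_mult_power[of "2 powr \<epsilon>" e] \<epsilon> True by (simp add: K_def \<kappa>_def)
  next
    case False
    have "2 = (2 powr (1 / \<epsilon>)) powr \<epsilon>" using \<epsilon> by (simp add: powr_powr)
    also have "\<dots> \<le> of_int r powr \<epsilon>"
      using False \<epsilon> by (intro powr_mono2) (auto simp: B_def ceiling_le_iff not_less)
    finally have "2 ^ e \<le> (of_int r powr \<epsilon>) ^ e" by (intro power_mono) auto
    moreover have "real (Suc e) \<le> 2 ^ e"
      using of_nat_mono[OF Suc_leI[OF less_exp[of e]], where ?'a = real] by simp
    ultimately show ?thesis using False by (simp add: \<kappa>_def)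
  qed
  have "real (card (pos_divisors n)) \<le> K ^ card {0..<B} * of_int n powr \<epsilon>" if n: "n > 0" for n
  proof -
    have "(\<Prod>r\<in>prime_factors n. \<kappa> r) = (\<Prod>r | r \<in> prime_factors n \<and> r < B. K)"
      by (simp only: \<kappa>_def prod.inter_filter[OF finite_set_mset])
    also have "\<dots> = K ^ card {r \<in> prime_factors n. r < B}" by simp
    also have "\<dots> \<le> K ^ card {0..<B}"
      by (intro power_increasing card_mono K) (auto simp: prime_factors_dvd prime_ge_0_int)
    finally have "(\<Prod>r\<in>prime_factors n. \<kappa> r) * of_int n powr \<epsilon> \<le> K ^ card {0..<B} * of_int n powr \<epsilon>"
      by (rule mult_right_mono) simp
    then show ?thesis using card_pos_divisors_le_prod[OF local n] by linarith
  qed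
  then show thesis using that[of "K ^ card {0..<B}"] K by (simp add: one_le_power)
qed

subsection \<open>Sums of two squares\<close>

definition minus_one_roots :: "int \<Rightarrow> int set" where
  "minus_one_roots m = {s \<in> {0..<m}. m dvd s\<^sup>2 + 1}"

lemma finite_minus_one_roots: "finite (minus_one_roots m)"
  by (rule finite_subset[of _ "{0..<m}"]) (auto simp: minus_one_roots_def)

lemma minus_one_roots_diff:
  assumes s: "s \<in> minus_one_roots m" and t: "t \<in> minus_one_roots m"
  shows "m div gcd (s - t) m dvd s + t"
proof -
  have m: "m > 0" using s by (auto simp: minus_one_roots_def)
  let ?d = "gcd (s - t) m"
  have "m dvd (s\<^sup>2 + 1) - (t\<^sup>2 + 1)" using s t by (intro dvd_diff) (auto simp: minus_one_roots_def)
  then have "m dvd (s - t) * (s + t)" by (simp add: power2_eq_square algebra_simps)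
  then have "?d * (m div ?d) dvd ?d * ((s - t) div ?d * (s + t))" by (simp flip: mult.assoc)
  then have "m div ?d dvd (s - t) div ?d * (s + t)" using m by (simp only: dvd_mult_cancel_left) auto
  moreover have "coprime (m div ?d) ((s - t) div ?d)"
    using div_gcd_coprime[of "s - t" m] m by (simp add: coprime_commute)
  ultimately show ?thesis by (simp only: coprime_dvd_mult_right_iff)
qed

lemma gcd_diff_sum_dvd_2:
  assumes t: "t \<in> minus_one_roots m" and d: "d dvd s - t" "d dvd s + t" "d dvd m"
  shows "d dvd 2"
proof -
  have "d dvd (s + t) - (s - t)" using d(2,1) by (rule dvd_diff)
  then have "d dvd 2 * t" by simp
  moreover have "coprime d t"
  proof (rule coprimeI)
    fix c assume c: "c dvd d" "c dvd t"
    then have "c dvd t\<^sup>2 + 1" using t d(3) by (auto simp: minus_one_roots_def intro: dvd_trans)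
    moreover have "c dvd t\<^sup>2" using c(2) by (simp add: power2_eq_square)
    ultimately show "c dvd 1" by (simp add: dvd_add_right_iff)
  qed
  ultimately show ?thesis using coprime_dvd_mult_left_iff by blast
qed

lemma minus_one_roots_eqI:
  assumes t: "t \<in> minus_one_roots m" and s: "s \<in> minus_one_roots m" "s' \<in> minus_one_roots m"
    and gcd: "gcd (s - t) m = gcd (s' - t) m" and half: "2 * s < m \<longleftrightarrow> 2 * s' < m"
  shows "s = s'"
proof -
  define d where "d = gcd (s - t) m"
  define e where "e = m div d"
  have m: "m > 0" "m = d * e" using s by (auto simp: minus_one_roots_def d_def e_def)
  have d: "d dvd s - t" "d dvd s' - t" "d > 0" using m(1) unfolding d_def by (simp, simp add: gcd, simp)
  have e: "e dvd s + t" "e dvd s' + t"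
    using minus_one_roots_diff[OF s(1) t] minus_one_roots_diff[OF s(2) t] gcd
    by (simp_all add: e_def d_def)
  have "e > 0" using m d(3) by (simp add: zero_less_mult_iff)
  have "d dvd (s - t) - (s' - t)" "e dvd (s + t) - (s' + t)"
    by (rule dvd_diff[OF d(1,2)], rule dvd_diff[OF e])
  then have "lcm d e dvd s - s'" by (intro lcm_least) simp_all
  moreover have "gcd d e dvd 2"
    using d(1) e(1) m(2) by (intro gcd_diff_sum_dvd_2[OF t, of _ s]) (auto intro: dvd_trans)
  ultimately have "gcd d e * lcm d e dvd 2 * (s - s')" by (intro mult_dvd_mono)
  then have "m dvd 2 * (s - s')" using prod_gcd_lcm_int[of d e] d(3) \<open>e > 0\<close> m(2) by simp
  moreover have "\<bar>2 * (s - s')\<bar> < m" using s half by (auto simp: minus_one_roots_def)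
  ultimately show ?thesis using int_eq_0_if_dvd_abs_less by fastforce
qed

lemma card_minus_one_roots_le:
  assumes m: "m > 0"
  shows "card (minus_one_roots m) \<le> 2 * card (pos_divisors m)"
proof (cases "minus_one_roots m = {}")
  case False
  then obtain t where t: "t \<in> minus_one_roots m" by blast
  define F where "F s = (gcd (s - t) m, 2 * s < m)" for s
  have "inj_on F (minus_one_roots m)" using minus_one_roots_eqI[OF t] by (auto simp: inj_on_def F_def)
  moreover have "F ` minus_one_roots m \<subseteq> pos_divisors m \<times> UNIV"
    using m by (auto simp: F_def pos_divisors_def)
  ultimately have "card (minus_one_roots m) \<le> card (pos_divisors m \<times> (UNIV :: bool set))"
    using finite_pos_divisors[OF m] by (intro card_inj_on_le) auto
  then show ?thesis by (simp add: card_cartesian_product)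
qed simp

definition two_squares :: "int \<Rightarrow> (int \<times> int) set" where
  "two_squares m = {(x, y). x\<^sup>2 + y\<^sup>2 = m}"

lemma finite_two_squares: "finite (two_squares m)"
proof (rule finite_subset)
  show "two_squares m \<subseteq> {-m..m} \<times> {-m..m}"
  proof (rule subrelI)
    fix x y assume "(x, y) \<in> two_squares m"
    then have "x\<^sup>2 \<le> m" "y\<^sup>2 \<le> m" by (auto simp: two_squares_def)
    then show "(x, y) \<in> {-m..m} \<times> {-m..m}"
      using abs_le_if_square_le[of x m] abs_le_if_square_le[of y m] by auto
  qed
qed auto

lemma two_squares_associates:
  assumes m: "m > 0" and xy: "(x, y) \<in> two_squares m" "(x', y') \<in> two_squares m"
    and dvd: "m dvd x * y' - x' * y"
  shows "(x', y') \<in> {(x, y), (- x, - y), (- y, x), (y, - x)}"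
proof -
  define A where "A = x * x' + y * y'"
  obtain b where b: "x * y' - x' * y = m * b" using dvd by (rule dvdE)
  have "A\<^sup>2 + (m * b)\<^sup>2 = (x\<^sup>2 + y\<^sup>2) * (x'\<^sup>2 + y'\<^sup>2)"
    unfolding A_def b[symmetric] by (simp add: power2_eq_square algebra_simps)
  then have A: "A\<^sup>2 + m\<^sup>2 * b\<^sup>2 = m\<^sup>2 * 1"
    using xy by (simp add: two_squares_def power_mult_distrib flip: power2_eq_square)
  have "m * x' = (x\<^sup>2 + y\<^sup>2) * x'" "m * y' = (x\<^sup>2 + y\<^sup>2) * y'"
    using xy by (simp_all add: two_squares_def)
  then have x': "m * x' = A * x - m * b * y" "m * y' = A * y + m * b * x"
    unfolding A_def b[symmetric] by (simp_all add: power2_eq_square algebra_simps)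
  have "m\<^sup>2 * b\<^sup>2 \<le> m\<^sup>2 * 1" using A zero_le_power2[of A] by linarith
  then have "b\<^sup>2 \<le> 1" using m by simp
  then have "\<bar>b\<bar> \<le> 1" by (simp add: abs_square_le_1)
  then consider "b = 0" | "b = 1" | "b = - 1" by linarith
  moreover have cancel: "z = w" if "m * z = m * w" for z w using that m by simp
  ultimately show ?thesis
  proof cases
    case 1
    then consider "A = m" | "A = - m" using A by (auto simp: power2_eq_iff)
    then show ?thesis
    proof cases
      case 1
      then show ?thesis using x' \<open>b = 0\<close> m by simp
    next
      case 2
      then have "x' = - x" "y' = - y" using x' \<open>b = 0\<close> by - (rule cancel, simp)+
      then show ?thesis by simp
    qed
  next
    case 2
    then have "x' = - y" "y' = x" using A x' by - (rule cancel, simp)+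
    then show ?thesis by simp
  next
    case 3
    then have "x' = y" "y' = - x" using A x' by - (rule cancel, simp)+
    then show ?thesis by simp
  qed
qed

definition primitive_two_squares :: "int \<Rightarrow> (int \<times> int) set" where
  "primitive_two_squares m = {(x, y) \<in> two_squares m. coprime x y}"

lemma finite_primitive_two_squares: "finite (primitive_two_squares m)"
  by (rule finite_subset[OF _ finite_two_squares]) (auto simp: primitive_two_squares_def)

lemma primitive_two_squares_root:
  assumes m: "m > 0" and xy: "(x, y) \<in> primitive_two_squares m"
  obtains s where "s \<in> minus_one_roots m" "m dvd x - s * y"
proof -
  have sq: "x\<^sup>2 + y\<^sup>2 = m" and cop: "coprime x y"
    using xy by (auto simp: primitive_two_squares_def two_squares_def)
  have y_m: "coprime y m"
  proof (rule coprimeI)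
    fix c assume c: "c dvd y" "c dvd m"
    then have "c dvd m - y\<^sup>2" by (simp add: power2_eq_square)
    then have "c dvd x\<^sup>2" by (simp flip: sq)
    moreover have "coprime (x\<^sup>2) y" using cop by simp
    ultimately show "c dvd 1" using c(1) coprime_common_divisor by blast
  qed
  obtain y' where y': "m dvd y' * y - 1" using inverse_mod[OF y_m] .
  define s where "s = x * y' mod m"
  have "m dvd x * y' - s" by (simp add: s_def minus_mod_eq_mult_div)
  then have "m dvd - (x * (y' * y - 1)) + (x * y' - s) * y" using y' by (intro dvd_add) auto
  then have dvd: "m dvd x - s * y" by (simp add: algebra_simps)
  then have "m dvd m - (x - s * y) * (x + s * y)" by simp
  also have "\<dots> = y\<^sup>2 * (s\<^sup>2 + 1)" by (simp add: sq[symmetric] power2_eq_square algebra_simps)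
  finally have "m dvd s\<^sup>2 + 1" using y_m by (simp add: coprime_commute coprime_dvd_mult_right_iff)
  then show thesis using that[OF _ dvd] m by (simp add: minus_one_roots_def s_def)
qed

lemma card_primitive_two_squares_le:
  assumes m: "m > 0"
  shows "card (primitive_two_squares m) \<le> 8 * card (pos_divisors m)"
proof -
  define F where "F s = {(x, y) \<in> two_squares m. m dvd x - s * y}" for s
  have F: "finite (F s)" for s by (rule finite_subset[OF _ finite_two_squares]) (auto simp: F_def)
  have card_F: "card (F s) \<le> 4" for s
  proof (cases "F s = {}")
    case False
    then obtain x y where xy: "(x, y) \<in> F s" by auto
    have "F s \<subseteq> {(x, y), (- x, - y), (- y, x), (y, - x)}"
    proof (rule subrelI)
      fix x' y' assume x'y': "(x', y') \<in> F s"
      have "m dvd (x - s * y) * y' - (x' - s * y') * y"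
        using xy x'y' by (auto simp: F_def intro: dvd_diff)
      then have "m dvd x * y' - x' * y" by (simp add: algebra_simps)
      then show "(x', y') \<in> {(x, y), (- x, - y), (- y, x), (y, - x)}"
        using two_squares_associates[OF m] xy x'y' by (auto simp: F_def)
    qed
    then have "card (F s) \<le> card (set [(x, y), (- x, - y), (- y, x), (y, - x)])"
      by (intro card_mono) auto
    also have "\<dots> \<le> 4" by (rule order_trans[OF card_length]) simp
    finally show ?thesis .
  qed simp
  have roots: "primitive_two_squares m \<subseteq> (\<Union>s\<in>minus_one_roots m. F s)"
  proof (rule subrelI)
    fix x y assume xy: "(x, y) \<in> primitive_two_squares m"
    then obtain s where "s \<in> minus_one_roots m" "m dvd x - s * y"
      by (rule primitive_two_squares_root[OF m])
    then show "(x, y) \<in> (\<Union>s\<in>minus_one_roots m. F s)"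
      using xy by (auto simp: F_def primitive_two_squares_def)
  qed
  have "card (primitive_two_squares m) \<le> card (\<Union>s\<in>minus_one_roots m. F s)"
    by (rule card_mono[OF _ roots]) (simp add: F finite_minus_one_roots)
  also have "\<dots> \<le> (\<Sum>s\<in>minus_one_roots m. card (F s))" by (rule card_UN_le[OF finite_minus_one_roots])
  also have "\<dots> \<le> card (minus_one_roots m) * 4"
    using sum_bounded_above[of "minus_one_roots m" "\<lambda>s. card (F s)" 4] card_F by simp
  also have "\<dots> \<le> 8 * card (pos_divisors m)" using card_minus_one_roots_le[OF m] by simp
  finally show ?thesis .
qed

lemma card_two_squares_le:
  assumes m: "m > 0"
  shows "card (two_squares m) \<le> 8 * (card (pos_divisors m))\<^sup>2"
proof -
  let ?P = "\<lambda>g. primitive_two_squares (m div g\<^sup>2)" and ?G = "{g \<in> pos_divisors m. g\<^sup>2 dvd m}"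
  have G: "finite ?G" using finite_pos_divisors[OF m] by simp
  have "two_squares m \<subseteq> (\<Union>g\<in>?G. (\<lambda>(x, y). (g * x, g * y)) ` ?P g)"
  proof (rule subrelI)
    fix x y assume "(x, y) \<in> two_squares m"
    then have xy: "x\<^sup>2 + y\<^sup>2 = m" by (simp add: two_squares_def)
    define g where "g = gcd x y"
    have g: "g > 0" using xy m by (auto simp: g_def)
    obtain a b where ab: "x = g * a" "y = g * b" "coprime a b"
      using gcd_coprime_exists[of x y] g unfolding g_def by (auto simp: mult.commute)
    have "m = g\<^sup>2 * (a\<^sup>2 + b\<^sup>2)"
      unfolding xy[symmetric] ab by (simp add: power_mult_distrib distrib_left)
    then have "g \<in> ?G" "(a, b) \<in> ?P g"
      using g ab(3) by (auto simp: pos_divisors_def primitive_two_squares_def two_squares_def power2_eq_square)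
    then show "(x, y) \<in> (\<Union>g\<in>?G. (\<lambda>(x, y). (g * x, g * y)) ` ?P g)"
      using ab by (intro UN_I[of g] image_eqI[of _ _ "(a, b)"]) auto
  qed
  then have "card (two_squares m) \<le> card (\<Union>g\<in>?G. (\<lambda>(x, y). (g * x, g * y)) ` ?P g)"
    by (intro card_mono) (auto simp: G finite_primitive_two_squares)
  also have "\<dots> \<le> (\<Sum>g\<in>?G. card ((\<lambda>(x, y). (g * x, g * y)) ` ?P g))" by (rule card_UN_le[OF G])
  also have "\<dots> \<le> (\<Sum>g\<in>?G. 8 * card (pos_divisors m))"
  proof (rule sum_mono)
    fix g assume g: "g \<in> ?G"
    then have div: "m div g\<^sup>2 > 0" "m div g\<^sup>2 dvd m"
      using m by (auto simp: pos_divisors_def pos_imp_zdiv_pos_iff zdvd_imp_le)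
    have "card ((\<lambda>(x, y). (g * x, g * y)) ` ?P g) \<le> card (?P g)"
      by (rule card_image_le[OF finite_primitive_two_squares])
    also have "\<dots> \<le> 8 * card (pos_divisors (m div g\<^sup>2))"
      by (rule card_primitive_two_squares_le[OF div(1)])
    also have "pos_divisors (m div g\<^sup>2) \<subseteq> pos_divisors m"
      using div(2) by (auto simp: pos_divisors_def intro: dvd_trans)
    then have "card (pos_divisors (m div g\<^sup>2)) \<le> card (pos_divisors m)"
      by (rule card_mono[OF finite_pos_divisors[OF m]])
    finally show "card ((\<lambda>(x, y). (g * x, g * y)) ` ?P g) \<le> 8 * card (pos_divisors m)" by simp
  qed
  also have "\<dots> = card ?G * (8 * card (pos_divisors m))" by simp
  also have "card ?G \<le> card (pos_divisors m)" by (rule card_mono[OF finite_pos_divisors[OF m]]) auto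
  finally show ?thesis by (simp add: power2_eq_square mult_ac)
qed

definition max_two_squares :: "int \<Rightarrow> nat" where
  "max_two_squares X = Max ((\<lambda>m. card (two_squares m)) ` {0..X})"

lemma card_two_squares_le_max: "0 \<le> m \<Longrightarrow> m \<le> X \<Longrightarrow> card (two_squares m) \<le> max_two_squares X"
  unfolding max_two_squares_def by (intro Max_ge) auto

lemma max_two_squares_mono: "0 \<le> X \<Longrightarrow> X \<le> Y \<Longrightarrow> max_two_squares X \<le> max_two_squares Y"
  unfolding max_two_squares_def by (intro Max_mono) auto

lemma max_two_squares_bound:
  fixes \<epsilon> :: real
  assumes "\<epsilon> > 0"
  obtains C where "C \<ge> 1" "\<And>X. X \<ge> 1 \<Longrightarrow> real (max_two_squares X) \<le> C * of_int X powr \<epsilon>"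
proof -
  obtain D where D: "D \<ge> 1" "\<And>n. n > 0 \<Longrightarrow> real (card (pos_divisors n)) \<le> D * of_int n powr (\<epsilon> / 2)"
    using divisor_bound[of "\<epsilon> / 2"] assms by auto
  have D1: "D\<^sup>2 \<ge> 1" using D(1) by (simp add: one_le_power)
  have "real (max_two_squares X) \<le> 8 * D\<^sup>2 * of_int X powr \<epsilon>" if X: "X \<ge> 1" for X
  proof -
    obtain m where m: "m \<in> {0..X}" "max_two_squares X = card (two_squares m)"
      using Max_in[of "(\<lambda>m. card (two_squares m)) ` {0..X}"] X unfolding max_two_squares_def by fastforce
    show ?thesis
    proof (cases "m = 0")
      case True
      have "two_squares 0 = {(0, 0)}" by (auto simp: two_squares_def sum_power2_eq_zero_iff)
      moreover have "1 * 1 \<le> (8 * D\<^sup>2) * of_int X powr \<epsilon>"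
        using D1 X assms by (intro mult_mono) (auto simp: ge_one_powr_ge_zero)
      ultimately show ?thesis using m True by simp
    next
      case False
      then have "m > 0" using m by simp
      have "real (card (two_squares m)) \<le> real (8 * (card (pos_divisors m))\<^sup>2)"
        using card_two_squares_le[OF \<open>m > 0\<close>] by (simp only: of_nat_le_iff)
      also have "\<dots> = 8 * (real (card (pos_divisors m)))\<^sup>2" by simp
      also have "\<dots> \<le> 8 * (D * of_int m powr (\<epsilon> / 2))\<^sup>2"
        using D(2) \<open>m > 0\<close> by (intro mult_left_mono power_mono) auto
      also have "\<dots> = 8 * D\<^sup>2 * of_int m powr \<epsilon>"
        by (simp add: power_mult_distrib power2_eq_square powr_add[symmetric])
      also have "\<dots> \<le> 8 * D\<^sup>2 * of_int X powr \<epsilon>"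
        using m \<open>m > 0\<close> assms by (intro mult_left_mono powr_mono2) auto
      finally show ?thesis using m(2) by simp
    qed
  qed
  then show thesis using that[of "8 * D\<^sup>2"] D1 by simp
qed

subsection \<open>Sums of three and four squares\<close>

lemma card_squares_le:
  fixes M :: int
  assumes "M \<ge> 0"
  shows "finite {b::int. b\<^sup>2 \<le> M}" "real (card {b::int. b\<^sup>2 \<le> M}) \<le> 2 * sqrt (of_int M) + 1"
proof -
  define s where "s = \<lfloor>sqrt (of_int M)\<rfloor>"
  have "s \<ge> 0" using assms by (simp add: s_def)
  have sub: "{b::int. b\<^sup>2 \<le> M} \<subseteq> {-s..s}"
  proof
    fix b :: int assume "b \<in> {b. b\<^sup>2 \<le> M}"
    then have "(of_int b)\<^sup>2 \<le> real_of_int M" by (simp flip: of_int_power)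
    then have "\<bar>b\<bar> \<le> s" by (simp add: s_def le_floor_iff real_le_rsqrt)
    then show "b \<in> {-s..s}" by auto
  qed
  then show "finite {b::int. b\<^sup>2 \<le> M}" by (rule finite_subset) simp
  have "real (card {b::int. b\<^sup>2 \<le> M}) \<le> real (card {-s..s})" using card_mono[OF _ sub] by simp
  also have "\<dots> \<le> 2 * sqrt (of_int M) + 1" using \<open>s \<ge> 0\<close> by (simp add: s_def)
  finally show "real (card {b::int. b\<^sup>2 \<le> M}) \<le> 2 * sqrt (of_int M) + 1" .
qed

lemma card_le_fibers:
  fixes B :: real
  assumes "finite A" "S \<subseteq> Sigma A F"
    and F: "\<And>a. a \<in> A \<Longrightarrow> finite (F a)" "\<And>a. a \<in> A \<Longrightarrow> real (card (F a)) \<le> B"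
  shows "finite S" "real (card S) \<le> real (card A) * B"
proof -
  have fin: "finite (Sigma A F)" using assms by auto
  then show "finite S" using assms(2) finite_subset by blast
  have "real (card S) \<le> real (card (Sigma A F))" using card_mono[OF fin assms(2)] by simp
  also have "\<dots> = (\<Sum>a\<in>A. real (card (F a)))" using assms by (simp add: card_SigmaI)
  also have "\<dots> \<le> (\<Sum>a\<in>A. B)" using F(2) by (rule sum_mono)
  finally show "real (card S) \<le> real (card A) * B" by simp
qed

definition three_squares :: "int \<Rightarrow> (int \<times> int \<times> int) set" where
  "three_squares M = {(b, c, d). b\<^sup>2 + c\<^sup>2 + d\<^sup>2 = M}"

lemma card_three_squares_le:
  assumes M: "0 \<le> M"
  shows "finite (three_squares M)"
    "real (card (three_squares M)) \<le> (2 * sqrt (of_int M) + 1) * max_two_squares M"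
proof -
  have sub: "three_squares M \<subseteq> Sigma {b. b\<^sup>2 \<le> M} (\<lambda>b. two_squares (M - b\<^sup>2))"
    by (auto simp: three_squares_def two_squares_def)
  have fiber: "real (card (two_squares (M - b\<^sup>2))) \<le> real (max_two_squares M)"
    if "b \<in> {b. b\<^sup>2 \<le> M}" for b
    using that card_two_squares_le_max[of "M - b\<^sup>2" M] by simp
  note fibers = card_le_fibers[OF card_squares_le(1)[OF M] sub finite_two_squares fiber]
  show "finite (three_squares M)" by (rule fibers(1))
  show "real (card (three_squares M)) \<le> (2 * sqrt (of_int M) + 1) * max_two_squares M"
    using fibers(2) mult_right_mono[OF card_squares_le(2)[OF M], of "real (max_two_squares M)"]
    by linarith
qed

lemma card_nrm_le:
  assumes M: "M \<ge> 1"
  shows "real (card {x. nrm x = M}) \<le> 9 * of_int M * real (max_two_squares M)"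
proof -
  let ?F = "\<lambda>b. three_squares (M - b\<^sup>2)" and ?f = "\<lambda>x. (q0 x, q1 x, q2 x, q3 x)"
  define s where "s = sqrt (of_int M)"
  have s: "s \<ge> 1" "s * s = of_int M" using M by (auto simp: s_def)
  have M0: "0 \<le> M" using M by simp
  have roots: "real (card {b. b\<^sup>2 \<le> M}) \<le> 3 * s"
    using card_squares_le(2)[OF M0] s(1) unfolding s_def by linarith
  have sub: "?f ` {x. nrm x = M} \<subseteq> Sigma {b. b\<^sup>2 \<le> M} ?F"
    by (auto simp: nrm_def three_squares_def)
  have fiber: "finite (?F b)" "real (card (?F b)) \<le> 3 * s * max_two_squares M"
    if b: "b \<in> {b. b\<^sup>2 \<le> M}" for b
  proof -
    have M_b: "0 \<le> M - b\<^sup>2" "M - b\<^sup>2 \<le> M" using b by auto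
    show "finite (?F b)" by (rule card_three_squares_le(1)[OF M_b(1)])
    have "real (card (?F b)) \<le> (2 * sqrt (of_int (M - b\<^sup>2)) + 1) * max_two_squares (M - b\<^sup>2)"
      by (rule card_three_squares_le(2)[OF M_b(1)])
    also have "\<dots> \<le> (2 * s + 1) * max_two_squares M"
      using max_two_squares_mono[OF M_b] s M_b by (intro mult_mono) (auto simp: s_def)
    also have "\<dots> \<le> 3 * s * max_two_squares M" using s by (intro mult_right_mono) auto
    finally show "real (card (?F b)) \<le> 3 * s * max_two_squares M" .
  qed
  have "inj_on ?f {x. nrm x = M}" by (auto simp: inj_on_def quat_eq_iff)
  then have "real (card {x. nrm x = M}) = real (card (?f ` {x. nrm x = M}))" by (simp add: card_image)
  also have "\<dots> \<le> real (card {b. b\<^sup>2 \<le> M}) * (3 * s * max_two_squares M)"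
    by (rule card_le_fibers(2)[OF card_squares_le(1)[OF M0] sub fiber])
  also have "\<dots> \<le> 3 * s * (3 * s * max_two_squares M)"
    using roots s(1) by (intro mult_right_mono) auto
  also have "\<dots> = 9 * of_int M * real (max_two_squares M)" by (simp add: s(2)[symmetric])
  finally show ?thesis .
qed

lemma card_primitive_le:
  assumes "M \<ge> 1"
  shows "real (card (primitive M)) \<le> 9 * of_int M * real (max_two_squares M)"
proof -
  have "card (primitive M) \<le> card {x. nrm x = M}"
    by (rule card_mono[OF finite_nrm]) (auto simp: primitive_def)
  then show ?thesis using card_nrm_le[OF assms] by linarith
qed

subsection \<open>Pairs of primitive quaternions of equal norm\<close>

text \<open>For congruent primitive \<open>y \<noteq> y'\<close> of norm \<open>n\<close>, write \<open>y y'\<^sup>* = c w\<close> with \<open>w\<close> of content \<open>1\<close>. Then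
  \<open>y = d t\<close> and \<open>y' = e t\<close> with \<open>t\<close> of norm \<open>c\<close>, and \<open>w = d e\<^sup>*\<close> is close to the scalar \<open>n / c\<close>.\<close>

definition near_scalars :: "int \<Rightarrow> int \<Rightarrow> quat set" where
  "near_scalars m q = {w. nrm w = m\<^sup>2 \<and> content w = 1 \<and> q dvd q1 w \<and> q dvd q2 w \<and> q dvd q3 w
     \<and> q\<^sup>2 dvd m - q0 w \<and> q0 w \<noteq> m}"

lemma card_congruent_abs_le:
  fixes m q :: int
  assumes "m > 0" "q > 0"
  defines "A \<equiv> {a. \<bar>a\<bar> \<le> m \<and> q dvd m - a \<and> a \<noteq> m}"
  shows "finite A" "real (card A) \<le> 2 * of_int m / of_int q"
proof -
  have sub: "A \<subseteq> (\<lambda>j. m - q * j) ` {1..(2 * m) div q}"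
  proof
    fix a assume "a \<in> A"
    then have a: "\<bar>a\<bar> \<le> m" "q dvd m - a" "a \<noteq> m" by (auto simp: A_def)
    obtain j where j: "m - a = q * j" using a(2) by (rule dvdE)
    then have "q * j > 0" "q * j \<le> 2 * m" using a by linarith+
    then have "j \<ge> 1" "j \<le> (2 * m) div q"
      using assms(2) zdiv_mono1[of "q * j" "2 * m" q] by (auto simp: zero_less_mult_iff)
    moreover have "a = m - q * j" using j by simp
    ultimately show "a \<in> (\<lambda>j. m - q * j) ` {1..(2 * m) div q}" by auto
  qed
  then show "finite A" by (rule finite_subset) simp
  have "card A \<le> card {1..(2 * m) div q}" using sub by (rule surj_card_le[rotated]) simp
  moreover have "(2 * m) div q \<ge> 0" using assms by (simp add: pos_imp_zdiv_nonneg_iff)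
  ultimately have "real (card A) \<le> real_of_int ((2 * m) div q)" by simp
  also have "\<dots> \<le> real_of_int (2 * m) / of_int q" by (rule real_of_int_div4)
  finally show "real (card A) \<le> 2 * of_int m / of_int q" by simp
qed

lemma near_scalars_coordinates:
  assumes m: "m > 0" and q: "q > 0"
  shows "inj_on (\<lambda>w. (q0 w, q1 w div q, q2 w div q, q3 w div q)) (near_scalars m q)"
    and "(\<lambda>w. (q0 w, q1 w div q, q2 w div q, q3 w div q)) ` near_scalars m q
      \<subseteq> Sigma {a. \<bar>a\<bar> \<le> m \<and> q\<^sup>2 dvd m - a \<and> a \<noteq> m} (\<lambda>a. three_squares ((m\<^sup>2 - a\<^sup>2) div q\<^sup>2))"
proof -
  let ?f = "\<lambda>w. (q0 w, q1 w div q, q2 w div q, q3 w div q)"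
  show "inj_on ?f (near_scalars m q)"
  proof (rule inj_onI)
    fix w w' assume "w \<in> near_scalars m q" "w' \<in> near_scalars m q"
    then have "q dvd q1 w" "q dvd q2 w" "q dvd q3 w" "q dvd q1 w'" "q dvd q2 w'" "q dvd q3 w'"
      by (auto simp: near_scalars_def)
    moreover assume "?f w = ?f w'"
    ultimately show "w = w'" unfolding quat_eq_iff by (auto simp: dvd_div_eq_iff)
  qed
  show "?f ` near_scalars m q \<subseteq> Sigma {a. \<bar>a\<bar> \<le> m \<and> q\<^sup>2 dvd m - a \<and> a \<noteq> m} (\<lambda>a.
    three_squares ((m\<^sup>2 - a\<^sup>2) div q\<^sup>2))"
  proof (rule image_subsetI)
    fix w assume w: "w \<in> near_scalars m q"
    then obtain b c d where bcd: "q1 w = q * b" "q2 w = q * c" "q3 w = q * d"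
      by (auto simp: near_scalars_def dvd_def)
    have nrm: "(q0 w)\<^sup>2 + q\<^sup>2 * (b\<^sup>2 + c\<^sup>2 + d\<^sup>2) = m\<^sup>2"
      using w bcd by (simp add: near_scalars_def nrm_def power_mult_distrib algebra_simps)
    then have "(m\<^sup>2 - (q0 w)\<^sup>2) div q\<^sup>2 = b\<^sup>2 + c\<^sup>2 + d\<^sup>2" using q by (simp flip: nrm)
    moreover have "(q0 w)\<^sup>2 \<le> m\<^sup>2" unfolding nrm[symmetric] by simp
    then have "\<bar>q0 w\<bar> \<le> m" using m by (simp add: abs_le_square_iff[symmetric])
    ultimately show "?f w \<in> Sigma {a. \<bar>a\<bar> \<le> m \<and> q\<^sup>2 dvd m - a \<and> a \<noteq> m} (\<lambda>a.
      three_squares ((m\<^sup>2 - a\<^sup>2) div q\<^sup>2))"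
      using w bcd q by (auto simp: three_squares_def near_scalars_def)
  qed
qed

lemma card_near_scalars_le:
  assumes m: "m > 0" and q: "q > 0"
  shows "finite (near_scalars m q)"
    "real (card (near_scalars m q)) \<le> 8 * (of_int m)\<^sup>2 / of_int q ^ 3 * max_two_squares (m\<^sup>2)"
proof -
  let ?A = "{a. \<bar>a\<bar> \<le> m \<and> q\<^sup>2 dvd m - a \<and> a \<noteq> m}" and ?F = "\<lambda>a. three_squares ((m\<^sup>2 - a\<^sup>2) div q\<^sup>2)"
  let ?B = "4 * of_int m / of_int q * real (max_two_squares (m\<^sup>2))"
  have A: "finite ?A" "real (card ?A) \<le> 2 * of_int m / (of_int q)\<^sup>2"
    using card_congruent_abs_le[OF m, of "q\<^sup>2"] q by simp_all
  have F: "finite (?F a)" "real (card (?F a)) \<le> ?B" if a: "a \<in> ?A" for a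
  proof -
    let ?M = "(m\<^sup>2 - a\<^sup>2) div q\<^sup>2"
    have "a\<^sup>2 \<le> m\<^sup>2" using a m by (simp add: abs_le_square_iff[symmetric])
    then have M0: "0 \<le> ?M" using q by (simp add: pos_imp_zdiv_nonneg_iff)
    show "finite (?F a)" by (rule card_three_squares_le(1)[OF M0])
    have "q\<^sup>2 > 0" using q by simp
    have "?M * 1 \<le> ?M * q\<^sup>2" using M0 q by (intro mult_left_mono) (auto simp: int_one_le_iff_zero_less)
    also have "\<dots> \<le> m\<^sup>2 - a\<^sup>2"
      using pos_mod_sign[of "q\<^sup>2" "m\<^sup>2 - a\<^sup>2"] div_mult_mod_eq[of "m\<^sup>2 - a\<^sup>2" "q\<^sup>2"] \<open>q\<^sup>2 > 0\<close>
      by linarith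
    finally have "?M \<le> m\<^sup>2" using zero_le_power2[of a] by linarith
    have "real_of_int ?M \<le> real_of_int (m\<^sup>2 - a\<^sup>2) / real_of_int (q\<^sup>2)" by (rule real_of_int_div4)
    also have "\<dots> \<le> (of_int m / of_int q)\<^sup>2" using q by (simp add: power_divide divide_right_mono)
    finally have sqrt_M: "sqrt (of_int ?M) \<le> of_int m / of_int q" using m q by (intro real_le_lsqrt) auto
    have "q\<^sup>2 \<le> \<bar>m - a\<bar>" using a dvd_imp_le_int[of "m - a" "q\<^sup>2"] by simp
    also have "\<dots> \<le> 2 * m" using a by auto
    finally have "q \<le> 2 * m" using self_le_power[of q 2] q by linarith
    then have "1 \<le> 2 * (real_of_int m / of_int q)" using q by (simp add: field_simps)
    then have "2 * sqrt (of_int ?M) + 1 \<le> 4 * of_int m / of_int q" using sqrt_M by simp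
    then have "(2 * sqrt (of_int ?M) + 1) * max_two_squares ?M \<le> ?B"
      using max_two_squares_mono[OF M0 \<open>?M \<le> m\<^sup>2\<close>] M0 m q by (intro mult_mono) auto
    then show "real (card (?F a)) \<le> ?B" using card_three_squares_le(2)[OF M0] by linarith
  qed
  note inj = near_scalars_coordinates(1)[OF m q]
  note fibers = card_le_fibers[OF A(1) near_scalars_coordinates(2)[OF m q] F]
  show "finite (near_scalars m q)" using finite_imageD[OF fibers(1) inj] .
  have "real (card (near_scalars m q)) \<le> real (card ?A) * ?B"
    using fibers(2) by (simp add: card_image[OF inj])
  also have "\<dots> \<le> 2 * of_int m / (of_int q)\<^sup>2 * ?B" using A(2) m q by (intro mult_right_mono) auto
  also have "\<dots> = 8 * (of_int m)\<^sup>2 / of_int q ^ 3 * max_two_squares (m\<^sup>2)"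
    by (simp add: power2_eq_square power3_eq_cube)
  finally show "real (card (near_scalars m q))
    \<le> 8 * (of_int m)\<^sup>2 / of_int q ^ 3 * max_two_squares (m\<^sup>2)" .
qed

lemma mem_near_scalars_if_qcong:
  assumes q: "odd q" "coprime q c" and c: "c > 0"
    and y: "nrm y = c * m" "nrm y' = c * m" "qcong q y y'" "y \<noteq> y'"
    and w: "y * qcnj y' = of_int c * w" "content w = 1"
  shows "w \<in> near_scalars m q"
proof -
  have "c\<^sup>2 * nrm w = c\<^sup>2 * m\<^sup>2"
    using arg_cong[OF w(1), of nrm] by (auto simp: y nrm_mult power2_eq_square mult_ac)
  then have "nrm w = m\<^sup>2" using c by simp
  have diff: "nrm (y - y') = 2 * (c * (m - q0 w))"
    using y w(1) by (simp add: nrm_def power2_eq_square algebra_simps quat_eq_iff)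
  have "qcong q (of_int (c * m)) (of_int c * w)"
    using qcong_mult_left[of q "qcnj y" "qcnj y'" y] y w(1) by (simp add: mult_qcnj)
  then have "q dvd q1 w" "q dvd q2 w" "q dvd q3 w"
    using q(2) by (auto simp: qcong_def qdvd_def coprime_dvd_mult_right_iff)
  moreover have "q\<^sup>2 dvd 2 * (c * (m - q0 w))"
    using qdvd_imp_square_dvd_nrm[of q "y - y'"] y(3) unfolding qcong_def diff .
  then have "q\<^sup>2 dvd m - q0 w" using q by (simp add: coprime_dvd_mult_right_iff)
  moreover have "q0 w \<noteq> m" using diff y(4) by (auto simp: nrm_eq_0_iff[of "y - y'"])
  ultimately show ?thesis using w(2) \<open>nrm w = m\<^sup>2\<close> by (simp add: near_scalars_def)
qed

lemma congruent_pair_decomp: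
  assumes n: "n > 0" "odd n" and q: "odd q" "coprime n q"
    and yy: "(y, y') \<in> congruent_pairs n q" "y \<noteq> y'"
  obtains c d e t where "c \<in> pos_divisors n" "nrm t = c" "y = d * t" "y' = e * t"
    "nrm d = n div c" "d * qcnj e \<in> near_scalars (n div c) q"
proof -
  have y: "nrm y = n" "nrm y' = n" "content y = 1" and cong: "qcong q y y'"
    using yy by (auto simp: congruent_pairs_def primitive_def)
  define x where "x = y * qcnj y'"
  define c where "c = content x"
  have x: "nrm x = n\<^sup>2" using y by (simp add: x_def nrm_mult power2_eq_square)
  then have "x \<noteq> 0" using n by auto
  have "c > 0" using \<open>x \<noteq> 0\<close> content_ge_0[of x] by (simp add: c_def less_le)
  have "c\<^sup>2 dvd n\<^sup>2" using content_square_dvd_nrm[of x] by (simp add: c_def x)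
  then have "c dvd n" by simp
  then obtain m where m: "n = c * m" by (rule dvdE)
  have div: "n div c = m" using m \<open>c > 0\<close> by simp
  have "right_factors c y \<inter> right_factors c y' \<noteq> {}"
    by (subst right_factors_Int_nonempty_iff)
      (use m n y \<open>c > 0\<close> in \<open>auto simp: c_def x_def qdvd_iff_dvd_content\<close>)
  then obtain d e t where t: "nrm t = c" "y = d * t" "y' = e * t" by (auto simp: right_factors_def)
  define w where "w = d * qcnj e"
  have x_w: "x = of_int c * w"
    unfolding x_def t(2,3) qcnj_mult w_def
    by (simp add: mult.assoc mult_qcnj_assoc t(1) of_int_mult_left_commute)
  have "nrm d = m" using y(1) t m \<open>c > 0\<close> by (simp add: nrm_mult)
  moreover have "content x = c * content w"
    using arg_cong[OF x_w, of content] \<open>c > 0\<close> by (simp add: content_of_int_mult)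
  then have "content w = 1" using \<open>c > 0\<close> by (simp flip: c_def)
  then have "w \<in> near_scalars m q"
    using mem_near_scalars_if_qcong[OF q(1) _ \<open>c > 0\<close> _ _ cong yy(2) x_w[unfolded x_def]] q(2) y
    by (simp add: m coprime_commute)
  ultimately show thesis
    using that[OF _ t] \<open>c > 0\<close> \<open>c dvd n\<close> by (simp add: div w_def pos_divisors_def)
qed

definition pair_data :: "int \<Rightarrow> int \<Rightarrow> int \<Rightarrow> (quat \<times> quat \<times> quat) set" where
  "pair_data n q c = (SIGMA w:near_scalars (n div c) q. left_factors (n div c) w \<times> {t. nrm t = c})"

definition pair_of_data :: "int \<Rightarrow> quat \<times> quat \<times> quat \<Rightarrow> quat \<times> quat" where
  "pair_of_data m = (\<lambda>(w, d, t). (d * t, qcnj (quat_div (qcnj d * w) m) * t))"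

lemma congruent_pairs_cover:
  assumes n: "n > 0" "odd n" and q: "odd q" "coprime n q"
  shows "congruent_pairs n q \<subseteq>
    (\<lambda>y. (y, y)) ` primitive n \<union> (\<Union>c\<in>pos_divisors n. pair_of_data (n div c) ` pair_data n q c)"
proof (rule subrelI)
  fix y y' assume yy: "(y, y') \<in> congruent_pairs n q"
  show "(y, y') \<in> (\<lambda>y. (y, y)) ` primitive n
    \<union> (\<Union>c\<in>pos_divisors n. pair_of_data (n div c) ` pair_data n q c)"
  proof (cases "y = y'")
    case True
    then show ?thesis using yy by (auto simp: congruent_pairs_def)
  next
    case False
    then obtain c d e t where c: "c \<in> pos_divisors n" and t: "nrm t = c" "y = d * t" "y' = e * t"
      and d: "nrm d = n div c" "d * qcnj e \<in> near_scalars (n div c) q"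
      using congruent_pair_decomp[OF n q yy] by metis
    have "n div c \<noteq> 0" using c n by (auto simp: pos_divisors_def dvd_div_eq_0_iff)
    then have "(y, y') = pair_of_data (n div c) (d * qcnj e, d, t)"
      by (simp add: pair_of_data_def t mult_qcnj_assoc d(1))
    moreover have "(d * qcnj e, d, t) \<in> pair_data n q c"
      using d t(1) by (auto simp: pair_data_def left_factors_def)
    ultimately show ?thesis using c by blast
  qed
qed

lemma card_left_factors_Times_nrm_le:
  assumes m: "m \<ge> 1" "odd m" and c: "c \<ge> 1" "c \<le> M" and w: "w \<in> near_scalars m q"
  shows "finite (left_factors m w \<times> {t. nrm t = c})"
    "real (card (left_factors m w \<times> {t. nrm t = c})) \<le> 72 * of_int c * real (max_two_squares M)"
proof -
  have left: "card (left_factors m w) = 8"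
    by (rule card_left_factors) (use w m in \<open>auto simp: near_scalars_def\<close>)
  then have "finite (left_factors m w)" by (intro card_ge_0_finite) simp
  then show "finite (left_factors m w \<times> {t. nrm t = c})" using finite_nrm by simp
  have "real (card {t. nrm t = c}) \<le> 9 * of_int c * real (max_two_squares c)"
    by (rule card_nrm_le[OF c(1)])
  also have "\<dots> \<le> 9 * of_int c * real (max_two_squares M)"
    using max_two_squares_mono[OF _ c(2)] c(1) by (intro mult_left_mono) auto
  finally show "real (card (left_factors m w \<times> {t. nrm t = c}))
    \<le> 72 * of_int c * real (max_two_squares M)"
    by (simp add: card_cartesian_product left mult_ac)
qed

lemma card_pair_data_le:
  assumes n: "n > 0" "odd n" and q: "q > 0" and c: "c \<in> pos_divisors n"
  defines "B \<equiv> real (max_two_squares (n\<^sup>2))"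
  shows "finite (pair_data n q c)"
    "real (card (pair_data n q c)) \<le> 576 * B\<^sup>2 * ((of_int n)\<^sup>2 / of_int q ^ 3)"
proof -
  obtain m where m: "n = c * m" using c by (auto simp: pos_divisors_def)
  have c0: "c \<ge> 1" using c by (auto simp: pos_divisors_def)
  then have m0: "m \<ge> 1" using n m by (simp add: zero_less_mult_iff)
  have div: "n div c = m" using m c0 by simp
  have "c \<le> n" "m \<le> n"
    unfolding m using c0 m0 by (simp_all add: mult_le_cancel_left1 mult_le_cancel_right1)
  moreover have "n \<le> n\<^sup>2" using n(1) by (intro self_le_power) auto
  ultimately have le: "c \<le> n\<^sup>2" "m\<^sup>2 \<le> n\<^sup>2" using m0 by (linarith, intro power_mono) auto
  have near: "finite (near_scalars m q)"
    "real (card (near_scalars m q)) \<le> 8 * (of_int m)\<^sup>2 / of_int q ^ 3 * B"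
  proof -
    show "finite (near_scalars m q)" using card_near_scalars_le(1)[of m q] m0 q by simp
    have "real (card (near_scalars m q)) \<le> 8 * (of_int m)\<^sup>2 / of_int q ^ 3 * max_two_squares (m\<^sup>2)"
      using card_near_scalars_le(2)[of m q] m0 q by simp
    also have "\<dots> \<le> 8 * (of_int m)\<^sup>2 / of_int q ^ 3 * B"
      using max_two_squares_mono[OF _ le(2)] q unfolding B_def by (intro mult_left_mono) auto
    finally show "real (card (near_scalars m q)) \<le> 8 * (of_int m)\<^sup>2 / of_int q ^ 3 * B" .
  qed
  have "odd m" using n(2) m by simp
  note fiber = card_left_factors_Times_nrm_le[OF m0 this c0 le(1), folded B_def]
  note fibers = card_le_fibers[OF near(1) order_refl fiber]
  show "finite (pair_data n q c)" unfolding pair_data_def div by (rule fibers(1))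
  have "real (card (pair_data n q c)) \<le> real (card (near_scalars m q)) * (72 * of_int c * B)"
    unfolding pair_data_def div by (rule fibers(2))
  also have "\<dots> \<le> 8 * (of_int m)\<^sup>2 / of_int q ^ 3 * B * (72 * of_int c * B)"
    using near(2) c0 by (intro mult_right_mono) (auto simp: B_def)
  also have "\<dots> = 576 * B\<^sup>2 * (of_int c * (of_int m)\<^sup>2 / of_int q ^ 3)" by (simp add: power2_eq_square)
  also have "\<dots> \<le> 576 * B\<^sup>2 * ((of_int n)\<^sup>2 / of_int q ^ 3)"
  proof (intro mult_left_mono divide_right_mono)
    have "of_int c * (of_int m)\<^sup>2 \<le> (real_of_int c)\<^sup>2 * (of_int m)\<^sup>2"
      using c0 self_le_power[of "real_of_int c" 2] by (intro mult_right_mono) auto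
    then show "of_int c * (of_int m)\<^sup>2 \<le> (real_of_int n)\<^sup>2" by (simp add: m power_mult_distrib)
  qed (use q in auto)
  finally show "real (card (pair_data n q c)) \<le> 576 * B\<^sup>2 * ((of_int n)\<^sup>2 / of_int q ^ 3)" .
qed

lemma card_congruent_pairs_le:
  assumes n: "n > 0" "odd n" and q: "q > 0" "odd q" "coprime n q"
  defines "B \<equiv> real (max_two_squares (n\<^sup>2))"
  shows "real (card (congruent_pairs n q))
    \<le> 9 * of_int n * B + real (card (pos_divisors n)) * (576 * B\<^sup>2 * ((of_int n)\<^sup>2 / of_int q ^ 3))"
proof -
  let ?D = "pos_divisors n" and ?E = "(\<lambda>y. (y, y)) ` primitive n"
    and ?P = "\<lambda>c. pair_of_data (n div c) ` pair_data n q c"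
  note data = card_pair_data_le[OF n q(1)]
  have D: "finite ?D" by (rule finite_pos_divisors[OF n(1)])
  have "card (congruent_pairs n q) \<le> card (?E \<union> (\<Union>c\<in>?D. ?P c))"
    by (rule card_mono[OF _ congruent_pairs_cover[OF n q(2,3)]]) (use D data(1) finite_primitive in auto)
  also have "\<dots> \<le> card ?E + card (\<Union>c\<in>?D. ?P c)" by (rule card_Un_le)
  also have "card ?E \<le> card (primitive n)" by (rule card_image_le[OF finite_primitive])
  also have "card (\<Union>c\<in>?D. ?P c) \<le> (\<Sum>c\<in>?D. card (pair_data n q c))"
    by (rule order_trans[OF card_UN_le[OF D]]) (intro sum_mono card_image_le data(1))
  finally have "card (congruent_pairs n q) \<le> card (primitive n) + (\<Sum>c\<in>?D. card (pair_data n q c))"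
    by simp
  then have "real (card (congruent_pairs n q))
    \<le> real (card (primitive n)) + (\<Sum>c\<in>?D. real (card (pair_data n q c)))"
    by (simp only: of_nat_le_iff flip: of_nat_add of_nat_sum)
  also have "\<dots> \<le> 9 * of_int n * B + (\<Sum>c\<in>?D. 576 * B\<^sup>2 * ((of_int n)\<^sup>2 / of_int q ^ 3))"
  proof (intro add_mono sum_mono)
    have "max_two_squares n \<le> max_two_squares (n\<^sup>2)"
      using n(1) by (intro max_two_squares_mono self_le_power) auto
    then have "9 * of_int n * real (max_two_squares n) \<le> 9 * of_int n * B"
      unfolding B_def using n(1) by (intro mult_left_mono) auto
    then show "real (card (primitive n)) \<le> 9 * of_int n * B"
      using card_primitive_le[of n] n(1) by linarith
  qed (use data(2) in \<open>simp add: B_def\<close>)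
  finally show ?thesis by simp
qed

lemma congruent_pairs_bound:
  fixes \<epsilon> :: real
  assumes \<epsilon>: "\<epsilon> > 0"
  obtains C where "C > 0" "\<And>n q. n > 0 \<Longrightarrow> odd n \<Longrightarrow> q > 0 \<Longrightarrow> odd q \<Longrightarrow> coprime n q \<Longrightarrow>
    real (card (congruent_pairs n q)) \<le> C * of_int n powr \<epsilon> * (of_int n + (of_int n)\<^sup>2 / of_int q ^ 3)"
proof -
  define \<eta> where "\<eta> = \<epsilon> / 5"
  have \<eta>: "\<eta> > 0" using \<epsilon> by (simp add: \<eta>_def)
  obtain C where C: "C \<ge> 1" "\<And>X. X \<ge> 1 \<Longrightarrow> real (max_two_squares X) \<le> C * of_int X powr \<eta>"
    using max_two_squares_bound[OF \<eta>] by blast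
  obtain D where D: "D \<ge> 1" "\<And>n. n > 0 \<Longrightarrow> real (card (pos_divisors n)) \<le> D * of_int n powr \<eta>"
    using divisor_bound[OF \<eta>] by blast
  define K where "K = 9 * C + 576 * D * C\<^sup>2"
  have "real (card (congruent_pairs n q))
    \<le> K * of_int n powr \<epsilon> * (of_int n + (of_int n)\<^sup>2 / of_int q ^ 3)"
    if n: "n > 0" "odd n" and q: "q > 0" "odd q" "coprime n q" for n q
  proof -
    define N E B where "N = real_of_int n" and "E = (real_of_int n)\<^sup>2 / of_int q ^ 3"
      and "B = real (max_two_squares (n\<^sup>2))"
    have N: "N \<ge> 1" and E: "E \<ge> 0" using n q by (simp_all add: N_def E_def)
    have "(N\<^sup>2) powr \<eta> = N powr (2 * \<eta>)"
      using N by (simp add: power2_eq_square powr_mult powr_add[symmetric])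
    then have B: "B \<le> C * N powr (2 * \<eta>)" using C(2)[of "n\<^sup>2"] n(1) by (simp add: B_def N_def)
    have "real (card (congruent_pairs n q)) \<le> 9 * N * B + real (card (pos_divisors n)) * (576 * B\<^sup>2 * E)"
      using card_congruent_pairs_le[OF n q] by (simp add: N_def E_def B_def)
    also have "\<dots> \<le> 9 * N * (C * N powr (2 * \<eta>)) + D * N powr \<eta> * (576 * (C * N powr (2 * \<eta>))\<^sup>2 * E)"
      using B D n N E by (intro add_mono mult_mono power_mono) (auto simp: N_def B_def)
    also have "\<dots> = 9 * C * N powr (2 * \<eta>) * N + 576 * D * C\<^sup>2 * N powr (5 * \<eta>) * E"
      by (simp add: power2_eq_square powr_add[symmetric])
    also have "\<dots> \<le> K * N powr \<epsilon> * N + K * N powr \<epsilon> * E"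
    proof (intro add_mono mult_right_mono mult_mono)
      show "N powr (2 * \<eta>) \<le> N powr \<epsilon>" "N powr (5 * \<eta>) \<le> N powr \<epsilon>"
        using N \<epsilon> by (auto simp: \<eta>_def intro: powr_mono)
    qed (use C D N E in \<open>auto simp: K_def\<close>)
    finally show ?thesis by (simp add: N_def E_def distrib_left)
  qed
  moreover have "K > 0" using C D by (simp add: K_def add_pos_pos)
  ultimately show thesis using that by blast
qed

section \<open>Power saving\<close>

definition power_saving :: "real \<Rightarrow> int set \<Rightarrow> (int \<Rightarrow> real) \<Rightarrow> bool" where
  "power_saving e N f \<longleftrightarrow> (\<exists>C \<delta>.
    C > 0 \<and> 0 < \<delta> \<and> \<delta> < 1 \<and> (\<forall>n\<in>N. n > 0 \<longrightarrow> \<bar>f n\<bar> \<le> C * of_int n powr (e - \<delta>)))"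

lemma power_savingI:
  "C > 0 \<Longrightarrow> 0 < \<delta> \<Longrightarrow> \<delta> < 1 \<Longrightarrow> (\<And>n. n \<in> N \<Longrightarrow> n > 0 \<Longrightarrow> \<bar>f n\<bar> \<le> C * of_int n powr (e - \<delta>)) \<Longrightarrow> power_saving e N f"
  unfolding power_saving_def by blast

lemma power_savingE:
  assumes "power_saving e N f"
  obtains C \<delta> where "C > 0" "0 < \<delta>" "\<delta> < 1" "\<And>n. n \<in> N \<Longrightarrow> n > 0 \<Longrightarrow> \<bar>f n\<bar> \<le> C * of_int n powr (e - \<delta>)"
  using assms unfolding power_saving_def by blast

lemma power_saving_0: "power_saving e N (\<lambda>_. 0)"
  by (rule power_savingI[of 1 "1 / 2"]) auto

lemma power_saving_minus: "power_saving e N f \<Longrightarrow> power_saving e N (\<lambda>n. - f n)"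
  by (simp add: power_saving_def)

lemma power_saving_abs: "power_saving e N f \<Longrightarrow> power_saving e N (\<lambda>n. \<bar>f n\<bar>)"
  by (simp add: power_saving_def)

lemma power_saving_add:
  assumes "power_saving e N f" "power_saving e N g"
  shows "power_saving e N (\<lambda>n. f n + g n)"
proof -
  obtain C c where f: "C > 0" "0 < c" "c < 1" "\<And>n. n \<in> N \<Longrightarrow> n > 0 \<Longrightarrow> \<bar>f n\<bar> \<le> C * of_int n powr (e - c)"
    using power_savingE[OF assms(1)] by blast
  obtain D d where g: "D > 0" "0 < d" "d < 1" "\<And>n. n \<in> N \<Longrightarrow> n > 0 \<Longrightarrow> \<bar>g n\<bar> \<le> D * of_int n powr (e - d)"
    using power_savingE[OF assms(2)] by blast
  show ?thesis
  proof (rule power_savingI[of "C + D" "min c d"])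
    fix n :: int assume n: "n \<in> N" "n > 0"
    have "C * of_int n powr (e - c) \<le> C * of_int n powr (e - min c d)"
      "D * of_int n powr (e - d) \<le> D * of_int n powr (e - min c d)"
      using n f(1) g(1) by (intro mult_left_mono powr_mono; simp)+
    then show "\<bar>f n + g n\<bar> \<le> (C + D) * of_int n powr (e - min c d)"
      using f(4)[OF n] g(4)[OF n] by (simp add: distrib_right)
  qed (use f g in auto)
qed

lemma power_saving_uniform:
  assumes A: "finite A" and f: "\<And>a. a \<in> A \<Longrightarrow> power_saving e N (f a)"
  obtains C \<delta> where "C > 0" "0 < \<delta>" "\<delta> < 1"
    "\<And>a n. a \<in> A \<Longrightarrow> n \<in> N \<Longrightarrow> n > 0 \<Longrightarrow> \<bar>f a n\<bar> \<le> C * of_int n powr (e - \<delta>)"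
proof -
  have "power_saving e N (\<lambda>n. \<Sum>a\<in>A. \<bar>f a n\<bar>)"
    using A f by (induction A rule: finite_induct)
      (simp_all add: power_saving_0 power_saving_add power_saving_abs)
  then obtain C \<delta> where C: "C > 0" "0 < \<delta>" "\<delta> < 1"
    and bound: "\<And>n. n \<in> N \<Longrightarrow> n > 0 \<Longrightarrow> \<bar>\<Sum>a\<in>A. \<bar>f a n\<bar>\<bar> \<le> C * of_int n powr (e - \<delta>)"
    by (rule power_savingE) blast
  have "\<bar>f a n\<bar> \<le> C * of_int n powr (e - \<delta>)" if "a \<in> A" "n \<in> N" "n > 0" for a n
  proof -
    have "\<bar>f a n\<bar> \<le> (\<Sum>a\<in>A. \<bar>f a n\<bar>)" using A that(1) by (intro member_le_sum) auto
    then show ?thesis using bound[OF that(2,3)] by linarith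
  qed
  then show thesis using that[OF C] by blast
qed

subsection \<open>Cuspidal sums over primitive quaternions\<close>

context odd_prime
begin

lemma power_rate:
  fixes \<theta> :: real
  assumes "9 / 10 \<le> \<theta>" "\<theta> < 1"
  obtains \<sigma> where "0 < \<sigma>" "\<sigma> < 1" "\<And>k. \<theta> ^ k = of_int (l ^ k) powr (- \<sigma>)"
proof -
  define \<sigma> where "\<sigma> = - ln \<theta> / ln (of_int l)"
  have l: "ln (real_of_int l) > 0" using l_gt_2 by simp
  have \<theta>: "ln \<theta> < 0" "\<theta> > 0" using assms by simp_all
  have "3 * (9 / 10) \<le> of_int l * \<theta>" using assms l_gt_2 by (intro mult_mono) auto
  then have "ln (of_int l * \<theta>) > 0" by simp
  then have "- ln \<theta> < ln (of_int l)" using l_gt_2 \<theta> by (simp add: ln_mult)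
  then have "\<sigma> < 1" unfolding \<sigma>_def using l by (subst pos_divide_less_eq) auto
  moreover have "\<sigma> > 0" using l \<theta> by (simp add: \<sigma>_def divide_neg_pos)
  moreover have "\<theta> ^ k = of_int (l ^ k) powr (- \<sigma>)" for k
    using l_gt_2 l \<theta> by (simp add: powr_def ln_realpow \<sigma>_def exp_of_nat2_mult)
  ultimately show thesis using that by blast
qed

lemma cube_scale:
  assumes "m > 0"
  obtains k where "(l ^ k) ^ 3 \<le> m" "m < (l ^ Suc k) ^ 3"
proof -
  have "nat l ^ 1 \<le> nat l ^ 3" using l_gt_2 by (intro power_increasing) auto
  then have "2 \<le> nat l ^ 3" using l_gt_2 by simp
  then obtain k where k: "(nat l ^ 3) ^ k \<le> nat m" "nat m < (nat l ^ 3) ^ (k + 1)"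
    using ex_power_ivl1[of "nat l ^ 3" "nat m"] assms by (metis One_nat_def Suc_leI zero_less_nat_eq)
  have cube: "int ((nat l ^ 3) ^ j) = (l ^ j) ^ 3" for j
    using l_gt_2 by (simp add: power_mult[symmetric] mult.commute)
  have "int ((nat l ^ 3) ^ k) \<le> int (nat m)" "int (nat m) < int ((nat l ^ 3) ^ (k + 1))"
    using k by (simp_all only: of_nat_le_iff of_nat_less_iff)
  then show thesis using that[of k] assms unfolding cube by simp
qed

end

context level
begin

lemma rate_at_cube_scale:
  assumes \<theta>: "9 / 10 \<le> \<theta>" "\<theta> < 1" and \<sigma>: "0 < \<sigma>" "\<And>k. \<theta> ^ k = of_int (l ^ k) powr (- \<sigma>)" and m: "m > 0"
  obtains k where "(l ^ k) ^ 3 \<le> m"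
    "real (Suc k) * \<theta> ^ k * \<theta> ^ k \<le> (1 / ln (1 / \<theta>) + 1) * (1 / \<theta> * of_int m powr (- \<sigma> / 3))"
proof -
  obtain k where k: "(l ^ k) ^ 3 \<le> m" "m < (l ^ Suc k) ^ 3" using cube_scale[OF m] .
  define N Q where "N = real_of_int m" and "Q = real_of_int (l ^ Suc k)"
  have N: "N \<ge> 1" using m by (simp add: N_def)
  have Q: "Q > 0" using l_pow_pos[of "Suc k"] unfolding Q_def of_int_0_less_iff .
  have "real_of_int m < of_int ((l ^ Suc k) ^ 3)" using k(2) unfolding of_int_less_iff .
  then have "N < Q ^ 3" unfolding Q_def N_def of_int_power .
  then have "(Q ^ 3) powr (- \<sigma> / 3) \<le> N powr (- \<sigma> / 3)" using \<sigma>(1) N by (intro powr_mono2') auto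
  moreover have "Q ^ 3 = Q powr 3" using Q by simp
  ultimately have "Q powr (- \<sigma>) \<le> N powr (- \<sigma> / 3)" by (simp only: powr_powr) simp
  then have "\<theta> ^ Suc k \<le> N powr (- \<sigma> / 3)" unfolding \<sigma>(2) Q_def .
  then have \<theta>_k: "\<theta> ^ k \<le> 1 / \<theta> * N powr (- \<sigma> / 3)" using \<theta> by (simp add: field_simps)
  have "1 / ln (1 / \<theta>) + 1 > 0" using \<theta> by (intro add_pos_pos) auto
  moreover have "real (Suc k) * \<theta> ^ k \<le> 1 / ln (1 / \<theta>) + 1"
    using Suc_le_mult_power[of "1 / \<theta>" k] \<theta> by (simp add: power_divide field_simps)
  ultimately have "real (Suc k) * \<theta> ^ k * \<theta> ^ k \<le> (1 / ln (1 / \<theta>) + 1) * (1 / \<theta> * N powr (- \<sigma> / 3))"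
    using \<theta>_k \<theta> by (intro mult_mono) auto
  then show thesis using that[OF k(1)] by (simp only: N_def)
qed

lemma cuspidal_primitive_sum_square_le:
  assumes \<theta>: "9 / 10 \<le> \<theta>" "\<theta> < 1" and C: "C > 0" and decay: "restricted_hecke_decay \<theta> C"
    and \<sigma>: "0 < \<sigma>" "\<And>k. \<theta> ^ k = of_int (l ^ k) powr (- \<sigma>)"
    and D: "D > 0" "\<And>k. real (card (congruent_pairs m (l ^ k)))
      \<le> D * N powr (\<sigma> / 6) * (N + N\<^sup>2 / of_int (l ^ k) ^ 3)"
    and m: "m > 0" "\<not> l dvd m" "N = of_int m" and h: "h \<in> cuspidal"
  defines "K \<equiv> C\<^sup>2 * (1 / ln (1 / \<theta>) + 1) * (1 / \<theta>) * (2 * D)"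
  shows "(\<Sum>y\<in>primitive m. h y)\<^sup>2 \<le> K * (N powr (1 - \<sigma> / 12))\<^sup>2 * (l2norm h)\<^sup>2"
proof -
  have N: "N \<ge> 1" using m by simp
  have K0: "1 / ln (1 / \<theta>) + 1 > 0" using \<theta> by (intro add_pos_pos) auto
  obtain k where k: "(l ^ k) ^ 3 \<le> m"
    and rate: "real (Suc k) * \<theta> ^ k * \<theta> ^ k \<le> (1 / ln (1 / \<theta>) + 1) * (1 / \<theta> * N powr (- \<sigma> / 3))"
    using rate_at_cube_scale[OF \<theta> \<sigma> m(1)] unfolding m(3) by blast
  define Q where "Q = real_of_int (l ^ k)"
  have Q: "Q > 0" using l_pow_pos[of k] unfolding Q_def of_int_0_less_iff .
  have "real_of_int ((l ^ k) ^ 3) \<le> of_int m" using k unfolding of_int_le_iff .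
  then have Q3: "Q ^ 3 \<le> N" unfolding Q_def m(3) of_int_power .
  have pairs: "Q ^ 3 * real (card (congruent_pairs m (l ^ k))) \<le> 2 * D * N powr (\<sigma> / 6) * N\<^sup>2"
  proof -
    have "Q ^ 3 * real (card (congruent_pairs m (l ^ k)))
      \<le> Q ^ 3 * (D * N powr (\<sigma> / 6) * (N + N\<^sup>2 / Q ^ 3))"
      using D(2)[of k] Q unfolding Q_def by (intro mult_left_mono) auto
    also have "\<dots> = D * N powr (\<sigma> / 6) * (Q ^ 3 * N + N\<^sup>2)" using Q by (simp add: field_simps)
    also have "\<dots> \<le> D * N powr (\<sigma> / 6) * (N * N + N\<^sup>2)"
      using Q3 N D(1) by (intro mult_left_mono add_mono mult_right_mono) auto
    finally show ?thesis by (simp add: power2_eq_square)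
  qed
  have "C\<^sup>2 * (real (Suc k) * \<theta> ^ k * \<theta> ^ k) * (Q ^ 3 * real (card (congruent_pairs m (l ^ k))))
    * (l2norm h)\<^sup>2
    \<le> C\<^sup>2 * ((1 / ln (1 / \<theta>) + 1) * (1 / \<theta> * N powr (- \<sigma> / 3))) * (2 * D * N powr (\<sigma> / 6) * N\<^sup>2)
      * (l2norm h)\<^sup>2"
    by (rule mult_right_mono[OF mult_mono[OF mult_left_mono[OF rate] pairs]]) (use \<theta> Q D(1) K0 in auto)
  also have "\<dots> = K * (N powr (- \<sigma> / 3) * N powr (\<sigma> / 6) * N powr 2) * (l2norm h)\<^sup>2"
    using N by (simp add: K_def)
  also have "N powr (- \<sigma> / 3) * N powr (\<sigma> / 6) * N powr 2 = (N powr (1 - \<sigma> / 12))\<^sup>2"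
    by (simp add: power2_eq_square powr_add[symmetric])
  finally show ?thesis
    using cuspidal_sum_square_le[OF \<theta>(1) less_imp_le[OF C] decay h m(2), of k]
    unfolding Q_def mult_2 power_add by (simp add: mult_ac del: of_nat_Suc)
qed

lemma cuspidal_primitive_sum_coprime:
  assumes \<theta>: "9 / 10 \<le> \<theta>" "\<theta> < 1" and C: "C > 0" and decay: "restricted_hecke_decay \<theta> C"
  obtains K \<delta> where "K > 0" "0 < \<delta>" "\<delta> < 1"
    "\<And>h m. h \<in> cuspidal \<Longrightarrow> m > 0 \<Longrightarrow> odd m \<Longrightarrow> \<not> l dvd m \<Longrightarrow>
      \<bar>\<Sum>y\<in>primitive m. h y\<bar> \<le> K * of_int m powr (1 - \<delta>) * l2norm h"
proof -
  obtain \<sigma> where \<sigma>: "0 < \<sigma>" "\<sigma> < 1" "\<And>k. \<theta> ^ k = of_int (l ^ k) powr (- \<sigma>)"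
    using power_rate[OF \<theta>] by blast
  obtain D where D: "D > 0" "\<And>n q. n > 0 \<Longrightarrow> odd n \<Longrightarrow> q > 0 \<Longrightarrow> odd q \<Longrightarrow> coprime n q \<Longrightarrow>
    real (card (congruent_pairs n q))
      \<le> D * of_int n powr (\<sigma> / 6) * (of_int n + (of_int n)\<^sup>2 / of_int q ^ 3)"
    using congruent_pairs_bound[of "\<sigma> / 6"] \<sigma> by auto
  define K where "K = C\<^sup>2 * (1 / ln (1 / \<theta>) + 1) * (1 / \<theta>) * (2 * D)"
  have "ln (1 / \<theta>) > 0" using \<theta> by simp
  then have "1 / ln (1 / \<theta>) + 1 > 0" by (simp add: add_pos_pos)
  then have K: "K > 0" using C D(1) \<theta> by (simp add: K_def)
  have "\<bar>\<Sum>y\<in>primitive m. h y\<bar> \<le> sqrt K * of_int m powr (1 - \<sigma> / 12) * l2norm h"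
    if h: "h \<in> cuspidal" and m: "m > 0" "odd m" "\<not> l dvd m" for h m
  proof -
    have pairs: "real (card (congruent_pairs m (l ^ k)))
      \<le> D * of_int m powr (\<sigma> / 6) * (of_int m + (of_int m)\<^sup>2 / of_int (l ^ k) ^ 3)" for k
      using coprime_l_pow[OF m(3)] by (intro D(2) m odd_l_pow l_pow_pos) (simp add: coprime_commute)
    have "\<bar>\<Sum>y\<in>primitive m. h y\<bar>\<^sup>2 \<le> (sqrt K * of_int m powr (1 - \<sigma> / 12) * l2norm h)\<^sup>2"
      using cuspidal_primitive_sum_square_le[OF \<theta> C decay \<sigma>(1,3) D(1) pairs m(1,3) refl h] K
      unfolding K_def[symmetric] by (simp add: power_mult_distrib)
    then show ?thesis using K by (elim power2_le_imp_le) simp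
  qed
  then show thesis using that[of "sqrt K" "\<sigma> / 12"] K \<sigma> by simp
qed

text \<open>For \<open>n = l ^ j * m\<close> the sum of \<open>h\<close> over norm \<open>n\<close> is a sum of \<open>hecke_op j h\<close> over norm \<open>m\<close>; both the operator
  and the shorter sum save a power.\<close>

lemma cuspidal_primitive_sum:
  obtains K \<delta> where "K > 0" "0 < \<delta>" "\<delta> < 1"
    "\<And>h n. h \<in> cuspidal \<Longrightarrow> n > 0 \<Longrightarrow> odd n \<Longrightarrow> \<bar>\<Sum>y\<in>primitive n. h y\<bar> \<le> K * of_int n powr (1 - \<delta>) * l2norm h"
proof -
  obtain \<theta> C where \<theta>: "9 / 10 \<le> \<theta>" "\<theta> < 1" and C: "C > 0" and decay: "restricted_hecke_decay \<theta> C"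
    using restricted_hecke_decay_exists .
  obtain \<sigma> where \<sigma>: "0 < \<sigma>" "\<sigma> < 1" "\<And>k. \<theta> ^ k = of_int (l ^ k) powr (- \<sigma>)"
    using power_rate[OF \<theta>] by blast
  obtain K \<delta> where K: "K > 0" "0 < \<delta>" "\<delta> < 1"
    and coprime: "\<And>h m. h \<in> cuspidal \<Longrightarrow> m > 0 \<Longrightarrow> odd m \<Longrightarrow> \<not> l dvd m \<Longrightarrow>
      \<bar>\<Sum>y\<in>primitive m. h y\<bar> \<le> K * of_int m powr (1 - \<delta>) * l2norm h"
    using cuspidal_primitive_sum_coprime[OF \<theta> C decay] by blast
  define \<rho> where "\<rho> = min \<sigma> \<delta>"
  have \<rho>: "0 < \<rho>" "\<rho> < 1" "\<rho> \<le> \<sigma>" "\<rho> \<le> \<delta>" using \<sigma> K by (auto simp: \<rho>_def)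
  have "\<bar>\<Sum>y\<in>primitive n. h y\<bar> \<le> K * C * of_int n powr (1 - \<rho>) * l2norm h"
    if h: "h \<in> cuspidal" and n: "n > 0" "odd n" for h n
  proof -
    obtain j m where m: "n = l ^ j * m" "\<not> l dvd m"
      using multiplicity_decompose'[of n l] n prime_l not_prime_unit by (metis less_irrefl)
    define a where "a = real_of_int (l ^ j)"
    have a: "a \<ge> 1" unfolding a_def of_int_1_le_iff using l_pow_pos[of j] by linarith
    have m_pos: "m > 0" using m n l_pow_pos[of j] by (metis zero_less_mult_pos)
    have n_eq: "of_int n = a * of_int m" by (simp add: m(1) a_def)
    have "8 * (\<Sum>y\<in>primitive n. h y) = (\<Sum>c\<in>primitive (l ^ j). \<Sum>y\<in>primitive m. h (c * y))"
      unfolding m(1) using odd_l_pow l_pow_pos coprime_l_pow[OF m(2)]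
      by (intro sum_primitive_mult[symmetric]) auto
    also have "\<dots> = (\<Sum>y\<in>primitive m. hecke_op j h y)" unfolding hecke_op_def by (rule sum.swap)
    also have "\<bar>\<dots>\<bar> \<le> K * of_int m powr (1 - \<delta>) * l2norm (hecke_op j h)"
      using m n by (intro coprime cuspidal_hecke_op h m_pos) auto
    also have "\<dots> \<le> K * of_int m powr (1 - \<delta>) * (C * (of_int l * \<theta>) ^ j * l2norm h)"
      using K by (intro mult_left_mono hecke_decay[OF decay h]) auto
    also have "(of_int l * \<theta>) ^ j = a powr (1 - \<sigma>)"
      using a unfolding power_mult_distrib \<sigma>(3) by (simp add: a_def powr_diff powr_minus divide_inverse)
    also have "K * of_int m powr (1 - \<delta>) * (C * a powr (1 - \<sigma>) * l2norm h)
      \<le> K * of_int m powr (1 - \<rho>) * (C * a powr (1 - \<rho>) * l2norm h)"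
      using K C m_pos a \<rho> by (intro mult_mono powr_mono mult_nonneg_nonneg) auto
    also have "\<dots> = K * C * of_int n powr (1 - \<rho>) * l2norm h"
      unfolding n_eq using a m_pos by (simp add: powr_mult)
    finally have "\<bar>8 * (\<Sum>y\<in>primitive n. h y)\<bar> \<le> K * C * of_int n powr (1 - \<rho>) * l2norm h" .
    then show ?thesis by (simp add: abs_mult)
  qed
  then show thesis using that[of "K * C" \<rho>] K C \<rho> by simp
qed

end

subsection \<open>Cuspidal sums over spheres\<close>

lemma sum_nrm_by_content:
  fixes F :: "quat \<Rightarrow> real"
  assumes n: "n > 0"
  shows "(\<Sum>x | nrm x = n. F x)
    = (\<Sum>c | c \<in> pos_divisors n \<and> c\<^sup>2 dvd n. \<Sum>y\<in>primitive (n div c\<^sup>2). F (of_int c * y))"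
proof -
  let ?S = "{x. nrm x = n}" and ?I = "{c \<in> pos_divisors n. c\<^sup>2 dvd n}"
  have "content ` ?S \<subseteq> ?I"
  proof (rule image_subsetI)
    fix x assume "x \<in> ?S"
    then have "(content x)\<^sup>2 dvd n" "x \<noteq> 0" using content_square_dvd_nrm[of x] n by auto
    moreover have "content x dvd n" using \<open>(content x)\<^sup>2 dvd n\<close> by (metis dvd_mult_left power2_eq_square)
    ultimately show "content x \<in> ?I" using content_ge_0[of x] by (simp add: pos_divisors_def less_le)
  qed
  then have "(\<Sum>x\<in>?S. F x) = (\<Sum>c\<in>?I. \<Sum>x | x \<in> ?S \<and> content x = c. F x)"
    using finite_nrm finite_pos_divisors[OF n] by (intro sum.group[symmetric]) auto
  also have "\<dots> = (\<Sum>c\<in>?I. \<Sum>y\<in>primitive (n div c\<^sup>2). F (of_int c * y))"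
  proof (rule sum.cong[OF refl])
    fix c assume "c \<in> ?I"
    then have c: "c > 0" "c\<^sup>2 dvd n" by (auto simp: pos_divisors_def)
    have "bij_betw (\<lambda>y. of_int c * y) (primitive (n div c\<^sup>2)) {x \<in> ?S. content x = c}"
    proof (rule bij_betw_imageI)
      show "inj_on (\<lambda>y. of_int c * y) (primitive (n div c\<^sup>2))" using c(1) by (simp add: inj_on_def)
      show "(\<lambda>y. of_int c * y) ` primitive (n div c\<^sup>2) = {x \<in> ?S. content x = c}"
      proof (intro Set.set_eqI iffI)
        fix x assume x: "x \<in> {x \<in> ?S. content x = c}"
        then have "x \<noteq> 0" using n by auto
        then obtain y where y: "x = of_int c * y" "content y = 1" using content_decomp x by blast
        then have "y \<in> primitive (n div c\<^sup>2)" using x c(1) by (auto simp: primitive_def nrm_mult)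
        then show "x \<in> (\<lambda>y. of_int c * y) ` primitive (n div c\<^sup>2)" using y by blast
      qed (use c in \<open>auto simp: primitive_def nrm_mult content_of_int_mult\<close>)
    qed
    then show "(\<Sum>x | x \<in> ?S \<and> content x = c. F x) = (\<Sum>y\<in>primitive (n div c\<^sup>2). F (of_int c * y))"
      using sum.reindex_bij_betw[of "\<lambda>y. of_int c * y" "primitive (n div c\<^sup>2)" "{x \<in> ?S. content x = c}" F] by simp
  qed
  finally show ?thesis .
qed

lemma (in level) cuspidal_sum_multiples_le:
  assumes h: "h \<in> cuspidal" and vanish: "\<And>x. qdvd p x \<Longrightarrow> h x = 0" and B: "B \<ge> 0"
    and bound: "\<And>h. h \<in> cuspidal \<Longrightarrow> \<bar>\<Sum>y\<in>Y. h y\<bar> \<le> B * l2norm h"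
  shows "\<bar>\<Sum>y\<in>Y. h (of_int c * y)\<bar> \<le> B * l2norm h"
proof (cases "p dvd c")
  case True
  then have "h (of_int c * y) = 0" for y by (intro vanish qdvd_of_int_mult_dvd)
  then show ?thesis using B by simp
next
  case False
  have "\<bar>\<Sum>y\<in>Y. h (of_int c * y)\<bar> \<le> B * l2norm (\<lambda>y. h (of_int c * y))"
    by (rule bound[OF cuspidal_of_int_mult[OF h False]])
  also have "l2norm (\<lambda>y. h (of_int c * y)) = l2norm h"
    by (rule l2norm_mult_left[OF cuspidal_periodic[OF h] p_not_dvd_nrm_of_int[OF False]])
  finally show ?thesis .
qed

lemma (in level) power_saving_cuspidal:
  assumes h: "h \<in> cuspidal" and vanish: "\<And>x. qdvd p x \<Longrightarrow> h x = 0"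
  shows "power_saving 1 {n. odd n} (\<lambda>n. \<Sum>x | nrm x = n. h x)"
proof -
  obtain K \<delta> where K: "K > 0" "0 < \<delta>" "\<delta> < 1"
    and bound: "\<And>h n. h \<in> cuspidal \<Longrightarrow> n > 0 \<Longrightarrow> odd n \<Longrightarrow>
      \<bar>\<Sum>y\<in>primitive n. h y\<bar> \<le> K * of_int n powr (1 - \<delta>) * l2norm h"
    using cuspidal_primitive_sum by blast
  obtain D where D: "D \<ge> 1" "\<And>n. n > 0 \<Longrightarrow> real (card (pos_divisors n)) \<le> D * of_int n powr (\<delta> / 2)"
    using divisor_bound[of "\<delta> / 2"] K by auto
  show ?thesis
  proof (rule power_savingI[of "D * (K * l2norm h) + 1" "\<delta> / 2"])
    fix n :: int assume "n \<in> {n. odd n}" and n: "n > 0"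
    define N B where "N = real_of_int n" and "B = K * N powr (1 - \<delta>) * l2norm h"
    have B: "B \<ge> 0" using K by (simp add: B_def)
    let ?I = "{c \<in> pos_divisors n. c\<^sup>2 dvd n}"
    have primitive_sum: "\<bar>\<Sum>y\<in>primitive (n div c\<^sup>2). h (of_int c * y)\<bar> \<le> B" if c: "c \<in> ?I" for c
    proof -
      obtain m where m: "n = c\<^sup>2 * m" using c by (auto elim: dvdE)
      have c_pos: "c > 0" using c by (simp add: pos_divisors_def)
      then have m_pos: "m > 0" "odd m" using m n \<open>n \<in> {n. odd n}\<close> by (auto simp: zero_less_mult_iff)
      have "1 * m \<le> n" unfolding m
        using c_pos m_pos by (intro mult_right_mono) (auto simp: int_one_le_iff_zero_less)
      have "\<bar>\<Sum>y\<in>primitive m. h (of_int c * y)\<bar> \<le> K * of_int m powr (1 - \<delta>) * l2norm h"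
        using K by (intro cuspidal_sum_multiples_le h vanish bound m_pos) auto
      also have "\<dots> \<le> B"
        unfolding B_def N_def
        using K m_pos \<open>1 * m \<le> n\<close> by (intro mult_right_mono mult_left_mono powr_mono2) auto
      finally show ?thesis using m c_pos by simp
    qed
    have "\<bar>\<Sum>x | nrm x = n. h x\<bar> \<le> (\<Sum>c\<in>?I. \<bar>\<Sum>y\<in>primitive (n div c\<^sup>2). h (of_int c * y)\<bar>)"
      unfolding sum_nrm_by_content[OF n] by (rule sum_abs)
    also have "\<dots> \<le> (\<Sum>c\<in>?I. B)" using primitive_sum by (rule sum_mono)
    also have "\<dots> = real (card ?I) * B" by simp
    also have "\<dots> \<le> D * N powr (\<delta> / 2) * B"
    proof (rule mult_right_mono[OF _ B])
      have "card ?I \<le> card (pos_divisors n)" by (rule card_mono[OF finite_pos_divisors[OF n]]) auto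
      then show "real (card ?I) \<le> D * N powr (\<delta> / 2)" using D(2)[OF n] unfolding N_def by linarith
    qed
    also have "\<dots> = D * (K * l2norm h) * N powr (1 - \<delta> / 2)" by (simp add: B_def powr_add[symmetric])
    also have "\<dots> \<le> (D * (K * l2norm h) + 1) * N powr (1 - \<delta> / 2)" by (simp add: distrib_right)
    finally show "\<bar>\<Sum>x | nrm x = n. h x\<bar> \<le> (D * (K * l2norm h) + 1) * of_int n powr (1 - \<delta> / 2)"
      by (simp add: N_def)
  qed (use K D in \<open>auto intro!: add_nonneg_pos\<close>)
qed

section \<open>Residue classes in dimension four\<close>

lemma qdvd_mult_coprime: "coprime m (nrm a) \<Longrightarrow> qdvd m (a * x) \<longleftrightarrow> qdvd m x"
proof
  assume m: "coprime m (nrm a)"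
  assume "qdvd m (a * x)"
  then have "qdvd m (qcnj a * (a * x))" by (rule qdvd_mult_left)
  then show "qdvd m x" using qdvd_of_int_mult_coprime[OF m] by (simp add: mult_qcnj_assoc)
qed (rule qdvd_mult_left)

lemma qcong_mult_left_coprime: "coprime m (nrm a) \<Longrightarrow> qcong m (a * x) (a * y) \<longleftrightarrow> qcong m x y"
  by (simp add: qcong_def qdvd_mult_coprime flip: right_diff_distrib)

lemma qcong_left_quotient:
  assumes "coprime (nrm a) m"
  obtains w where "qcong m (a * w) u"
proof -
  obtain c where c: "m dvd c * nrm a - 1" using inverse_mod[OF assms] .
  have "a * (of_int c * (qcnj a * u)) = of_int (c * nrm a) * u"
    by (simp only: of_int_mult_left_commute[of a c] mult_qcnj_assoc of_int_mult mult.assoc)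
  moreover have "qcong m (of_int (c * nrm a) * u) (of_int 1 * u)" by (rule qcong_of_int_mult[OF c])
  ultimately show thesis using that[of "of_int c * (qcnj a * u)"] by simp
qed

lemma qcong_right_quotient:
  assumes "coprime (nrm a) m"
  obtains w where "qcong m (w * a) u"
proof -
  obtain w where "qcong m (qcnj a * w) (qcnj u)"
    using qcong_left_quotient[of "qcnj a" m "qcnj u"] assms by auto
  then have "qcong m (qcnj w * a) u" using qcong_qcnj[of m "qcnj w * a" u] by (simp add: qcnj_mult)
  then show thesis by (rule that)
qed

definition class_count :: "int \<Rightarrow> quat \<Rightarrow> int \<Rightarrow> nat" where
  "class_count p u n = card {x. nrm x = n \<and> qcong p x u}"

lemma class_count_cong: "qcong p u v \<Longrightarrow> class_count p u n = class_count p v n"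
  by (simp add: class_count_def qcong_cong_right)

lemma class_count_qcnj: "class_count p (qcnj u) n = class_count p u n"
  unfolding class_count_def
proof (rule bij_betw_same_card[of qcnj], rule bij_betw_byWitness[where f' = qcnj])
  show "qcnj ` {x. nrm x = n \<and> qcong p x (qcnj u)} \<subseteq> {x. nrm x = n \<and> qcong p x u}"
    using qcong_qcnj[of p _ "qcnj u"] by auto
qed auto

lemma class_count_left_multiples:
  assumes e: "coprime p (nrm e)" "e \<noteq> 0"
  shows "card {x. nrm x = nrm e * n \<and> x \<in> range (\<lambda>y. e * y) \<and> qcong p x (e * u)} = class_count p u n"
  unfolding class_count_def
proof (rule bij_betw_same_card[symmetric])
  show "bij_betw (\<lambda>y. e * y) {y. nrm y = n \<and> qcong p y u}
    {x. nrm x = nrm e * n \<and> x \<in> range (\<lambda>y. e * y) \<and> qcong p x (e * u)}"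
    using e by (intro bij_betw_imageI) (auto simp: inj_on_def nrm_mult qcong_mult_left_coprime)
qed

lemma class_count_unit:
  assumes e: "nrm e = 1"
  shows "class_count p (e * u) n = class_count p u n"
proof -
  have "x = e * (qcnj e * x)" for x by (simp add: mult_qcnj_assoc e)
  then have "range (\<lambda>y. e * y) = UNIV" by blast
  moreover have "e \<noteq> 0" using e by auto
  ultimately show ?thesis using class_count_left_multiples[of p e n u] e by (auto simp: class_count_def)
qed

lemma class_count_eq_sum: "real (class_count p u n) = (\<Sum>x | nrm x = n. of_bool (qcong p x u))"
  using finite_nrm by (simp add: class_count_def sum_of_bool_eq Collect_conj_eq)

definition equidistributed :: "int \<Rightarrow> quat \<Rightarrow> quat \<Rightarrow> bool" where
  "equidistributed p u v \<longleftrightarrow> power_saving 1 {n. odd n} (\<lambda>n.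
    real (class_count p u n) - real (class_count p v n))"

lemma equidistributedI: "(\<And>n. class_count p u n = class_count p v n) \<Longrightarrow> equidistributed p u v"
  by (simp add: equidistributed_def power_saving_0)

lemma equidistributed_sym: "equidistributed p u v \<Longrightarrow> equidistributed p v u"
  unfolding equidistributed_def by (drule power_saving_minus) simp

lemma equidistributed_trans [trans]: "equidistributed p u v \<Longrightarrow> equidistributed p v w \<Longrightarrow>
  equidistributed p u w"
  unfolding equidistributed_def by (drule (1) power_saving_add) simp

lemma equidistributed_qcong: "qcong p u v \<Longrightarrow> equidistributed p u v"
  by (rule equidistributedI) (rule class_count_cong)

lemma equidistributed_qcnj: "equidistributed p (qcnj u) (qcnj v) \<longleftrightarrow> equidistributed p u v"
  by (simp add: equidistributed_def class_count_qcnj)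

subsection \<open>Moves between classes of equal norm\<close>

context level
begin

lemma l2inner_indicator:
  assumes "periodic p f"
  shows "l2inner (\<lambda>x. of_bool (qcong p x t)) f = f t"
proof -
  have t: "quat_mod t p \<in> quat_residues p" using p.l_gt_2 by (simp add: quat_mod_in_quat_residues)
  have "l2inner (\<lambda>x. of_bool (qcong p x t)) f
    = (\<Sum>x\<in>quat_residues p. if x = quat_mod t p then f x else 0)"
    unfolding l2inner_def
    by (intro sum.cong refl) (auto simp: quat_mod_residue simp flip: quat_mod_eq_iff)
  also have "\<dots> = f (quat_mod t p)" using t by (simp add: finite_quat_residues)
  also have "\<dots> = f t" by (rule periodicD[OF assms qcong_sym[OF qcong_quat_mod]])
  finally show ?thesis .
qed

lemma equidistributed_if_norm_invariant_eq:
  assumes v: "\<not> qdvd p v" and w: "\<not> qdvd p w" and eq: "\<And>f. norm_invariant f \<Longrightarrow> f v = f w"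
  shows "equidistributed p v w"
proof -
  define h :: "quat \<Rightarrow> real" where "h x = of_bool (qcong p x v) - of_bool (qcong p x w)" for x
  have "periodic p h" by (simp add: periodic_def h_def qcong_cong_left)
  moreover have "l2inner h f = 0" if f: "norm_invariant f" for f
  proof -
    have "l2inner h f = l2inner (\<lambda>x. of_bool (qcong p x v)) f - l2inner (\<lambda>x. of_bool (qcong p x w)) f"
      by (simp only: l2inner_def h_def left_diff_distrib sum_subtractf)
    then show ?thesis using eq[OF f] by (simp add: l2inner_indicator norm_invariant_periodic[OF f])
  qed
  ultimately have "h \<in> cuspidal" by (simp add: cuspidal_def)
  moreover have "h x = 0" if "qdvd p x" for x using that v w qcong_qdvd_iff by (auto simp: h_def)
  ultimately have "power_saving 1 {n. odd n} (\<lambda>n. \<Sum>x | nrm x = n. h x)" by (rule power_saving_cuspidal)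
  then show ?thesis by (simp add: equidistributed_def class_count_eq_sum h_def sum_subtractf)
qed

lemma equidistributed_mult_nrm_l:
  assumes a: "nrm a = l" "nrm a' = l" and u: "\<not> qdvd p u"
  shows "equidistributed p (a * (a' * u)) (of_int l * u)"
proof (rule equidistributed_if_norm_invariant_eq)
  have l: "coprime p l" using p.coprime_l[OF p_not_dvd_l] by (simp add: coprime_commute)
  then show "\<not> qdvd p (a * (a' * u))" "\<not> qdvd p (of_int l * u)"
    using u a by (simp_all add: qdvd_mult_coprime qdvd_of_int_mult_coprime)
  fix f assume f: "norm_invariant f"
  show "f (a * (a' * u)) = f (of_int l * u)"
    using norm_invariantD[OF f, of a "qcnj a'" "a' * u"] a by (simp add: mult_qcnj_assoc)
qed

end

lemma (in odd_prime) left_factor_nrm_l: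
  assumes "l dvd nrm w"
  obtains a d where "nrm a = l" "w = a * d"
proof (cases "qdvd l w")
  case True
  then obtain w' where w': "w = of_int l * w'" by (rule qdvdE)
  have "primitive l \<noteq> {}" using card_primitive_l l_gt_2 by auto
  then obtain a where "nrm a = l" by (auto simp: primitive_def)
  moreover have "w = a * (qcnj a * w')" by (simp add: mult_qcnj_assoc w' \<open>nrm a = l\<close>)
  ultimately show thesis by (rule that)
next
  case False
  then have "card (left_factors (l ^ 1) w) = 8" using assms by (intro card_left_factors_l) simp_all
  then have "left_factors l w \<noteq> {}" by auto
  then show thesis using that by (auto simp: left_factors_def)
qed

lemma qcong_mult_self: "qcong m ((1 + g) * (1 + g)) (of_int (2 + tr g) * g)" if "m dvd nrm g - 1"
proof -
  have "(1 + g) * (1 + g) - of_int (2 + tr g) * g = of_int (- (nrm g - 1)) * 1"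
    by (simp add: quat_eq_iff tr_def nrm_def power2_eq_square algebra_simps)
  then show ?thesis using qdvd_of_int_mult_dvd[of m "- (nrm g - 1)" 1] that
    by (simp only: qcong_def dvd_minus_iff)
qed

lemma odd_nrm_representative:
  assumes "odd p"
  obtains y where "qcong p y x" "odd (nrm y)"
proof (cases "odd (nrm x)")
  case False
  have "nrm (x + of_int p) = nrm x + (2 * (p * q0 x) + p * p)"
    by (simp add: nrm_def power2_eq_square algebra_simps)
  then have "odd (nrm (x + of_int p))" using False assms by simp
  then show thesis using that[of "x + of_int p"] by (simp add: qcong_def)
qed (use that[of x] in simp)

context
  fixes p :: int
  assumes prime_p: "prime p" and odd_p: "odd p"
begin

interpretation p: odd_prime p
  by standard (rule prime_p odd_p)+

lemma coprime_p: "\<not> p dvd c \<Longrightarrow> coprime p c"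
  using p.coprime_l by (simp add: coprime_commute)

lemma equidistributed_nrm_square:
  assumes "c > 0" "odd c" "\<not> p dvd c" "nrm w = c\<^sup>2" "\<not> qdvd p u"
  shows "equidistributed p (w * u) (of_int c * u)"
  using assms
proof (induction "nat c" arbitrary: c w u rule: less_induct)
  case less
  show ?case
  proof (cases "c = 1")
    case True
    then show ?thesis using less.prems by (intro equidistributedI) (simp add: class_count_unit)
  next
    case False
    then obtain l where l: "prime l" "l dvd c" using prime_divisor_exists[of c] less.prems(1) by auto
    then obtain b where b: "c = l * b" by (auto elim: dvdE)
    have "l \<ge> 2" using prime_ge_2_int[OF l(1)] .
    then have b_pos: "b > 0" using b less.prems(1) by (simp add: zero_less_mult_iff)
    then have "b < c" using b \<open>l \<ge> 2\<close> by (simp add: mult_less_cancel_right1)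
    then have smaller: "nat b < nat c" using b_pos by simp
    have odd: "odd b" "odd l" "\<not> p dvd b" "\<not> p dvd l" using b less.prems by auto
    interpret level l p by standard (use l odd prime_p odd_p in auto)
    obtain a w1 where a: "nrm a = l" "w = a * w1"
      using left_factor_nrm_l[of w] less.prems(4) b by (auto simp: power2_eq_square)
    have w1: "nrm w1 = l * b\<^sup>2" using less.prems(4) a b \<open>l \<ge> 2\<close> by (simp add: nrm_mult power2_eq_square)
    then obtain a' w2 where a': "nrm a' = l" "w1 = a' * w2" using left_factor_nrm_l[of w1] by auto
    have w2: "nrm w2 = b\<^sup>2" using w1 a' \<open>l \<ge> 2\<close> by (simp add: nrm_mult)
    have "coprime p (nrm w2)" using coprime_p[OF odd(3)] by (simp add: w2)
    then have "\<not> qdvd p (w2 * u)" using less.prems(5) by (simp add: qdvd_mult_coprime)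
    then have "equidistributed p (a * (a' * (w2 * u))) (of_int l * (w2 * u))"
      by (rule equidistributed_mult_nrm_l[OF a(1) a'(1)])
    also have "of_int l * (w2 * u) = w2 * (of_int l * u)" by (simp only: of_int_mult_left_commute)
    also have "equidistributed p \<dots> (of_int b * (of_int l * u))"
      using less.prems(5) coprime_p[OF odd(4)]
      by (intro less.hyps[OF smaller b_pos odd(1,3) w2]) (simp add: qdvd_of_int_mult_coprime)
    also have "of_int b * (of_int l * u) = of_int c * u" by (simp add: b quat_eq_iff)
    finally show ?thesis by (simp add: a(2) a'(2) mult.assoc)
  qed
qed

text \<open>If \<open>g\<close> has norm \<open>1\<close> modulo \<open>p\<close>, then \<open>(1 + g)\<^sup>2\<close> is \<open>2 + tr g\<close> times \<open>g\<close>, and \<open>2 + tr g\<close> is the norm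
  of \<open>1 + g\<close>.\<close>

lemma equidistributed_mult_left_if_tr:
  assumes g: "p dvd nrm g - 1" and u: "\<not> qdvd p u" and tr: "\<not> p dvd 2 + tr g"
  shows "equidistributed p (g * u) u"
proof -
  obtain y where y: "qcong p y (1 + g)" "odd (nrm y)" using odd_nrm_representative[OF odd_p] .
  define c where "c = nrm y"
  have "c - (2 + tr g) = (c - nrm (1 + g)) + (nrm g - 1)"
    by (simp add: nrm_def tr_def power2_eq_square algebra_simps)
  then have c_tr: "p dvd c - (2 + tr g)"
    using dvd_add[OF qcong_dvd_nrm_diff[OF y(1)] g] unfolding c_def[symmetric] by (simp only:)
  have c: "c > 0" "odd c" using y(2) nrm_ge_0[of y] by (auto simp: c_def less_le)
  have "\<not> p dvd c" using tr c_tr dvd_diff[of p c "c - (2 + tr g)"] by auto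
  then have "coprime (nrm (of_int c)) p" using coprime_p by (simp add: coprime_commute)
  then obtain u' where u': "qcong p (of_int c * u') u" by (rule qcong_left_quotient)
  have "\<not> qdvd p u'" using u qcong_qdvd_iff[OF u'] qdvd_mult_left by blast
  then have "equidistributed p (y * y * u') (of_int c * u')"
    using equidistributed_nrm_square[OF c \<open>\<not> p dvd c\<close>, of "y * y"]
    by (simp add: nrm_mult c_def power2_eq_square)
  moreover have "qcong p (g * u) (y * y * u')"
  proof -
    have "qcong p (g * u) (g * (of_int c * u'))" by (rule qcong_mult_left[OF qcong_sym[OF u']])
    also have "g * (of_int c * u') = of_int c * (g * u')" by (rule of_int_mult_left_commute)
    also have "qcong p \<dots> (of_int (2 + tr g) * (g * u'))" by (rule qcong_of_int_mult[OF c_tr])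
    also have "of_int (2 + tr g) * (g * u') = of_int (2 + tr g) * g * u'" by (rule mult.assoc[symmetric])
    also have "qcong p \<dots> ((1 + g) * (1 + g) * u')"
      by (rule qcong_mult_right[OF qcong_sym[OF qcong_mult_self[OF g]]])
    also have "qcong p \<dots> (y * (1 + g) * u')" by (intro qcong_mult_right qcong_sym[OF y(1)])
    also have "qcong p \<dots> (y * y * u')" by (intro qcong_mult_right qcong_mult_left qcong_sym[OF y(1)])
    finally show ?thesis .
  qed
  ultimately show ?thesis using u' equidistributed_qcong equidistributed_trans by blast
qed

lemma equidistributed_mult_left:
  assumes g: "p dvd nrm g - 1" and u: "\<not> qdvd p u"
  shows "equidistributed p (g * u) u"
proof (cases "p dvd 2 + tr g")
  case False
  then show ?thesis using equidistributed_mult_left_if_tr[OF g u] by blast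
next
  case True
  have "\<not> p dvd 2 + tr (- g)"
  proof
    assume "p dvd 2 + tr (- g)"
    with True have "p dvd (2 + tr g) + (2 + tr (- g))" by (rule dvd_add)
    then have "p dvd 2 * 2" by (simp add: tr_def)
    then have "p dvd 2" using prime_p prime_dvd_mult_iff by blast
    then show False using p.l_gt_2 zdvd_imp_le[of p 2] by simp
  qed
  then have "equidistributed p (- g * u) u" using equidistributed_mult_left_if_tr[of "- g" u] g u by simp
  moreover have "equidistributed p (g * u) (- g * u)"
    by (rule equidistributedI) (use class_count_unit[of "- 1" p "g * u"] in simp)
  ultimately show ?thesis using equidistributed_trans by blast
qed

lemma equidistributed_mult_right:
  assumes "p dvd nrm g - 1" "\<not> qdvd p u"
  shows "equidistributed p (u * g) u"
  using equidistributed_mult_left[of "qcnj g" "qcnj u"] assms equidistributed_qcnj[of p "u * g" u]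
  by (simp add: qcnj_mult)

lemma equidistributed_mult_null:
  assumes u: "p dvd nrm u" and x: "p dvd nrm x" and ux: "\<not> qdvd p (u * x)"
  shows "equidistributed p (u * x) u"
proof -
  obtain g where "\<not> p dvd tr (u * x * g)" using not_dvd_tr_mult[OF odd_p ux] .
  then obtain s where s: "p dvd s * tr (u * x * g) - 1" using inverse_mod[OF p.coprime_l] by blast
  define t where "t = of_int s * qcnj g"
  define h where "h = x + qcnj u * t"
  have "tr (x * qcnj (qcnj u * t)) = tr ((x * qcnj t) * u)" by (simp add: qcnj_mult mult.assoc)
  also have "\<dots> = tr (u * (x * qcnj t))" by (rule tr_mult_commute)
  also have "\<dots> = s * tr (u * x * g)" by (simp add: t_def tr_def algebra_simps)
  finally have "nrm h = nrm x + s * tr (u * x * g) + nrm u * nrm t"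
    unfolding h_def nrm_add by (simp add: nrm_mult)
  then have "nrm h - 1 = nrm x + (s * tr (u * x * g) - 1) + nrm u * nrm t" by simp
  then have "p dvd nrm h - 1" using u x s by (simp only: dvd_add dvd_mult2)
  moreover have "\<not> qdvd p u" using ux qdvd_mult_right by blast
  ultimately have "equidistributed p (u * h) u" by (rule equidistributed_mult_right)
  moreover have "u * h - u * x = of_int (nrm u) * t" by (simp add: h_def distrib_left mult_qcnj_assoc)
  then have "qcong p (u * h) (u * x)" using u by (simp add: qcong_def qdvd_of_int_mult_dvd)
  ultimately show ?thesis using equidistributed_qcong equidistributed_sym equidistributed_trans by blast
qed

lemma equidistributed_if_nrm_eq:
  assumes u: "\<not> qdvd p u" and v: "\<not> qdvd p v" and eq: "p dvd nrm u - nrm v"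
  shows "equidistributed p u v"
proof (cases "p dvd nrm u")
  case False
  then obtain g where g: "qcong p (g * u) v" by (rule qcong_right_quotient[OF p.coprime_l])
  have "p dvd (nrm (g * u) - nrm v) - (nrm u - nrm v)" by (rule dvd_diff[OF qcong_dvd_nrm_diff[OF g] eq])
  then have "p dvd (nrm g - 1) * nrm u" by (simp add: nrm_mult left_diff_distrib)
  then have "p dvd nrm g - 1" using False prime_p prime_dvd_mult_iff by blast
  then have "equidistributed p (g * u) u" using u by (rule equidistributed_mult_left)
  then show ?thesis using g equidistributed_qcong equidistributed_sym equidistributed_trans by blast
next
  case True
  then have nv: "p dvd nrm v" using dvd_diff[OF True eq] by simp
  obtain \<kappa> where \<kappa>: "\<not> qdvd p (u * \<kappa> * v)" using not_qdvd_prime_mult[OF prime_p odd_p u v] .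
  have "equidistributed p (u * (\<kappa> * v)) u"
    using \<kappa> True nv by (intro equidistributed_mult_null) (auto simp: nrm_mult mult.assoc)
  moreover have "equidistributed p (qcnj v * qcnj (u * \<kappa>)) (qcnj v)"
    using \<kappa> True nv by (intro equidistributed_mult_null) (auto simp: nrm_mult simp flip: qcnj_mult)
  then have "equidistributed p (u * (\<kappa> * v)) v"
    using equidistributed_qcnj[of p "u * \<kappa> * v" v] by (simp add: qcnj_mult mult.assoc)
  ultimately show ?thesis using equidistributed_sym equidistributed_trans by blast
qed

lemma class_count_diff_bound_odd:
  obtains C \<delta> where "C > 0" "0 < \<delta>" "\<delta> < 1"
    "\<And>u v n. \<not> qdvd p u \<Longrightarrow> \<not> qdvd p v \<Longrightarrow> p dvd nrm u - nrm v \<Longrightarrow> n > 0 \<Longrightarrow> odd n \<Longrightarrow>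
      \<bar>real (class_count p u n) - real (class_count p v n)\<bar> \<le> C * of_int n powr (1 - \<delta>)"
proof -
  define A where "A = {(u, v) \<in> quat_residues p \<times> quat_residues p.
    \<not> qdvd p u \<and> \<not> qdvd p v \<and> p dvd nrm u - nrm v}"
  have "finite A" by (rule finite_subset[of _ "quat_residues p \<times> quat_residues p"])
    (auto simp: A_def finite_quat_residues)
  define d where "d a n = real (class_count p (fst a) n) - real (class_count p (snd a) n)" for a n
  have "power_saving 1 {n. odd n} (d a)" if "a \<in> A" for a
    using that equidistributed_if_nrm_eq
    unfolding d_def equidistributed_def[symmetric] by (auto simp: A_def)
  then obtain C \<delta> where C: "C > 0" "0 < \<delta>" "\<delta> < 1"
    and bound: "\<And>a n. a \<in> A \<Longrightarrow> n \<in> {n. odd n} \<Longrightarrow> n > 0 \<Longrightarrow> \<bar>d a n\<bar> \<le> C * of_int n powr (1 - \<delta>)"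
    using power_saving_uniform[OF \<open>finite A\<close>, of 1 "{n. odd n}" d] by blast
  have "\<bar>real (class_count p u n) - real (class_count p v n)\<bar> \<le> C * of_int n powr (1 - \<delta>)"
    if u: "\<not> qdvd p u" and v: "\<not> qdvd p v" and eq: "p dvd nrm u - nrm v" and n: "n > 0" "odd n" for u v n
  proof -
    have residue: "qcong p x (quat_mod x p)" for x by (rule qcong_quat_mod)
    have "p dvd (nrm u - nrm v) - (nrm u - nrm (quat_mod u p)) + (nrm v - nrm (quat_mod v p))"
      by (intro dvd_add dvd_diff[OF eq] qcong_dvd_nrm_diff residue)
    then have "(quat_mod u p, quat_mod v p) \<in> A"
      using u v p.l_gt_2 qcong_qdvd_iff[OF residue]
      by (auto simp: A_def quat_mod_in_quat_residues algebra_simps)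
    then show ?thesis using bound[of "(quat_mod u p, quat_mod v p)" n] n class_count_cong[OF residue]
      by (simp add: d_def)
  qed
  then show thesis using that[OF C] by blast
qed

end

subsection \<open>Even norms\<close>

lemma range_mult_left_iff:
  assumes "e \<noteq> 0"
  shows "x \<in> range (\<lambda>y. e * y) \<longleftrightarrow> qdvd (nrm e) (qcnj e * x)"
proof -
  have "qdvd (nrm e) (qcnj e * x) \<longleftrightarrow> qdvd (nrm e) (qcnj x * e)"
    using qdvd_qcnj[of "nrm e" "qcnj e * x"] by (simp add: qcnj_mult)
  also have "\<dots> \<longleftrightarrow> (\<exists>w. qcnj x = w * qcnj e)" by (rule qdvd_nrm_mult_iff[OF assms])
  also have "\<dots> \<longleftrightarrow> (\<exists>w. x = e * w)" by (metis qcnj_mult qcnj_simps(1))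
  finally show ?thesis by auto
qed

definition norm_2_elements :: "quat set" where
  "norm_2_elements = {1 + qi, 1 + qj, 1 + qk}"

lemma nrm_norm_2_elements: "e \<in> norm_2_elements \<Longrightarrow> nrm e = 2"
  by (auto simp: norm_2_elements_def nrm_def)

lemma nrm_mod_4:
  "nrm x mod 4 = (of_bool (odd (q0 x)) + of_bool (odd (q1 x)) + of_bool (odd (q2 x))
    + of_bool (odd (q3 x))) mod 4"
proof -
  have square: "a\<^sup>2 mod 4 = of_bool (odd a)" for a :: int
  proof (cases "even a")
    case False
    then obtain b where "a = 2 * b + 1" by (rule oddE)
    then have "a\<^sup>2 = 1 + (b\<^sup>2 + b) * 4" by (simp add: power2_eq_square algebra_simps)
    then show ?thesis using False by (simp only: mod_mult_self1) simp
  qed auto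
  have "nrm x mod 4 = ((q0 x)\<^sup>2 mod 4 + (q1 x)\<^sup>2 mod 4 + (q2 x)\<^sup>2 mod 4 + (q3 x)\<^sup>2 mod 4) mod 4"
    unfolding nrm_def by (intro mod_add_cong) simp_all
  then show ?thesis by (simp only: square)
qed

lemma range_mult_norm_2_iff:
  "x \<in> range (\<lambda>y. (1 + qi) * y) \<longleftrightarrow> even (q0 x + q1 x) \<and> even (q2 x + q3 x)"
  "x \<in> range (\<lambda>y. (1 + qj) * y) \<longleftrightarrow> even (q0 x + q2 x) \<and> even (q1 x + q3 x)"
  "x \<in> range (\<lambda>y. (1 + qk) * y) \<longleftrightarrow> even (q0 x + q3 x) \<and> even (q1 x + q2 x)"
  by (subst range_mult_left_iff; auto simp: quat_eq_iff qdvd_def nrm_def)+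

lemma norm_2_divisor_if_4_dvd:
  assumes "4 dvd nrm x"
  shows "x \<in> range (\<lambda>y. (1 + qi) * y)"
proof -
  have "nrm x mod 4 = 0" using assms by simp
  then show ?thesis unfolding nrm_mod_4 range_mult_norm_2_iff
    by (cases "even (q0 x)"; cases "even (q1 x)"; cases "even (q2 x)"; cases "even (q3 x)") auto
qed

lemma norm_2_divisor_unique:
  assumes "nrm x mod 4 = 2"
  shows "\<exists>!e. e \<in> norm_2_elements \<and> x \<in> range (\<lambda>y. e * y)"
proof -
  have "(x \<in> range (\<lambda>y. (1 + qi) * y) \<and> x \<notin> range (\<lambda>y. (1 + qj) * y) \<and> x \<notin> range (\<lambda>y. (1 + qk) * y))
    \<or> (x \<notin> range (\<lambda>y. (1 + qi) * y) \<and> x \<in> range (\<lambda>y. (1 + qj) * y) \<and> x \<notin> range (\<lambda>y. (1 + qk) * y))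
    \<or> (x \<notin> range (\<lambda>y. (1 + qi) * y) \<and> x \<notin> range (\<lambda>y. (1 + qj) * y) \<and> x \<in> range (\<lambda>y. (1 + qk) * y))"
    using assms unfolding nrm_mod_4 range_mult_norm_2_iff
    by (cases "even (q0 x)"; cases "even (q1 x)"; cases "even (q2 x)"; cases "even (q3 x)") auto
  then show ?thesis unfolding norm_2_elements_def by blast
qed

lemma class_count_double_even:
  assumes "odd p" "even n" "qcong p ((1 + qi) * w) u"
  shows "class_count p u (2 * n) = class_count p w n"
proof -
  have "nrm (1 + qi) = 2" "1 + qi \<noteq> 0" by (simp_all add: nrm_def quat_eq_iff)
  moreover have "x \<in> range (\<lambda>y. (1 + qi) * y)" if "nrm x = 2 * n" for x
    using assms(2) that by (intro norm_2_divisor_if_4_dvd) auto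
  then have "{x. nrm x = 2 * n \<and> qcong p x ((1 + qi) * w)}
    = {x. nrm x = 2 * n \<and> x \<in> range (\<lambda>y. (1 + qi) * y) \<and> qcong p x ((1 + qi) * w)}"
    by blast
  moreover have "coprime p 2" using assms(1) by simp
  ultimately show ?thesis
    using class_count_left_multiples[of p "1 + qi" n w] class_count_cong[OF assms(3), of "2 * n"]
    by (auto simp: class_count_def)
qed

lemma class_count_double_odd:
  assumes "odd p" "odd n" and w: "\<And>e. e \<in> norm_2_elements \<Longrightarrow> qcong p (e * w e) u"
  shows "class_count p u (2 * n) = (\<Sum>e\<in>norm_2_elements. class_count p (w e) n)"
proof -
  define S where "S = {x. nrm x = 2 * n \<and> qcong p x u}"
  define multiples where "multiples e = {x \<in> S. x \<in> range (\<lambda>y. e * y)}" for e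
  have fin: "finite S" by (rule finite_subset[OF _ finite_nrm[of "2 * n"]]) (auto simp: S_def)
  have E: "finite norm_2_elements" by (simp add: norm_2_elements_def)
  have unique: "\<exists>!e. e \<in> norm_2_elements \<and> x \<in> multiples e" if "x \<in> S" for x
  proof -
    have "nrm x mod 4 = 2" using assms(2) that by (auto simp: S_def elim!: oddE)
    then show ?thesis using norm_2_divisor_unique[of x] that unfolding multiples_def by blast
  qed
  have sub: "multiples e \<subseteq> S" for e by (auto simp: multiples_def)
  have "S = (\<Union>e\<in>norm_2_elements. multiples e)" using unique sub by blast
  then have "class_count p u (2 * n) = card (\<Union>e\<in>norm_2_elements. multiples e)"
    unfolding class_count_def S_def by (rule arg_cong)
  also have "\<dots> = (\<Sum>e\<in>norm_2_elements. card (multiples e))"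
  proof (rule card_UN_disjoint[OF E])
    show "\<forall>e\<in>norm_2_elements. finite (multiples e)" using fin by (simp add: multiples_def)
    show "\<forall>e\<in>norm_2_elements. \<forall>e'\<in>norm_2_elements. e \<noteq> e' \<longrightarrow> multiples e \<inter> multiples e' = {}"
      using unique sub by blast
  qed
  also have "\<dots> = (\<Sum>e\<in>norm_2_elements. class_count p (w e) n)"
  proof (rule sum.cong[OF refl])
    fix e assume e: "e \<in> norm_2_elements"
    have e': "coprime p (nrm e)" "e \<noteq> 0" using nrm_norm_2_elements[OF e] assms(1) by auto
    have multiples: "multiples e = {x. nrm x = nrm e * n \<and> x \<in> range (\<lambda>y. e * y) \<and> qcong p x (e * w e)}"
      using qcong_cong_right[OF w[OF e]] nrm_norm_2_elements[OF e] by (auto simp: multiples_def S_def)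
    show "card (multiples e) = class_count p (w e) n"
      unfolding multiples by (rule class_count_left_multiples[OF e'])
  qed
  finally show ?thesis .
qed

context
  fixes p :: int
  assumes prime_p: "prime p" and odd_p: "odd p"
begin

definition left_quotient :: "quat \<Rightarrow> quat \<Rightarrow> quat" where
  "left_quotient e u = (SOME w. qcong p (e * w) u)"

lemma qcong_mult_left_quotient:
  assumes "e \<in> norm_2_elements"
  shows "qcong p (e * left_quotient e u) u"
proof -
  have "coprime (nrm e) p" using nrm_norm_2_elements[OF assms] odd_p by simp
  then obtain w where "qcong p (e * w) u" by (rule qcong_left_quotient)
  then show ?thesis unfolding left_quotient_def by (rule someI)
qed

lemma left_quotient_equal_nrm:
  assumes e: "e \<in> norm_2_elements" and u: "\<not> qdvd p u" and v: "\<not> qdvd p v" and eq: "p dvd nrm u - nrm v"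
  shows "\<not> qdvd p (left_quotient e u)" "\<not> qdvd p (left_quotient e v)"
    "p dvd nrm (left_quotient e u) - nrm (left_quotient e v)"
proof -
  let ?q = "left_quotient e"
  have q: "qcong p (e * ?q x) x" for x by (rule qcong_mult_left_quotient[OF e])
  show "\<not> qdvd p (?q u)" "\<not> qdvd p (?q v)" using u v qcong_qdvd_iff[OF q] qdvd_mult_left by blast+
  have "p dvd (nrm (e * ?q u) - nrm u) + (nrm u - nrm v) - (nrm (e * ?q v) - nrm v)"
    by (intro dvd_diff dvd_add[OF _ eq] qcong_dvd_nrm_diff q)
  then have "p dvd 2 * (nrm (?q u) - nrm (?q v))" by (simp add: nrm_mult nrm_norm_2_elements[OF e])
  moreover have "coprime p 2" using odd_p by simp
  ultimately show "p dvd nrm (?q u) - nrm (?q v)" using coprime_dvd_mult_right_iff by blast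
qed

lemma class_count_diff_double_odd_le:
  assumes m: "odd m" and bound: "\<And>e. e \<in> norm_2_elements \<Longrightarrow>
    \<bar>real (class_count p (left_quotient e u) m) - real (class_count p (left_quotient e v) m)\<bar> \<le> B"
  shows "\<bar>real (class_count p u (2 * m)) - real (class_count p v (2 * m))\<bar> \<le> 3 * B"
proof -
  let ?d = "\<lambda>e. real (class_count p (left_quotient e u) m) - real (class_count p (left_quotient e v) m)"
  have "\<bar>real (class_count p u (2 * m)) - real (class_count p v (2 * m))\<bar> = \<bar>\<Sum>e\<in>norm_2_elements. ?d e\<bar>"
    by (simp add: class_count_double_odd[OF odd_p m qcong_mult_left_quotient] sum_subtractf)
  also have "\<dots> \<le> (\<Sum>e\<in>norm_2_elements. \<bar>?d e\<bar>)" by (rule sum_abs)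
  also have "\<dots> \<le> (\<Sum>e\<in>norm_2_elements. B)" by (intro sum_mono bound)
  also have "\<dots> = 3 * B" by (simp add: norm_2_elements_def quat_eq_iff)
  finally show ?thesis .
qed

lemma class_count_diff_bound:
  obtains C \<delta> where "C > 0" "0 < \<delta>" "\<delta> < 1"
    "\<And>u v n. \<not> qdvd p u \<Longrightarrow> \<not> qdvd p v \<Longrightarrow> p dvd nrm u - nrm v \<Longrightarrow> n > 0 \<Longrightarrow>
      \<bar>real (class_count p u n) - real (class_count p v n)\<bar> \<le> C * of_int n powr (1 - \<delta>)"
proof -
  let ?d = "\<lambda>u v n. \<bar>real (class_count p u n) - real (class_count p v n)\<bar>"
  obtain C \<delta> where C: "C > 0" "0 < \<delta>" "\<delta> < 1"
    and odd_bound: "\<And>u v n. \<not> qdvd p u \<Longrightarrow> \<not> qdvd p v \<Longrightarrow> p dvd nrm u - nrm v \<Longrightarrow> n > 0 \<Longrightarrow> odd n \<Longrightarrow>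
      ?d u v n \<le> C * of_int n powr (1 - \<delta>)"
    using class_count_diff_bound_odd[OF prime_p odd_p] by blast
  have "?d u v n \<le> 3 * C * of_int n powr (1 - \<delta>)"
    if "\<not> qdvd p u" "\<not> qdvd p v" "p dvd nrm u - nrm v" "n > 0" for u v n
    using that
  proof (induction "nat n" arbitrary: n u v rule: less_induct)
    case less
    note quotients = left_quotient_equal_nrm[OF _ less.prems(1-3)]
    have double: "3 * C * of_int m powr (1 - \<delta>) \<le> 3 * C * of_int n powr (1 - \<delta>)" if "n = 2 * m" for m
      using that less.prems(4) C by (intro mult_left_mono powr_mono2) auto
    consider "odd n" | m where "n = 2 * m" "odd m" | m where "n = 2 * m" "even m" by (metis evenE)
    then show ?case
    proof cases
      case 1
      have "0 \<le> C * of_int n powr (1 - \<delta>)" using C by simp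
      then show ?thesis using odd_bound[OF less.prems 1] by simp
    next
      case 2
      have "?d u v n \<le> 3 * (C * of_int m powr (1 - \<delta>))"
        unfolding 2(1) using quotients 2 less.prems(4)
        by (intro class_count_diff_double_odd_le odd_bound) auto
      also have "\<dots> = 3 * C * of_int m powr (1 - \<delta>)" by simp
      also have "\<dots> \<le> 3 * C * of_int n powr (1 - \<delta>)" by (rule double[OF 2(1)])
      finally show ?thesis .
    next
      case 3
      have e: "1 + qi \<in> norm_2_elements" by (simp add: norm_2_elements_def)
      have "?d u v n = ?d (left_quotient (1 + qi) u) (left_quotient (1 + qi) v) m"
        unfolding 3(1) by (simp add: class_count_double_even[OF odd_p 3(2) qcong_mult_left_quotient[OF e]])
      also have "\<dots> \<le> 3 * C * of_int m powr (1 - \<delta>)"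
        using 3(1) less.prems(4) by (intro less.hyps quotients[OF e]) auto
      also have "\<dots> \<le> 3 * C * of_int n powr (1 - \<delta>)" by (rule double[OF 3(1)])
      finally show ?thesis .
    qed
  qed
  then show thesis using that[of "3 * C" \<delta>] C by simp
qed

end

lemma card_primitive_ge:
  assumes "n > 0" "odd n"
  shows "real (card (primitive n)) \<ge> 8 * of_int n"
  using assms
proof (induction "nat n" arbitrary: n rule: less_induct)
  case less
  show ?case
  proof (cases "n = 1")
    case True
    then show ?thesis by (simp add: primitive_1 card_units)
  next
    case False
    then have "n > 1" using less.prems(1) by simp
    then obtain l j m where l: "prime l" "n = l ^ j * m" "\<not> l dvd m" and m: "0 < m" "m < n"
      by (rule prime_power_factorE)
    have "j > 0" using l(2) m by (cases j) auto
    then have odd: "odd l" "odd m" using l(2) less.prems(2) by auto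
    interpret odd_prime l by standard (rule l(1) odd(1))+
    have "(8 * of_int (l ^ j)) * (8 * of_int m)
      \<le> real (card (primitive (l ^ j))) * real (card (primitive m))"
      using less.hyps[of m] m odd(2) card_primitive_l_pow_bounds(1)[of j] by (intro mult_mono) auto
    also have "\<dots> = 8 * real (card (primitive n))"
      using sum_primitive_mult[OF odd_l_pow l_pow_pos coprime_l_pow[OF l(3)], where F = "\<lambda>_. 1"]
      by (simp add: l(2))
    finally show ?thesis by (simp add: l(2) mult_ac)
  qed
qed

section \<open>Higher dimensions\<close>

definition square_sum :: "int list \<Rightarrow> int" where
  "square_sum x = (\<Sum>a\<leftarrow>x. a\<^sup>2)"

lemma square_sum_simps [simp]:
  "square_sum [] = 0" "square_sum (a # x) = a\<^sup>2 + square_sum x"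
  "square_sum (x @ y) = square_sum x + square_sum y" "square_sum (rev x) = square_sum x"
  by (simp_all add: square_sum_def rev_map[symmetric])

lemma square_sum_ge_0 [simp]: "square_sum x \<ge> 0"
  by (induction x) auto

lemma square_le_square_sum: "a \<in> set x \<Longrightarrow> a\<^sup>2 \<le> square_sum x"
  by (induction x) (auto intro: add_increasing)

lemma finite_square_sum: "finite {x. length x = d \<and> square_sum x = n}"
proof (rule finite_subset)
  show "{x. length x = d \<and> square_sum x = n} \<subseteq> {x. set x \<subseteq> {-n..n} \<and> length x = d}"
  proof safe
    fix x a assume "n = square_sum x" "d = length x" "a \<in> set x"
    then have "\<bar>a\<bar> \<le> square_sum x" by (intro abs_le_if_square_le square_le_square_sum)
    then show "a \<in> {- square_sum x..square_sum x}" by auto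
  qed
qed (simp add: finite_lists_length_eq)

definition zero_mod :: "int \<Rightarrow> int list \<Rightarrow> bool" where
  "zero_mod p x \<longleftrightarrow> (\<forall>a\<in>set x. p dvd a)"

lemma zero_mod_simps [simp]:
  "zero_mod p []" "zero_mod p (a # x) \<longleftrightarrow> p dvd a \<and> zero_mod p x"
  "zero_mod p (x @ y) \<longleftrightarrow> zero_mod p x \<and> zero_mod p y" "zero_mod p (rev x) \<longleftrightarrow> zero_mod p x"
  by (auto simp: zero_mod_def)

definition list_cong :: "int \<Rightarrow> int list \<Rightarrow> int list \<Rightarrow> bool" where
  "list_cong p = list_all2 (\<lambda>a b. p dvd a - b)"

lemma list_cong_zero_mod: "list_cong p x u \<Longrightarrow> zero_mod p x \<longleftrightarrow> zero_mod p u"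
  unfolding list_cong_def
  by (induction rule: list_all2_induct) (auto simp: dvd_diff_left_iff dvd_diff_right_iff)

definition list_class_count :: "int \<Rightarrow> int list \<Rightarrow> int \<Rightarrow> nat" where
  "list_class_count p u n = card {x. list_cong p x u \<and> square_sum x = n}"

lemma finite_list_cong: "finite {x. list_cong p x u \<and> square_sum x = n}"
  by (rule finite_subset[OF _ finite_square_sum[of "length u" n]])
    (auto simp: list_cong_def dest: list_all2_lengthD)

lemma list_class_count_rev: "list_class_count p (rev u) n = list_class_count p u n"
  unfolding list_class_count_def
  by (rule bij_betw_same_card[of rev], rule bij_betw_byWitness[where f' = rev])
    (auto simp: list_cong_def list_all2_rev1)

lemma list_class_count_Cons:
  "list_class_count p (t # u) n = (\<Sum>s | p dvd s - t \<and> s\<^sup>2 \<le> n. list_class_count p u (n - s\<^sup>2))"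
proof -
  let ?S = "{s. p dvd s - t \<and> s\<^sup>2 \<le> n}" and ?F = "\<lambda>s. {y. list_cong p y u \<and> square_sum y = n - s\<^sup>2}"
  have fin: "finite ?S"
    by (rule finite_subset[of _ "{-n..n}"]) (auto simp: abs_le_iff dest!: abs_le_if_square_le)
  have "{x. list_cong p x (t # u) \<and> square_sum x = n} = (\<lambda>(s, y). s # y) ` Sigma ?S ?F"
  proof (intro Set.set_eqI iffI)
    fix x assume x: "x \<in> {x. list_cong p x (t # u) \<and> square_sum x = n}"
    then obtain s y where sy: "x = s # y" "p dvd s - t" "list_cong p y u"
      by (auto simp: list_cong_def list_all2_Cons2)
    then have "s\<^sup>2 \<le> n" "square_sum y = n - s\<^sup>2"
      using x square_sum_ge_0[of y] by (auto simp del: square_sum_ge_0)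
    then show "x \<in> (\<lambda>(s, y). s # y) ` Sigma ?S ?F" using sy by (auto simp: image_iff)
  qed (auto simp: list_cong_def)
  moreover have "inj_on (\<lambda>(s, y). s # y) (Sigma ?S ?F)" by (auto simp: inj_on_def)
  ultimately have "list_class_count p (t # u) n = card (Sigma ?S ?F)"
    by (simp add: list_class_count_def card_image)
  then show ?thesis using fin finite_list_cong by (simp add: card_SigmaI list_class_count_def)
qed

lemma list_class_count_nonpos:
  assumes u: "\<not> zero_mod p u" and n: "n \<le> 0"
  shows "list_class_count p u n = 0"
proof -
  have False if x: "list_cong p x u" "square_sum x = n" for x
  proof -
    obtain a where a: "a \<in> set x" "\<not> p dvd a"
      using list_cong_zero_mod[OF x(1)] u by (auto simp: zero_mod_def)
    then have "a\<^sup>2 \<le> 0" using square_le_square_sum[OF a(1)] x n by linarith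
    then show False using a by simp
  qed
  then have "{x. list_cong p x u \<and> square_sum x = n} = {}" by blast
  then show ?thesis unfolding list_class_count_def by (simp only: card.empty)
qed

definition list_equidistributed :: "int \<Rightarrow> int list \<Rightarrow> int list \<Rightarrow> bool" where
  "list_equidistributed p u v \<longleftrightarrow>
    power_saving (real (length u) / 2 - 1) UNIV (\<lambda>n.
      real (list_class_count p u n) - real (list_class_count p v n))"

lemma list_equidistributed_sym:
  "list_equidistributed p u v \<Longrightarrow> length u = length v \<Longrightarrow> list_equidistributed p v u"
  unfolding list_equidistributed_def by (drule power_saving_minus) simp

lemma list_equidistributed_trans:
  "list_equidistributed p u v \<Longrightarrow> list_equidistributed p v w \<Longrightarrow> length u = length v \<Longrightarrow>
    list_equidistributed p u w"
  unfolding list_equidistributed_def by (drule power_saving_add) auto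

lemma list_equidistributed_rev: "list_equidistributed p (rev u) (rev v) \<longleftrightarrow> list_equidistributed p u v"
  by (simp add: list_equidistributed_def list_class_count_rev)

lemma list_equidistributed_Cons:
  assumes eq: "list_equidistributed p u v" and u: "\<not> zero_mod p u" and v: "\<not> zero_mod p v"
    and d: "length u \<ge> 4"
  shows "list_equidistributed p (t # u) (t # v)"
proof -
  define e where "e = real (length u) / 2 - 1"
  let ?c = "\<lambda>u n. real (list_class_count p u n)"
  obtain C \<delta> where C: "C > 0" "0 < \<delta>" "\<delta> < 1"
    and bound: "\<And>n. n > 0 \<Longrightarrow> \<bar>?c u n - ?c v n\<bar> \<le> C * of_int n powr (e - \<delta>)"
    using eq unfolding list_equidistributed_def e_def by (auto elim: power_savingE)
  have e: "e - \<delta> \<ge> 0" using d C(3) by (simp add: e_def)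
  have "power_saving (e + 1 / 2) UNIV (\<lambda>n. ?c (t # u) n - ?c (t # v) n)"
  proof (rule power_savingI[of "3 * C" \<delta>])
    fix n :: int assume n: "n > 0"
    let ?S = "{s. p dvd s - t \<and> s\<^sup>2 \<le> n}"
    have term_le: "\<bar>?c u (n - s\<^sup>2) - ?c v (n - s\<^sup>2)\<bar> \<le> C * of_int n powr (e - \<delta>)" if "s \<in> ?S" for s
    proof (cases "n - s\<^sup>2 > 0")
      case True
      have "\<bar>?c u (n - s\<^sup>2) - ?c v (n - s\<^sup>2)\<bar> \<le> C * of_int (n - s\<^sup>2) powr (e - \<delta>)"
        by (rule bound[OF True])
      also have "\<dots> \<le> C * of_int n powr (e - \<delta>)" using True C e by (intro mult_left_mono powr_mono2) auto
      finally show ?thesis .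
    qed (use list_class_count_nonpos[OF u] list_class_count_nonpos[OF v] C in auto)
    have "real (card ?S) \<le> real (card {s. s\<^sup>2 \<le> n})"
      using card_mono[OF card_squares_le(1)[of n], of ?S] n by auto
    also have "\<dots> \<le> 3 * sqrt (of_int n)"
    proof -
      have "1 \<le> sqrt (real_of_int n)" using n by simp
      then show ?thesis using card_squares_le(2)[of n] n by linarith
    qed
    finally have card_S: "real (card ?S) \<le> 3 * of_int n powr (1 / 2)"
      using n by (simp add: powr_half_sqrt)
    have "\<bar>?c (t # u) n - ?c (t # v) n\<bar> \<le> (\<Sum>s\<in>?S. \<bar>?c u (n - s\<^sup>2) - ?c v (n - s\<^sup>2)\<bar>)"
      by (simp add: list_class_count_Cons sum_abs flip: sum_subtractf)
    also have "\<dots> \<le> (\<Sum>s\<in>?S. C * of_int n powr (e - \<delta>))" using term_le by (rule sum_mono)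
    also have "\<dots> = real (card ?S) * (C * of_int n powr (e - \<delta>))" by simp
    also have "\<dots> \<le> (3 * of_int n powr (1 / 2)) * (C * of_int n powr (e - \<delta>))"
      using card_S C by (intro mult_right_mono) auto
    also have "\<dots> = 3 * C * of_int n powr (e + 1 / 2 - \<delta>)" by (simp add: algebra_simps flip: powr_add)
    finally show "\<bar>?c (t # u) n - ?c (t # v) n\<bar> \<le> 3 * C * of_int n powr (e + 1 / 2 - \<delta>)" .
  qed (use C in auto)
  then show ?thesis by (simp add: list_equidistributed_def e_def add_divide_distrib)
qed

definition equidistributed_dim :: "int \<Rightarrow> nat \<Rightarrow> bool" where
  "equidistributed_dim p d \<longleftrightarrow> (\<forall>u v. length u = d \<longrightarrow> length v = d \<longrightarrow> \<not> zero_mod p u \<longrightarrow> \<not> zero_mod p v \<longrightarrow>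
     p dvd square_sum u - square_sum v \<longrightarrow> list_equidistributed p u v)"

lemma equidistributed_dim_Cons:
  assumes "equidistributed_dim p d" "d \<ge> 4" "length u = d" "length v = d" "\<not> zero_mod p u"
    "\<not> zero_mod p v"
    "p dvd square_sum u - square_sum v"
  shows "list_equidistributed p (t # u) (t # v)"
  using assms by (intro list_equidistributed_Cons) (auto simp: equidistributed_dim_def)

lemma equidistributed_dim_snoc:
  assumes "equidistributed_dim p d" "d \<ge> 4" "length u = d" "length v = d" "\<not> zero_mod p u"
    "\<not> zero_mod p v"
    "p dvd square_sum u - square_sum v"
  shows "list_equidistributed p (u @ [t]) (v @ [t])"
  using equidistributed_dim_Cons[OF assms(1,2), of "rev u" "rev v" t] assms
    list_equidistributed_rev[of p "u @ [t]" "v @ [t]"] by simp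

lemma list_class_count_4: "list_class_count p [a, b, c, e] n = class_count p (Quat a b c e) n"
  unfolding list_class_count_def class_count_def
  by (rule bij_betw_same_card[symmetric, of "\<lambda>x. [q0 x, q1 x, q2 x, q3 x]"], rule bij_betw_imageI)
    (auto simp: inj_on_def quat_eq_iff list_cong_def list_all2_Cons2 nrm_def qcong_def qdvd_def image_iff add.assoc
      intro!: exI[of _ "Quat _ _ _ _"])

lemma equidistributed_dim_4:
  assumes "prime p" "odd p"
  shows "equidistributed_dim p 4"
  unfolding equidistributed_dim_def
proof (intro allI impI)
  fix u v :: "int list" assume len: "length u = 4" "length v = 4"
    and nonzero: "\<not> zero_mod p u" "\<not> zero_mod p v"
    and eq: "p dvd square_sum u - square_sum v"
  have "\<exists>a b c e. u = [a, b, c, e]" if "length u = 4" for u :: "int list"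
    using that by (auto simp: numeral_eq_Suc length_Suc_conv)
  then obtain a b c e a' b' c' e' where uv: "u = [a, b, c, e]" "v = [a', b', c', e']" using len by metis
  let ?x = "Quat a b c e" and ?y = "Quat a' b' c' e'"
  have xy: "\<not> qdvd p ?x" "\<not> qdvd p ?y" "p dvd nrm ?x - nrm ?y"
    using nonzero eq by (auto simp: uv qdvd_def nrm_def add.assoc)
  obtain C \<delta> where "C > 0" "0 < \<delta>" "\<delta> < 1"
    and "\<And>n. n > 0 \<Longrightarrow> \<bar>real (class_count p ?x n) - real (class_count p ?y n)\<bar> \<le> C * of_int n powr (1 - \<delta>)"
    using class_count_diff_bound[OF assms] xy by metis
  then have "power_saving 1 UNIV (\<lambda>n. real (class_count p ?x n) - real (class_count p ?y n))"
    by (rule power_savingI)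
  then show "list_equidistributed p u v" by (simp add: list_equidistributed_def uv list_class_count_4)
qed

lemma sum_three_squares_mod:
  fixes p c :: int
  assumes "prime p" "odd p" "d \<ge> 3"
  obtains y where "length y = d" "\<not> zero_mod p y" "p dvd square_sum y - c"
proof -
  obtain x z where "p dvd x\<^sup>2 + z\<^sup>2 - (c - 1)" by (rule sum_two_squares_mod[OF assms(1,2)])
  moreover have "square_sum (replicate k 0) = 0" for k by (induction k) auto
  ultimately show thesis using that[of "1 # x # z # replicate (d - 3) 0"] assms not_prime_unit[of p]
    by (auto simp: algebra_simps)
qed

lemma nonzero_middle:
  assumes p: "prime p" "odd p" and k: "k \<ge> 3" and dim: "equidistributed_dim p (Suc k)"
    and u: "length u = Suc (Suc k)" "\<not> zero_mod p u"
  obtains t w s where "length w = k" "\<not> zero_mod p w" "p dvd t\<^sup>2 + square_sum w + s\<^sup>2 - square_sum u"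
    "list_equidistributed p u (t # w @ [s])"
proof -
  have k': "Suc k \<ge> 4" using k by simp
  obtain t x where x: "u = t # x" "length x = Suc k" using u(1) by (auto simp: length_Suc_conv)
  then obtain w s where "x = w @ [s]" by (cases x rule: rev_cases) auto
  then have tws: "u = t # w @ [s]" "length w = k" using x by auto
  show thesis
  proof (cases "zero_mod p (w @ [s])")
    case False
    obtain y where y: "length y = k" "\<not> zero_mod p y" "p dvd square_sum y - (square_sum w + s\<^sup>2)"
      by (rule sum_three_squares_mod[OF p k])
    have "p dvd square_sum (w @ [s]) - square_sum (y @ [0])" using y(3) by (simp add: dvd_diff_commute)
    then have "list_equidistributed p u (t # y @ [0])"
      unfolding tws(1) by (intro equidistributed_dim_Cons[OF dim k']) (use False y tws in auto)
    moreover have "p dvd t\<^sup>2 + square_sum y + 0\<^sup>2 - square_sum u"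
      using y(3) by (simp add: tws algebra_simps)
    ultimately show thesis using y that by blast
  next
    case True
    obtain y where y: "length y = k" "\<not> zero_mod p y" "p dvd square_sum y - (t\<^sup>2 + square_sum w)"
      by (rule sum_three_squares_mod[OF p k])
    have "p dvd square_sum (t # w) - square_sum (0 # y)" using y(3) by (simp add: dvd_diff_commute)
    then have "list_equidistributed p ((t # w) @ [s]) ((0 # y) @ [s])"
      by (intro equidistributed_dim_snoc[OF dim k']) (use u True y tws in auto)
    then have "list_equidistributed p u (0 # y @ [s])" by (simp add: tws)
    moreover have "p dvd 0\<^sup>2 + square_sum y + s\<^sup>2 - square_sum u"
      using y(3) by (simp add: tws algebra_simps)
    ultimately show thesis using y that by blast
  qed
qed

lemma equidistributed_dim_Suc:
  assumes p: "prime p" "odd p" and k: "k \<ge> 3" and dim: "equidistributed_dim p (Suc k)"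
  shows "equidistributed_dim p (Suc (Suc k))"
  unfolding equidistributed_dim_def
proof (intro allI impI)
  fix u v assume u: "length u = Suc (Suc k)" "\<not> zero_mod p u"
    and v: "length v = Suc (Suc k)" "\<not> zero_mod p v"
    and eq: "p dvd square_sum u - square_sum v"
  have k': "Suc k \<ge> 4" using k by simp
  obtain t w s where w: "length w = k" "\<not> zero_mod p w" "p dvd t\<^sup>2 + square_sum w + s\<^sup>2 - square_sum u"
    and u_w: "list_equidistributed p u (t # w @ [s])"
    using nonzero_middle[OF p k dim u] .
  obtain t' w' s' where w': "length w' = k" "\<not> zero_mod p w'"
    "p dvd t'\<^sup>2 + square_sum w' + s'\<^sup>2 - square_sum v"
    and v_w': "list_equidistributed p v (t' # w' @ [s'])"
    using nonzero_middle[OF p k dim v] .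
  obtain y where y: "length y = k" "\<not> zero_mod p y" "p dvd square_sum y - (square_sum w + s\<^sup>2 - s'\<^sup>2)"
    by (rule sum_three_squares_mod[OF p k])
  have "p dvd square_sum (w @ [s]) - square_sum (y @ [s'])"
    using y(3) by (subst dvd_diff_commute) (simp add: algebra_simps)
  then have w_y: "list_equidistributed p (t # w @ [s]) (t # y @ [s'])"
    by (intro equidistributed_dim_Cons[OF dim k']) (use w y in auto)
  have "p dvd (square_sum y - (square_sum w + s\<^sup>2 - s'\<^sup>2)) + (t\<^sup>2 + square_sum w + s\<^sup>2 - square_sum u)
    + (square_sum u - square_sum v) - (t'\<^sup>2 + square_sum w' + s'\<^sup>2 - square_sum v)"
    by (rule dvd_diff[OF dvd_add[OF dvd_add[OF y(3) w(3)] eq] w'(3)])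
  then have "p dvd square_sum (t # y) - square_sum (t' # w')" by (simp add: algebra_simps)
  then have "list_equidistributed p ((t # y) @ [s']) ((t' # w') @ [s'])"
    by (intro equidistributed_dim_snoc[OF dim k']) (use w' y in auto)
  then have "list_equidistributed p (t # y @ [s']) v"
    using list_equidistributed_trans[of p "t # y @ [s']" "t' # w' @ [s']" v] list_equidistributed_sym[OF v_w']
      y w' v by simp
  then show "list_equidistributed p u v"
    using list_equidistributed_trans[OF list_equidistributed_trans[OF u_w w_y]] u w y by simp
qed

lemma equidistributed_dim_ge_4:
  assumes p: "prime p" "odd p" and "d \<ge> 4"
  shows "equidistributed_dim p d"
  using \<open>d \<ge> 4\<close>
proof (induction d rule: dec_induct)
  case base
  show ?case by (rule equidistributed_dim_4[OF p])
next
  case (step d)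
  then obtain k where "d = Suc k" "k \<ge> 3" by (cases d) auto
  then show ?case using equidistributed_dim_Suc[OF p] step.IH by blast
qed

subsection \<open>Lower bounds for the number of representations\<close>

definition nonzero_sphere :: "int \<Rightarrow> nat \<Rightarrow> int \<Rightarrow> int list set" where
  "nonzero_sphere p d n = {x. length x = d \<and> \<not> zero_mod p x \<and> square_sum x = n}"

lemma finite_nonzero_sphere: "finite (nonzero_sphere p d n)"
  by (rule finite_subset[OF _ finite_square_sum[of d n]]) (auto simp: nonzero_sphere_def)

lemma card_nonzero_sphere_4:
  assumes "prime p" "n > 0" "odd n"
  shows "real (card (nonzero_sphere p 4 n)) \<ge> 8 * of_int n"
proof -
  have "\<not> qdvd p x" if "x \<in> primitive n" for x
    using that assms(1) not_prime_unit[of p] by (auto simp: primitive_def qdvd_iff_dvd_content)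
  then have "card (primitive n) \<le> card (nonzero_sphere p 4 n)"
    by (intro card_inj_on_le[where f = "\<lambda>x. [q0 x, q1 x, q2 x, q3 x]"] finite_nonzero_sphere)
      (auto simp: inj_on_def quat_eq_iff primitive_def nonzero_sphere_def nrm_def qdvd_def add.assoc)
  then show ?thesis using card_primitive_ge[OF assms(2,3)] by linarith
qed

lemma opposite_parity_squares:
  assumes "n > 0"
  obtains S where "finite S" "real (card S) \<ge> sqrt (of_int n) / 8"
    "\<And>s. s \<in> S \<Longrightarrow> 2 * s\<^sup>2 \<le> n \<and> odd (n - s\<^sup>2)"
proof -
  define r :: int where "r = (if odd n then 0 else 1)"
  define q where "q = sqrt (of_int n)"
  define m where "m = nat \<lceil>q / 8\<rceil>"
  let ?f = "\<lambda>k::nat. 2 * int k + r"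
  have q: "q \<ge> 1" "q\<^sup>2 = of_int n" using assms by (auto simp: q_def)
  have "2 * (?f k)\<^sup>2 \<le> n \<and> odd (n - (?f k)\<^sup>2)" if "k < m" for k
  proof
    have k: "8 * real k \<le> q" using that by (simp add: m_def) linarith
    show "2 * (?f k)\<^sup>2 \<le> n"
    proof (cases "k = 0")
      case True
      then show ?thesis using assms by (auto simp: r_def)
    next
      case False
      then have "2 * real k + of_int r \<le> 3 / 8 * q" using k by (auto simp: r_def)
      then have "(2 * real k + of_int r)\<^sup>2 \<le> (3 / 8 * q)\<^sup>2" by (intro power_mono) (auto simp: r_def)
      then have "2 * (2 * real k + of_int r)\<^sup>2 \<le> of_int n"
        unfolding power_mult_distrib q(2) using assms by (simp add: power2_eq_square)
      then have "real_of_int (2 * (?f k)\<^sup>2) \<le> of_int n" by simp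
      then show ?thesis by (simp only: of_int_le_iff)
    qed
    show "odd (n - (?f k)\<^sup>2)" by (auto simp: r_def)
  qed
  then have "2 * s\<^sup>2 \<le> n \<and> odd (n - s\<^sup>2)" if "s \<in> ?f ` {..<m}" for s using that by blast
  moreover have "inj_on ?f {..<m}" by (auto simp: inj_on_def)
  then have "card (?f ` {..<m}) = m" by (simp add: card_image)
  moreover have "real m \<ge> q / 8" using q unfolding m_def by linarith
  ultimately show thesis using that[of "?f ` {..<m}"] by (simp add: q_def)
qed

lemma card_nonzero_sphere_Suc:
  assumes lower: "\<And>m. m > 0 \<Longrightarrow> odd m \<Longrightarrow> real (card (nonzero_sphere p d m)) \<ge> c * of_int m powr e"
    and "c > 0" "e \<ge> 0" "n > 0"
  shows "real (card (nonzero_sphere p (Suc d) n)) \<ge> (c / 8 / 2 powr e) * of_int n powr (e + 1 / 2)"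
proof -
  obtain S where S: "finite S" "real (card S) \<ge> sqrt (of_int n) / 8"
    "\<And>s. s \<in> S \<Longrightarrow> 2 * s\<^sup>2 \<le> n \<and> odd (n - s\<^sup>2)"
    using opposite_parity_squares[OF \<open>n > 0\<close>] by blast
  have slice: "c * (of_int n / 2) powr e \<le> real (card (nonzero_sphere p d (n - s\<^sup>2)))" if "s \<in> S" for s
  proof -
    have s: "2 * s\<^sup>2 \<le> n" "odd (n - s\<^sup>2)" using S(3)[OF that] by auto
    then have "of_int (2 * s\<^sup>2) \<le> (of_int n :: real)" by (simp only: of_int_le_iff)
    then have "c * (of_int n / 2) powr e \<le> c * of_int (n - s\<^sup>2) powr e"
      using assms by (intro mult_left_mono powr_mono2) auto
    also have "\<dots> \<le> real (card (nonzero_sphere p d (n - s\<^sup>2)))" using s assms by (intro lower) auto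
    finally show ?thesis .
  qed
  have "(c / 8 / 2 powr e) * of_int n powr (e + 1 / 2)
    = (sqrt (of_int n) / 8) * (c * (of_int n / 2) powr e)"
    using assms by (simp add: powr_add powr_divide powr_half_sqrt)
  also have "\<dots> \<le> real (card S) * (c * (of_int n / 2) powr e)"
    using S(2) assms by (intro mult_right_mono) auto
  also have "\<dots> = (\<Sum>s\<in>S. c * (of_int n / 2) powr e)" by simp
  also have "\<dots> \<le> (\<Sum>s\<in>S. real (card (nonzero_sphere p d (n - s\<^sup>2))))" using slice by (rule sum_mono)
  also have "\<dots> = real (card (Sigma S (\<lambda>s. nonzero_sphere p d (n - s\<^sup>2))))"
    using S(1) finite_nonzero_sphere by (simp add: card_SigmaI)
  also have "\<dots> \<le> real (card (nonzero_sphere p (Suc d) n))"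
    unfolding of_nat_le_iff
    by (rule card_inj_on_le[where f = "\<lambda>(s, y). s # y"])
      (use finite_nonzero_sphere in \<open>auto simp: inj_on_def nonzero_sphere_def\<close>)
  finally show ?thesis .
qed

lemma card_nonzero_sphere_ge:
  assumes p: "prime p" and "d \<ge> 4"
  shows "\<exists>c>0. \<forall>n>0. d \<ge> 5 \<or> odd n \<longrightarrow>
    real (card (nonzero_sphere p d n)) \<ge> c * of_int n powr (real d / 2 - 1)"
  using \<open>d \<ge> 4\<close>
proof (induction d rule: dec_induct)
  case base
  show ?case using card_nonzero_sphere_4[OF p] by (intro exI[of _ 8]) auto
next
  case (step d)
  then obtain c where c: "c > 0"
    "\<And>n. n > 0 \<Longrightarrow> odd n \<Longrightarrow> real (card (nonzero_sphere p d n)) \<ge> c * of_int n powr (real d / 2 - 1)"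
    by blast
  have "real (card (nonzero_sphere p (Suc d) n))
    \<ge> (c / 8 / 2 powr (real d / 2 - 1)) * of_int n powr (real (Suc d) / 2 - 1)" if "n > 0" for n
    using card_nonzero_sphere_Suc[OF c(2) c(1) _ that] step by (simp add: field_simps)
  then show ?case using c(1) by (intro exI[of _ "c / 8 / 2 powr (real d / 2 - 1)"]) auto
qed

section \<open>Equidistribution\<close>

lemma average_diff_le:
  fixes f :: "'b \<Rightarrow> complex"
  assumes X: "finite X" "r ` X \<subseteq> A" "X \<noteq> {}" and A: "finite A"
    and fibers: "\<And>u v. u \<in> A \<Longrightarrow> v \<in> A \<Longrightarrow> \<bar>real (card {x \<in> X. r x = u}) - real (card {x \<in> X. r x = v})\<bar> \<le> K"
  shows "norm (1 / of_nat (card X) * (\<Sum>x\<in>X. f (r x)) - 1 / of_nat (card A) * (\<Sum>u\<in>A. f u))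
    \<le> (\<Sum>u\<in>A. norm (f u)) * (K / real (card X))"
proof -
  define k where "k u = card {x \<in> X. r x = u}" for u
  have pos: "card A > 0" "card X > 0" using X A by (auto simp: card_gt_0_iff)
  have total: "(\<Sum>u\<in>A. k u) = card X"
    using sum.group[OF X(1) A X(2), of "\<lambda>_. 1::nat"] by (simp add: k_def)
  have "(\<Sum>x\<in>X. f (r x)) = (\<Sum>u\<in>A. \<Sum>x | x \<in> X \<and> r x = u. f (r x))"
    using sum.group[OF X(1) A X(2), of "\<lambda>x. f (r x)"] by simp
  also have "\<dots> = (\<Sum>u\<in>A. of_nat (k u) * f u)" by (intro sum.cong) (auto simp: k_def)
  finally have sum_X: "(\<Sum>x\<in>X. f (r x)) = (\<Sum>u\<in>A. of_nat (k u) * f u)" .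
  have weight: "\<bar>real (k u) / real (card X) - 1 / real (card A)\<bar> \<le> K / real (card X)" if "u \<in> A" for u
  proof -
    have "real (card A) * real (k u) - real (card X) = (\<Sum>v\<in>A. real (k u) - real (k v))"
      unfolding total[symmetric] by (simp add: sum_subtractf)
    also have "\<bar>\<dots>\<bar> \<le> (\<Sum>v\<in>A. \<bar>real (k u) - real (k v)\<bar>)" by (rule sum_abs)
    also have "\<dots> \<le> (\<Sum>v\<in>A. K)" using fibers that unfolding k_def by (intro sum_mono) blast
    finally have "\<bar>real (card A) * real (k u) - real (card X)\<bar> \<le> real (card A) * K" by simp
    moreover have "real (k u) / real (card X) - 1 / real (card A)
      = (real (card A) * real (k u) - real (card X)) / (real (card A) * real (card X))"
      using pos by (simp add: field_simps)
    ultimately show ?thesis using pos by (simp add: abs_divide abs_mult divide_simps mult_ac)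
  qed
  have "1 / of_nat (card X) * (\<Sum>x\<in>X. f (r x)) - 1 / of_nat (card A) * (\<Sum>u\<in>A. f u)
    = (\<Sum>u\<in>A. of_real (real (k u) / real (card X) - 1 / real (card A)) * f u)"
    unfolding sum_X sum_distrib_left sum_subtractf[symmetric]
    by (intro sum.cong) (auto simp: algebra_simps)
  also have "norm \<dots> \<le> (\<Sum>u\<in>A. norm (f u) * (K / real (card X)))"
  proof (rule sum_norm_le)
    fix u assume "u \<in> A"
    then show "norm (of_real (real (k u) / real (card X) - 1 / real (card A)) * f u)
      \<le> norm (f u) * (K / real (card X))"
      unfolding norm_mult norm_of_real mult.commute[of _ "norm (f u)"]
      using weight by (intro mult_left_mono) auto
  qed
  finally show ?thesis unfolding sum_distrib_right .
qed

lemma tendsto_at_top_through: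
  fixes F :: "nat \<Rightarrow> complex"
  assumes "\<delta> > 0" and bound: "\<And>n. n \<in> N \<Longrightarrow> n > 0 \<Longrightarrow> norm (F n - a) \<le> K * real n powr (- \<delta>)"
  shows "(F \<longlongrightarrow> a) (at_top_through N)"
proof -
  have bound: "\<forall>\<^sub>F n in at_top_through N. norm (F n - a) \<le> norm (real n powr (- \<delta>)) * K"
    unfolding at_top_through_def eventually_inf_principal
    by (rule eventually_mono[OF eventually_gt_at_top[of 0]]) (simp add: bound mult.commute[of _ K])
  have "((\<lambda>n. real n powr (- \<delta>)) \<longlongrightarrow> 0) sequentially"
    using assms(1) by (intro tendsto_neg_powr filterlim_real_sequentially) auto
  then have "((\<lambda>n. real n powr (- \<delta>)) \<longlongrightarrow> 0) (at_top_through N)"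
    unfolding at_top_through_def by (rule tendsto_mono[rotated]) simp
  from tendsto_0_le[OF this bound] show ?thesis by (rule LIM_zero_cancel)
qed

subsection \<open>Vectors as lists\<close>

lemma card_int_vecs_list:
  "card {x \<in> int_vecs d. P (map x [0..<d])} = card {l. length l = d \<and> P l}"
proof (rule bij_betw_same_card, rule bij_betw_byWitness)
  show "\<forall>x\<in>{x \<in> int_vecs d. P (map x [0..<d])}. (\<lambda>i\<in>{..<d}. map x [0..<d] ! i) = x"
    by (auto simp: int_vecs_def fun_eq_iff PiE_iff extensional_def)
  have list: "map (\<lambda>i\<in>{..<d}. l ! i) [0..<d] = l" if "length l = d" for l :: "int list"
    using that by (intro nth_equalityI) auto
  then show "\<forall>l\<in>{l. length l = d \<and> P l}. map (\<lambda>i\<in>{..<d}. l ! i) [0..<d] = l" by blast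
  show "(\<lambda>l. \<lambda>i\<in>{..<d}. l ! i) ` {l. length l = d \<and> P l} \<subseteq> {x \<in> int_vecs d. P (map x [0..<d])}"
    using list by (auto simp: int_vecs_def simp del: map_eq_conv split: if_splits)
qed auto

lemma square_sum_map_upt: "square_sum (map x [0..<d]) = Q_int d x x"
  by (induction d) (auto simp: Q_int_def power2_eq_square)

lemma zero_mod_map_upt: "x \<in> int_vecs d \<Longrightarrow> zero_mod (int p) (map x [0..<d]) \<longleftrightarrow> x \<in> multiple_vecs p d"
  by (auto simp: zero_mod_def multiple_vecs_def int_vecs_def PiE_iff)

lemma card_X_int': "card (X_int' p d n) = card (nonzero_sphere (int p) d (int n))"
proof -
  have "X_int' p d n = {x \<in> int_vecs d.
    \<not> zero_mod (int p) (map x [0..<d]) \<and> square_sum (map x [0..<d]) = int n}"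
    by (auto simp: X_int'_def zero_mod_map_upt square_sum_map_upt)
  then show ?thesis using card_int_vecs_list[of d "\<lambda>l. \<not> zero_mod (int p) l \<and> square_sum l = int n"]
    by (simp add: nonzero_sphere_def)
qed

lemma residue_vecs_iff: "p > 0 \<Longrightarrow> u \<in> residue_vecs p d \<longleftrightarrow> u \<in> int_vecs d \<and> (\<forall>i<d. 0 \<le> u i \<and> u i < int p)"
  by (auto simp: residue_vecs_def int_vecs_def residue_ring_def PiE_iff)

lemma zero_vec_iff:
  assumes "p > 0" "u \<in> residue_vecs p d"
  shows "u = zero_vec d \<longleftrightarrow> zero_mod (int p) (map u [0..<d])"
proof
  assume "zero_mod (int p) (map u [0..<d])"
  then have "u i = 0" if "i < d" for i
    using that assms zdvd_not_zless[of "u i" "int p"] by (force simp: zero_mod_def residue_vecs_iff)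
  then show "u = zero_vec d" using assms
    by (auto simp: zero_vec_def fun_eq_iff residue_vecs_iff int_vecs_def PiE_iff extensional_def)
qed (auto simp: zero_vec_def zero_mod_def)

lemma reduce_eq_iff:
  assumes "p > 0" "u \<in> residue_vecs p d"
  shows "reduce p d x = u \<longleftrightarrow> list_cong (int p) (map x [0..<d]) (map u [0..<d])"
proof -
  have "reduce p d x = u \<longleftrightarrow> (\<forall>i<d. x i mod int p = u i)"
    using assms by (auto simp: reduce_def fun_eq_iff residue_vecs_iff int_vecs_def PiE_iff extensional_def)
  also have "\<dots> \<longleftrightarrow> (\<forall>i<d. int p dvd x i - u i)"
    using assms by (auto simp: residue_vecs_iff mod_eq_dvd_iff[symmetric])
  finally show ?thesis by (simp add: list_cong_def list_all2_conv_all_nth)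
qed

lemma card_fiber_reduce:
  assumes "p > 0" "u \<in> residue_vecs p d" "u \<noteq> zero_vec d"
  shows "card {x \<in> X_int' p d n. reduce p d x = u} = list_class_count (int p) (map u [0..<d]) (int n)"
proof -
  let ?u = "map u [0..<d]"
  have "{x \<in> X_int' p d n. reduce p d x = u}
    = {x \<in> int_vecs d. list_cong (int p) (map x [0..<d]) ?u \<and> square_sum (map x [0..<d]) = int n}"
    using assms zero_mod_map_upt[of _ d p] list_cong_zero_mod[of "int p" _ ?u]
    by (auto simp: X_int'_def square_sum_map_upt reduce_eq_iff zero_vec_iff)
  also have "card \<dots> = card {l. length l = d \<and> list_cong (int p) l ?u \<and> square_sum l = int n}"
    by (rule card_int_vecs_list)
  also have "{l. length l = d \<and> list_cong (int p) l ?u \<and> square_sum l = int n}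
    = {l. list_cong (int p) l ?u \<and> square_sum l = int n}"
    by (auto simp: list_cong_def dest: list_all2_lengthD)
  finally show ?thesis by (simp add: list_class_count_def)
qed

lemma Q_mod_eq:
  assumes "p > 1"
  shows "Q_mod p d x y = Q_int d x y mod int p"
proof -
  interpret residues "int p" "residue_ring (int p)" by unfold_locales (use assms in auto)
  show ?thesis
  proof (induction d)
    case 0
    show ?case using assms by (simp add: Q_mod_def Q_int_def zero_cong)
  next
    case (Suc d)
    have "(\<lambda>i. x i \<otimes>\<^bsub>residue_ring (int p)\<^esub> y i) \<in> A \<rightarrow> carrier (residue_ring (int p))" for A
      using assms by (auto simp: res_mult_eq res_carrier_eq)
    then show ?case using Suc assms unfolding Q_mod_def Q_int_def lessThan_Suc
      by (simp add: res_add_eq res_mult_eq res_carrier_eq mod_simps add.commute)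
  qed
qed

lemma finite_X_mod: "p > 0 \<Longrightarrow> finite (X_mod p d a)"
  by (rule finite_subset[of _ "residue_vecs p d"])
    (auto simp: X_mod_def residue_vecs_def residue_ring_def intro: finite_PiE)

lemma reduce_in_X_mod:
  assumes p: "p > 1" and a: "0 \<le> a" "a < int p" and n: "[int n = a] (mod int p)"
    and x: "x \<in> X_int' p d n"
  shows "reduce p d x \<in> X_mod p d a - {zero_vec d}"
proof
  have residue: "reduce p d x \<in> residue_vecs p d"
    using p by (simp add: residue_vecs_iff reduce_def int_vecs_def)
  have "Q_int d (reduce p d x) (reduce p d x) mod int p = Q_int d x x mod int p"
    unfolding Q_int_def reduce_def
    by (subst (1 2) mod_sum_eq[symmetric]) (simp add: mod_mult_eq)
  also have "\<dots> = a" using n x a by (simp add: X_int'_def cong_def)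
  finally show "reduce p d x \<in> X_mod p d a" using residue p by (simp add: X_mod_def Q_mod_eq)
  have "list_cong (int p) (map x [0..<d]) (map (reduce p d x) [0..<d])"
    using reduce_eq_iff[OF _ residue, of x] p by simp
  then show "reduce p d x \<notin> {zero_vec d}"
    using x residue p list_cong_zero_mod zero_mod_map_upt zero_vec_iff[OF _ residue]
    by (fastforce simp: X_int'_def)
qed

subsection \<open>The limit formulas\<close>

lemma card_fiber_reduce_diff:
  assumes d: "d \<ge> 4" and p: "prime p" "odd p"
  obtains C \<delta> where "C > 0" "0 < \<delta>" "\<delta> < 1"
    "\<And>u v n. u \<in> X_mod p d a - {zero_vec d} \<Longrightarrow> v \<in> X_mod p d a - {zero_vec d} \<Longrightarrow> n > 0 \<Longrightarrow>
      \<bar>real (card {x \<in> X_int' p d n. reduce p d x = u})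
        - real (card {x \<in> X_int' p d n. reduce p d x = v})\<bar>
        \<le> C * real n powr (real d / 2 - 1 - \<delta>)"
proof -
  let ?A = "X_mod p d a - {zero_vec d}" and ?l = "\<lambda>u. map u [0..<d]"
  have p': "p > 1" "p > 0" "prime (int p)" "odd (int p)" using p prime_gt_1_nat[of p] by auto
  define D where "D w n = real (list_class_count (int p) (?l (fst w)) n)
    - real (list_class_count (int p) (?l (snd w)) n)" for w n
  have saving: "power_saving (real d / 2 - 1) UNIV (D w)" if "w \<in> ?A \<times> ?A" for w
  proof -
    obtain u v where w: "w = (u, v)" by (cases w)
    have uv: "u \<in> residue_vecs p d" "u \<noteq> zero_vec d" "v \<in> residue_vecs p d" "v \<noteq> zero_vec d"
      "Q_int d u u mod int p = a" "Q_int d v v mod int p = a"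
      using that p' by (auto simp: w X_mod_def Q_mod_eq)
    then have "int p dvd square_sum (?l u) - square_sum (?l v)"
      by (simp add: square_sum_map_upt flip: mod_eq_dvd_iff)
    then have "list_equidistributed (int p) (?l u) (?l v)"
      using equidistributed_dim_ge_4[OF p'(3,4) d] uv zero_vec_iff p'
      by (simp add: equidistributed_dim_def)
    then show ?thesis by (simp add: list_equidistributed_def D_def[abs_def] w)
  qed
  have "finite (?A \<times> ?A)" using finite_X_mod[OF p'(2)] by simp
  then show thesis
  proof (rule power_saving_uniform[where f = D, OF _ saving])
    fix C \<delta> :: real assume C: "C > 0" "0 < \<delta>" "\<delta> < 1"
      and bound: "\<And>w n. w \<in> ?A \<times> ?A \<Longrightarrow> n \<in> UNIV \<Longrightarrow> n > 0 \<Longrightarrow>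
        \<bar>D w n\<bar> \<le> C * of_int n powr (real d / 2 - 1 - \<delta>)"
    have fiber: "card {x \<in> X_int' p d n. reduce p d x = w} = list_class_count (int p) (?l w) (int n)"
      if "w \<in> ?A" for w n
      by (rule card_fiber_reduce[OF p'(2)]) (use that in \<open>simp_all add: X_mod_def\<close>)
    show thesis
    proof (rule that[OF C])
      fix u v :: "nat \<Rightarrow> int" and n :: nat assume "u \<in> ?A" "v \<in> ?A" "n > 0"
      then show "\<bar>real (card {x \<in> X_int' p d n. reduce p d x = u})
        - real (card {x \<in> X_int' p d n. reduce p d x = v})\<bar>
          \<le> C * real n powr (real d / 2 - 1 - \<delta>)"
        using bound[of "(u, v)" "int n"] fiber[of u n] fiber[of v n] by (simp add: D_def)
    qed
  qed
qed

lemma equidistribution: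
  fixes f :: "(nat \<Rightarrow> int) \<Rightarrow> complex"
  assumes d: "d \<ge> 4" and p: "prime p" "odd p" and a: "0 \<le> a" "a < int p"
    and N: "\<And>n. n \<in> N \<Longrightarrow> [int n = a] (mod int p)" "\<And>n. n \<in> N \<Longrightarrow> d \<ge> 5 \<or> odd n"
  shows "((\<lambda>n. 1 / of_nat (card (X_int' p d n)) * (\<Sum>x\<in>X_int' p d n. f (reduce p d x)))
    \<longlongrightarrow> 1 / of_nat (card (X_mod p d a - {zero_vec d})) * (\<Sum>x\<in>X_mod p d a - {zero_vec d}. f x))
    (at_top_through N)"
proof -
  let ?A = "X_mod p d a - {zero_vec d}"
  define e where "e = real d / 2 - 1"
  have p': "p > 1" "p > 0" "prime (int p)" using p prime_gt_1_nat[of p] by auto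
  obtain C \<delta> where C: "C > 0" "0 < \<delta>" "\<delta> < 1"
    and fibers: "\<And>u v n. u \<in> ?A \<Longrightarrow> v \<in> ?A \<Longrightarrow> n > 0 \<Longrightarrow>
      \<bar>real (card {x \<in> X_int' p d n. reduce p d x = u})
        - real (card {x \<in> X_int' p d n. reduce p d x = v})\<bar>
        \<le> C * real n powr (e - \<delta>)"
    using card_fiber_reduce_diff[OF d p, of a] unfolding e_def by blast
  obtain c where c: "c > 0"
    and lower: "\<And>n. n > 0 \<Longrightarrow> d \<ge> 5 \<or> odd n \<Longrightarrow>
      real (card (nonzero_sphere (int p) d n)) \<ge> c * of_int n powr e"
    using card_nonzero_sphere_ge[OF p'(3) d] unfolding e_def by blast
  show ?thesis
  proof (rule tendsto_at_top_through[OF C(2)])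
    fix n assume n: "n \<in> N" "n > 0"
    let ?X = "X_int' p d n"
    have X_ge: "real (card ?X) \<ge> c * real n powr e"
      using lower[of "int n"] N(2)[OF n(1)] n by (simp add: card_X_int')
    moreover have "c * real n powr e > 0" using c n(2) by simp
    ultimately have pos: "real (card ?X) > 0" by linarith
    then have X: "finite ?X" "?X \<noteq> {}" by (auto intro: card_ge_0_finite)
    have "norm (1 / of_nat (card ?X) * (\<Sum>x\<in>?X. f (reduce p d x)) - 1 / of_nat (card ?A) * (\<Sum>x\<in>?A. f x))
      \<le> (\<Sum>u\<in>?A. norm (f u)) * (C * real n powr (e - \<delta>) / real (card ?X))"
      using reduce_in_X_mod[OF p'(1) a N(1)[OF n(1)]] finite_X_mod[OF p'(2)]
      by (intro average_diff_le[OF X(1) _ X(2)] fibers n(2)) auto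
    also have "\<dots> \<le> (\<Sum>u\<in>?A. norm (f u)) * (C * real n powr (e - \<delta>) / (c * real n powr e))"
      using X_ge pos c C(1) n(2) by (intro mult_left_mono divide_left_mono sum_nonneg mult_pos_pos) auto
    also have "\<dots> = (\<Sum>u\<in>?A. norm (f u)) * (C / c) * real n powr (- \<delta>)"
      using n(2) c by (simp add: powr_diff powr_minus divide_inverse)
    finally show "norm (1 / of_nat (card ?X) * (\<Sum>x\<in>?X. f (reduce p d x))
      - 1 / of_nat (card ?A) * (\<Sum>x\<in>?A. f x))
      \<le> (\<Sum>u\<in>?A. norm (f u)) * (C / c) * real n powr (- \<delta>)" .
  qed
qed

lemma X_int_eq_X_int':
  assumes "[int n = a] (mod int p)" "\<not> int p dvd a"
  shows "X_int d n = X_int' p d n"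
proof -
  have "\<not> int p dvd int n" using assms cong_dvd_iff by blast
  moreover have multiple: "int p dvd Q_int d x x" if "x \<in> multiple_vecs p d" for x
    using that by (auto simp: multiple_vecs_def Q_int_def PiE_iff intro!: dvd_sum)
  ultimately show ?thesis by (auto simp: X_int_def X_int'_def dest: multiple)
qed

lemma zero_vec_in_X_mod_iff:
  assumes "p > 1"
  shows "zero_vec d \<in> X_mod p d a \<longleftrightarrow> a = 0"
  using assms by (auto simp: X_mod_def residue_vecs_iff int_vecs_def zero_vec_def Q_mod_eq Q_int_def)

lemma equidistribution_nonzero:
  fixes f :: "(nat \<Rightarrow> int) \<Rightarrow> complex"
  assumes d: "d \<ge> 4" and p: "prime p" "odd p" and a: "a \<in> carrier (residue_ring (int p))" "a \<noteq> 0"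
    and N: "\<And>n. n \<in> N \<Longrightarrow> [int n = a] (mod int p)" "\<And>n. n \<in> N \<Longrightarrow> d \<ge> 5 \<or> odd n"
  shows "((\<lambda>n. 1 / of_nat (card (X_int d n)) * (\<Sum>x\<in>X_int d n. f (reduce p d x)))
    \<longlongrightarrow> 1 / of_nat (card (X_mod p d a)) * (\<Sum>x\<in>X_mod p d a. f x)) (at_top_through N)"
proof -
  have a': "0 \<le> a" "a < int p" using a(1) by (auto simp: residue_ring_def)
  then have "\<not> int p dvd a" using a(2) zdvd_not_zless by auto
  then have "X_int d n = X_int' p d n" if "n \<in> N" for n using X_int_eq_X_int'[OF N(1)[OF that]] by simp
  then have "\<forall>\<^sub>F n in at_top_through N. 1 / of_nat (card (X_int' p d n))
    * (\<Sum>x\<in>X_int' p d n. f (reduce p d x))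
    = 1 / of_nat (card (X_int d n)) * (\<Sum>x\<in>X_int d n. f (reduce p d x))"
    unfolding at_top_through_def eventually_inf_principal by (auto intro!: always_eventually)
  moreover have "X_mod p d a - {zero_vec d} = X_mod p d a"
    using zero_vec_in_X_mod_iff[of p d a] prime_gt_1_nat[OF p(1)] a(2) by auto
  ultimately show ?thesis
    using Lim_transform_eventually equidistribution[OF d p a' N, where f = f] by fastforce
qed

lemma equidistribution_zero:
  fixes f :: "(nat \<Rightarrow> int) \<Rightarrow> complex"
  assumes d: "d \<ge> 4" and p: "prime p" "odd p"
    and N: "\<And>n. n \<in> N \<Longrightarrow> p dvd n" "\<And>n. n \<in> N \<Longrightarrow> d \<ge> 5 \<or> odd n"
  shows "((\<lambda>n. 1 / of_nat (card (X_int' p d n)) * (\<Sum>x\<in>X_int' p d n. f (reduce p d x)))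
    \<longlongrightarrow> 1 / (of_nat (card (X_mod p d 0)) - 1) * (\<Sum>x\<in>X_mod p d 0 - {zero_vec d}. f x)) (at_top_through N)"
proof -
  have "p > 1" using prime_gt_1_nat[OF p(1)] .
  then have zero: "zero_vec d \<in> X_mod p d 0" and "finite (X_mod p d 0)"
    by (simp_all add: zero_vec_in_X_mod_iff finite_X_mod)
  then have "card (X_mod p d 0) > 0" by (auto simp: card_gt_0_iff)
  then have "of_nat (card (X_mod p d 0 - {zero_vec d})) = (of_nat (card (X_mod p d 0)) - 1 :: complex)"
    using zero by (simp add: card_Diff_singleton of_nat_diff)
  then show ?thesis using equidistribution[OF d p, where a = 0 and N = N and f = f] N \<open>p > 1\<close>
    by (simp add: cong_0_iff)
qed

theorem theorem1p1:
  fixes d p :: nat and a :: int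
  assumes "d \<ge> 4" and "prime p" and "odd p"
    and "a \<in> carrier (residue_ring (int p))"
  shows
    "(a \<noteq> 0 \<longrightarrow>
       (d \<ge> 5 \<longrightarrow>
         (\<forall>f :: (nat \<Rightarrow> int) \<Rightarrow> complex.
           ((\<lambda>n. 1 / of_nat (card (X_int d n)) * (\<Sum>x\<in>X_int d n. f (reduce p d x)))
             \<longlongrightarrow> 1 / of_nat (card (X_mod p d a)) * (\<Sum>x\<in>X_mod p d a. f x))
           (at_top_through {n. [int n = a] (mod int p)}))) \<and>
       (d = 4 \<longrightarrow>
         (\<forall>f :: (nat \<Rightarrow> int) \<Rightarrow> complex.
           ((\<lambda>n. 1 / of_nat (card (X_int d n)) * (\<Sum>x\<in>X_int d n. f (reduce p d x)))
             \<longlongrightarrow> 1 / of_nat (card (X_mod p d a)) * (\<Sum>x\<in>X_mod p d a. f x))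
           (at_top_through {n. odd n \<and> [int n = a] (mod int p)})))) \<and>
     (a = 0 \<longrightarrow>
       (d \<ge> 5 \<longrightarrow>
         (\<forall>f :: (nat \<Rightarrow> int) \<Rightarrow> complex.
           ((\<lambda>n. 1 / of_nat (card (X_int' p d n)) * (\<Sum>x\<in>X_int' p d n. f (reduce p d x)))
             \<longlongrightarrow> 1 / (of_nat (card (X_mod p d 0)) - 1)
                  * (\<Sum>x\<in>X_mod p d 0 - {zero_vec d}. f x))
           (at_top_through {n. p dvd n}))) \<and>
       (d = 4 \<longrightarrow>
         (\<forall>f :: (nat \<Rightarrow> int) \<Rightarrow> complex.
           ((\<lambda>n. 1 / of_nat (card (X_int' p d n)) * (\<Sum>x\<in>X_int' p d n. f (reduce p d x)))
             \<longlongrightarrow> 1 / (of_nat (card (X_mod p d 0)) - 1)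
                  * (\<Sum>x\<in>X_mod p d 0 - {zero_vec d}. f x))
           (at_top_through {n. odd n \<and> p dvd n}))))"
  by (intro conjI impI allI;
      (rule equidistribution_nonzero[OF assms] | rule equidistribution_zero[OF assms(1-3)])) auto

end
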